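(* The problem $\{2,3\}$-CH and, for every fixed integer $k\geq 3$, the problem $[\{2,3\},k]$-CH are $\Pi_2^p$-complete in subgrids, even when restricted to instances $(G,f)$ in which every vertex $v$ of degree $4$ in $G$ has $f(v)=3$ and every vertex $v$ of degree $2$ in $G$ has $f(v)=2$.
   Context: All graphs are finite and simple. The grid $G(p,q)$ is the graph with vertex set $\{(i,j): 1\le i\le p,\ 1\le j\le q\}$ in which $(i,j)$ is adjacent to $(i,j+1)$ for $1\le j\le q-1$ and to $(i+1,j)$ for $1\le i\le p-1$ (no other edges). A subgrid is an induced subgraph of a grid. Given a graph $G=(V,E)$, a function $f:V\to\mathbb N$ and an integer $k\ge\max_v f(v)$, $G$ is $[f,k]$-choosable if for every assignment of lists $L(v)\subseteq\{1,\dots,k\}$ with $|L(v)|=f(v)$ for all $v$, there is a proper coloring $c$ of $G$ with $c(v)\in L(v)$ for all $v$. $G$ is $f$-choosable if it is $[f,k]$-choosable for every $k\ge \max_v f(v)$. For a fixed finite set $\Lambda$ of positive integers, $[\Lambda,k]$-CH is the decision problem: given a graph $G$ and a function $f:V(G)\to\Lambda$, decide whether $G$ is $[f,k]$-choosable. $\Lambda$-CH is the analogous problem of deciding whether $G$ is $f$-choosable. $\Pi_2^p$ is the usual class of the polynomial hierarchy; completeness is with respect to polynomial-time many-one reductions. *)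

theory Defs
  imports
    "HOL-Computational_Algebra.Polynomial"
    "Graph_Theory.Pair_Digraph"
    "Graph_Theory.Digraph_Isomorphism"
begin

section \<open>Grids, subgrids and choosability\<close>

text \<open>
  A finite simple graph is a \<^locale>\<open>pair_graph\<close> of the entry Graph-Theory: a finite, symmetric
  and loop-free set of ordered pairs. The edge $uv$ is present iff both \<open>(u, v)\<close> and \<open>(v, u)\<close>
  are arcs, and the degree of \<open>v\<close> is its \<^const>\<open>out_degree\<close>.
\<close>

definition grid_edges :: "nat \<Rightarrow> nat \<Rightarrow> ((nat \<times> nat) \<times> (nat \<times> nat)) set" where
  "grid_edges p q =
     {((i, j), (i, j + 1)) | i j. 1 \<le> i \<and> i \<le> p \<and> 1 \<le> j \<and> j < q} \<union>
     {((i, j), (i + 1, j)) | i j. 1 \<le> i \<and> i < p \<and> 1 \<le> j \<and> j \<le> q}"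

definition grid :: "nat \<Rightarrow> nat \<Rightarrow> (nat \<times> nat) pair_pre_digraph" where
  "grid p q = \<lparr>pverts = {1..p} \<times> {1..q}, parcs = grid_edges p q \<union> (grid_edges p q)\<inverse>\<rparr>"

lemma pair_graph_grid: "pair_graph (grid p q)"
proof -
  have sub: "parcs (grid p q) \<subseteq> pverts (grid p q) \<times> pverts (grid p q)"
    by (auto simp: grid_def grid_edges_def)
  have "finite (pverts (grid p q))"
    by (simp add: grid_def)
  moreover from this have "finite (parcs (grid p q))"
    using sub finite_subset by blast
  moreover have "symmetric (with_proj (grid p q))"
    by (auto simp: symmetric_def grid_def sym_def)
  ultimately show ?thesis
    using sub by unfold_locales (auto, auto simp: grid_def grid_edges_def)
qed

text \<open>Input graphs come without coordinates, so being a subgrid is a property up to isomorphism.\<close>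

definition subgrid :: "'a pair_pre_digraph \<Rightarrow> bool" where
  "subgrid G \<longleftrightarrow> (\<exists>p q H. induced_subgraph (with_proj H) (with_proj (grid p q)) \<and>
     digraph_iso (with_proj G) (with_proj H))"

definition proper_coloring :: "'a pair_pre_digraph \<Rightarrow> ('a \<Rightarrow> nat) \<Rightarrow> bool" where
  "proper_coloring G c \<longleftrightarrow> (\<forall>(u, v) \<in> parcs G. c u \<noteq> c v)"

text \<open>Only meaningful if \<open>k\<close> is at least the maximum of \<open>f\<close> on the vertices.\<close>

definition choosable_within :: "'a pair_pre_digraph \<Rightarrow> ('a \<Rightarrow> nat) \<Rightarrow> nat \<Rightarrow> bool" where
  "choosable_within G f k \<longleftrightarrow>
     (\<forall>L. (\<forall>v \<in> pverts G. L v \<subseteq> {1..k} \<and> card (L v) = f v) \<longrightarrow>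
       (\<exists>c. proper_coloring G c \<and> (\<forall>v \<in> pverts G. c v \<in> L v)))"

definition choosable :: "'a pair_pre_digraph \<Rightarrow> ('a \<Rightarrow> nat) \<Rightarrow> bool" where
  "choosable G f \<longleftrightarrow> (\<forall>k. (\<forall>v \<in> pverts G. f v \<le> k) \<longrightarrow> choosable_within G f k)"

definition degree_condition :: "'a pair_pre_digraph \<Rightarrow> ('a \<Rightarrow> nat) \<Rightarrow> bool" where
  "degree_condition G f \<longleftrightarrow> (\<forall>v \<in> pverts G.
     (out_degree (with_proj G) v = 4 \<longrightarrow> f v = 3) \<and>
     (out_degree (with_proj G) v = 2 \<longrightarrow> f v = 2))"


section \<open>Turing machines and the polynomial hierarchy\<close>

text \<open>
  Deterministic Turing machines with any fixed number of tapes, infinite in both directions. The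
  states are the numbers up to and including \<open>num_states\<close>; the initial state is \<open>0\<close> and the
  halting state is \<open>num_states\<close>. The tape symbols are the numbers below \<open>num_symbols\<close>; \<open>0\<close> is the
  blank, \<open>1\<close> and \<open>2\<close> stand for the bits. Given a state and the list of scanned symbols, \<open>trans\<close>
  returns the next state and, for every tape, the symbol to write and the head movement.
\<close>

datatype move = Go_Left | Stay | Go_Right

record tm =
  num_tapes :: nat
  num_states :: nat
  num_symbols :: nat
  trans :: "nat \<Rightarrow> nat list \<Rightarrow> nat \<times> (nat \<times> move) list"

text \<open>
  Values of \<open>trans\<close> on arguments outside the finite domain constrained here are never used, so
  that well-formed machines are finite objects.
\<close>

definition wf_tm :: "tm \<Rightarrow> bool" where
  "wf_tm M \<longleftrightarrow> num_tapes M \<ge> 1 \<and> num_symbols M \<ge> 3 \<and>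
     (\<forall>s < num_states M. \<forall>as. length as = num_tapes M \<and> set as \<subseteq> {..<num_symbols M} \<longrightarrow>
       (case trans M s as of (s', acts) \<Rightarrow>
          s' \<le> num_states M \<and> length acts = num_tapes M \<and> fst ` set acts \<subseteq> {..<num_symbols M}))"

text \<open>A tape consists of its contents and the position of the head.\<close>

type_synonym tape = "(int \<Rightarrow> nat) \<times> int"
type_synonym config = "nat \<times> tape list"

fun scanned :: "tape \<Rightarrow> nat" where
  "scanned (t, h) = t h"

fun move_head :: "move \<Rightarrow> int \<Rightarrow> int" where
  "move_head Go_Left h = h - 1"
| "move_head Stay h = h"
| "move_head Go_Right h = h + 1"

fun act :: "nat \<times> move \<Rightarrow> tape \<Rightarrow> tape" where
  "act (a, m) (t, h) = (t(h := a), move_head m h)"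

fun tm_step :: "tm \<Rightarrow> config \<Rightarrow> config" where
  "tm_step M (s, ts) =
     (if s < num_states M
      then case trans M s (map scanned ts) of (s', acts) \<Rightarrow> (s', map2 act acts ts)
      else (s, ts))"

definition bit_symbol :: "bool \<Rightarrow> nat" where
  "bit_symbol b = (if b then 2 else 1)"

definition input_tape :: "bool list \<Rightarrow> tape" where
  "input_tape x =
     (\<lambda>i. if 0 \<le> i \<and> i < int (length x) then bit_symbol (x ! nat i) else 0, 0)"

text \<open>The input is on the first tape; the output is on the last one.\<close>

definition initial_config :: "tm \<Rightarrow> bool list \<Rightarrow> config" where
  "initial_config M x = (0, input_tape x # replicate (num_tapes M - 1) (input_tape []))"

text \<open>The output is the string between cell \<open>0\<close> and the first blank to its right.\<close>

definition halted_with_output :: "tm \<Rightarrow> config \<Rightarrow> bool list \<Rightarrow> bool" where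
  "halted_with_output M cfg y \<longleftrightarrow> fst cfg = num_states M \<and>
     (let t = fst (last (snd cfg)) in
        (\<forall>i < length y. t (int i) = bit_symbol (y ! i)) \<and> t (int (length y)) = 0)"

definition polytime :: "(bool list \<Rightarrow> bool list) \<Rightarrow> bool" where
  "polytime F \<longleftrightarrow> (\<exists>M (p :: nat poly). wf_tm M \<and>
     (\<forall>x. halted_with_output M
        ((tm_step M ^^ poly p (length x)) (initial_config M x)) (F x)))"

definition class_P :: "bool list set set" where
  "class_P = {A. polytime (\<lambda>x. [x \<in> A])}"

text \<open>Injective pairing of bit strings: double every bit of the first one, then a separator.\<close>

definition str_pair :: "bool list \<Rightarrow> bool list \<Rightarrow> bool list" where
  "str_pair x y = concat (map (\<lambda>b. [b, b]) x) @ [False, True] @ y"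

fun Sigma_p :: "nat \<Rightarrow> bool list set set" and Pi_p :: "nat \<Rightarrow> bool list set set" where
  "Sigma_p 0 = class_P"
| "Sigma_p (Suc n) = {A. \<exists>(p :: nat poly). \<exists>B \<in> Pi_p n.
     \<forall>x. x \<in> A \<longleftrightarrow> (\<exists>y. length y \<le> poly p (length x) \<and> str_pair x y \<in> B)}"
| "Pi_p 0 = class_P"
| "Pi_p (Suc n) = {A. \<exists>(p :: nat poly). \<exists>B \<in> Sigma_p n.
     \<forall>x. x \<in> A \<longleftrightarrow> (\<forall>y. length y \<le> poly p (length x) \<longrightarrow> str_pair x y \<in> B)}"

text \<open>
  A decision problem is given by the set \<open>I\<close> of (codes of) its instances and the set
  \<open>Y \<subseteq> I\<close> of its yes-instances. A reduction to the problem has to produce instances only; this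
  matters for restricted problems, where \<open>I\<close> need not be decidable in polynomial time.
\<close>

definition complete_problem :: "bool list set set \<Rightarrow> bool list set \<Rightarrow> bool list set \<Rightarrow> bool" where
  "complete_problem C I Y \<longleftrightarrow> Y \<subseteq> I \<and> Y \<in> C \<and>
     (\<forall>A \<in> C. \<exists>F. polytime F \<and> (\<forall>x. F x \<in> I \<and> (x \<in> A \<longleftrightarrow> F x \<in> Y)))"


section \<open>The choosability problems\<close>

text \<open>The vertices of an input graph are named \<open>0, \<dots>, n - 1\<close>.\<close>

type_synonym ch_instance = "nat pair_pre_digraph \<times> (nat \<Rightarrow> nat)"

definition ch_instances :: "nat set \<Rightarrow> ch_instance set" where
  "ch_instances \<Lambda> = {(G, f). pair_graph G \<and> pverts G = {..<card (pverts G)} \<and>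
     (\<forall>v \<in> pverts G. f v \<in> \<Lambda>)}"

text \<open>
  Code of an instance: the number of vertices in unary, the adjacency matrix, and the values of
  \<open>f\<close> in unary (which are bounded, as \<open>\<Lambda>\<close> is a fixed finite set).
\<close>

definition unary :: "nat \<Rightarrow> bool list" where
  "unary n = replicate n True @ [False]"

fun encode :: "ch_instance \<Rightarrow> bool list" where
  "encode (G, f) = (let n = card (pverts G) in
     unary n @
     concat (map (\<lambda>u. map (\<lambda>v. (u, v) \<in> parcs G) [0..<n]) [0..<n]) @
     concat (map (\<lambda>v. unary (f v)) [0..<n]))"

lemma unary_append_inject: "unary m @ x = unary n @ y \<longleftrightarrow> m = n \<and> x = y"
  unfolding unary_def
proof (induction m arbitrary: n)
  case 0
  then show ?case by (cases n) auto
next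
  case (Suc m)
  then show ?case by (cases n) auto
qed

lemma concat_unary_inject:
  "concat (map (\<lambda>v. unary (f v)) vs) = concat (map (\<lambda>v. unary (g v)) vs) \<longleftrightarrow>
     (\<forall>v \<in> set vs. f v = g v)"
  by (induction vs) (auto simp: unary_append_inject)

lemma concat_map_inject:
  "concat (map (\<lambda>u. map (P u) vs) us) = concat (map (\<lambda>u. map (Q u) vs) us) \<longleftrightarrow>
     (\<forall>u \<in> set us. \<forall>v \<in> set vs. P u v = Q u v)"
  by (induction us) auto

lemma encode_inject:
  assumes "(G, f) \<in> ch_instances \<Lambda>" "(H, g) \<in> ch_instances \<Lambda>" "encode (G, f) = encode (H, g)"
  shows "G = H" and "\<forall>v \<in> pverts G. f v = g v"
proof -
  define n where "n = card (pverts G)"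
  have n': "card (pverts H) = n"
    using assms(3) by (simp add: Let_def unary_append_inject n_def)
  have V: "pverts G = {..<n}" "pverts H = {..<n}"
    using assms(1,2) n' by (auto simp: ch_instances_def n_def)
  interpret G: pair_graph G using assms(1) by (simp add: ch_instances_def)
  interpret H: pair_graph H using assms(2) by (simp add: ch_instances_def)
  let ?m = "\<lambda>G. concat (map (\<lambda>u. map (\<lambda>v. (u, v) \<in> parcs G) [0..<n]) [0..<n])"
  let ?u = "\<lambda>f. concat (map (\<lambda>v. unary (f v)) [0..<n])"
  have len: "length (?m G) = length (?m H)"
    by (simp add: length_concat o_def)
  have "?m G @ ?u f = ?m H @ ?u g"
    using assms(3) n' by (simp add: Let_def unary_append_inject flip: n_def)
  with len have eqs: "?m G = ?m H" "?u f = ?u g"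
    by (metis append_eq_append_conv)+
  from eqs(1) have E: "(u, v) \<in> parcs G \<longleftrightarrow> (u, v) \<in> parcs H" if "u < n" "v < n" for u v
    unfolding concat_map_inject using that by auto
  have "parcs G \<subseteq> {..<n} \<times> {..<n}" "parcs H \<subseteq> {..<n} \<times> {..<n}"
    using G.wellformed' H.wellformed' V by (auto simp: subset_iff)
  with E have "parcs G = parcs H"
    by auto
  then show "G = H"
    using V by simp
  show "\<forall>v \<in> pverts G. f v = g v"
    using eqs(2) V unfolding concat_unary_inject by auto
qed

text \<open>
  The problem of deciding the property \<open>Q\<close>, with values of \<open>f\<close> in \<open>\<Lambda>\<close> and restricted to the
  instances that satisfy \<open>R\<close>, is complete for the second universal level of the hierarchy.
\<close>

definition Pi2_complete ::
  "nat set \<Rightarrow> (nat pair_pre_digraph \<Rightarrow> (nat \<Rightarrow> nat) \<Rightarrow> bool) \<Rightarrow>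
    (nat pair_pre_digraph \<Rightarrow> (nat \<Rightarrow> nat) \<Rightarrow> bool) \<Rightarrow> bool" where
  "Pi2_complete \<Lambda> R Q \<longleftrightarrow> complete_problem (Pi_p 2)
     (encode ` {(G, f) \<in> ch_instances \<Lambda>. R G f})
     (encode ` {(G, f) \<in> ch_instances \<Lambda>. R G f \<and> Q G f})"

definition CH_Pi2_complete ::
  "nat set \<Rightarrow> (nat pair_pre_digraph \<Rightarrow> (nat \<Rightarrow> nat) \<Rightarrow> bool) \<Rightarrow> bool" where
  "CH_Pi2_complete \<Lambda> R \<longleftrightarrow> Pi2_complete \<Lambda> R choosable"

definition bounded_CH_Pi2_complete ::
  "nat set \<Rightarrow> nat \<Rightarrow> (nat pair_pre_digraph \<Rightarrow> (nat \<Rightarrow> nat) \<Rightarrow> bool) \<Rightarrow> bool" where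
  "bounded_CH_Pi2_complete \<Lambda> k R \<longleftrightarrow> Pi2_complete \<Lambda> R (\<lambda>G f. choosable_within G f k)"

end

theory Submission
  imports Defs
begin

text \<open>
  Membership: the list assignment is the universal and the colouring the existential certificate.
  The existential certificate also contains an embedding into a grid, whose coordinates can be
  compressed to size at most \<open>2 * n\<close>; without a bound on the colours, \<open>3 * n\<close> colours suffice up
  to renaming.

  Hardness: a problem of the second universal level reduces to quantified formulas. The clauses that
  describe a computation are implications between facts, so every satisfying assignment contains the
  facts of the real computation on the guessed input, and it suffices to exclude the rejecting symbol.

  For the reduction to graphs, every edge of a coarse grid is replaced by a wire, a path with a detour
  whose lists act as one forbidden pair of colours, at the adversary's choice. So a coarse graph has to
  be coloured against an arbitrary conflict on every edge. A variable has two sources, one of which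
  can be kept free of restrictions; for an existential variable the colouring decides which one, for
  a universal one the conflicts do. In the crossing block of a clause and a literal, a colouring can
  be completed if exactly one corner is chosen: a left one unless the row is active (all literals of
  the clause so far are false), a top one unless the column is active (the literal is false). If the
  literal belongs to the clause, an edge is missing and a row may become inactive at an inactive
  column. The cycles at the ends can make all rows active at the start and forbid it at the end.
\<close>

section \<open>Register programs\<close>

text \<open>Lists are fixed before any colour is chosen, so a gadget must be completable under every
  list assignment and must enforce its logical effect under at least one. Arguing with concrete
  colours would not survive the first demand. Everything is therefore phrased through
  \<open>single\<close>: a connection excludes at most one pair of end colours. This property passes
  through a vertex with two colours; a vertex with two colours can dodge one conflict, a vertex with
  three colours can dodge two, and all constructions of colourings are countings of this kind.
  Concrete colours occur only on the adversary's side. A second obstacle is that membership and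
  reductions refer to concrete Turing machines. No machine is designed by hand: a small language of
  arithmetic expressions with bounded sums is compiled once, and every reduction and verifier is
  shown to be given by such an expression. This is why instances, clauses and certificates appear as
  closed formulas for their bits.\<close>

datatype com = Skip | Inc nat | Dec nat | Out bool | Seq com com
  | If nat nat com com | While nat nat com

datatype action = Nop | Mov nat move | Emit bool

type_synonym state = "(nat \<Rightarrow> int) \<times> bool list"

fun action_of :: "com \<Rightarrow> action" where
  "action_of (Inc r) = Mov r Go_Right"
| "action_of (Dec r) = Mov r Go_Left"
| "action_of (Out b) = Emit b"
| "action_of (Seq c d) = action_of c"
| "action_of _ = Nop"

text \<open>The residual program plays the role of a machine state: a step inspects at most one
  register, and only finitely many residual programs can arise.\<close>

fun next_com :: "(nat \<Rightarrow> nat) \<Rightarrow> com \<Rightarrow> com" where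
  "next_com g (Seq c d) = (if c = Skip then d else Seq (next_com g c) d)"
| "next_com g (If r a c d) = (if g r = a then c else d)"
| "next_com g (While r a c) = (if g r = a then Skip else Seq c (While r a c))"
| "next_com g _ = Skip"

fun do_action :: "action \<Rightarrow> state \<Rightarrow> state" where
  "do_action Nop s = s"
| "do_action (Mov r m) (p, out) = (p(r := move_head m (p r)), out)"
| "do_action (Emit b) (p, out) = (p, out @ [b])"

text \<open>Register \<open>0\<close> is the position of the input head. Every other register is the position of
  the head on a tape that has the symbol \<open>1\<close> in cell \<open>0\<close> only, so that zero can be tested.\<close>

definition scan :: "bool list \<Rightarrow> (nat \<Rightarrow> int) \<Rightarrow> nat \<Rightarrow> nat" where
  "scan x p r = (if r = 0 then fst (input_tape x) (p 0) else if p r = 0 then 1 else 0)"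

fun step :: "bool list \<Rightarrow> com \<times> state \<Rightarrow> com \<times> state" where
  "step x (c, s) = (next_com (scan x (fst s)) c, do_action (action_of c) s)"

text \<open>An upper bound on the time, so that bounds can be rounded up freely; \<open>Skip\<close>
  is a fixed point of \<open>step\<close>, hence waiting does no harm.\<close>

definition exec :: "bool list \<Rightarrow> com \<Rightarrow> state \<Rightarrow> nat \<Rightarrow> state \<Rightarrow> bool" where
  "exec x c s t s' \<longleftrightarrow> (\<exists>t' \<le> t. (step x ^^ t') (c, s) = (Skip, s'))"

lemma step_Skip: "(step x ^^ t) (Skip, s) = (Skip, s)"
  by (induction t) auto

lemma exec_mono: "exec x c s t s' \<Longrightarrow> t \<le> u \<Longrightarrow> exec x c s u s'"
  unfolding exec_def using le_trans by blast

lemma exec_step: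
  assumes "exec x (next_com (scan x (fst s)) c) (do_action (action_of c) s) t s'"
  shows "exec x c s (Suc t) s'"
proof -
  obtain t' where "t' \<le> t"
    "(step x ^^ t') (next_com (scan x (fst s)) c, do_action (action_of c) s) = (Skip, s')"
    using assms unfolding exec_def by blast
  then have "(step x ^^ Suc t') (c, s) = (Skip, s')"
    by (simp add: funpow_swap1)
  then show ?thesis unfolding exec_def using \<open>t' \<le> t\<close> by (metis Suc_le_mono)
qed

lemma exec_Skip: "exec x Skip s t s"
  unfolding exec_def using step_Skip by blast

lemma exec_Inc: "exec x (Inc r) (p, out) (Suc t) (p(r := p r + 1), out)"
  using exec_step[of x "(p, out)" "Inc r"] exec_Skip by simp

lemma exec_Dec: "exec x (Dec r) (p, out) (Suc t) (p(r := p r - 1), out)"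
  using exec_step[of x "(p, out)" "Dec r"] exec_Skip by simp

lemma exec_Out: "exec x (Out b) (p, out) (Suc t) (p, out @ [b])"
  using exec_step[of x "(p, out)" "Out b"] exec_Skip by simp

lemma steps_Seq:
  "(step x ^^ t) (c, s) = (Skip, s') \<Longrightarrow> \<exists>t' \<le> t. (step x ^^ t') (Seq c d, s) = (Seq Skip d, s')"
proof (induction t arbitrary: c s)
  case 0
  then show ?case by (intro exI[of _ 0]) auto
next
  case (Suc t)
  show ?case
  proof (cases "c = Skip")
    case True
    then show ?thesis using Suc.prems step_Skip[of "Suc t" x s] by (intro exI[of _ 0]) auto
  next
    case False
    let ?c = "next_com (scan x (fst s)) c" and ?s = "do_action (action_of c) s"
    have "(step x ^^ t) (?c, ?s) = (Skip, s')"
      using Suc.prems by (simp add: funpow_swap1)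
    from Suc.IH[OF this] obtain t' where
      t': "t' \<le> t" "(step x ^^ t') (Seq ?c d, ?s) = (Seq Skip d, s')" by blast
    have "(step x ^^ Suc t') (Seq c d, s) = (Seq Skip d, s')"
      using t'(2) False by (simp add: funpow_swap1)
    then show ?thesis using t'(1) by (metis Suc_le_mono)
  qed
qed

lemma exec_Seq:
  assumes "exec x c s t s1" "exec x d s1 u s2"
  shows "exec x (Seq c d) s (t + u + 1) s2"
proof -
  obtain t' where "t' \<le> t" "(step x ^^ t') (c, s) = (Skip, s1)"
    using assms(1) unfolding exec_def by blast
  then obtain t1 where t1: "t1 \<le> t" "(step x ^^ t1) (Seq c d, s) = (Seq Skip d, s1)"
    using steps_Seq le_trans by meson
  obtain u1 where u1: "u1 \<le> u" "(step x ^^ u1) (d, s1) = (Skip, s2)"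
    using assms(2) unfolding exec_def by blast
  have "(step x ^^ (u1 + Suc t1)) (Seq c d, s) = (step x ^^ u1) (step x ((step x ^^ t1) (Seq c d, s)))"
    by (simp add: funpow_add funpow_swap1)
  also have "\<dots> = (Skip, s2)"
    using t1 u1 by simp
  finally show ?thesis
    unfolding exec_def using t1 u1 by (intro exI[of _ "u1 + Suc t1"]) auto
qed

lemma exec_If:
  assumes "exec x (if scan x (fst s) r = a then c else d) s t s'"
  shows "exec x (If r a c d) s (Suc t) s'"
  using exec_step[of x s "If r a c d" t s'] assms by simp

text \<open>A round costs two steps beyond its body: one unfolds the loop, the other drops the
  finished \<open>Skip\<close> in front of it. One more step leaves the loop. The induction runs
  over the number of rounds that remain.\<close>

lemma exec_While:
  assumes "\<And>i. i < N \<Longrightarrow> scan x (fst (S i)) r \<noteq> a \<and> exec x c (S i) t (S (Suc i))"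
    and "scan x (fst (S N)) r = a"
  shows "exec x (While r a c) (S 0) (N * (t + 2) + 1) (S N)"
proof -
  have "k \<le> N \<Longrightarrow> exec x (While r a c) (S (N - k)) (k * (t + 2) + 1) (S N)" for k
  proof (induction k)
    case 0
    then show ?case
      using assms(2) exec_step[of x "S N" "While r a c" 0] exec_Skip by simp
  next
    case (Suc k)
    have i: "N - Suc k < N" "Suc (N - Suc k) = N - k" using Suc.prems by auto
    have "exec x (Seq c (While r a c)) (S (N - Suc k)) (t + (k * (t + 2) + 1) + 1) (S N)"
      using assms(1)[OF i(1)] i(2) Suc by (intro exec_Seq) auto
    then have "exec x (While r a c) (S (N - Suc k)) (Suc (t + (k * (t + 2) + 1) + 1)) (S N)"
      using assms(1)[OF i(1)] by (intro exec_step) simp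
    then show ?case by (simp add: algebra_simps)
  qed
  from this[of N] show ?thesis by simp
qed

subsection \<open>Compilation to Turing machines\<close>

text \<open>A finite superset of the residual programs, closed under \<open>next_com\<close>. A loop
  contributes \<open>Seq c' (While r a c)\<close> for every residue \<open>c'\<close> of its body,
  so unfolding it again leads nowhere new.\<close>

fun coms :: "com \<Rightarrow> com set" where
  "coms (Seq c d) = (\<lambda>c'. Seq c' d) ` coms c \<union> coms d"
| "coms (If r a c d) = insert (If r a c d) (coms c \<union> coms d)"
| "coms (While r a c) = {While r a c, Skip} \<union> (\<lambda>c'. Seq c' (While r a c)) ` coms c"
| "coms c = {c, Skip}"

fun regs :: "com \<Rightarrow> nat set" where
  "regs (Inc r) = {r}"
| "regs (Dec r) = {r}"
| "regs (Seq c d) = regs c \<union> regs d"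
| "regs (If r a c d) = insert r (regs c \<union> regs d)"
| "regs (While r a c) = insert r (regs c)"
| "regs _ = {}"

lemma finite_coms: "finite (coms c)"
  by (induction c) auto

lemma finite_regs: "finite (regs c)"
  by (induction c) auto

lemma self_in_coms: "c \<in> coms c"
  by (induction c) auto

lemma Skip_in_coms: "Skip \<in> coms c"
  by (induction c) auto

lemma next_com_in_coms: "c' \<in> coms c \<Longrightarrow> next_com g c' \<in> coms c"
proof (induction c arbitrary: c')
  case (Seq c d)
  then show ?case using self_in_coms Skip_in_coms by (auto split: if_splits)
next
  case (If r a c d)
  then show ?case using self_in_coms by (auto split: if_splits)
next
  case (While r a c)
  then show ?case using self_in_coms by (auto split: if_splits)
qed auto

lemma regs_coms: "c' \<in> coms c \<Longrightarrow> regs c' \<subseteq> regs c"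
proof (induction c arbitrary: c')
  case (Seq c d)
  then show ?case by fastforce
next
  case (If r a c d)
  then show ?case by fastforce
next
  case (While r a c)
  then show ?case by fastforce
qed auto

lemma next_com_cong: "(\<And>r. r \<in> regs c \<Longrightarrow> g r = h r) \<Longrightarrow> next_com g c = next_com h c"
  by (induction c) auto

fun tape_action :: "action \<Rightarrow> nat \<Rightarrow> nat \<Rightarrow> nat \<Rightarrow> nat \<times> move" where
  "tape_action Nop K r a = (a, Stay)"
| "tape_action (Mov r' m) K r a = (a, if r = r' then m else Stay)"
| "tape_action (Emit b) K r a = (if r = Suc K then (bit_symbol b, Go_Right) else (a, Stay))"

text \<open>Tape \<open>0\<close> holds the input, tapes \<open>1\<close> to \<open>K\<close> the
  registers and tape \<open>K + 1\<close> the output. State \<open>0\<close> is reserved for a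
  preparatory step that writes the mark \<open>1\<close> into cell \<open>0\<close> of every
  register tape.\<close>

definition program_tm :: "(com \<Rightarrow> nat) \<Rightarrow> (nat \<Rightarrow> com) \<Rightarrow> nat \<Rightarrow> nat \<Rightarrow> com \<Rightarrow> tm" where
  "program_tm idx prog N K c = \<lparr>num_tapes = K + 2, num_states = N, num_symbols = 3,
     trans = (\<lambda>q as. if q = 0
       then (idx c, map (\<lambda>r. (if r = 0 \<or> r = Suc K then as ! r else 1, Stay)) [0..<K + 2])
       else (idx (next_com ((!) as) (prog q)),
             map (\<lambda>r. tape_action (action_of (prog q)) K r (as ! r)) [0..<K + 2]))\<rparr>"

definition tapes :: "bool list \<Rightarrow> nat \<Rightarrow> state \<Rightarrow> tape list" where
  "tapes x K s = map (\<lambda>r. if r = 0 then (fst (input_tape x), fst s 0)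
     else if r = Suc K then (fst (input_tape (snd s)), int (length (snd s)))
     else ((\<lambda>i. if i = 0 then 1 else 0), fst s r)) [0..<K + 2]"

lemma input_tape_snoc:
  "fst (input_tape (xs @ [b])) = (fst (input_tape xs))(int (length xs) := bit_symbol b)"
proof (rule ext)
  fix i
  show "fst (input_tape (xs @ [b])) i = ((fst (input_tape xs))(int (length xs) := bit_symbol b)) i"
    by (cases "i = int (length xs)") (auto simp: input_tape_def nth_append)
qed

lemma nth_tapes: "r < K + 2 \<Longrightarrow> tapes x K s ! r = (if r = 0 then (fst (input_tape x), fst s 0)
     else if r = Suc K then (fst (input_tape (snd s)), int (length (snd s)))
     else ((\<lambda>i. if i = 0 then 1 else 0), fst s r))"
  unfolding tapes_def by (simp del: upt_Suc add: nth_map)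

lemma length_tapes [simp]: "length (tapes x K s) = K + 2"
  by (simp add: tapes_def)

lemma scanned_tapes:
  "r < K + 1 \<Longrightarrow> scanned (tapes x K s ! r) = scan x (fst s) r"
  by (simp add: nth_tapes scan_def)

lemma act_tapes:
  assumes "regs c \<subseteq> {..K}"
  shows "map2 act (map (\<lambda>r. tape_action (action_of c) K r (map scanned (tapes x K s) ! r)) [0..<K + 2])
    (tapes x K s) = tapes x K (do_action (action_of c) s)"
proof (rule nth_equalityI)
  have a: "action_of c = Mov r m \<Longrightarrow> r \<in> regs c" for r m
    by (induction c) auto
  fix r assume "r < length (map2 act (map (\<lambda>r. tape_action (action_of c) K r (map scanned (tapes x K s) ! r)) [0..<K + 2])
    (tapes x K s))"
  then have r: "r < K + 2" by simp
  obtain p out where s: "s = (p, out)" by (cases s)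
  have n: "[0..<K + 2] ! r = r" using r by (simp del: upt_Suc)
  show "map2 act (map (\<lambda>r. tape_action (action_of c) K r (map scanned (tapes x K s) ! r)) [0..<K + 2])
    (tapes x K s) ! r = tapes x K (do_action (action_of c) s) ! r"
    using r a assms s n
    by (cases "action_of c") (fastforce simp: nth_tapes input_tape_snoc simp del: upt_Suc)+
qed simp

text \<open>After the preparatory step machine and program move in lockstep. \<open>Skip\<close>
  becomes the halting state, where nothing changes, so an upper bound on the time is enough although
  \<open>polytime\<close> looks at one exact time.\<close>

lemma polytime_program:
  fixes c :: com and F :: "bool list \<Rightarrow> bool list"
  assumes "\<And>x. \<exists>p. exec x c (\<lambda>_. 0, []) ((length x + 2) ^ k) (p, F x)"
  shows "polytime F"
proof -
  define K where "K = Max (insert 0 (regs c))"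
  have K: "regs c \<subseteq> {..K}"
    using finite_regs[of c] by (auto simp: K_def)
  define A where "A = coms c - {Skip}"
  define N where "N = Suc (card A)"
  obtain h where h: "bij_betw h A {1..<N}"
    using finite_same_card_bij[of A "{1..<N}"] finite_coms[of c] by (auto simp: A_def N_def)
  define idx where "idx c' = (if c' = Skip then N else h c')" for c'
  define prog where "prog q = (if q = N then Skip else inv_into A h q)" for q
  have idx: "1 \<le> idx c'" "idx c' \<le> N" "prog (idx c') = c'" if "c' \<in> coms c" for c'
  proof -
    have "c' \<noteq> Skip \<Longrightarrow> h c' \<in> {1..<N}"
      using that h by (auto simp: A_def bij_betw_def)
    then show "1 \<le> idx c'" "idx c' \<le> N" "prog (idx c') = c'"
      using that h by (auto simp: idx_def prog_def A_def N_def bij_betw_def)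
  qed
  have prog: "prog q \<in> coms c" if "1 \<le> q" "q \<le> N" for q
  proof (cases "q = N")
    case False
    then have "q \<in> h ` A" using h that by (auto simp: bij_betw_def)
    then show ?thesis using False inv_into_into[of q h A] by (auto simp: prog_def A_def)
  qed (simp add: prog_def Skip_in_coms)
  have idxN: "idx c' < N \<longleftrightarrow> c' \<noteq> Skip" if "c' \<in> coms c" for c'
    using that h by (auto simp: idx_def A_def bij_betw_def)
  define M where "M = program_tm idx prog N K c"
  have wf: "wf_tm M"
    unfolding wf_tm_def
  proof (intro conjI allI impI)
    fix q as assume q: "q < num_states M" and as: "length as = num_tapes M \<and> set as \<subseteq> {..<num_symbols M}"
    have as': "as ! r < 3" if "r < K + 2" for r
      using as that nth_mem[of r as] unfolding M_def program_tm_def by (auto dest!: subsetD)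
    have "fst (tape_action (action_of d) K r (as ! r)) < 3" if "r < K + 2" for r d
      using as'[OF that] by (cases "action_of d") (auto simp: bit_symbol_def)
    then show "case trans M q as of (s', acts) \<Rightarrow>
      s' \<le> num_states M \<and> length acts = num_tapes M \<and> fst ` set acts \<subseteq> {..<num_symbols M}"
      using as' idx self_in_coms next_com_in_coms prog q
      by (auto simp: M_def program_tm_def simp del: upt_Suc)
  qed (auto simp: M_def program_tm_def)
  have sim: "tm_step M (idx c', tapes x K s) = (idx (fst (step x (c', s))), tapes x K (snd (step x (c', s))))"
    if c': "c' \<in> coms c" for c' x s
  proof (cases "c' = Skip")
    case True
    then show ?thesis by (simp add: M_def program_tm_def idx_def)
  next
    case False
    have *: "next_com ((!) (map scanned (tapes x K s))) c' = next_com (scan x (fst s)) c'"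
      using regs_coms[OF c'] K by (intro next_com_cong) (auto simp: scanned_tapes subset_iff less_Suc_eq_le)
    have "regs c' \<subseteq> {..K}" using regs_coms[OF c'] K by auto
    from act_tapes[OF this] show ?thesis
      using False idxN[OF c'] idx[OF c'] *
      by (simp add: M_def program_tm_def del: upt_Suc)
  qed
  have sims: "c' \<in> coms c \<Longrightarrow> (tm_step M ^^ t) (idx c', tapes x K s) =
      (idx (fst ((step x ^^ t) (c', s))), tapes x K (snd ((step x ^^ t) (c', s)))) \<and>
      fst ((step x ^^ t) (c', s)) \<in> coms c" for c' x s t
  proof (induction t)
    case (Suc t)
    show ?case
      using Suc.IH[OF Suc.prems] sim next_com_in_coms
      by (cases "(step x ^^ t) (c', s)") auto
  qed simp
  have init: "tm_step M (initial_config M x) = (idx c, tapes x K (\<lambda>_. 0, []))" for x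
  proof -
    define T where "T = input_tape x # replicate (Suc K) (input_tape [])"
    have T: "initial_config M x = (0, T)"
      by (simp add: T_def initial_config_def M_def program_tm_def)
    have "map2 act (map (\<lambda>r. (if r = 0 \<or> r = Suc K then map scanned T ! r else 1, Stay)) [0..<K + 2]) T =
      tapes x K (\<lambda>_. 0, [])" (is "?l = ?r")
    proof (rule nth_equalityI)
      show "length ?l = length ?r" by (simp add: T_def)
      fix r assume "r < length ?l"
      then have r: "r < K + 2" by (simp add: T_def)
      have n: "[0..<K + 2] ! r = r" using r by (simp del: upt_Suc)
      have i: "input_tape [] = (\<lambda>_. 0, 0)" by (auto simp: input_tape_def)
      show "?l ! r = ?r ! r"
        using r n by (cases r) (auto simp: T_def nth_tapes i input_tape_def simp del: upt_Suc replicate_Suc)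
    qed
    then show ?thesis
      unfolding T by (simp add: M_def program_tm_def N_def del: upt_Suc)
  qed
  \<comment> \<open>The polynomial is \<open>2 + X\<close> to the power \<open>k\<close>, plus one
    for the preparatory step.\<close>
  have "halted_with_output M ((tm_step M ^^ poly ([:2, 1:] ^ k + 1) (length x)) (initial_config M x)) (F x)" for x
  proof -
    obtain p t where t: "t \<le> (length x + 2) ^ k" "(step x ^^ t) (c, (\<lambda>_. 0, [])) = (Skip, (p, F x))"
      using assms[of x] unfolding exec_def by blast
    define d where "d = (length x + 2) ^ k - t"
    have "poly ([:2, 1:] ^ k + 1) (length x) = Suc (d + t)"
      using t(1) by (simp add: d_def add.commute)
    moreover have "(step x ^^ (d + t)) (c, (\<lambda>_. 0, [])) = (Skip, (p, F x))"
      using t(2) by (simp add: funpow_add step_Skip)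
    ultimately have "(tm_step M ^^ poly ([:2, 1:] ^ k + 1) (length x)) (initial_config M x) =
        (idx Skip, tapes x K (p, F x))"
      using sims[OF self_in_coms, of "d + t" x "(\<lambda>_. 0, [])"] init[of x]
      by (simp add: funpow_swap1)
    moreover have "last (tapes x K (p, F x)) = tapes x K (p, F x) ! Suc K"
      by (subst last_conv_nth) (auto simp flip: length_0_conv)
    ultimately show ?thesis
      by (auto simp: halted_with_output_def M_def program_tm_def idx_def nth_tapes input_tape_def)
  qed
  then show ?thesis
    unfolding polytime_def using wf by blast
qed

section \<open>Arithmetic expressions over the bits of the input\<close>

datatype exp = Var nat | Const nat | Add exp exp | Sub exp exp | Bit exp | Len | Sum exp exp

fun eval :: "bool list \<Rightarrow> nat list \<Rightarrow> exp \<Rightarrow> nat" where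
  "eval x env (Var i) = (if i < length env then env ! i else 0)"
| "eval x env (Const k) = k"
| "eval x env (Add a b) = eval x env a + eval x env b"
| "eval x env (Sub a b) = eval x env a - eval x env b"
| "eval x env (Bit a) = (if eval x env a < length x \<and> x ! eval x env a then 1 else 0)"
| "eval x env Len = length x"
| "eval x env (Sum a b) = (\<Sum>v<eval x env a. eval x (v # env) b)"

text \<open>In a register other than \<open>0\<close> the symbol \<open>1\<close> is scanned exactly
  at zero, so the loop runs until \<open>r\<close> is empty. Addition destroys its source; this is
  why a variable is read by moving it into two registers at once and moving one of them
  back.\<close>

definition add_to :: "nat \<Rightarrow> nat \<Rightarrow> com" where
  "add_to r d = While r 1 (Seq (Dec r) (Inc d))"

text \<open>The value of an expression is computed into register \<open>n + 1\<close>; all registers above \<open>n\<close>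
  are assumed to be zero, and \<open>\<rho>\<close> lists the registers that hold the variables.\<close>

fun compile :: "nat list \<Rightarrow> nat \<Rightarrow> exp \<Rightarrow> com" where
  "compile \<rho> n (Var i) = (if i < length \<rho>
     then Seq (While (\<rho> ! i) 1 (Seq (Dec (\<rho> ! i)) (Seq (Inc (n + 1)) (Inc (n + 2))))) (add_to (n + 2) (\<rho> ! i))
     else Skip)"
| "compile \<rho> n (Const k) = (Seq (Inc (n + 1)) ^^ k) Skip"
| "compile \<rho> n (Add a b) = Seq (compile \<rho> n a) (Seq (compile \<rho> (n + 1) b) (add_to (n + 2) (n + 1)))"
| "compile \<rho> n (Sub a b) = Seq (compile \<rho> n a) (Seq (compile \<rho> (n + 1) b)
     (While (n + 2) 1 (Seq (Dec (n + 2)) (If (n + 1) 1 Skip (Dec (n + 1))))))"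
| "compile \<rho> n (Bit a) = Seq (compile \<rho> n a)
     (Seq (While (n + 1) 1 (Seq (Dec (n + 1)) (Seq (Inc 0) (Inc (n + 2)))))
     (Seq (If 0 2 (Inc (n + 1)) Skip)
       (While (n + 2) 1 (Seq (Dec (n + 2)) (Dec 0)))))"
| "compile \<rho> n Len = Seq (While 0 0 (Seq (Inc 0) (Seq (Inc (n + 1)) (Inc (n + 2)))))
     (While (n + 2) 1 (Seq (Dec (n + 2)) (Dec 0)))"
| "compile \<rho> n (Sum a b) = Seq (compile \<rho> (n + 1) a)
     (While (n + 2) 1 (Seq (Dec (n + 2)) (Seq (compile ((n + 2) # \<rho>) (n + 2) b) (add_to (n + 3) (n + 1)))))"

definition ready :: "nat list \<Rightarrow> nat \<Rightarrow> nat list \<Rightarrow> (nat \<Rightarrow> int) \<Rightarrow> bool" where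
  "ready \<rho> n env p \<longleftrightarrow> length \<rho> = length env \<and> p 0 = 0 \<and> (\<forall>r > n. p r = 0) \<and>
     (\<forall>i < length env. 1 \<le> \<rho> ! i \<and> \<rho> ! i \<le> n \<and> p (\<rho> ! i) = int (env ! i))"

lemma exec_eq: "exec x c s t s1 \<Longrightarrow> s1 = s2 \<Longrightarrow> t \<le> u \<Longrightarrow> exec x c s u s2"
  using exec_mono by blast

text \<open>The common shape of counting loops. The counter \<open>r\<close> is overwritten outside
  the family \<open>P\<close>, so a body is verified only for its own effect. The four extra steps
  per round are \<open>Dec\<close>, its \<open>Seq\<close>, and the two steps of
  \<open>exec_While\<close>.\<close>

lemma exec_countdown:
  assumes "\<And>i. i < N \<Longrightarrow> exec x c ((P i)(r := int (N - Suc i)), Q i) t ((P (Suc i))(r := int (N - Suc i)), Q (Suc i))"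
    and "r \<noteq> 0" "p = (P 0)(r := int N)" "p' = (P N)(r := 0)" "out = Q 0" "out' = Q N" "N * (t + 4) + 1 \<le> u"
  shows "exec x (While r 1 (Seq (Dec r) c)) (p, out) u (p', out')"
proof -
  let ?S = "\<lambda>i. ((P i)(r := int (N - i)), Q i)"
  have "exec x (While r 1 (Seq (Dec r) c)) (?S 0) (N * ((t + 2) + 2) + 1) (?S N)"
  proof (rule exec_While)
    fix i assume i: "i < N"
    have "exec x (Dec r) (?S i) (Suc 0) ((P i)(r := int (N - Suc i)), Q i)"
      by (rule exec_eq[OF exec_Dec]) (use i in auto)
    from exec_Seq[OF this assms(1)[OF i]]
    show "scan x (fst (?S i)) r \<noteq> 1 \<and> exec x (Seq (Dec r) c) (?S i) (t + 2) (?S (Suc i))"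
      using i assms(2) by (auto simp: scan_def)
  qed (use assms(2) in \<open>auto simp: scan_def\<close>)
  then show ?thesis by (rule exec_eq[OF back_subst[where P = "\<lambda>s. exec x _ s _ _"]]) (use assms in \<open>auto simp: algebra_simps\<close>)
qed

lemma exec_add_to:
  assumes "r \<noteq> 0" "d \<noteq> r" "p r = int N"
  shows "exec x (add_to r d) (p, out) (5 * N + 1) (p(r := 0, d := p d + int N), out)"
  unfolding add_to_def
  by (rule exec_countdown[where P = "\<lambda>i. p(d := p d + int i)" and Q = "\<lambda>_. out" and t = 1 and N = N])
     (use assms in \<open>auto simp: fun_eq_iff intro!: exec_eq[OF exec_Inc[where t = 0]]\<close>)

text \<open>As the base is at least two, constants and sums are absorbed by a larger exponent, and
  one number \<open>k\<close> describes a bound.\<close>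

definition poly_bounded :: "(nat \<Rightarrow> nat) \<Rightarrow> bool" where
  "poly_bounded f \<longleftrightarrow> (\<exists>k. \<forall>m. f m \<le> (m + 2) ^ k)"

lemma poly_bounded_const: "poly_bounded (\<lambda>_. c)"
proof -
  have "c \<le> (m + 2) ^ c" for m :: nat
    by (metis less_exp le_add2 less_imp_le order_trans power_mono zero_le)
  then show ?thesis unfolding poly_bounded_def by blast
qed

lemma poly_bounded_id: "poly_bounded (\<lambda>m. m)"
  unfolding poly_bounded_def by (intro exI[of _ 1]) auto

lemma poly_bounded_mult:
  assumes "poly_bounded f" "poly_bounded g"
  shows "poly_bounded (\<lambda>m. f m * g m)"
proof -
  obtain k l where "\<And>m. f m \<le> (m + 2) ^ k" "\<And>m. g m \<le> (m + 2) ^ l"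
    using assms unfolding poly_bounded_def by blast
  then have "f m * g m \<le> (m + 2) ^ (k + l)" for m
    by (metis mult_le_mono power_add)
  then show ?thesis unfolding poly_bounded_def by blast
qed

lemma poly_bounded_add:
  assumes "poly_bounded f" "poly_bounded g"
  shows "poly_bounded (\<lambda>m. f m + g m)"
proof -
  obtain k l where "\<And>m. f m \<le> (m + 2) ^ k" "\<And>m. g m \<le> (m + 2) ^ l"
    using assms unfolding poly_bounded_def by blast
  moreover have "(m + 2) ^ k \<le> (m + 2) ^ (k + l)" "(m + 2) ^ l \<le> (m + 2) ^ (k + l)" for m :: nat
    by (auto intro: power_increasing)
  ultimately have "f m + g m \<le> 2 * (m + 2) ^ (k + l)" for m
    by (metis add_le_mono le_trans mult_2)
  moreover have "2 * (m + 2) ^ (k + l) \<le> (m + 2) ^ Suc (k + l)" for m :: nat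
    by simp
  ultimately show ?thesis unfolding poly_bounded_def using le_trans by blast
qed

lemma poly_bounded_power: "poly_bounded f \<Longrightarrow> poly_bounded (\<lambda>m. f m ^ k)"
  by (induction k) (auto intro: poly_bounded_mult poly_bounded_const)

lemmas poly_bounded_intros = poly_bounded_const poly_bounded_id poly_bounded_mult poly_bounded_add poly_bounded_power

lemma ready_upd: "ready \<rho> n env p \<Longrightarrow> ready \<rho> (Suc n) env (p(Suc n := v))"
  unfolding ready_def by fastforce

lemma exec_Incs:
  "exec x ((Seq (Inc r) ^^ k) Skip) (p, out) (2 * k + 1) (p(r := p r + int k), out)"
proof (induction k arbitrary: p)
  case (Suc k)
  show ?case
    unfolding funpow.simps o_apply
    by (rule exec_eq[OF exec_Seq[OF exec_Inc[of x r p out 0] Suc[of "p(r := p r + 1)"]]]) (auto simp: fun_eq_iff)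
qed (auto intro: exec_Skip)

text \<open>Value and time are bounded together because the value of a subexpression determines the
  number of rounds of the loops around it. The parameter \<open>m\<close> bounds the input length
  and the variables alike; below a \<open>Sum\<close> it is replaced by a larger one that also
  covers the summation index.\<close>

definition computes :: "exp \<Rightarrow> nat \<Rightarrow> bool" where
  "computes e k \<longleftrightarrow> (\<forall>x env m. length x \<le> m \<longrightarrow> (\<forall>v \<in> set env. v \<le> m) \<longrightarrow>
     eval x env e \<le> (m + 2) ^ k \<and> (\<forall>\<rho> n p out. ready \<rho> n env p \<longrightarrow>
       exec x (compile \<rho> n e) (p, out) ((m + 2) ^ k) (p(n + 1 := int (eval x env e)), out)))"

lemma computesI:
  assumes "poly_bounded T"
    and "\<And>x env m. length x \<le> m \<Longrightarrow> \<forall>v \<in> set env. v \<le> m \<Longrightarrow> eval x env e \<le> T m"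
    and "\<And>x env m \<rho> n p out. length x \<le> m \<Longrightarrow> \<forall>v \<in> set env. v \<le> m \<Longrightarrow> ready \<rho> n env p \<Longrightarrow>
      exec x (compile \<rho> n e) (p, out) (T m) (p(n + 1 := int (eval x env e)), out)"
  shows "\<exists>k. computes e k"
proof -
  obtain k where "\<And>m. T m \<le> (m + 2) ^ k"
    using assms(1) unfolding poly_bounded_def by blast
  then show ?thesis
    unfolding computes_def using assms(2,3) exec_mono le_trans by meson
qed

lemma computes_V: "\<exists>k. computes (Var i) k"
proof (rule computesI[where T = "\<lambda>m. m * 8 + m * 5 + 3"])
  show "poly_bounded (\<lambda>m. m * 8 + m * 5 + 3)" by (intro poly_bounded_intros)
  fix x :: "bool list" and env and m :: nat
  assume m: "\<forall>v \<in> set env. v \<le> m"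
  show "eval x env (Var i) \<le> m * 8 + m * 5 + 3"
    using m nth_mem[of i env] by fastforce
  fix \<rho> n p and out :: "bool list" assume r: "ready \<rho> n env p"
  show "exec x (compile \<rho> n (Var i)) (p, out) (m * 8 + m * 5 + 3) (p(n + 1 := int (eval x env (Var i))), out)"
  proof (cases "i < length env")
    case False
    then show ?thesis
      using r by (auto simp: ready_def fun_upd_idem exec_Skip)
  next
    case True
    let ?r = "\<rho> ! i" and ?N = "env ! i"
    have r': "?r \<noteq> 0" "?r \<le> n" "p ?r = int ?N" "p (Suc n) = 0" "p (Suc (Suc n)) = 0" "i < length \<rho>"
      using r True by (auto simp: ready_def)
    let ?p = "p(n + 1 := int ?N, n + 2 := int ?N, ?r := 0)"
    have 1: "exec x (While ?r 1 (Seq (Dec ?r) (Seq (Inc (n + 1)) (Inc (n + 2))))) (p, out) (?N * 8 + 1) (?p, out)"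
      by (rule exec_countdown[where P = "\<lambda>i. p(n + 1 := int i, n + 2 := int i)" and Q = "\<lambda>_. out" and t = 3 and N = ?N])
         (use r' in \<open>auto simp: fun_eq_iff intro!: exec_eq[OF exec_Seq[OF exec_Inc[where t = 0] exec_Inc[where t = 0]]]\<close>)
    have 2: "exec x (add_to (n + 2) ?r) (?p, out) (5 * ?N + 1) (p(n + 1 := int ?N), out)"
      by (rule exec_eq[OF exec_add_to[where N = ?N]]) (use r' in \<open>auto simp: fun_eq_iff\<close>)
    have "?N \<le> m" using m True by simp
    then show ?thesis
      using r' True exec_eq[OF exec_Seq[OF 1 2] refl] by simp
  qed
qed

lemma computes_C: "\<exists>k'. computes (Const k) k'"
proof (rule computesI[where T = "\<lambda>m. 2 * k + 1"])
  fix x :: "bool list" and env \<rho> n p out assume "ready \<rho> n env p"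
  then show "exec x (compile \<rho> n (Const k)) (p, out) (2 * k + 1) (p(n + 1 := int (eval x env (Const k))), out)"
    using exec_Incs[where x = x and r = "n + 1" and k = k and p = p and out = out] by (simp add: ready_def)
qed (auto intro: poly_bounded_intros)

lemma computes_Add:
  assumes "computes a k" "computes b l"
  shows "\<exists>k. computes (Add a b) k"
proof (rule computesI[where T = "\<lambda>m. (m + 2) ^ k + 6 * (m + 2) ^ l + 3"])
  show "poly_bounded (\<lambda>m. (m + 2) ^ k + 6 * (m + 2) ^ l + 3)" by (intro poly_bounded_intros)
  fix x :: "bool list" and env and m :: nat
  assume m: "length x \<le> m" "\<forall>v \<in> set env. v \<le> m"
  let ?A = "eval x env a" and ?B = "eval x env b"
  have v: "?A \<le> (m + 2) ^ k" "?B \<le> (m + 2) ^ l"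
    using assms m unfolding computes_def by auto
  show "eval x env (Add a b) \<le> (m + 2) ^ k + 6 * (m + 2) ^ l + 3"
    using v by simp
  fix \<rho> n p and out :: "bool list" assume r: "ready \<rho> n env p"
  have 1: "exec x (compile \<rho> n a) (p, out) ((m + 2) ^ k) (p(n + 1 := int ?A), out)"
    using assms(1) m r unfolding computes_def by blast
  have 2: "exec x (compile \<rho> (n + 1) b) (p(n + 1 := int ?A), out) ((m + 2) ^ l) (p(n + 1 := int ?A, n + 2 := int ?B), out)"
    using assms(2) m ready_upd[OF r] unfolding computes_def by fastforce
  have 3: "exec x (add_to (n + 2) (n + 1)) (p(n + 1 := int ?A, n + 2 := int ?B), out) (5 * ?B + 1) (p(n + 1 := int (?A + ?B)), out)"
    by (rule exec_eq[OF exec_add_to[where N = ?B]]) (use r in \<open>auto simp: fun_eq_iff ready_def\<close>)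
  show "exec x (compile \<rho> n (Add a b)) (p, out) ((m + 2) ^ k + 6 * (m + 2) ^ l + 3) (p(n + 1 := int (eval x env (Add a b))), out)"
    using exec_eq[OF exec_Seq[OF 1 exec_Seq[OF 2 3]] refl] v by simp
qed

lemma computes_Sub:
  assumes "computes a k" "computes b l"
  shows "\<exists>k. computes (Sub a b) k"
proof (rule computesI[where T = "\<lambda>m. (m + 2) ^ k + 9 * (m + 2) ^ l + 3"])
  show "poly_bounded (\<lambda>m. (m + 2) ^ k + 9 * (m + 2) ^ l + 3)" by (intro poly_bounded_intros)
  fix x :: "bool list" and env and m :: nat
  assume m: "length x \<le> m" "\<forall>v \<in> set env. v \<le> m"
  let ?A = "eval x env a" and ?B = "eval x env b"
  have v: "?A \<le> (m + 2) ^ k" "?B \<le> (m + 2) ^ l"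
    using assms m unfolding computes_def by auto
  show "eval x env (Sub a b) \<le> (m + 2) ^ k + 9 * (m + 2) ^ l + 3"
    using v by simp
  fix \<rho> n p and out :: "bool list" assume r: "ready \<rho> n env p"
  have 1: "exec x (compile \<rho> n a) (p, out) ((m + 2) ^ k) (p(n + 1 := int ?A), out)"
    using assms(1) m r unfolding computes_def by blast
  have 2: "exec x (compile \<rho> (n + 1) b) (p(n + 1 := int ?A), out) ((m + 2) ^ l) (p(n + 1 := int ?A, n + 2 := int ?B), out)"
    using assms(2) m ready_upd[OF r] unfolding computes_def by fastforce
  let ?c = "If (n + 1) 1 Skip (Dec (n + 1))"
  have body: "exec x ?c (q, out) 2 (q(n + 1 := int (?A - Suc i)), out)" if "q (n + 1) = int (?A - i)" for q i
  proof (cases "?A \<le> i")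
    case True
    then show ?thesis using that
      by (intro exec_eq[OF exec_If[where t = 0]]) (auto simp: scan_def intro!: exec_eq[OF exec_Skip])
  next
    case False
    then show ?thesis using that
      by (intro exec_eq[OF exec_If[where t = 1]]) (auto simp: scan_def intro!: exec_eq[OF exec_Dec[where t = 0]])
  qed
  have body': "exec x ?c (p(n + 1 := int (?A - i), n + 2 := j), out) 2 (p(n + 1 := int (?A - Suc i), n + 2 := j), out)" for i j
    by (rule exec_eq[OF body[of _ i]]) (auto simp: fun_eq_iff)
  have 3: "exec x (While (n + 2) 1 (Seq (Dec (n + 2)) ?c)) (p(n + 1 := int ?A, n + 2 := int ?B), out) (?B * 6 + 1) (p(n + 1 := int (?A - ?B)), out)"
    by (rule exec_countdown[where P = "\<lambda>i. p(n + 1 := int (?A - i))" and Q = "\<lambda>_. out" and t = 2 and N = ?B, OF body'])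
       (use r in \<open>auto simp: fun_eq_iff ready_def\<close>)
  show "exec x (compile \<rho> n (Sub a b)) (p, out) ((m + 2) ^ k + 9 * (m + 2) ^ l + 3) (p(n + 1 := int (eval x env (Sub a b))), out)"
    using exec_eq[OF exec_Seq[OF 1 exec_Seq[OF 2 3]] refl] v by simp
qed

lemma scan_input: "scan x p 0 = (if 0 \<le> p 0 \<and> p 0 < int (length x) then if x ! nat (p 0) then 2 else 1 else 0)"
  by (simp add: scan_def input_tape_def bit_symbol_def)

lemma exec_rewind:
  assumes "p 0 = int N" "p r = int N" "r \<noteq> 0"
  shows "exec x (While r 1 (Seq (Dec r) (Dec 0))) (p, out) (N * 5 + 1) (p(0 := 0, r := 0), out)"
  by (rule exec_countdown[where P = "\<lambda>i. p(0 := int (N - i))" and Q = "\<lambda>_. out" and t = 1 and N = N])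
     (use assms in \<open>auto simp: fun_eq_iff intro!: exec_eq[OF exec_Dec[where t = 0]]\<close>)

lemma computes_Bit:
  assumes "computes a k"
  shows "\<exists>k. computes (Bit a) k"
proof (rule computesI[where T = "\<lambda>m. 13 * (m + 2) ^ k + (m + 2) ^ k + 7"])
  show "poly_bounded (\<lambda>m. 13 * (m + 2) ^ k + (m + 2) ^ k + 7)" by (intro poly_bounded_intros)
  fix x :: "bool list" and env and m :: nat
  assume m: "length x \<le> m" "\<forall>v \<in> set env. v \<le> m"
  let ?A = "eval x env a"
  have v: "?A \<le> (m + 2) ^ k"
    using assms m unfolding computes_def by auto
  show "eval x env (Bit a) \<le> 13 * (m + 2) ^ k + (m + 2) ^ k + 7" by simp
  fix \<rho> n p and out :: "bool list" assume r: "ready \<rho> n env p"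
  let ?v = "int (eval x env (Bit a))"
  have 1: "exec x (compile \<rho> n a) (p, out) ((m + 2) ^ k) (p(n + 1 := int ?A), out)"
    using assms m r unfolding computes_def by blast
  have 2: "exec x (While (n + 1) 1 (Seq (Dec (n + 1)) (Seq (Inc 0) (Inc (n + 2))))) (p(n + 1 := int ?A), out)
      (?A * 7 + 1) (p(0 := int ?A, n + 2 := int ?A), out)"
    by (rule exec_countdown[where P = "\<lambda>i. p(0 := int i, n + 2 := int i)" and Q = "\<lambda>_. out" and t = 3 and N = ?A])
       (use r in \<open>auto simp: fun_eq_iff ready_def intro!: exec_eq[OF exec_Seq[OF exec_Inc[where t = 0] exec_Inc[where t = 0]]]\<close>)
  have 3: "exec x (If 0 2 (Inc (n + 1)) Skip) (p(0 := int ?A, n + 2 := int ?A), out) 2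
      (p(0 := int ?A, n + 2 := int ?A, n + 1 := ?v), out)"
    using r by (intro exec_eq[OF exec_If[where t = 1]])
      (auto simp: scan_input ready_def intro!: exec_eq[OF exec_Inc[where t = 0]] exec_eq[OF exec_Skip])
  have 4: "exec x (While (n + 2) 1 (Seq (Dec (n + 2)) (Dec 0))) (p(0 := int ?A, n + 2 := int ?A, n + 1 := ?v), out)
     (?A * 5 + 1) (p(n + 1 := ?v), out)"
    by (rule exec_eq[OF exec_rewind[where N = ?A]]) (use r in \<open>auto simp: fun_eq_iff ready_def\<close>)
  show "exec x (compile \<rho> n (Bit a)) (p, out) (13 * (m + 2) ^ k + (m + 2) ^ k + 7) (p(n + 1 := ?v), out)"
    using exec_eq[OF exec_Seq[OF 1 exec_Seq[OF 2 exec_Seq[OF 3 4]]] refl] v by simp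
qed

lemma computes_Len: "\<exists>k. computes Len k"
proof (rule computesI[where T = "\<lambda>m. m * 7 + m * 5 + 3"])
  show "poly_bounded (\<lambda>m. m * 7 + m * 5 + 3)" by (intro poly_bounded_intros)
  fix x :: "bool list" and env and m :: nat
  assume m: "length x \<le> m" "\<forall>v \<in> set env. v \<le> m"
  show "eval x env Len \<le> m * 7 + m * 5 + 3" using m by simp
  fix \<rho> n p and out :: "bool list" assume r: "ready \<rho> n env p"
  let ?S = "\<lambda>i. (p(0 := int i, n + 1 := int i, n + 2 := int i), out)"
  have "exec x (While 0 0 (Seq (Inc 0) (Seq (Inc (n + 1)) (Inc (n + 2))))) (?S 0) (length x * (5 + 2) + 1) (?S (length x))"
  proof (rule exec_While)
    fix i assume "i < length x"
    then show "scan x (fst (?S i)) 0 \<noteq> 0 \<and>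
        exec x (Seq (Inc 0) (Seq (Inc (n + 1)) (Inc (n + 2)))) (?S i) 5 (?S (Suc i))"
      by (auto simp: scan_input fun_eq_iff intro!: exec_eq[OF exec_Seq[OF exec_Inc[where t = 0] exec_Seq[OF exec_Inc[where t = 0] exec_Inc[where t = 0]]]])
  qed (simp add: scan_input)
  moreover have "?S 0 = (p, out)"
    using r by (auto simp: ready_def fun_eq_iff)
  ultimately have 1: "exec x (While 0 0 (Seq (Inc 0) (Seq (Inc (n + 1)) (Inc (n + 2))))) (p, out) (length x * 7 + 1) (?S (length x))"
    by simp
  have 2: "exec x (While (n + 2) 1 (Seq (Dec (n + 2)) (Dec 0))) (?S (length x)) (length x * 5 + 1) (p(n + 1 := int (length x)), out)"
    by (rule exec_eq[OF exec_rewind[where N = "length x"]]) (use r in \<open>auto simp: fun_eq_iff ready_def\<close>)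
  show "exec x (compile \<rho> n Len) (p, out) (m * 7 + m * 5 + 3) (p(n + 1 := int (eval x env Len)), out)"
    using exec_eq[OF exec_Seq[OF 1 2] refl] m by simp
qed

lemma computes_Sum:
  assumes "computes a k" "computes b l"
  shows "\<exists>k. computes (Sum a b) k"
proof -
  \<comment> \<open>Cost of one evaluation of \<open>b\<close>: inside the sum the bound
    \<open>m\<close> is raised to \<open>(m + 2) ^ k + m\<close>, as the index can be almost as
    large as the value of \<open>a\<close>.\<close>
  define W where "W m = ((m + 2) ^ k + m + 2) ^ l" for m :: nat
  define T where "T m = (m + 2) ^ k + (m + 2) ^ k * (6 * W m + 6) + 2" for m :: nat
  show ?thesis
  proof (rule computesI[where T = T])
    show "poly_bounded T" unfolding T_def W_def by (intro poly_bounded_intros)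
    fix x :: "bool list" and env and m :: nat
    assume m: "length x \<le> m" "\<forall>v \<in> set env. v \<le> m"
    let ?A = "eval x env a" and ?f = "\<lambda>v. eval x (v # env) b"
    have A: "?A \<le> (m + 2) ^ k" using assms m unfolding computes_def by auto
    have B: "?f v \<le> W m \<and> (\<forall>\<rho> n p out. ready \<rho> n (v # env) p \<longrightarrow>
       exec x (compile \<rho> n b) (p, out) (W m) (p(n + 1 := int (?f v)), out))" if "v < ?A" for v
      using assms(2)[unfolded computes_def, rule_format, of x "(m + 2) ^ k + m" "v # env"] m that A
      unfolding W_def by fastforce
    have "(\<Sum>v<?A. ?f v) \<le> ?A * W m"
      using sum_bounded_above[of "{..<?A}" ?f "W m"] B by simp
    also have "\<dots> \<le> (m + 2) ^ k * W m" using A by simp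
    also have "\<dots> \<le> T m" by (simp add: T_def algebra_simps)
    finally show "eval x env (Sum a b) \<le> T m" by simp
    fix \<rho> n p and out :: "bool list" assume r: "ready \<rho> n env p"
    \<comment> \<open>The counter runs downwards, so after \<open>i\<close> rounds the summands of
      the last \<open>i\<close> indices have been added.\<close>
    define s where "s i = int (\<Sum>v\<in>{?A - i..<?A}. ?f v)" for i
    let ?c = "Seq (compile ((n + 2) # \<rho>) (n + 2) b) (add_to (n + 3) (n + 1))"
    have 1: "exec x (compile \<rho> (n + 1) a) (p, out) ((m + 2) ^ k) (p(n + 2 := int ?A), out)"
      using assms(1) m ready_upd[OF r, of 0] r unfolding computes_def ready_def by (fastforce simp: fun_upd_idem)
    have body: "exec x ?c (p(n + 1 := s i, n + 2 := int (?A - Suc i)), out) (6 * W m + 2)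
        (p(n + 1 := s (Suc i), n + 2 := int (?A - Suc i)), out)" if i: "i < ?A" for i
    proof -
      let ?v = "?A - Suc i" and ?p = "p(n + 1 := s i, n + 2 := int (?A - Suc i))"
      have v: "?v < ?A" using i by simp
      have rd: "ready ((n + 2) # \<rho>) (n + 2) (?v # env) ?p"
        using r by (auto simp: ready_def nth_Cons split: nat.splits)
      have 1: "exec x (compile ((n + 2) # \<rho>) (n + 2) b) (?p, out) (W m) (?p(n + 3 := int (?f ?v)), out)"
        using B[OF v, THEN conjunct2, rule_format, OF rd] by (simp add: numeral_3_eq_3)
      have "{?A - Suc i..<?A} = insert ?v {?A - i..<?A}" using i by auto
      then have s: "s (Suc i) = s i + int (?f ?v)" using i by (simp add: s_def)
      have 2: "exec x (add_to (n + 3) (n + 1)) (?p(n + 3 := int (?f ?v)), out) (5 * ?f ?v + 1)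
          (p(n + 1 := s (Suc i), n + 2 := int (?A - Suc i)), out)"
        by (rule exec_eq[OF exec_add_to[where N = "?f ?v"]]) (use r s in \<open>auto simp: ready_def fun_eq_iff\<close>)
      show ?thesis
        using exec_eq[OF exec_Seq[OF 1 2] refl] B[OF v] by simp
    qed
    have 2: "exec x (While (n + 2) 1 (Seq (Dec (n + 2)) ?c)) (p(n + 2 := int ?A), out)
        (?A * (6 * W m + 6) + 1) (p(n + 1 := s ?A), out)"
      by (rule exec_countdown[where P = "\<lambda>i. p(n + 1 := s i)" and Q = "\<lambda>_. out" and t = "6 * W m + 2" and N = ?A])
         (use body r in \<open>auto simp: ready_def fun_eq_iff s_def\<close>)
    have "?A * (6 * W m + 6) \<le> (m + 2) ^ k * (6 * W m + 6)" using A by simp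
    then show "exec x (compile \<rho> n (Sum a b)) (p, out) (T m) (p(n + 1 := int (eval x env (Sum a b))), out)"
      using exec_eq[OF exec_Seq[OF 1 2] refl] by (simp add: T_def s_def atLeast0LessThan)
  qed
qed

lemma ex_computes: "\<exists>k. computes e k"
  by (induction e) (use computes_V computes_C computes_Add computes_Sub computes_Bit computes_Len computes_Sum in blast)+

text \<open>Register \<open>1\<close> counts the bits still to be written, register \<open>2\<close>
  is the index of the current one, register \<open>3\<close> receives its value. Register
  \<open>3\<close> is emptied in each round because \<open>compile\<close> expects zeros above the
  variables.\<close>

definition emit_bits :: "exp \<Rightarrow> exp \<Rightarrow> com" where
  "emit_bits N e = Seq (compile [] 0 N) (While 1 1 (Seq (Dec 1)
     (Seq (compile [2] 2 e) (Seq (If 3 1 (Out False) (Out True)) (Seq (While 3 1 (Seq (Dec 3) Skip)) (Inc 2))))))"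

theorem polytime_bits:
  fixes N e :: exp
  shows "polytime (\<lambda>x. map (\<lambda>i. eval x [i] e \<noteq> 0) [0..<eval x [] N])"
proof -
  obtain k l where k: "computes N k" and l: "computes e l"
    using ex_computes by blast
  define W where "W m = ((m + 2) ^ k + m + 2) ^ l" for m :: nat
  define T where "T m = (m + 2) ^ k + (m + 2) ^ k * (5 * W m + 13) + 2" for m :: nat
  have "poly_bounded T" unfolding T_def W_def by (intro poly_bounded_intros)
  then obtain j where j: "\<And>m. T m \<le> (m + 2) ^ j" unfolding poly_bounded_def by blast
  show ?thesis
  proof (rule polytime_program[where c = "emit_bits N e"])
    fix x :: "bool list"
    let ?m = "length x" and ?N = "eval x [] N" and ?f = "\<lambda>i. eval x [i] e"
    have A: "?N \<le> (?m + 2) ^ k" using k unfolding computes_def by auto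
    have B: "?f v \<le> W ?m \<and> (\<forall>\<rho> n p out. ready \<rho> n [v] p \<longrightarrow>
       exec x (compile \<rho> n e) (p, out) (W ?m) (p(n + 1 := int (?f v)), out))" if "v < ?N" for v
      using l[unfolded computes_def, rule_format, of x "(?m + 2) ^ k + ?m" "[v]"] that A
      unfolding W_def by fastforce
    let ?z = "\<lambda>_. 0 :: int"
    have 1: "exec x (compile [] 0 N) (?z, []) ((?m + 2) ^ k) (?z(1 := int ?N), [])"
      using k unfolding computes_def by (fastforce simp: ready_def)
    let ?Q = "\<lambda>i. map (\<lambda>i. ?f i \<noteq> 0) [0..<i]"
    let ?c = "Seq (compile [2] 2 e) (Seq (If 3 1 (Out False) (Out True)) (Seq (While 3 1 (Seq (Dec 3) Skip)) (Inc 2)))"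
    have body: "exec x ?c (?z(2 := int i, 1 := v), ?Q i) (5 * W ?m + 9) (?z(2 := int (Suc i), 1 := v), ?Q (Suc i))"
      if i: "i < ?N" for i v
    proof -
      let ?p = "?z(2 := int i, 1 := v)"
      have 1: "exec x (compile [2] 2 e) (?p, ?Q i) (W ?m) (?p(3 := int (?f i)), ?Q i)"
        using B[OF i, THEN conjunct2, rule_format, of "[2]" 2 ?p "?Q i"] by (simp add: ready_def)
      have 2: "exec x (If 3 1 (Out False) (Out True)) (?p(3 := int (?f i)), ?Q i) 2 (?p(3 := int (?f i)), ?Q (Suc i))"
        by (intro exec_eq[OF exec_If[where t = 1]]) (auto simp: scan_def intro!: exec_eq[OF exec_Out[where t = 0]])
      have 3: "exec x (While 3 1 (Seq (Dec 3) Skip)) (?p(3 := int (?f i)), ?Q (Suc i)) (?f i * 4 + 1) (?p, ?Q (Suc i))"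
        by (rule exec_countdown[where P = "\<lambda>_. ?p" and Q = "\<lambda>_. ?Q (Suc i)" and t = 0 and N = "?f i"])
           (auto simp: fun_eq_iff intro: exec_Skip)
      have 4: "exec x (Inc 2) (?p, ?Q (Suc i)) 1 (?z(2 := int (Suc i), 1 := v), ?Q (Suc i))"
        by (rule exec_eq[OF exec_Inc[where t = 0]]) (auto simp: fun_eq_iff)
      show ?thesis
        using exec_eq[OF exec_Seq[OF 1 exec_Seq[OF 2 exec_Seq[OF 3 4]]] refl] B[OF i] by simp
    qed
    have 2: "exec x (While 1 1 (Seq (Dec 1) ?c)) (?z(1 := int ?N), []) (?N * (5 * W ?m + 13) + 1) (?z(2 := int ?N), ?Q ?N)"
      by (rule exec_countdown[where P = "\<lambda>i. ?z(2 := int i)" and Q = ?Q and t = "5 * W ?m + 9" and N = ?N])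
         (use body in \<open>auto simp: fun_eq_iff\<close>)
    have "?N * (5 * W ?m + 13) \<le> (?m + 2) ^ k * (5 * W ?m + 13)" using A by simp
    then have "(?m + 2) ^ k + (?N * (5 * W ?m + 13) + 1) + 1 \<le> T ?m" by (simp add: T_def)
    then have "exec x (emit_bits N e) (?z, []) ((?m + 2) ^ j) (?z(2 := int ?N), ?Q ?N)"
      unfolding emit_bits_def using exec_eq[OF exec_Seq[OF 1 2] refl] j le_trans by blast
    then show "\<exists>p. exec x (emit_bits N e) (?z, []) ((?m + 2) ^ j) (p, map (\<lambda>i. ?f i \<noteq> 0) [0..<?N])"
      by blast
  qed
qed

text \<open>A variable beyond the environment has value zero. So an expression meant for the empty
  environment can be used in \<open>polytime_bits\<close>, where it computes the single bit with
  index zero.\<close>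

lemma eval_append_0: "eval x (env @ [0]) e = eval x env e"
proof (induction e arbitrary: env)
  case (Sum a b)
  from Sum(2)[of "_ # env"] show ?case using Sum(1) by simp
qed (auto simp: nth_append)

corollary class_P_nonzero: "{x. eval x [] e \<noteq> 0} \<in> class_P"
  using polytime_bits[of e "Const 1"] eval_append_0[of _ "[]" e] by (simp add: class_P_def)

section \<open>Definable functions\<close>

text \<open>A function of \<open>s\<close> is definable if it is the value of a fixed expression, where \<open>inp s\<close> is
  the input string and the functions in \<open>vs\<close> give the values of the variables.\<close>

definition definable :: "('s \<Rightarrow> bool list) \<Rightarrow> ('s \<Rightarrow> nat) list \<Rightarrow> ('s \<Rightarrow> nat) \<Rightarrow> bool" where
  "definable inp vs F \<longleftrightarrow> (\<exists>e. \<forall>s. F s = eval (inp s) (map (\<lambda>v. v s) vs) e)"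

definition bit_at :: "bool list \<Rightarrow> nat \<Rightarrow> bool" where
  "bit_at x i \<longleftrightarrow> i < length x \<and> x ! i"

fun lift :: "nat \<Rightarrow> exp \<Rightarrow> exp" where
  "lift k (Var i) = Var (if i < k then i else Suc i)"
| "lift k (Add a b) = Add (lift k a) (lift k b)"
| "lift k (Sub a b) = Sub (lift k a) (lift k b)"
| "lift k (Bit a) = Bit (lift k a)"
| "lift k (Sum a b) = Sum (lift k a) (lift (Suc k) b)"
| "lift k e = e"

lemma eval_lift: "eval x (env @ v # env') (lift (length env) e) = eval x (env @ env') e"
proof (induction e arbitrary: env)
  case (Sum a b)
  from Sum(2)[of "_ # env"] show ?case using Sum(1)[of env] by simp
qed (auto simp: nth_append)

named_theorems D_intros

lemma D_var: "f \<in> set vs \<Longrightarrow> definable inp vs f"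
proof -
  assume "f \<in> set vs"
  then obtain i where "i < length vs" "vs ! i = f" by (auto simp: in_set_conv_nth)
  then show ?thesis unfolding definable_def by (intro exI[of _ "Var i"]) auto
qed

lemma D_const [D_intros]: "definable inp vs (\<lambda>_. c)"
  unfolding definable_def by (intro exI[of _ "Const c"]) auto

lemma D_add [D_intros]:
  "definable inp vs f \<Longrightarrow> definable inp vs g \<Longrightarrow> definable inp vs (\<lambda>s. f s + g s)"
  unfolding definable_def by (metis eval.simps(3))

lemma D_sub [D_intros]:
  "definable inp vs f \<Longrightarrow> definable inp vs g \<Longrightarrow> definable inp vs (\<lambda>s. f s - g s)"
  unfolding definable_def by (metis eval.simps(4))

lemma D_bit [D_intros]:
  "definable inp vs f \<Longrightarrow> definable inp vs (\<lambda>s. of_bool (bit_at (inp s) (f s)))"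
proof -
  assume "definable inp vs f"
  then obtain e where "\<And>s. f s = eval (inp s) (map (\<lambda>v. v s) vs) e"
    unfolding definable_def by blast
  then show ?thesis unfolding definable_def by (intro exI[of _ "Bit e"]) (auto simp: bit_at_def)
qed

lemma D_length [D_intros]: "definable inp vs (\<lambda>s. length (inp s))"
  unfolding definable_def by (intro exI[of _ Len]) auto

text \<open>Under a binder the state becomes a pair of the old state and the bound value, whose
  variable is put in front of the others. In de Bruijn terms, old expressions are lifted at position
  zero.\<close>

lemma D_weaken:
  assumes "definable inp vs f"
  shows "definable (\<lambda>p. inp (fst p)) (snd # map (\<lambda>v p. v (fst p)) vs) (\<lambda>p. f (fst p))"
proof -
  obtain e where "\<And>s. f s = eval (inp s) (map (\<lambda>v. v s) vs) e"
    using assms unfolding definable_def by blast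
  then show ?thesis
    unfolding definable_def using eval_lift[of _ "[]"]
    by (intro exI[of _ "lift 0 e"]) (auto simp: o_def)
qed

lemma D_sum [D_intros]:
  assumes "definable inp vs f"
    and "definable (\<lambda>p. inp (fst p)) (snd # map (\<lambda>v p. v (fst p)) vs) (\<lambda>p. g (fst p) (snd p))"
  shows "definable inp vs (\<lambda>s. \<Sum>v<f s. g s v)"
proof -
  obtain d where "\<And>s. f s = eval (inp s) (map (\<lambda>v. v s) vs) d"
    using assms(1) unfolding definable_def by blast
  moreover obtain e where
    "\<And>s v. g s v = eval (inp s) (v # map (\<lambda>v. v s) vs) e"
    using assms(2) unfolding definable_def by (auto simp: o_def)
  ultimately show ?thesis
    unfolding definable_def by (intro exI[of _ "Sum d e"]) auto
qed

lemma D_cong: "definable inp vs f \<Longrightarrow> (\<And>s. f s = g s) \<Longrightarrow> definable inp vs g"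
  unfolding definable_def by simp

lemma D_mult [D_intros]:
  assumes "definable inp vs f" "definable inp vs g"
  shows "definable inp vs (\<lambda>s. f s * g s)"
  by (rule D_cong[OF D_sum[OF assms(1) D_weaken[OF assms(2)]]]) simp

lemma D_Suc [D_intros]: "definable inp vs f \<Longrightarrow> definable inp vs (\<lambda>s. Suc (f s))"
  using D_add[OF _ D_const[of inp vs 1], of f] by simp

lemma D_less [D_intros]:
  "definable inp vs f \<Longrightarrow> definable inp vs g \<Longrightarrow> definable inp vs (\<lambda>s. of_bool (f s < g s))"
  by (rule D_cong[where f = "\<lambda>s. 1 - (1 - (g s - f s))"], (intro D_intros; assumption)[1], auto)

lemma D_not [D_intros]:
  "definable inp vs (\<lambda>s. of_bool (P s)) \<Longrightarrow> definable inp vs (\<lambda>s. of_bool (\<not> P s))"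
  by (rule D_cong[where f = "\<lambda>s. 1 - of_bool (P s)"], (intro D_intros; assumption)[1], auto)

lemma D_conj [D_intros]:
  "definable inp vs (\<lambda>s. of_bool (P s)) \<Longrightarrow> definable inp vs (\<lambda>s. of_bool (Q s)) \<Longrightarrow>
    definable inp vs (\<lambda>s. of_bool (P s \<and> Q s))"
  by (rule D_cong[where f = "\<lambda>s. of_bool (P s) * of_bool (Q s)"], (intro D_intros; assumption)[1], auto)

lemma D_disj [D_intros]:
  "definable inp vs (\<lambda>s. of_bool (P s)) \<Longrightarrow> definable inp vs (\<lambda>s. of_bool (Q s)) \<Longrightarrow>
    definable inp vs (\<lambda>s. of_bool (P s \<or> Q s))"
  by (rule D_cong[where f = "\<lambda>s. of_bool (\<not> (\<not> P s \<and> \<not> Q s))"], (intro D_intros; assumption)[1], auto)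

lemma D_imp [D_intros]:
  "definable inp vs (\<lambda>s. of_bool (P s)) \<Longrightarrow> definable inp vs (\<lambda>s. of_bool (Q s)) \<Longrightarrow>
    definable inp vs (\<lambda>s. of_bool (P s \<longrightarrow> Q s))"
  by (rule D_cong[where f = "\<lambda>s. of_bool (\<not> P s \<or> Q s)"], (intro D_intros; assumption)[1], auto)

lemma D_iff [D_intros]:
  "definable inp vs (\<lambda>s. of_bool (P s)) \<Longrightarrow> definable inp vs (\<lambda>s. of_bool (Q s)) \<Longrightarrow>
    definable inp vs (\<lambda>s. of_bool (P s \<longleftrightarrow> Q s))"
  by (rule D_cong[where f = "\<lambda>s. of_bool ((P s \<longrightarrow> Q s) \<and> (Q s \<longrightarrow> P s))"], (intro D_intros; assumption)[1], auto)

lemma D_le [D_intros]: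
  "definable inp vs f \<Longrightarrow> definable inp vs g \<Longrightarrow> definable inp vs (\<lambda>s. of_bool (f s \<le> g s))"
  by (rule D_cong[where f = "\<lambda>s. of_bool (\<not> g s < f s)"], (intro D_intros; assumption)[1], auto)

lemma D_eq [D_intros]:
  "definable inp vs f \<Longrightarrow> definable inp vs g \<Longrightarrow> definable inp vs (\<lambda>s. of_bool (f s = g s))"
  by (rule D_cong[where f = "\<lambda>s. of_bool (f s \<le> g s \<and> g s \<le> f s)"], (intro D_intros; assumption)[1], auto)

lemma D_ex [D_intros]:
  assumes "definable inp vs f"
    and "definable (\<lambda>p. inp (fst p)) (snd # map (\<lambda>v p. v (fst p)) vs) (\<lambda>p. of_bool (P (fst p) (snd p)))"
  shows "definable inp vs (\<lambda>s. of_bool (\<exists>v<f s. P s v))"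
  by (rule D_cong[OF D_less[OF D_const[of _ _ 0] D_sum[OF assms]]]) auto

lemma D_all [D_intros]:
  assumes "definable inp vs f"
    and "definable (\<lambda>p. inp (fst p)) (snd # map (\<lambda>v p. v (fst p)) vs) (\<lambda>p. of_bool (P (fst p) (snd p)))"
  shows "definable inp vs (\<lambda>s. of_bool (\<forall>v<f s. P s v))"
  by (rule D_cong[OF D_not[OF D_ex[OF assms(1) D_not[OF assms(2)]]]]) auto

lemma D_if [D_intros]:
  assumes "definable inp vs (\<lambda>s. of_bool (P s))" "definable inp vs f" "definable inp vs g"
  shows "definable inp vs (\<lambda>s. if P s then f s else g s)"
  by (rule D_cong[where f = "\<lambda>s. of_bool (P s) * f s + of_bool (\<not> P s) * g s"])
    (intro D_intros assms, auto)

lemma D_if_bool [D_intros]: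
  assumes "definable inp vs (\<lambda>s. of_bool (P s))" "definable inp vs (\<lambda>s. of_bool (Q s))"
    "definable inp vs (\<lambda>s. of_bool (R s))"
  shows "definable inp vs (\<lambda>s. of_bool (if P s then Q s else R s))"
  by (rule D_cong[where f = "\<lambda>s. if P s then of_bool (Q s) else of_bool (R s)"])
    (intro D_intros assms, auto)

text \<open>Bounded sums are the only loops of the language, so the quotient is obtained by counting
  the positive multiples of \<open>b\<close> up to \<open>a\<close>; for \<open>b = 0\<close> both
  sides vanish.\<close>

lemma div_eq_sum: "a div b = (\<Sum>q<a. of_bool (0 < b \<and> Suc q * b \<le> a))" for a b :: nat
proof (cases "b = 0")
  case False
  have "q < a \<and> Suc q * b \<le> a \<longleftrightarrow> q < a div b" for q
    using less_eq_div_iff_mult_less_eq[of b "Suc q" a] False div_le_dividend[of a b]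
    unfolding Suc_le_eq by linarith
  then have "{q. q < a \<and> Suc q * b \<le> a} = {..<a div b}" by blast
  moreover have "(\<Sum>q<a. of_bool (0 < b \<and> Suc q * b \<le> a)) = card {q. q < a \<and> Suc q * b \<le> a}"
    using False by (simp add: Int_def del: mult_Suc)
  ultimately show ?thesis by simp
qed simp

lemma D_div [D_intros]:
  assumes "definable inp vs f" "definable inp vs g"
  shows "definable inp vs (\<lambda>s. f s div g s)"
  unfolding div_eq_sum by (intro D_intros assms D_weaken[OF assms(1)] D_weaken[OF assms(2)] D_var) simp

lemma D_mod [D_intros]:
  assumes "definable inp vs f" "definable inp vs g"
  shows "definable inp vs (\<lambda>s. f s mod g s)"
  by (rule D_cong[where f = "\<lambda>s. f s - f s div g s * g s"])
     (intro D_intros assms, auto simp: modulo_nat_def mult.commute)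

lemma D_poly [D_intros]:
  fixes p :: "nat poly"
  shows "definable inp vs f \<Longrightarrow> definable inp vs (\<lambda>s. poly p (f s))"
  by (induction p) (auto intro!: D_intros)

lemma D_finite_ex:
  assumes "\<And>k. k < n \<Longrightarrow> definable inp vs (\<lambda>s. of_bool (P k s))"
  shows "definable inp vs (\<lambda>s. of_bool (\<exists>k<n::nat. P k s))"
  using assms
proof (induction n)
  case (Suc n)
  have "definable inp vs (\<lambda>s. of_bool ((\<exists>k<n. P k s) \<or> P n s))"
    using Suc by (intro D_disj) auto
  then show ?case by (rule D_cong) (auto simp: less_Suc_eq)
qed (auto intro: D_intros)

theorem polytime_definable:
  assumes "definable (\<lambda>x. x) [] N" "definable fst [snd] (\<lambda>p. of_bool (P (fst p) (snd p)))"
  shows "polytime (\<lambda>x. map (P x) [0..<N x])"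
proof -
  obtain d where "\<And>x. N x = eval x [] d" using assms(1) unfolding definable_def by auto
  moreover obtain e where "\<And>x i. of_bool (P x i) = eval x [i] e"
    using assms(2) unfolding definable_def by auto
  then have "\<And>x i. P x i \<longleftrightarrow> eval x [i] e \<noteq> 0" by (metis of_bool_eq_0_iff)
  ultimately show ?thesis using polytime_bits[of e d] by presburger
qed

theorem class_P_definable:
  assumes "definable (\<lambda>x. x) [] (\<lambda>x. of_bool (P x))"
  shows "{x. P x} \<in> class_P"
proof -
  obtain e where "\<And>x. of_bool (P x) = eval x [] e"
    using assms unfolding definable_def by auto
  then have "\<And>x. P x \<longleftrightarrow> eval x [] e \<noteq> 0" by (metis of_bool_eq_0_iff)
  then show ?thesis using class_P_nonzero[of e] by presburger
qed

section \<open>Wires\<close>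

text \<open>The relation may hold at \<open>(\<alpha>, \<beta>)\<close> too: at most one pair is
  excluded.\<close>

definition single :: "('a \<Rightarrow> 'b \<Rightarrow> bool) \<Rightarrow> bool" where
  "single R \<longleftrightarrow> (\<exists>\<alpha> \<beta>. \<forall>x y. x \<noteq> \<alpha> \<or> y \<noteq> \<beta> \<longrightarrow> R x y)"

text \<open>A wire is a path with colour lists \<open>P, A, B, E\<close> between two vertices coloured \<open>x\<close> and \<open>y\<close>, together with
  a second path with lists \<open>D, C\<close> between its vertices with lists \<open>A\<close> and \<open>B\<close>. With three colours in \<open>B\<close> and
  two in the other lists it forbids at most one pair \<open>(x, y)\<close>, and any given pair for suitable lists.\<close>

definition wire_rel ::
  "nat set \<Rightarrow> nat set \<Rightarrow> nat set \<Rightarrow> nat set \<Rightarrow> nat set \<Rightarrow> nat set \<Rightarrow> nat \<Rightarrow> nat \<Rightarrow> bool" where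
  "wire_rel P A B E D C x y \<longleftrightarrow> (\<exists>p\<in>P. \<exists>a\<in>A. \<exists>b\<in>B. \<exists>e\<in>E. \<exists>d\<in>D. \<exists>c\<in>C.
     x \<noteq> p \<and> p \<noteq> a \<and> a \<noteq> b \<and> b \<noteq> e \<and> e \<noteq> y \<and> a \<noteq> d \<and> d \<noteq> c \<and> c \<noteq> b)"

text \<open>The part of a wire behind the vertex with list \<open>A\<close>: the cycle through
  \<open>b\<close>, \<open>c\<close>, \<open>d\<close> and that vertex, whose colour
  \<open>a\<close> is given, followed by the neighbour \<open>e\<close> of \<open>b\<close>.\<close>

definition diode_rel :: "nat set \<Rightarrow> nat set \<Rightarrow> nat set \<Rightarrow> nat \<Rightarrow> nat \<Rightarrow> bool" where
  "diode_rel B D C a e \<longleftrightarrow> (\<exists>b\<in>B. \<exists>d\<in>D. \<exists>c\<in>C. a \<noteq> b \<and> a \<noteq> d \<and> d \<noteq> c \<and> c \<noteq> b \<and> b \<noteq> e)"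

lemma pick2: "card L = 2 \<Longrightarrow> \<exists>y\<in>L. y \<noteq> k"
  by (metis card_2_iff insert_iff)

lemma pick3: "card L = 3 \<Longrightarrow> \<exists>y\<in>L. y \<noteq> k \<and> y \<noteq> l"
  by (auto simp: card_3_iff)

text \<open>Three colours let \<open>b\<close> avoid both neighbours \<open>a\<close> and
  \<open>e\<close>, and by assumption the detour does not object to such a \<open>b\<close>.\<close>

lemma diode_free:
  assumes "card B = 3" "\<And>b. b \<noteq> a \<Longrightarrow> \<exists>d\<in>D. \<exists>c\<in>C. a \<noteq> d \<and> d \<noteq> c \<and> c \<noteq> b"
  shows "diode_rel B D C a e"
proof -
  obtain b where "b \<in> B" "b \<noteq> a" "b \<noteq> e" using pick3[OF assms(1)] by blast
  then show ?thesis using assms(2)[of b] unfolding diode_rel_def by metis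
qed

text \<open>For a fixed \<open>a\<close> only one \<open>e\<close> can fail, and one of the two
  colours in \<open>A\<close> never fails. Hence all failures share the other colour of
  \<open>A\<close> and its one bad \<open>e\<close>.\<close>

lemma diode_rel_single:
  assumes A: "card A = 2" and B: "card B = 3" and D: "card D = 2" and C: "card C = 2"
  shows "\<exists>\<alpha>\<in>A. \<exists>\<beta>. \<forall>a\<in>A. \<forall>e. a \<noteq> \<alpha> \<or> e \<noteq> \<beta> \<longrightarrow> diode_rel B D C a e"
proof -
  \<comment> \<open>The detour is coloured first; then \<open>b\<close> avoids \<open>a\<close> and
    \<open>c\<close> with its three colours, and only \<open>e = b\<close> remains bad.\<close>
  have kill: "\<exists>\<beta>. \<forall>e. e \<noteq> \<beta> \<longrightarrow> diode_rel B D C a e" for a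
  proof -
    obtain d where d: "d \<in> D" "d \<noteq> a" using pick2[OF D] by blast
    obtain c where c: "c \<in> C" "c \<noteq> d" using pick2[OF C] by blast
    obtain b where b: "b \<in> B" "b \<noteq> a" "b \<noteq> c" using pick3[OF B] by blast
    show ?thesis
      unfolding diode_rel_def using b c d by metis
  qed
  \<comment> \<open>If some \<open>a\<close> is missing from \<open>D\<close>, then \<open>d\<close>
    only has to avoid \<open>c\<close>. Otherwise \<open>A = D\<close>, and \<open>a\<close> forces
    the other colour on \<open>d\<close>. If that colour is missing from \<open>C\<close>, then
    \<open>c\<close> is free to avoid \<open>b\<close>; if \<open>C\<close> equals \<open>A\<close>
    as well, then \<open>c\<close> gets the colour \<open>a\<close>, which \<open>b\<close> avoids
    anyway.\<close>
  have free: "\<exists>a\<in>A. \<forall>e. diode_rel B D C a e"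
  proof (cases "A \<subseteq> D")
    case False
    then obtain a where a: "a \<in> A" "a \<notin> D" by blast
    have "\<exists>d\<in>D. \<exists>c\<in>C. a \<noteq> d \<and> d \<noteq> c \<and> c \<noteq> b" for b
      using pick2[OF C, of b] pick2[OF D] a by metis
    then show ?thesis using a diode_free[OF B] by blast
  next
    case True
    then obtain a a' where a: "A = {a, a'}" "a \<noteq> a'" "D = {a, a'}"
      using A D by (metis card_2_iff card_subset_eq card.infinite zero_neq_numeral)
    show ?thesis
    proof (cases "a' \<in> C \<and> a \<in> C")
      case True
      then have "C = {a, a'}" using C a(2) by (auto simp: card_2_iff doubleton_eq_iff)
      then show ?thesis using a diode_free[OF B, of a] by auto
    next
      case False
      then have "a' \<notin> C \<or> a \<notin> C" by blast
      then show ?thesis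
      proof
        assume "a' \<notin> C"
        then have "\<exists>d\<in>D. \<exists>c\<in>C. a \<noteq> d \<and> d \<noteq> c \<and> c \<noteq> b" for b
          using pick2[OF C, of b] a by auto
        then show ?thesis using a diode_free[OF B] by blast
      next
        assume "a \<notin> C"
        then have "\<exists>d\<in>D. \<exists>c\<in>C. a' \<noteq> d \<and> d \<noteq> c \<and> c \<noteq> b" for b
          using pick2[OF C, of b] a by auto
        then show ?thesis using a diode_free[OF B] by blast
      qed
    qed
  qed
  then obtain a where a: "a \<in> A" "\<And>e. diode_rel B D C a e" by blast
  obtain \<alpha> where \<alpha>: "A = {a, \<alpha>}" using a(1) A by (auto simp: card_2_iff)
  then show ?thesis using a kill[of \<alpha>] by auto
qed

text \<open>The vertex with list \<open>A\<close> can take its harmless colour \<open>a\<close>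
  unless \<open>x\<close> blocks every way to it, which happens for at most one \<open>x\<close>.
  For that \<open>x\<close> it takes \<open>\<alpha>\<close>, and the last inner vertex takes the
  colour \<open>\<gamma>\<close> that the diode tolerates, so only \<open>y = \<gamma>\<close>
  fails.\<close>

lemma wire_rel_single:
  assumes P: "card P = 2" and A: "card A = 2" and B: "card B = 3" and E: "card E = 2"
    and D: "card D = 2" and C: "card C = 2"
  shows "single (wire_rel P A B E D C)"
proof -
  obtain \<alpha> \<beta> where \<alpha>: "\<alpha> \<in> A" "\<And>a e. a \<in> A \<Longrightarrow> a \<noteq> \<alpha> \<or> e \<noteq> \<beta> \<Longrightarrow> diode_rel B D C a e"
    using diode_rel_single[OF A B D C] by blast
  obtain \<gamma> where \<gamma>: "\<gamma> \<in> E" "\<gamma> \<noteq> \<beta>" using pick2[OF E] by blast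
  obtain a where a: "a \<in> A" "a \<noteq> \<alpha>" using pick2[OF A] by blast
  \<comment> \<open>If \<open>a\<close> lies in \<open>P\<close>, it is reached through the other
    colour of \<open>P\<close>, which is therefore \<open>\<xi>\<close>. Otherwise every
    \<open>x\<close> leaves \<open>a\<close> reachable, and \<open>\<xi>\<close> only has to differ
    from the colour \<open>p\<close> that leads to \<open>\<alpha>\<close>.\<close>
  obtain \<xi> where \<xi>: "\<And>x. x \<noteq> \<xi> \<Longrightarrow> \<exists>p\<in>P. x \<noteq> p \<and> p \<noteq> a" "\<exists>p\<in>P. \<xi> \<noteq> p \<and> p \<noteq> \<alpha>"
  proof (cases "a \<in> P")
    case True
    then obtain \<xi> where \<xi>: "P = {a, \<xi>}" "\<xi> \<noteq> a" using P by (auto simp: card_2_iff)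
    show ?thesis by (rule that[of \<xi>]) (use \<xi> a in auto)
  next
    case False
    obtain p where p: "p \<in> P" "p \<noteq> \<alpha>" using pick2[OF P] by blast
    have "\<exists>p\<in>P. x \<noteq> p \<and> p \<noteq> a" for x using False pick2[OF P, of x] by metis
    moreover obtain \<xi> where "\<xi> \<noteq> p" by (metis n_not_Suc_n)
    ultimately show ?thesis using that[of \<xi>] p by auto
  qed
  have "wire_rel P A B E D C x y" if "x \<noteq> \<xi> \<or> y \<noteq> \<gamma>" for x y
  proof (cases "x = \<xi>")
    case False
    obtain e where "e \<in> E" "e \<noteq> y" using pick2[OF E] by blast
    then show ?thesis
      using \<xi>(1)[OF False] \<alpha>(2)[OF a(1), of e] a unfolding diode_rel_def wire_rel_def by fastforce
  next
    case True
    then have "\<gamma> \<noteq> y" using that by auto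
    then show ?thesis
      using \<xi>(2) True \<alpha>(2)[OF \<alpha>(1), of \<gamma>] \<alpha>(1) \<gamma> unfolding diode_rel_def wire_rel_def by fastforce
  qed
  then show ?thesis unfolding single_def by blast
qed

text \<open>Each list leaves one colour: \<open>p\<close> next to \<open>x\<close>, then
  \<open>\<beta>\<close>, then \<open>b\<close> and \<open>c\<close> on the detour, hence
  \<open>b\<close> where the detour ends. After that \<open>{b, \<beta>}\<close> has no colour for
  the last vertex before \<open>y\<close>.\<close>

lemma not_wire_rel:
  assumes "\<And>z. z \<in> B \<Longrightarrow> z = b \<or> z = \<beta> \<or> z = c"
  shows "\<not> wire_rel {\<alpha>, p} {p, \<beta>} B {b, \<beta>} {\<beta>, b} {b, c} \<alpha> \<beta>"
proof
  assume "wire_rel {\<alpha>, p} {p, \<beta>} B {b, \<beta>} {\<beta>, b} {b, c} \<alpha> \<beta>"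
  then obtain p' a' b' e' d' c' where
    *: "p' \<in> {\<alpha>, p}" "a' \<in> {p, \<beta>}" "b' \<in> B" "e' \<in> {b, \<beta>}" "d' \<in> {\<beta>, b}" "c' \<in> {b, c}" and
    ne: "\<alpha> \<noteq> p'" "p' \<noteq> a'" "a' \<noteq> b'" "b' \<noteq> e'" "e' \<noteq> \<beta>" "a' \<noteq> d'" "d' \<noteq> c'" "c' \<noteq> b'"
    unfolding wire_rel_def by blast
  have "p' = p" using *(1) ne(1) by blast
  then have a: "a' = \<beta>" using *(2) ne(2) by blast
  then have d: "d' = b" using *(5) ne(6) by blast
  then have "c' = c" using *(6) ne(7) by blast
  then have "b' = b" using assms[OF *(3)] a ne(3,8) by blast
  then show False using *(4) ne(4,5) by blast
qed

text \<open>Three colours suffice for all lists, which is what gives hardness for every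
  \<open>k\<close> from \<open>3\<close> on. The colour \<open>p\<close> differs from both end
  colours, and \<open>b\<close>, \<open>c\<close> are the two colours other than
  \<open>\<beta>\<close>.\<close>

lemma wire_rel_conflict:
  assumes "\<alpha> \<in> {1, 2, 3}" "\<beta> \<in> {1, 2, 3}"
  shows "\<exists>P A E D C. P \<subseteq> {1..3} \<and> A \<subseteq> {1..3} \<and> E \<subseteq> {1..3} \<and> D \<subseteq> {1..3} \<and> C \<subseteq> {1..3} \<and>
    card P = 2 \<and> card A = 2 \<and> card E = 2 \<and> card D = 2 \<and> card C = 2 \<and>
    \<not> wire_rel P A {1, 2, 3} E D C \<alpha> \<beta>"
proof -
  have ab: "\<alpha> \<in> {1..3}" "\<beta> \<in> {1..3}" using assms by auto
  have "card {1..3 :: nat} = 3" by simp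
  from pick3[OF this, of \<alpha> \<beta>] obtain p where p3: "p \<in> {1..3}" and p: "p \<noteq> \<alpha>" "p \<noteq> \<beta>"
    by metis
  have key: ?thesis if "{1, 2, 3} \<subseteq> {b, \<beta>, c}" "b \<noteq> \<beta>" "b \<noteq> c" "b \<in> {1..3}" "c \<in> {1..3}" for b c
  proof (intro exI conjI)
    show "\<not> wire_rel {\<alpha>, p} {p, \<beta>} {1, 2, 3} {b, \<beta>} {\<beta>, b} {b, c} \<alpha> \<beta>"
      using that(1) by (intro not_wire_rel) blast
    show "{\<alpha>, p} \<subseteq> {1..3}" "{p, \<beta>} \<subseteq> {1..3}" "{b, \<beta>} \<subseteq> {1..3}" "{\<beta>, b} \<subseteq> {1..3}" "{b, c} \<subseteq> {1..3}"
      using ab p3 that(4,5) by blast+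
  qed (use p that(2,3) in simp_all)
  consider "\<beta> = 1" | "\<beta> = 2" | "\<beta> = 3" using assms(2) by blast
  then show ?thesis
  proof cases
    case 1 show ?thesis by (rule key[of 2 3]) (simp_all add: 1)
  next
    case 2 show ?thesis by (rule key[of 1 3]) (simp_all add: 2)
  next
    case 3 show ?thesis by (rule key[of 1 2]) (simp_all add: 3)
  qed
qed

section \<open>Replacing the edges of a grid by wires\<close>

text \<open>Coarse instances live on the vertices \<open>(X, Y)\<close> with \<open>X < W\<close>, \<open>Y < H\<close>; \<open>hE X Y\<close> and
  \<open>vE X Y\<close> say whether \<open>(X, Y)\<close> is joined to \<open>(X + 1, Y)\<close> and to \<open>(X, Y + 1)\<close>.\<close>

definition wire_cell :: "nat \<Rightarrow> nat \<Rightarrow> bool" where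
  "wire_cell r s \<longleftrightarrow> s = 0 \<and> r \<in> {1, 2, 3, 4} \<or> s = 1 \<and> r \<in> {2, 3}"

text \<open>Period five leaves exactly the four cells of a wire between neighbouring nodes. The
  detours of the two wires that start at a node lie in the same square but come only diagonally
  close, so the induced subgraph gets no unwanted edges.\<close>

definition cell_present :: "(nat \<Rightarrow> nat \<Rightarrow> bool) \<Rightarrow> (nat \<Rightarrow> nat \<Rightarrow> bool) \<Rightarrow> nat \<Rightarrow> nat \<Rightarrow> bool" where
  "cell_present hE vE a b \<longleftrightarrow> a mod 5 = 0 \<and> b mod 5 = 0 \<or>
     hE (a div 5) (b div 5) \<and> wire_cell (a mod 5) (b mod 5) \<or>
     vE (a div 5) (b div 5) \<and> wire_cell (b mod 5) (a mod 5)"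

definition cell_size :: "(nat \<Rightarrow> nat \<Rightarrow> bool) \<Rightarrow> nat \<Rightarrow> nat \<Rightarrow> nat" where
  "cell_size f3 a b = (if a mod 5 = 0 \<and> b mod 5 = 0 \<and> f3 (a div 5) (b div 5) \<or>
     a mod 5 = 3 \<and> b mod 5 = 0 \<or> a mod 5 = 0 \<and> b mod 5 = 3 then 3 else 2)"

definition cell_adj :: "nat \<times> nat \<Rightarrow> nat \<times> nat \<Rightarrow> bool" where
  "cell_adj p q \<longleftrightarrow> fst p = fst q \<and> (snd q = Suc (snd p) \<or> snd p = Suc (snd q)) \<or>
     snd p = snd q \<and> (fst q = Suc (fst p) \<or> fst p = Suc (fst q))"

definition wire_arc :: "nat \<Rightarrow> (nat \<Rightarrow> nat \<Rightarrow> bool) \<Rightarrow> (nat \<Rightarrow> nat \<Rightarrow> bool) \<Rightarrow> nat \<Rightarrow> nat \<Rightarrow> bool" where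
  "wire_arc M hE vE u v \<longleftrightarrow> cell_present hE vE (u div M) (u mod M) \<and> cell_present hE vE (v div M) (v mod M) \<and>
     cell_adj (u div M, u mod M) (v div M, v mod M)"

text \<open>Cell \<open>(a, b)\<close> is the vertex \<open>a * (5 * H) + b\<close>; absent cells are isolated vertices.\<close>

definition wire_graph :: "nat \<Rightarrow> nat \<Rightarrow> (nat \<Rightarrow> nat \<Rightarrow> bool) \<Rightarrow> (nat \<Rightarrow> nat \<Rightarrow> bool) \<Rightarrow> nat pair_pre_digraph" where
  "wire_graph W H hE vE = \<lparr>pverts = {..<5 * W * (5 * H)},
     parcs = {(u, v). u < 5 * W * (5 * H) \<and> v < 5 * W * (5 * H) \<and> wire_arc (5 * H) hE vE u v}\<rparr>"

definition wire_size :: "nat \<Rightarrow> (nat \<Rightarrow> nat \<Rightarrow> bool) \<Rightarrow> nat \<Rightarrow> nat" where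
  "wire_size H f3 u = cell_size f3 (u div (5 * H)) (u mod (5 * H))"

definition conflict_colorable ::
  "nat \<Rightarrow> nat \<Rightarrow> (nat \<Rightarrow> nat \<Rightarrow> bool) \<Rightarrow> (nat \<Rightarrow> nat \<Rightarrow> bool) \<Rightarrow> (nat \<Rightarrow> nat \<Rightarrow> bool) \<Rightarrow> bool" where
  "conflict_colorable W H hE vE f3 \<longleftrightarrow> (\<forall>L Rh Rv.
     (\<forall>X<W. \<forall>Y<H. card (L X Y) = (if f3 X Y then 3 else 2)) \<longrightarrow>
     (\<forall>X Y. single (Rh X Y) \<and> single (Rv X Y)) \<longrightarrow>
     (\<exists>col :: nat \<Rightarrow> nat \<Rightarrow> nat. (\<forall>X<W. \<forall>Y<H. col X Y \<in> L X Y) \<and>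
       (\<forall>X Y. hE X Y \<longrightarrow> Rh X Y (col X Y) (col (Suc X) Y)) \<and>
       (\<forall>X Y. vE X Y \<longrightarrow> Rv X Y (col X Y) (col X (Suc Y)))))"

definition wire_ok :: "(nat \<Rightarrow> nat \<Rightarrow> nat) \<Rightarrow> nat \<Rightarrow> nat \<Rightarrow> bool" where
  "wire_ok g x y \<longleftrightarrow> x \<noteq> g 1 0 \<and> g 1 0 \<noteq> g 2 0 \<and> g 2 0 \<noteq> g 3 0 \<and> g 3 0 \<noteq> g 4 0 \<and> g 4 0 \<noteq> y \<and>
     g 2 0 \<noteq> g 2 1 \<and> g 2 1 \<noteq> g 3 1 \<and> g 3 1 \<noteq> g 3 0"

definition wire_rel' :: "(nat \<Rightarrow> nat \<Rightarrow> nat set) \<Rightarrow> nat \<Rightarrow> nat \<Rightarrow> bool" where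
  "wire_rel' Lf = wire_rel (Lf 1 0) (Lf 2 0) (Lf 3 0) (Lf 4 0) (Lf 2 1) (Lf 3 1)"

lemma wire_rel'_iff:
  "wire_rel' Lf x y \<longleftrightarrow> (\<exists>g. (\<forall>r s. wire_cell r s \<longrightarrow> g r s \<in> Lf r s) \<and> wire_ok g x y)" (is "?l \<longleftrightarrow> ?r")
proof
  assume ?l
  then obtain p a b e d c where
    "p \<in> Lf 1 0" "a \<in> Lf 2 0" "b \<in> Lf 3 0" "e \<in> Lf 4 0" "d \<in> Lf 2 1" "c \<in> Lf 3 1"
    "x \<noteq> p" "p \<noteq> a" "a \<noteq> b" "b \<noteq> e" "e \<noteq> y" "a \<noteq> d" "d \<noteq> c" "c \<noteq> b"
    unfolding wire_rel'_def wire_rel_def by blast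
  then show ?r
    by (intro exI[of _ "\<lambda>r s. if s = 0 then if r = 1 then p else if r = 2 then a else if r = 3 then b else e
         else if r = 2 then d else c"]) (auto simp: wire_ok_def wire_cell_def)
next
  assume ?r
  then obtain g where g: "\<And>r s. wire_cell r s \<Longrightarrow> g r s \<in> Lf r s" "wire_ok g x y" by blast
  have "g 1 0 \<in> Lf 1 0" "g 2 0 \<in> Lf 2 0" "g 3 0 \<in> Lf 3 0" "g 4 0 \<in> Lf 4 0" "g 2 1 \<in> Lf 2 1" "g 3 1 \<in> Lf 3 1"
    using g(1) by (auto simp: wire_cell_def)
  then show ?l
    using g(2) unfolding wire_rel'_def wire_rel_def wire_ok_def by blast
qed

lemma wire_cell_cases:
  "wire_cell r s \<longleftrightarrow> (r, s) = (1, 0) \<or> (r, s) = (2, 0) \<or> (r, s) = (3, 0) \<or> (r, s) = (4, 0) \<or> (r, s) = (2, 1) \<or> (r, s) = (3, 1)"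
  by (auto simp: wire_cell_def)

definition fine_color ::
  "(nat \<Rightarrow> nat \<Rightarrow> bool) \<Rightarrow> (nat \<Rightarrow> nat \<Rightarrow> bool) \<Rightarrow> (nat \<Rightarrow> nat \<Rightarrow> nat) \<Rightarrow> (nat \<Rightarrow> nat \<Rightarrow> nat \<Rightarrow> nat \<Rightarrow> nat) \<Rightarrow>
    (nat \<Rightarrow> nat \<Rightarrow> nat \<Rightarrow> nat \<Rightarrow> nat) \<Rightarrow> (nat \<Rightarrow> nat \<Rightarrow> nat) \<Rightarrow> nat \<Rightarrow> nat \<Rightarrow> nat" where
  "fine_color hE vE col gh gv d a b = (if a mod 5 = 0 \<and> b mod 5 = 0 then col (a div 5) (b div 5)
     else if hE (a div 5) (b div 5) \<and> wire_cell (a mod 5) (b mod 5) then gh (a div 5) (b div 5) (a mod 5) (b mod 5)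
     else if vE (a div 5) (b div 5) \<and> wire_cell (b mod 5) (a mod 5) then gv (a div 5) (b div 5) (b mod 5) (a mod 5)
     else d a b)"

lemma five_cases:
  fixes a :: nat
  obtains X where "a = 5 * X" | X where "a = Suc (5 * X)" | X where "a = Suc (Suc (5 * X))"
    | X where "a = Suc (Suc (Suc (5 * X)))" | X where "a = Suc (Suc (Suc (Suc (5 * X))))"
proof -
  have "a = 5 * (a div 5) \<or> a = Suc (5 * (a div 5)) \<or> a = Suc (Suc (5 * (a div 5))) \<or>
    a = Suc (Suc (Suc (5 * (a div 5)))) \<or> a = Suc (Suc (Suc (Suc (5 * (a div 5)))))"
    by presburger
  then show ?thesis using that by metis
qed

lemma five_simps [simp]:
  "Suc (5 * X) div 5 = X" "Suc (5 * X) mod 5 = 1"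
  "Suc (Suc (5 * X)) div 5 = X" "Suc (Suc (5 * X)) mod 5 = 2"
  "Suc (Suc (Suc (5 * X))) div 5 = X" "Suc (Suc (Suc (5 * X))) mod 5 = 3"
  "Suc (Suc (Suc (Suc (5 * X)))) div 5 = X" "Suc (Suc (Suc (Suc (5 * X)))) mod 5 = 4"
  "Suc (Suc (Suc (Suc (Suc (5 * X))))) div 5 = Suc X" "Suc (Suc (Suc (Suc (Suc (5 * X))))) mod 5 = 0"
  for X :: nat
  by presburger+

text \<open>The residues modulo five show that two neighbouring present cells belong to the same
  wire or are the end of a wire and its node; \<open>wire_ok\<close> lists exactly these
  pairs.\<close>

lemma fine_color_adjacent:
  assumes h: "\<And>X Y. hE X Y \<Longrightarrow> wire_ok (gh X Y) (col X Y) (col (Suc X) Y)"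
    and v: "\<And>X Y. vE X Y \<Longrightarrow> wire_ok (gv X Y) (col X Y) (col X (Suc Y))"
    and ab: "cell_present hE vE a b"
  shows "cell_present hE vE (Suc a) b \<Longrightarrow> fine_color hE vE col gh gv d a b \<noteq> fine_color hE vE col gh gv d (Suc a) b"
    and "cell_present hE vE a (Suc b) \<Longrightarrow> fine_color hE vE col gh gv d a b \<noteq> fine_color hE vE col gh gv d a (Suc b)"
proof -
  note defs = cell_present_def fine_color_def wire_cell_def
  show "cell_present hE vE (Suc a) b \<Longrightarrow> fine_color hE vE col gh gv d a b \<noteq> fine_color hE vE col gh gv d (Suc a) b"
    using ab by (cases a rule: five_cases; cases b rule: five_cases)
      (auto simp: defs dest!: h[unfolded wire_ok_def] v[unfolded wire_ok_def])
  show "cell_present hE vE a (Suc b) \<Longrightarrow> fine_color hE vE col gh gv d a b \<noteq> fine_color hE vE col gh gv d a (Suc b)"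
    using ab by (cases a rule: five_cases; cases b rule: five_cases)
      (auto simp: defs dest!: h[unfolded wire_ok_def] v[unfolded wire_ok_def])
qed

section \<open>Subgrids in coordinates\<close>

lemma grid_arcs_iff:
  "(p, q) \<in> parcs (grid m n) \<longleftrightarrow> p \<in> {1..m} \<times> {1..n} \<and> q \<in> {1..m} \<times> {1..n} \<and> cell_adj p q"
  by (cases p; cases q) (auto simp: grid_def grid_edges_def cell_adj_def)

lemma pair_wf_iff: "wf_digraph (with_proj G) \<longleftrightarrow> (\<forall>(u, v) \<in> parcs G. u \<in> pverts G \<and> v \<in> pverts G)"
  by (fastforce simp: wf_digraph_def)

text \<open>Free of the dimensions of the grid and of isomorphism records. In this form the subgrid
  property is proved for the constructed graphs and stored in certificates.\<close>

definition grid_embedding :: "'a pair_pre_digraph \<Rightarrow> ('a \<Rightarrow> nat \<times> nat) \<Rightarrow> bool" where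
  "grid_embedding G \<phi> \<longleftrightarrow> inj_on \<phi> (pverts G) \<and>
     (\<forall>u\<in>pverts G. \<forall>v\<in>pverts G. (u, v) \<in> parcs G \<longleftrightarrow> cell_adj (\<phi> u) (\<phi> v))"

text \<open>A finite set of points fits into some grid after both coordinates are shifted by one,
  since grid vertices start at \<open>(1, 1)\<close>.\<close>

lemma subgrid_iff:
  assumes "pair_graph G"
  shows "subgrid G \<longleftrightarrow> (\<exists>\<phi>. grid_embedding G \<phi>)"
proof
  interpret pair_graph G by fact
  assume "subgrid G"
  then obtain p q H where ind: "induced_subgraph (with_proj H) (with_proj (grid p q))"
    and iso: "digraph_iso (with_proj G) (with_proj H)"
    unfolding subgrid_def by blast
  obtain f where f: "pre_digraph.digraph_isomorphism (with_proj G) f" "with_proj H = app_iso f (with_proj G)"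
    using iso unfolding digraph_iso_def by blast
  let ?\<phi> = "iso_verts f"
  have H: "pverts H = ?\<phi> ` pverts G" "parcs H = iso_arcs f ` parcs G" "iso_tail f = fst" "iso_head f = snd"
    using f(2) by (auto simp: with_proj_def app_iso_def)
  have inj: "inj_on ?\<phi> (pverts G)"
    using f(1) by (simp add: pre_digraph.digraph_isomorphism_def)
  have arc: "iso_arcs f a = (?\<phi> (fst a), ?\<phi> (snd a))" if "a \<in> parcs G" for a
    using f(1) that H(3,4) by (auto simp: pre_digraph.digraph_isomorphism_def intro: prod_eqI)
  have "(u, v) \<in> parcs G \<longleftrightarrow> cell_adj (?\<phi> u) (?\<phi> v)" if "u \<in> pverts G" "v \<in> pverts G" for u v
  proof -
    have V: "?\<phi> u \<in> pverts H" "?\<phi> v \<in> pverts H" using that H by auto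
    have "pverts H \<subseteq> {1..p} \<times> {1..q}"
      using ind unfolding induced_subgraph_def subgraph_def by (auto simp: grid_def)
    then have "(?\<phi> u, ?\<phi> v) \<in> parcs H \<longleftrightarrow> cell_adj (?\<phi> u) (?\<phi> v)"
      using ind V unfolding induced_subgraph_def by (auto simp: grid_arcs_iff)
    moreover have "(?\<phi> u, ?\<phi> v) \<in> parcs H \<longleftrightarrow> (u, v) \<in> parcs G"
    proof
      assume "(?\<phi> u, ?\<phi> v) \<in> parcs H"
      then obtain a where a: "a \<in> parcs G" "(?\<phi> u, ?\<phi> v) = (?\<phi> (fst a), ?\<phi> (snd a))"
        unfolding H(2) using arc by auto
      then have "u = fst a" "v = snd a"
        using inj_onD[OF inj] that arc_fst_in_verts[OF a(1)] arc_snd_in_verts[OF a(1)] by auto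
      then show "(u, v) \<in> parcs G" using a(1) by simp
    next
      assume "(u, v) \<in> parcs G"
      then show "(?\<phi> u, ?\<phi> v) \<in> parcs H" unfolding H(2) using arc[of "(u, v)"] by force
    qed
    ultimately show ?thesis by blast
  qed
  then show "\<exists>\<phi>. grid_embedding G \<phi>" unfolding grid_embedding_def using inj by blast
next
  interpret pair_graph G by fact
  assume "\<exists>\<phi>. grid_embedding G \<phi>"
  then obtain \<psi> where \<psi>: "grid_embedding G \<psi>" by blast
  define \<phi> where "\<phi> v = (Suc (fst (\<psi> v)), Suc (snd (\<psi> v)))" for v
  have adj: "cell_adj (\<phi> u) (\<phi> v) \<longleftrightarrow> cell_adj (\<psi> u) (\<psi> v)" for u v
    by (auto simp: cell_adj_def \<phi>_def)
  have inj: "inj_on \<phi> (pverts G)"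
    using \<psi> by (auto simp: grid_embedding_def inj_on_def \<phi>_def prod_eq_iff)
  define p where "p = Max (insert 0 (fst ` \<phi> ` pverts G))"
  define q where "q = Max (insert 0 (snd ` \<phi> ` pverts G))"
  have range: "\<phi> v \<in> {1..p} \<times> {1..q}" if "v \<in> pverts G" for v
  proof -
    have "fst (\<phi> v) \<le> p" "snd (\<phi> v) \<le> q"
      unfolding p_def q_def using that pair_finite_verts by (auto intro!: Max_ge simp del: Max_insert)
    moreover have "1 \<le> fst (\<phi> v)" "1 \<le> snd (\<phi> v)" by (auto simp: \<phi>_def)
    ultimately show ?thesis by (auto simp: mem_Times_iff)
  qed
  define H where "H = \<lparr>pverts = \<phi> ` pverts G, parcs = (\<lambda>(u, v). (\<phi> u, \<phi> v)) ` parcs G\<rparr>"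
  have arcs: "(\<phi> u, \<phi> v) \<in> parcs H \<longleftrightarrow> cell_adj (\<phi> u) (\<phi> v)" if "u \<in> pverts G" "v \<in> pverts G" for u v
  proof -
    have "(\<phi> u, \<phi> v) \<in> parcs H \<longleftrightarrow> (u, v) \<in> parcs G"
    proof
      assume "(\<phi> u, \<phi> v) \<in> parcs H"
      then obtain u' v' where "(u', v') \<in> parcs G" "\<phi> u' = \<phi> u" "\<phi> v' = \<phi> v"
        by (auto simp: H_def)
      then show "(u, v) \<in> parcs G"
        using inj_onD[OF inj, of u' u] inj_onD[OF inj, of v' v] that in_arcsD1 in_arcsD2 by metis
    qed (force simp: H_def)
    then show ?thesis using \<psi> that adj by (auto simp: grid_embedding_def)
  qed
  have wfH: "wf_digraph (with_proj H)"
    by (auto simp: pair_wf_iff H_def dest: in_arcsD1 in_arcsD2)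
  have wfgrid: "wf_digraph (with_proj (grid p q))"
    by (auto simp: pair_wf_iff grid_arcs_iff) (auto simp: grid_def)
  have "parcs H = {e \<in> parcs (grid p q). fst e \<in> pverts H \<and> snd e \<in> pverts H}"
  proof (intro set_eqI iffI)
    fix e assume e: "e \<in> parcs H"
    then obtain u v where "u \<in> pverts G" "v \<in> pverts G" "e = (\<phi> u, \<phi> v)"
      by (auto simp: H_def dest: in_arcsD1 in_arcsD2)
    then show "e \<in> {e \<in> parcs (grid p q). fst e \<in> pverts H \<and> snd e \<in> pverts H}"
      using e arcs[of u v] range[of u] range[of v] unfolding mem_Collect_eq \<open>e = _\<close> grid_arcs_iff
      by (auto simp: H_def)
  next
    fix e assume "e \<in> {e \<in> parcs (grid p q). fst e \<in> pverts H \<and> snd e \<in> pverts H}"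
    then obtain u v where "u \<in> pverts G" "v \<in> pverts G" "e = (\<phi> u, \<phi> v)" "e \<in> parcs (grid p q)"
      by (cases e) (auto simp: H_def)
    then show "e \<in> parcs H" using arcs by (auto simp: grid_arcs_iff)
  qed
  moreover have "pverts H \<subseteq> pverts (grid p q)"
  proof -
    have "\<phi> v \<in> pverts (grid p q)" if "v \<in> pverts G" for v
      using range[OF that] by (simp add: grid_def)
    then show ?thesis by (auto simp: H_def)
  qed
  ultimately have ind: "induced_subgraph (with_proj H) (with_proj (grid p q))"
    using wfH wfgrid unfolding induced_subgraph_def subgraph_def compatible_def by auto
  define f where "f = \<lparr>iso_verts = \<phi>, iso_arcs = (\<lambda>(u, v). (\<phi> u, \<phi> v)), iso_head = snd, iso_tail = fst\<rparr>"
  have "inj_on (\<lambda>(u, v). (\<phi> u, \<phi> v)) (parcs G)"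
  proof (rule inj_onI; clarify)
    fix u v u' v' assume "(u, v) \<in> parcs G" "(u', v') \<in> parcs G" "\<phi> u = \<phi> u'" "\<phi> v = \<phi> v'"
    then show "u = u' \<and> v = v'"
      using inj_onD[OF inj, of u u'] inj_onD[OF inj, of v v'] in_arcsD1 in_arcsD2 by metis
  qed
  then have "pre_digraph.digraph_isomorphism (with_proj G) f"
    using inj wf_digraph_axioms by (auto simp: pre_digraph.digraph_isomorphism_def f_def)
  moreover have "with_proj H = app_iso f (with_proj G)"
    by (simp add: app_iso_def with_proj_def f_def H_def)
  ultimately have "digraph_iso (with_proj G) (with_proj H)"
    unfolding digraph_iso_def by blast
  then show "subgrid G" unfolding subgrid_def using ind by blast
qed

lemma cell_adj_sym: "cell_adj p q \<longleftrightarrow> cell_adj q p"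
  by (auto simp: cell_adj_def)

lemma pair_graph_wire: "pair_graph (wire_graph W H hE vE)"
proof -
  have sub: "parcs (wire_graph W H hE vE) \<subseteq> pverts (wire_graph W H hE vE) \<times> pverts (wire_graph W H hE vE)"
    by (auto simp: wire_graph_def)
  have fin: "finite (pverts (wire_graph W H hE vE))" by (simp add: wire_graph_def)
  then have "finite (parcs (wire_graph W H hE vE))" using sub finite_subset by blast
  moreover have "symmetric (with_proj (wire_graph W H hE vE))"
    by (auto simp: symmetric_def wire_graph_def sym_def wire_arc_def cell_adj_sym)
  ultimately show ?thesis
    using sub fin by unfold_locales (auto, auto simp: wire_graph_def wire_arc_def cell_adj_def)
qed

lemma double_ne_Suc_double: "2 * a \<noteq> Suc (2 * b)" for a b :: nat
  by presburger

text \<open>Absent cells are isolated vertices and need places without neighbours: they are sent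
  beyond the last column, with coordinates spread by a factor of two. In return the numbering of the
  vertices is a plain product.\<close>

lemma subgrid_wire: "subgrid (wire_graph W H hE vE)"
proof -
  define M where "M = 5 * H"
  define \<phi> where "\<phi> u = (if cell_present hE vE (u div M) (u mod M) then (u div M, u mod M)
     else (5 * W + 2 + 2 * (u div M), 2 * (u mod M)))" for u
  have range: "u div M < 5 * W" if "u < 5 * W * M" for u
    using that by (simp add: less_mult_imp_div_less)
  have "inj_on \<phi> {..<5 * W * M}"
  proof (rule inj_onI)
    fix u v assume uv: "u \<in> {..<5 * W * M}" "v \<in> {..<5 * W * M}" "\<phi> u = \<phi> v"
    then have "u div M < 5 * W" "v div M < 5 * W" using range by auto
    then have "u div M = v div M \<and> u mod M = v mod M"
      using uv(3) by (auto simp: \<phi>_def split: if_splits)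
    then show "u = v" by (metis div_mult_mod_eq)
  qed
  moreover have "(u, v) \<in> parcs (wire_graph W H hE vE) \<longleftrightarrow> cell_adj (\<phi> u) (\<phi> v)"
    if "u < 5 * W * M" "v < 5 * W * M" for u v
  proof -
    have "(u, v) \<in> parcs (wire_graph W H hE vE) \<longleftrightarrow> wire_arc M hE vE u v"
      using that by (simp add: wire_graph_def M_def)
    also have "\<dots> \<longleftrightarrow> cell_adj (\<phi> u) (\<phi> v)"
      using range[OF that(1)] range[OF that(2)]
      by (cases "cell_present hE vE (u div M) (u mod M)"; cases "cell_present hE vE (v div M) (v mod M)";
          simp add: wire_arc_def \<phi>_def cell_adj_def double_ne_Suc_double)
    finally show ?thesis .
  qed
  ultimately have "grid_embedding (wire_graph W H hE vE) \<phi>"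
    by (auto simp: grid_embedding_def wire_graph_def M_def)
  then show ?thesis using subgrid_iff[OF pair_graph_wire] by blast
qed

section \<open>Colouring wire graphs\<close>

lemma cell_index:
  assumes "b < M"
  shows "(a * M + b) div M = a" "(a * M + b) mod M = (b :: nat)" "a < N \<Longrightarrow> a * M + b < N * M"
proof -
  assume "a < N"
  then have "Suc a * M \<le> N * M" by (intro mult_le_mono1) simp
  then show "a * M + b < N * M" using assms by simp
qed (use assms in auto)

lemma wire_cell_bound: "wire_cell r s \<Longrightarrow> r < 5 \<and> s < 5"
  by (auto simp: wire_cell_def)

lemma five_div_mod [simp]: "r < 5 \<Longrightarrow> (5 * X + r) div 5 = X" "r < 5 \<Longrightarrow> (5 * X + r) mod 5 = (r :: nat)"
  by auto

lemma cell_size_wire: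
  assumes "wire_cell r s"
  shows "cell_size f3 (5 * X + r) (5 * Y + s) = (if (r, s) = (3, 0) then 3 else 2)"
    and "cell_size f3 (5 * X + s) (5 * Y + r) = (if (r, s) = (3, 0) then 3 else 2)"
  using assms unfolding wire_cell_cases by (elim disjE; simp add: cell_size_def)+

lemma wire_rel'_single:
  assumes "\<And>r s. wire_cell r s \<Longrightarrow> card (Lf r s) = (if (r, s) = (3, 0) then 3 else 2)"
  shows "single (wire_rel' Lf)"
  unfolding wire_rel'_def by (intro wire_rel_single) (simp_all add: assms wire_cell_def)

lemma single_True: "single (\<lambda>_ _. True)"
  by (auto simp: single_def)

theorem wire_graph_choosable:
  assumes hE: "\<And>X Y. hE X Y \<Longrightarrow> Suc X < W \<and> Y < H" and vE: "\<And>X Y. vE X Y \<Longrightarrow> X < W \<and> Suc Y < H"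
    and "conflict_colorable W H hE vE f3"
  shows "choosable_within (wire_graph W H hE vE) (wire_size H f3) k"
  unfolding choosable_within_def
proof (intro allI impI)
  fix L assume "\<forall>v\<in>pverts (wire_graph W H hE vE). L v \<subseteq> {1..k} \<and> card (L v) = wire_size H f3 v"
  then have L: "card (L v) = wire_size H f3 v" if "v < 5 * W * (5 * H)" for v
    using that by (simp add: wire_graph_def)
  define M where "M = 5 * H"
  define Lc where "Lc a b = L (a * M + b)" for a b
  have Lc: "card (Lc a b) = cell_size f3 a b" if "a < 5 * W" "b < 5 * H" for a b
  proof -
    have "a * M + b < 5 * W * M" using cell_index(3)[of b M a "5 * W"] that by (simp add: M_def)
    then show ?thesis
      using L[of "a * M + b"] cell_index(1,2)[of b M a] that by (simp add: Lc_def M_def wire_size_def)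
  qed
  have bound: "5 * X + r < 5 * W" if "X < W" "r < 5" for X r W :: nat
    using that by linarith
  define hL where "hL X Y r s = Lc (5 * X + r) (5 * Y + s)" for X Y r s
  define vL where "vL X Y r s = Lc (5 * X + s) (5 * Y + r)" for X Y r s
  have hcard: "card (hL X Y r s) = (if (r, s) = (3, 0) then 3 else 2)" if "hE X Y" "wire_cell r s" for X Y r s
  proof -
    have "5 * X + r < 5 * W" "5 * Y + s < 5 * H"
      using hE[OF that(1)] wire_cell_bound[OF that(2)] bound[of X W r] bound[of Y H s] by simp_all
    from Lc[OF this] show ?thesis unfolding hL_def cell_size_wire(1)[OF that(2)] .
  qed
  have vcard: "card (vL X Y r s) = (if (r, s) = (3, 0) then 3 else 2)" if "vE X Y" "wire_cell r s" for X Y r s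
  proof -
    have "5 * X + s < 5 * W" "5 * Y + r < 5 * H"
      using vE[OF that(1)] wire_cell_bound[OF that(2)] bound[of X W s] bound[of Y H r] by simp_all
    from Lc[OF this] show ?thesis unfolding vL_def cell_size_wire(2)[OF that(2)] .
  qed
  \<comment> \<open>Where there is no wire the relation is made trivially true, so that the
    hypothesis on coarse colourings applies to all positions.\<close>
  define Rh where "Rh X Y = (if hE X Y then wire_rel' (hL X Y) else (\<lambda>_ _. True))" for X Y
  define Rv where "Rv X Y = (if vE X Y then wire_rel' (vL X Y) else (\<lambda>_ _. True))" for X Y
  have "\<forall>X<W. \<forall>Y<H. card (Lc (5 * X) (5 * Y)) = (if f3 X Y then 3 else 2)"
    by (auto simp: Lc cell_size_def)
  moreover have "\<forall>X Y. single (Rh X Y) \<and> single (Rv X Y)"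
  proof (intro allI conjI)
    fix X Y
    show "single (Rh X Y)"
      using wire_rel'_single[of "hL X Y"] hcard[of X Y] single_True by (cases "hE X Y") (simp_all add: Rh_def)
    show "single (Rv X Y)"
      using wire_rel'_single[of "vL X Y"] vcard[of X Y] single_True by (cases "vE X Y") (simp_all add: Rv_def)
  qed
  ultimately obtain col where "\<forall>X<W. \<forall>Y<H. col X Y \<in> Lc (5 * X) (5 * Y)"
    "\<forall>X Y. hE X Y \<longrightarrow> Rh X Y (col X Y) (col (Suc X) Y)" "\<forall>X Y. vE X Y \<longrightarrow> Rv X Y (col X Y) (col X (Suc Y))"
    using assms(3)[unfolded conflict_colorable_def, THEN spec, THEN spec, THEN spec,
      of "\<lambda>X Y. Lc (5 * X) (5 * Y)" Rh Rv] by metis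
  then have col: "\<And>X Y. X < W \<Longrightarrow> Y < H \<Longrightarrow> col X Y \<in> Lc (5 * X) (5 * Y)"
    "\<And>X Y. hE X Y \<Longrightarrow> wire_rel' (hL X Y) (col X Y) (col (Suc X) Y)"
    "\<And>X Y. vE X Y \<Longrightarrow> wire_rel' (vL X Y) (col X Y) (col X (Suc Y))"
    by (auto simp: Rh_def Rv_def)
  have "\<forall>X Y. \<exists>g. hE X Y \<longrightarrow> (\<forall>r s. wire_cell r s \<longrightarrow> g r s \<in> hL X Y r s) \<and> wire_ok g (col X Y) (col (Suc X) Y)"
    using col(2) unfolding wire_rel'_iff by blast
  then obtain gh where gh: "\<And>X Y r s. hE X Y \<Longrightarrow> wire_cell r s \<Longrightarrow> gh X Y r s \<in> hL X Y r s"
    "\<And>X Y. hE X Y \<Longrightarrow> wire_ok (gh X Y) (col X Y) (col (Suc X) Y)"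
    by metis
  have "\<forall>X Y. \<exists>g. vE X Y \<longrightarrow> (\<forall>r s. wire_cell r s \<longrightarrow> g r s \<in> vL X Y r s) \<and> wire_ok g (col X Y) (col X (Suc Y))"
    using col(3) unfolding wire_rel'_iff by blast
  then obtain gv where gv: "\<And>X Y r s. vE X Y \<Longrightarrow> wire_cell r s \<Longrightarrow> gv X Y r s \<in> vL X Y r s"
    "\<And>X Y. vE X Y \<Longrightarrow> wire_ok (gv X Y) (col X Y) (col X (Suc Y))"
    by metis
  \<comment> \<open>Absent cells are isolated and get any colour of their list.\<close>
  define C where "C = fine_color hE vE col gh gv (\<lambda>a b. SOME c. c \<in> Lc a b)"
  have adjacent1: "C a b \<noteq> C (Suc a) b" if "cell_present hE vE a b" "cell_present hE vE (Suc a) b" for a b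
    unfolding C_def by (rule fine_color_adjacent(1)[of hE gh col vE gv a b, OF gh(2) gv(2) that])
  have adjacent2: "C a b \<noteq> C a (Suc b)" if "cell_present hE vE a b" "cell_present hE vE a (Suc b)" for a b
    unfolding C_def by (rule fine_color_adjacent(2)[of hE gh col vE gv a b, OF gh(2) gv(2) that])
  have mem: "C a b \<in> Lc a b" if ab: "a < 5 * W" "b < 5 * H" for a b
  proof -
    have 5: "5 * (a div 5) + a mod 5 = a" "5 * (b div 5) + b mod 5 = b" by simp_all
    have "a div 5 < W" "b div 5 < H" using ab by auto
    then have "a mod 5 = 0 \<and> b mod 5 = 0 \<Longrightarrow> col (a div 5) (b div 5) \<in> Lc a b"
      using col(1)[of "a div 5" "b div 5"] 5 by simp
    moreover have "Lc a b \<noteq> {}" using Lc[OF ab] by (auto simp: cell_size_def split: if_splits)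
    ultimately show ?thesis
      using gh(1)[of "a div 5" "b div 5" "a mod 5" "b mod 5"] gv(1)[of "a div 5" "b div 5" "b mod 5" "a mod 5"]
      by (auto simp: C_def fine_color_def hL_def vL_def some_in_eq)
  qed
  have neq: "C a b \<noteq> C a' b'" if "cell_present hE vE a b" "cell_present hE vE a' b'" "cell_adj (a, b) (a', b')" for a b a' b'
    using that adjacent1 adjacent2 unfolding cell_adj_def fst_conv snd_conv by metis
  show "\<exists>c. proper_coloring (wire_graph W H hE vE) c \<and> (\<forall>v\<in>pverts (wire_graph W H hE vE). c v \<in> L v)"
  proof (intro exI[of _ "\<lambda>u. C (u div M) (u mod M)"] conjI ballI)
    show "proper_coloring (wire_graph W H hE vE) (\<lambda>u. C (u div M) (u mod M))"
      using neq by (auto simp: proper_coloring_def wire_graph_def wire_arc_def M_def)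
    fix v assume "v \<in> pverts (wire_graph W H hE vE)"
    then have v: "v < 5 * W * M" by (simp add: wire_graph_def M_def)
    then have "0 < M" by (cases "M = 0") auto
    then have "v div M < 5 * W" "v mod M < 5 * H" using v by (auto simp: less_mult_imp_div_less M_def)
    from mem[OF this] show "C (v div M) (v mod M) \<in> L v" by (simp add: Lc_def)
  qed
qed

text \<open>A bad list assignment is assembled from \<open>wire_rel_conflict\<close>: every wire
  realises the conflict that \<open>ch\<close> or \<open>cv\<close> prescribes, while nodes and
  absent cells get an initial segment of the colours.\<close>

theorem wire_graph_not_choosable:
  fixes ch cv :: "nat \<Rightarrow> nat \<Rightarrow> nat \<times> nat"
  assumes hE: "\<And>X Y. hE X Y \<Longrightarrow> Suc X < W \<and> Y < H" and vE: "\<And>X Y. vE X Y \<Longrightarrow> X < W \<and> Suc Y < H"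
    and ch: "\<And>X Y. ch X Y \<in> {1, 2, 3} \<times> {1, 2, 3}" and cv: "\<And>X Y. cv X Y \<in> {1, 2, 3} \<times> {1, 2, 3}"
    and none: "\<And>col. (\<And>X Y. X < W \<Longrightarrow> Y < H \<Longrightarrow> col X Y \<in> {1..if f3 X Y then 3 else 2}) \<Longrightarrow>
      (\<And>X Y. hE X Y \<Longrightarrow> (col X Y, col (Suc X) Y) \<noteq> ch X Y) \<Longrightarrow>
      (\<And>X Y. vE X Y \<Longrightarrow> (col X Y, col X (Suc Y)) \<noteq> cv X Y) \<Longrightarrow> False"
    and k: "3 \<le> k"
  shows "\<not> choosable_within (wire_graph W H hE vE) (wire_size H f3) k"
proof
  assume ch_all: "choosable_within (wire_graph W H hE vE) (wire_size H f3) k"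
  have "\<exists>Lf. (\<forall>r s. wire_cell r s \<longrightarrow> Lf r s \<subseteq> {1..3} \<and> card (Lf r s) = (if (r, s) = (3, 0) then 3 else 2)) \<and>
      \<not> wire_rel' Lf (fst c) (snd c)" if c: "c \<in> {1, 2, 3} \<times> {1, 2, 3}" for c
  proof -
    have "fst c \<in> {1, 2, 3}" "snd c \<in> {1, 2, 3}" using c by auto
    from wire_rel_conflict[OF this] obtain P A E D C where
      *: "P \<subseteq> {1..3}" "A \<subseteq> {1..3}" "E \<subseteq> {1..3}" "D \<subseteq> {1..3}" "C \<subseteq> {1..3}"
      "card P = 2" "card A = 2" "card E = 2" "card D = 2" "card C = 2"
      "\<not> wire_rel P A {1, 2, 3} E D C (fst c) (snd c)" by (elim exE conjE) (rule that)
    define Lf where "Lf r s = (if s = 0 then if r = 1 then P else if r = 2 then A else if r = 3 then {1, 2, 3} else E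
         else if r = 2 then D else C)" for r s :: nat
    have "wire_rel' Lf = wire_rel P A {1, 2, 3} E D C"
      unfolding wire_rel'_def Lf_def by simp
    moreover have "Lf r s \<subseteq> {1..3} \<and> card (Lf r s) = (if (r, s) = (3, 0) then 3 else 2)" if "wire_cell r s" for r s
      using that * by (auto simp: wire_cell_def Lf_def)
    ultimately show ?thesis using *(11) by metis
  qed
  then obtain wl where wl: "\<And>c r s. c \<in> {1, 2, 3} \<times> {1, 2, 3} \<Longrightarrow> wire_cell r s \<Longrightarrow>
      wl c r s \<subseteq> {1..3} \<and> card (wl c r s) = (if (r, s) = (3, 0) then 3 else 2)"
    "\<And>c. c \<in> {1, 2, 3} \<times> {1, 2, 3} \<Longrightarrow> \<not> wire_rel' (wl c) (fst c) (snd c)"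
    by metis
  define M where "M = 5 * H"
  define Lc where "Lc a b = (if hE (a div 5) (b div 5) \<and> wire_cell (a mod 5) (b mod 5)
     then wl (ch (a div 5) (b div 5)) (a mod 5) (b mod 5)
     else if vE (a div 5) (b div 5) \<and> wire_cell (b mod 5) (a mod 5) then wl (cv (a div 5) (b div 5)) (b mod 5) (a mod 5)
     else {1..cell_size f3 a b})" for a b
  have size: "cell_size f3 a b \<le> 3" for a b by (simp add: cell_size_def)
  have sub3: "Lc a b \<subseteq> {1..3} \<and> card (Lc a b) = cell_size f3 a b" for a b
  proof -
    have 5: "5 * (a div 5) + a mod 5 = a" "5 * (b div 5) + b mod 5 = b" by simp_all
    show ?thesis
      using wl(1)[OF ch, of "a mod 5" "b mod 5" "a div 5" "b div 5"] wl(1)[OF cv, of "b mod 5" "a mod 5" "a div 5" "b div 5"]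
        cell_size_wire(1)[of "a mod 5" "b mod 5" f3 "a div 5" "b div 5"]
        cell_size_wire(2)[of "b mod 5" "a mod 5" f3 "a div 5" "b div 5"] size[of a b] 5
      by (simp add: Lc_def)
  qed
  let ?L = "\<lambda>v. Lc (v div M) (v mod M)"
  have k3: "{1..3} \<subseteq> {1..k}" using k by auto
  have "?L v \<subseteq> {1..k} \<and> card (?L v) = wire_size H f3 v" for v
    unfolding wire_size_def M_def[symmetric]
    by (intro conjI subset_trans[OF conjunct1[OF sub3] k3] conjunct2[OF sub3])
  then have "\<exists>c. proper_coloring (wire_graph W H hE vE) c \<and> (\<forall>v\<in>pverts (wire_graph W H hE vE). c v \<in> ?L v)"
    by (intro ch_all[unfolded choosable_within_def, THEN spec, THEN mp] ballI)
  moreover have "pverts (wire_graph W H hE vE) = {..<5 * W * M}" by (simp add: wire_graph_def M_def)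
  ultimately obtain c where c: "proper_coloring (wire_graph W H hE vE) c" "\<And>v. v < 5 * W * M \<Longrightarrow> c v \<in> ?L v"
    by (metis lessThan_iff)
  define C where "C a b = c (a * M + b)" for a b
  have mem: "C a b \<in> Lc a b" if "a < 5 * W" "b < 5 * H" for a b
    using c(2)[OF cell_index(3)[of b M a "5 * W"]] cell_index(1,2)[of b M a] that by (simp add: C_def M_def)
  have neq: "C a b \<noteq> C a' b'"
    if "a < 5 * W" "b < 5 * H" "a' < 5 * W" "b' < 5 * H" "cell_present hE vE a b" "cell_present hE vE a' b'" "cell_adj (a, b) (a', b')"
    for a b a' b'
  proof -
    have "b < M" "b' < M" using that by (auto simp: M_def)
    then have "(a * M + b, a' * M + b') \<in> parcs (wire_graph W H hE vE)"
      using that cell_index(3)[of b M a "5 * W"] cell_index(3)[of b' M a' "5 * W"]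
      unfolding wire_graph_def wire_arc_def M_def[symmetric]
      by (simp add: cell_index(1,2)[of b M a] cell_index(1,2)[of b' M a'] del: mult.assoc)
    then show ?thesis using c(1) by (auto simp: proper_coloring_def C_def)
  qed
  show False
  proof (rule none[of "\<lambda>X Y. C (5 * X) (5 * Y)"])
    fix X Y assume XY: "X < W" "Y < H"
    then show "C (5 * X) (5 * Y) \<in> {1..if f3 X Y then 3 else 2}"
      using mem[of "5 * X" "5 * Y"] by (simp add: Lc_def wire_cell_def cell_size_def)
  next
    fix X Y assume e: "hE X Y"
    let ?g = "\<lambda>r s. C (5 * X + r) (5 * Y + s)"
    have XY: "5 * X + 5 < 5 * W" "5 * Y + 4 < 5 * H" using hE[OF e] by auto
    \<comment> \<open>Offset \<open>(5, 0)\<close> is the node at the far end of the wire.\<close>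
    have P: "cell_present hE vE (5 * X + r) (5 * Y + s) \<and> 5 * X + r < 5 * W \<and> 5 * Y + s < 5 * H"
      if "wire_cell r s \<or> (r, s) = (0, 0) \<or> (r, s) = (5, 0)" for r s
      using that XY e wire_cell_bound[of r s] by (auto simp: cell_present_def)
    have N: "?g r s \<noteq> ?g r' s'"
      if "wire_cell r s \<or> (r, s) = (0, 0) \<or> (r, s) = (5, 0)" "wire_cell r' s' \<or> (r', s') = (0, 0) \<or> (r', s') = (5, 0)"
        "cell_adj (r, s) (r', s')" for r s r' s'
      using P[OF that(1)] P[OF that(2)] that(3) by (intro neq) (simp_all add: cell_adj_def)
    have "wire_ok ?g (?g 0 0) (?g 5 0)"
      unfolding wire_ok_def by (intro conjI N) (simp_all add: wire_cell_def cell_adj_def)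
    then have "wire_ok ?g (C (5 * X) (5 * Y)) (C (5 * Suc X) (5 * Y))"
      by (simp add: add.commute)
    moreover have "wire_cell r s \<Longrightarrow> ?g r s \<in> wl (ch X Y) r s" for r s
      using mem[of "5 * X + r" "5 * Y + s"] XY e wire_cell_bound[of r s] by (simp add: Lc_def)
    ultimately have "wire_rel' (wl (ch X Y)) (C (5 * X) (5 * Y)) (C (5 * Suc X) (5 * Y))"
      unfolding wire_rel'_iff by (intro exI[of _ ?g]) blast
    then show "(C (5 * X) (5 * Y), C (5 * Suc X) (5 * Y)) \<noteq> ch X Y"
      using wl(2)[OF ch, of X Y] by (metis fst_conv snd_conv)
  next
    fix X Y assume e: "vE X Y"
    let ?g = "\<lambda>r s. C (5 * X + s) (5 * Y + r)"
    have XY: "5 * X + 4 < 5 * W" "5 * Y + 5 < 5 * H" using vE[OF e] by auto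
    have P: "cell_present hE vE (5 * X + s) (5 * Y + r) \<and> 5 * X + s < 5 * W \<and> 5 * Y + r < 5 * H"
      if "wire_cell r s \<or> (r, s) = (0, 0) \<or> (r, s) = (5, 0)" for r s
      using that XY e wire_cell_bound[of r s] by (auto simp: cell_present_def)
    have N: "?g r s \<noteq> ?g r' s'"
      if "wire_cell r s \<or> (r, s) = (0, 0) \<or> (r, s) = (5, 0)" "wire_cell r' s' \<or> (r', s') = (0, 0) \<or> (r', s') = (5, 0)"
        "cell_adj (r, s) (r', s')" for r s r' s'
      using P[OF that(1)] P[OF that(2)] that(3) by (intro neq) (auto simp: cell_adj_def)
    have "wire_ok ?g (?g 0 0) (?g 5 0)"
      unfolding wire_ok_def by (intro conjI N) (simp_all add: wire_cell_def cell_adj_def)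
    then have "wire_ok ?g (C (5 * X) (5 * Y)) (C (5 * X) (5 * Suc Y))"
      by (simp add: add.commute)
    moreover have "wire_cell r s \<Longrightarrow> ?g r s \<in> wl (cv X Y) r s" for r s
      using mem[of "5 * X + s" "5 * Y + r"] XY e wire_cell_bound[of r s]
      by (auto simp: Lc_def wire_cell_def)
    ultimately have "wire_rel' (wl (cv X Y)) (C (5 * X) (5 * Y)) (C (5 * X) (5 * Suc Y))"
      unfolding wire_rel'_iff by (intro exI[of _ ?g]) blast
    then show "(C (5 * X) (5 * Y), C (5 * X) (5 * Suc Y)) \<noteq> cv X Y"
      using wl(2)[OF cv, of X Y] by (metis fst_conv snd_conv)
  qed
qed

section \<open>Degrees in wire graphs\<close>

definition coarse_degree :: "(nat \<Rightarrow> nat \<Rightarrow> bool) \<Rightarrow> (nat \<Rightarrow> nat \<Rightarrow> bool) \<Rightarrow> nat \<Rightarrow> nat \<Rightarrow> nat" where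
  "coarse_degree hE vE X Y = of_bool (hE X Y) + of_bool (0 < X \<and> hE (X - 1) Y) +
     of_bool (vE X Y) + of_bool (0 < Y \<and> vE X (Y - 1))"

definition fine_degree :: "(nat \<Rightarrow> nat \<Rightarrow> bool) \<Rightarrow> (nat \<Rightarrow> nat \<Rightarrow> bool) \<Rightarrow> nat \<Rightarrow> nat \<Rightarrow> nat" where
  "fine_degree hE vE a b = of_bool (cell_present hE vE (Suc a) b) + of_bool (0 < a \<and> cell_present hE vE (a - 1) b) +
     of_bool (cell_present hE vE a (Suc b)) + of_bool (0 < b \<and> cell_present hE vE a (b - 1))"

lemma mod5_pred:
  assumes "0 < X"
  shows "(5 * X - Suc 0) div 5 = X - 1" "(5 * X - Suc 0) mod 5 = (4 :: nat)"
proof -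
  have "5 * X - Suc 0 = 5 * (X - 1) + 4" using assms by simp
  then show "(5 * X - Suc 0) div 5 = X - 1" "(5 * X - Suc 0) mod 5 = (4 :: nat)"
    by (simp_all only: five_div_mod)
qed

lemma fine_degree_node: "fine_degree hE vE (5 * X) (5 * Y) = coarse_degree hE vE X Y"
  by (cases X; cases Y) (simp_all add: fine_degree_def coarse_degree_def cell_present_def wire_cell_def mod5_pred)

text \<open>Inside wires no cell has degree four, and three colours occur only at degree three. So
  wires never violate the degree condition.\<close>

lemma fine_degree_wire:
  assumes "cell_present hE vE a b" "\<not> (a mod 5 = 0 \<and> b mod 5 = 0)"
  shows "fine_degree hE vE a b = (if cell_size f3 a b = 3 then 3 else fine_degree hE vE a b) \<and> fine_degree hE vE a b \<in> {2, 3}"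
  using assms
  by (cases a rule: five_cases; cases b rule: five_cases)
     (auto simp: fine_degree_def cell_present_def wire_cell_def cell_size_def mod5_pred)

lemma out_degree_wire:
  assumes hE: "\<And>X Y. hE X Y \<Longrightarrow> Suc X < W \<and> Y < H" and vE: "\<And>X Y. vE X Y \<Longrightarrow> X < W \<and> Suc Y < H"
    and u: "u < 5 * W * (5 * H)" "cell_present hE vE (u div (5 * H)) (u mod (5 * H))"
  shows "out_degree (with_proj (wire_graph W H hE vE)) u = fine_degree hE vE (u div (5 * H)) (u mod (5 * H))"
proof -
  define M where "M = 5 * H"
  define a where "a = u div M"
  define b where "b = u mod M"
  have M: "0 < M" using u by (cases "M = 0") (auto simp: M_def)
  have ab: "a < 5 * W" "b < M" "u = a * M + b"
    using u(1) M less_mult_imp_div_less[of u "5 * W" M] unfolding M_def[symmetric]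
    by (simp_all add: a_def b_def del: mult.assoc)
  have present: "cell_present hE vE a b" using u by (simp add: a_def b_def M_def)
  \<comment> \<open>The neighbours with a larger coordinate must stay in the frame: past the last
    cell of a column the numbering would run into the next column.\<close>
  have R: "Suc a < 5 * W" if "cell_present hE vE (Suc a) b"
    using present that ab hE vE
    by (cases a rule: five_cases; cases b rule: five_cases)
       (force simp: cell_present_def wire_cell_def)+
  have D: "Suc b < M" if "cell_present hE vE a (Suc b)"
    using present that ab hE vE unfolding M_def
    by (cases a rule: five_cases; cases b rule: five_cases)
       (force simp: cell_present_def wire_cell_def)+
  let ?S = "\<lambda>P q. if P then {(u, fst q * M + snd q)} else {}"
  have "{e \<in> parcs (wire_graph W H hE vE). fst e = u} =
      ?S (cell_present hE vE (Suc a) b) (Suc a, b) \<union> ?S (0 < a \<and> cell_present hE vE (a - 1) b) (a - 1, b) \<union>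
      ?S (cell_present hE vE a (Suc b)) (a, Suc b) \<union> ?S (0 < b \<and> cell_present hE vE a (b - 1)) (a, b - 1)"
    (is "?l = ?r")
  proof (intro set_eqI iffI)
    fix e assume "e \<in> ?l"
    then obtain v where e: "e = (u, v)" "(u, v) \<in> parcs (wire_graph W H hE vE)" by (cases e) auto
    define a' where "a' = v div M"
    define b' where "b' = v mod M"
    have v: "cell_present hE vE a' b'" "cell_adj (a, b) (a', b')"
      using e(2) by (auto simp: wire_graph_def wire_arc_def a_def b_def M_def a'_def b'_def)
    have v': "v = a' * M + b'" by (simp add: a'_def b'_def)
    show "e \<in> ?r"
      using v unfolding e(1) v' cell_adj_def by auto
  next
    have mem: "(u, a' * M + b') \<in> ?l" if "cell_present hE vE a' b'" "cell_adj (a, b) (a', b')" "a' < 5 * W" "b' < M" for a' b'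
    proof -
      have "a' * M + b' < 5 * W * M" using cell_index(3)[OF that(4,3)] .
      then show ?thesis
        using that present u cell_index(1,2)[OF that(4)]
        unfolding wire_graph_def wire_arc_def M_def[symmetric] a_def b_def by (simp del: mult.assoc)
    qed
    fix e assume "e \<in> ?r"
    then show "e \<in> ?l"
      using mem[of "Suc a" b] mem[of "a - 1" b] mem[of a "Suc b"] mem[of a "b - 1"] R D ab
      by (auto simp: cell_adj_def split: if_splits)
  qed
  moreover have "card ?r = fine_degree hE vE a b"
  proof -
    have inj: "a1 * M + b1 = a2 * M + b2 \<longleftrightarrow> a1 = a2 \<and> b1 = b2" if "b1 < M" "b2 < M" for a1 b1 a2 b2
      by (metis cell_index(1,2) that)
    have b': "b - 1 < M" using ab(2) by simp
    have "Suc a * M + b \<noteq> (a - 1) * M + b" unfolding inj[OF ab(2) ab(2)] by simp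
    moreover have "Suc a * M + b \<noteq> a * M + Suc b" if "cell_present hE vE a (Suc b)"
      unfolding inj[OF ab(2) D[OF that]] by simp
    moreover have "Suc a * M + b \<noteq> a * M + (b - 1)" unfolding inj[OF ab(2) b'] by simp
    moreover have "(a - 1) * M + b \<noteq> a * M + Suc b" if "cell_present hE vE a (Suc b)"
      unfolding inj[OF ab(2) D[OF that]] by simp
    moreover have "(a - 1) * M + b \<noteq> a * M + (b - 1)" if "0 < a"
      unfolding inj[OF ab(2) b'] using that by simp
    moreover have "a * M + Suc b \<noteq> a * M + (b - 1)" if "cell_present hE vE a (Suc b)"
      unfolding inj[OF D[OF that] b'] by simp
    ultimately show ?thesis
      unfolding fine_degree_def fst_conv snd_conv
      by (cases "cell_present hE vE (Suc a) b"; cases "0 < a \<and> cell_present hE vE (a - 1) b";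
          cases "cell_present hE vE a (Suc b)"; cases "0 < b \<and> cell_present hE vE a (b - 1)")
         (simp_all only: if_True if_False of_bool_eq Un_empty_left Un_empty_right Un_insert_left
           card_insert_if card.empty finite.intros insert_iff empty_iff prod.inject, auto)
  qed
  ultimately show ?thesis
    by (simp add: out_degree_def out_arcs_def a_def b_def M_def)
qed

lemma out_degree_absent:
  assumes "\<not> cell_present hE vE (u div (5 * H)) (u mod (5 * H))"
  shows "out_degree (with_proj (wire_graph W H hE vE)) u = 0"
proof -
  have "{e \<in> parcs (wire_graph W H hE vE). fst e = u} = {}"
    using assms by (auto simp: wire_graph_def wire_arc_def)
  then show ?thesis by (simp only: out_degree_def out_arcs_def with_proj_simps card.empty)
qed

theorem wire_graph_degree_condition:
  assumes hE: "\<And>X Y. hE X Y \<Longrightarrow> Suc X < W \<and> Y < H" and vE: "\<And>X Y. vE X Y \<Longrightarrow> X < W \<and> Suc Y < H"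
    and d: "\<And>X Y. X < W \<Longrightarrow> Y < H \<Longrightarrow>
      (coarse_degree hE vE X Y = 4 \<longrightarrow> f3 X Y) \<and> (coarse_degree hE vE X Y = 2 \<longrightarrow> \<not> f3 X Y)"
  shows "degree_condition (wire_graph W H hE vE) (wire_size H f3)"
  unfolding degree_condition_def
proof
  fix v assume "v \<in> pverts (wire_graph W H hE vE)"
  then have v: "v < 5 * W * (5 * H)" by (simp add: wire_graph_def)
  define a where "a = v div (5 * H)"
  define b where "b = v mod (5 * H)"
  have "0 < 5 * H" using v by (cases "H = 0") auto
  then have ab: "a < 5 * W" "b < 5 * H" using v by (auto simp: a_def b_def less_mult_imp_div_less)
  have ws: "wire_size H f3 v = cell_size f3 a b" by (simp add: wire_size_def a_def b_def)
  consider "\<not> cell_present hE vE a b" | "cell_present hE vE a b" "a mod 5 = 0" "b mod 5 = 0"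
    | "cell_present hE vE a b" "\<not> (a mod 5 = 0 \<and> b mod 5 = 0)"
    by (cases "cell_present hE vE a b"; cases "a mod 5 = 0 \<and> b mod 5 = 0") simp_all
  then show "(out_degree (with_proj (wire_graph W H hE vE)) v = 4 \<longrightarrow> wire_size H f3 v = 3) \<and>
      (out_degree (with_proj (wire_graph W H hE vE)) v = 2 \<longrightarrow> wire_size H f3 v = 2)"
  proof cases
    case 1
    then show ?thesis using out_degree_absent[of hE vE v H W] by (simp add: a_def b_def)
  next
    case 2
    then obtain X Y where XY: "a = 5 * X" "b = 5 * Y" by (auto elim!: dvdE)
    have "out_degree (with_proj (wire_graph W H hE vE)) v = coarse_degree hE vE X Y"
      using out_degree_wire[of hE W H vE v] hE vE v 2(1) XY fine_degree_node[of hE vE X Y] by (simp add: a_def b_def)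
    then show ?thesis using d[of X Y] ab XY unfolding ws by (auto simp: cell_size_def)
  next
    case 3
    have "out_degree (with_proj (wire_graph W H hE vE)) v = fine_degree hE vE a b"
      using out_degree_wire[of hE W H vE v] hE vE v 3(1) by (simp add: a_def b_def)
    moreover have "cell_size f3 a b \<in> {2, 3}" by (simp add: cell_size_def)
    ultimately show ?thesis
      using fine_degree_wire[OF 3, of f3] unfolding ws by (auto split: if_splits)
  qed
qed

section \<open>The crossing block\<close>

lemma single_flip: "single R \<Longrightarrow> single (\<lambda>x y. R y x)"
  unfolding single_def by metis

text \<open>Let \<open>R\<close> fail only at \<open>(\<alpha>, \<beta>)\<close> and
  \<open>S\<close> only at \<open>(\<gamma>, \<delta>)\<close>. If \<open>x\<close> is not
  \<open>\<alpha>\<close>, a middle colour other than \<open>\<gamma>\<close> works; if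
  \<open>z\<close> is not \<open>\<delta>\<close>, one other than \<open>\<beta>\<close> works. Only
  \<open>(\<alpha>, \<delta>)\<close> remains.\<close>

lemma single_comp:
  assumes "single R" "single S" "card L = 2"
  shows "single (\<lambda>x z. \<exists>y\<in>L. R x y \<and> S y z)"
proof -
  obtain \<alpha> \<beta> where R: "\<And>x y. x \<noteq> \<alpha> \<or> y \<noteq> \<beta> \<Longrightarrow> R x y" using assms(1) unfolding single_def by metis
  obtain \<gamma> \<delta> where S: "\<And>x y. x \<noteq> \<gamma> \<or> y \<noteq> \<delta> \<Longrightarrow> S x y" using assms(2) unfolding single_def by metis
  obtain y where "y \<in> L" "y \<noteq> \<beta>" using pick2[OF assms(3)] by blast
  obtain y' where "y' \<in> L" "y' \<noteq> \<gamma>" using pick2[OF assms(3)] by blast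
  have "\<exists>y\<in>L. R x y \<and> S y z" if "x \<noteq> \<alpha> \<or> z \<noteq> \<delta>" for x z
    using R S \<open>y \<in> L\<close> \<open>y \<noteq> \<beta>\<close> \<open>y' \<in> L\<close> \<open>y' \<noteq> \<gamma>\<close> that by metis
  then show ?thesis unfolding single_def by blast
qed

lemma singleE:
  assumes "single R" obtains \<alpha> \<beta> where "\<And>x y. x \<noteq> \<alpha> \<Longrightarrow> R x y" "\<And>x y. y \<noteq> \<beta> \<Longrightarrow> R x y"
  using assms unfolding single_def by metis

text \<open>The graph on \<open>a, b, c, d\<close> with all edges but \<open>ab\<close>. If \<open>a\<close> loses a colour then the
  remaining lists suffice for every choice of conflicts, and so they do if \<open>b\<close> and \<open>c\<close> lose a colour each.\<close>

lemma fan_out: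
  assumes La: "card La = 2" and Lb: "card Lb = 3" and Lc: "card Lc = 3" and Ld: "card Ld = 2"
    and Rbc: "single Rbc" and Rcd: "single Rcd" and Rbd: "single Rbd" and Rad: "single Rad" and Rac: "single Rac"
  shows "\<exists>a\<in>La. \<exists>b\<in>Lb. \<exists>c\<in>Lc. \<exists>d\<in>Ld. a \<noteq> ka \<and> Rbc b c \<and> Rcd c d \<and> Rbd b d \<and> Rad a d \<and> Rac a c"
    and "\<exists>a\<in>La. \<exists>b\<in>Lb. \<exists>c\<in>Lc. \<exists>d\<in>Ld. b \<noteq> kb \<and> c \<noteq> kc \<and> Rbc b c \<and> Rcd c d \<and> Rbd b d \<and> Rad a d \<and> Rac a c"
proof -
  obtain bc1 bc2 where bc: "\<And>x y. x \<noteq> bc1 \<Longrightarrow> Rbc x y" "\<And>x y. y \<noteq> bc2 \<Longrightarrow> Rbc x y" using singleE[OF Rbc] by blast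
  obtain cd1 cd2 where cd: "\<And>x y. x \<noteq> cd1 \<Longrightarrow> Rcd x y" "\<And>x y. y \<noteq> cd2 \<Longrightarrow> Rcd x y" using singleE[OF Rcd] by blast
  obtain bd1 bd2 where bd: "\<And>x y. x \<noteq> bd1 \<Longrightarrow> Rbd x y" "\<And>x y. y \<noteq> bd2 \<Longrightarrow> Rbd x y" using singleE[OF Rbd] by blast
  obtain ad1 ad2 where ad: "\<And>x y. x \<noteq> ad1 \<Longrightarrow> Rad x y" "\<And>x y. y \<noteq> ad2 \<Longrightarrow> Rad x y" using singleE[OF Rad] by blast
  obtain ac1 ac2 where ac: "\<And>x y. x \<noteq> ac1 \<Longrightarrow> Rac x y" "\<And>x y. y \<noteq> ac2 \<Longrightarrow> Rac x y" using singleE[OF Rac] by blast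
  \<comment> \<open>Greedy choice in the order \<open>a\<close>, \<open>d\<close>, \<open>c\<close>,
    \<open>b\<close>: every conflict is dodged at the later end of its edge, and only
    \<open>c\<close> and \<open>b\<close>, which have three colours, must dodge two.\<close>
  obtain a where a: "a \<in> La" "a \<noteq> ka" using pick2[OF La] by blast
  obtain d where d: "d \<in> Ld" "d \<noteq> ad2" using pick2[OF Ld] by blast
  obtain c where c: "c \<in> Lc" "c \<noteq> ac2" "c \<noteq> cd1" using pick3[OF Lc] by blast
  obtain b where b: "b \<in> Lb" "b \<noteq> bd1" "b \<noteq> bc1" using pick3[OF Lb] by blast
  show "\<exists>a\<in>La. \<exists>b\<in>Lb. \<exists>c\<in>Lc. \<exists>d\<in>Ld. a \<noteq> ka \<and> Rbc b c \<and> Rcd c d \<and> Rbd b d \<and> Rad a d \<and> Rac a c"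
    using a b c d bc(1) cd(1) bd(1) ad(2) ac(2) by metis
  obtain d1 d2 where d12: "Ld = {d1, d2}" "d1 \<noteq> d2" using Ld by (auto simp: card_2_iff)
  \<comment> \<open>As \<open>d\<close> has two colours, one of them equals at most one of
    \<open>ad2\<close>, \<open>bd2\<close>, \<open>cd2\<close>. It settles two of the three edges at
    \<open>d\<close>; the third is settled at its other end.\<close>
  then obtain d where d: "d \<in> Ld" "(d \<noteq> bd2 \<and> d \<noteq> cd2) \<or> (d \<noteq> ad2 \<and> d \<noteq> cd2) \<or> (d \<noteq> ad2 \<and> d \<noteq> bd2)"
    by (metis insertI1 insertI2)
  from d(2) show "\<exists>a\<in>La. \<exists>b\<in>Lb. \<exists>c\<in>Lc. \<exists>d\<in>Ld. b \<noteq> kb \<and> c \<noteq> kc \<and> Rbc b c \<and> Rcd c d \<and> Rbd b d \<and> Rad a d \<and> Rac a c"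
  proof (elim disjE conjE)
    assume *: "d \<noteq> bd2" "d \<noteq> cd2"
    obtain a where a: "a \<in> La" "a \<noteq> ad1" using pick2[OF La] by blast
    obtain c where c: "c \<in> Lc" "c \<noteq> ac2" "c \<noteq> kc" using pick3[OF Lc] by blast
    obtain b where b: "b \<in> Lb" "b \<noteq> kb" "b \<noteq> bc1" using pick3[OF Lb] by blast
    show ?thesis using a b c d(1) * bc(1) cd(2) bd(2) ad(1) ac(2) by metis
  next
    assume *: "d \<noteq> ad2" "d \<noteq> cd2"
    obtain a where a: "a \<in> La" "a \<noteq> ac1" using pick2[OF La] by blast
    obtain c where c: "c \<in> Lc" "c \<noteq> bc2" "c \<noteq> kc" using pick3[OF Lc] by blast
    obtain b where b: "b \<in> Lb" "b \<noteq> kb" "b \<noteq> bd1" using pick3[OF Lb] by blast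
    show ?thesis using a b c d(1) * bc(2) cd(2) bd(1) ad(2) ac(1) by metis
  next
    assume *: "d \<noteq> ad2" "d \<noteq> bd2"
    obtain a where a: "a \<in> La" "a \<noteq> ac1" using pick2[OF La] by blast
    obtain c where c: "c \<in> Lc" "c \<noteq> cd1" "c \<noteq> kc" using pick3[OF Lc] by blast
    obtain b where b: "b \<in> Lb" "b \<noteq> kb" "b \<noteq> bc1" using pick3[OF Lb] by blast
    show ?thesis using a b c d(1) * bc(1) cd(1) bd(2) ad(2) ac(1) by metis
  qed
qed

text \<open>A corner of the block: the inner vertex is \<open>z\<close>, the outer ones are \<open>n\<close> (next to \<open>b\<close>) and \<open>w\<close>
  (joined to \<open>c\<close> by a path). A chosen corner restricts \<open>n\<close> and \<open>w\<close>, any other one restricts \<open>z\<close>.\<close>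

lemma corner:
  assumes lists: "card La = 2" "card Lb = 3" "card Lc = 3" "card Ld = 2" "card Ls = 2" "card Lt = 2" "card Lp = 2" "card Lq = 2"
    and rels: "single Rbs" "single Rsc" "single Rcd" "single Rbd" "single Rda" "single Rat" "single Rtc"
      "single Rcp" "single Rpq" "single Rqw" "single Rbn" "single Raz"
  shows "\<exists>kn kw kz. \<forall>chosen. \<exists>a\<in>La. \<exists>b\<in>Lb. \<exists>c\<in>Lc. \<exists>d\<in>Ld. \<exists>s\<in>Ls. \<exists>t\<in>Lt.
    Rbs b s \<and> Rsc s c \<and> Rcd c d \<and> Rbd b d \<and> Rda d a \<and> Rat a t \<and> Rtc t c \<and>
    (\<forall>n. (chosen \<longrightarrow> n \<noteq> kn) \<longrightarrow> Rbn b n) \<and>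
    (\<forall>w. (chosen \<longrightarrow> w \<noteq> kw) \<longrightarrow> (\<exists>p\<in>Lp. \<exists>q\<in>Lq. Rcp c p \<and> Rpq p q \<and> Rqw q w)) \<and>
    (\<forall>z. (\<not> chosen \<longrightarrow> z \<noteq> kz) \<longrightarrow> Raz a z)"
proof -
  define Rbc where "Rbc b c \<longleftrightarrow> (\<exists>s\<in>Ls. Rbs b s \<and> Rsc s c)" for b c
  define Rac where "Rac a c \<longleftrightarrow> (\<exists>t\<in>Lt. Rat a t \<and> Rtc t c)" for a c
  define Rcq where "Rcq c q \<longleftrightarrow> (\<exists>p\<in>Lp. Rcp c p \<and> Rpq p q)" for c q
  define Rcw where "Rcw c w \<longleftrightarrow> (\<exists>q\<in>Lq. Rcq c q \<and> Rqw q w)" for c w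
  have bc: "single Rbc" and ac: "single Rac" and cq: "single Rcq"
    unfolding Rbc_def Rac_def Rcq_def by (intro single_comp lists rels)+
  have cw: "single Rcw" unfolding Rcw_def by (intro single_comp lists rels cq)
  note fan = fan_out[OF lists(1-4) bc rels(3,4) single_flip[OF rels(5)] ac]
  obtain bn1 bn2 where bn: "\<And>x y. x \<noteq> bn1 \<Longrightarrow> Rbn x y" "\<And>x y. y \<noteq> bn2 \<Longrightarrow> Rbn x y" using singleE[OF rels(11)] by blast
  obtain cw1 cw2 where cw: "\<And>x y. x \<noteq> cw1 \<Longrightarrow> Rcw x y" "\<And>x y. y \<noteq> cw2 \<Longrightarrow> Rcw x y" using singleE[OF cw] by blast
  obtain az1 az2 where az: "\<And>x y. x \<noteq> az1 \<Longrightarrow> Raz x y" "\<And>x y. y \<noteq> az2 \<Longrightarrow> Raz x y" using singleE[OF rels(12)] by blast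
  show ?thesis
  proof (intro exI[of _ bn2] exI[of _ cw2] exI[of _ az2] allI)
    fix chosen
    \<comment> \<open>In a chosen corner \<open>a\<close> dodges its conflict with \<open>z\<close>,
      at the expense of \<open>n\<close> and \<open>w\<close>. In any other corner \<open>b\<close>
      and \<open>c\<close> dodge theirs, at the expense of \<open>z\<close>.\<close>
    obtain a b c d where abcd: "a \<in> La" "b \<in> Lb" "c \<in> Lc" "d \<in> Ld" "Rbc b c" "Rcd c d" "Rbd b d" "Rda d a" "Rac a c"
      "if chosen then a \<noteq> az1 else b \<noteq> bn1 \<and> c \<noteq> cw1"
      by (cases chosen) (use fan(1)[of az1] fan(2)[of bn1 cw1] in \<open>fastforce+\<close>)
    then obtain s t where st: "s \<in> Ls" "Rbs b s" "Rsc s c" "t \<in> Lt" "Rat a t" "Rtc t c"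
      unfolding Rbc_def Rac_def by blast
    have "(chosen \<longrightarrow> n \<noteq> bn2) \<longrightarrow> Rbn b n" for n using bn abcd(10) by (cases chosen) auto
    moreover have "(chosen \<longrightarrow> w \<noteq> cw2) \<longrightarrow> (\<exists>p\<in>Lp. \<exists>q\<in>Lq. Rcp c p \<and> Rpq p q \<and> Rqw q w)" for w
    proof -
      have "(chosen \<longrightarrow> w \<noteq> cw2) \<longrightarrow> Rcw c w" using cw abcd(10) by (cases chosen) auto
      then show ?thesis unfolding Rcw_def Rcq_def by blast
    qed
    moreover have "(\<not> chosen \<longrightarrow> z \<noteq> az2) \<longrightarrow> Raz a z" for z using az abcd(10) by (cases chosen) auto
    ultimately show "\<exists>a\<in>La. \<exists>b\<in>Lb. \<exists>c\<in>Lc. \<exists>d\<in>Ld. \<exists>s\<in>Ls. \<exists>t\<in>Lt.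
      Rbs b s \<and> Rsc s c \<and> Rcd c d \<and> Rbd b d \<and> Rda d a \<and> Rat a t \<and> Rtc t c \<and>
      (\<forall>n. (chosen \<longrightarrow> n \<noteq> bn2) \<longrightarrow> Rbn b n) \<and>
      (\<forall>w. (chosen \<longrightarrow> w \<noteq> cw2) \<longrightarrow> (\<exists>p\<in>Lp. \<exists>q\<in>Lq. Rcp c p \<and> Rpq p q \<and> Rqw q w)) \<and>
      (\<forall>z. (\<not> chosen \<longrightarrow> z \<noteq> az2) \<longrightarrow> Raz a z)"
      using abcd(1-9) st by metis
  qed
qed

text \<open>Four mirror images of a corner surround the path \<open>(2, 3)\<close>,
  \<open>(3, 3)\<close>, \<open>(4, 3)\<close>, whose ends are the inner vertices of the two left
  and of the two right corners. In the upper left corner \<open>a, b, c, d\<close> are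
  \<open>(2, 2), (2, 0), (1, 1), (2, 1)\<close>; \<open>b\<close> and \<open>c\<close> are joined
  through \<open>(1, 0)\<close>, \<open>a\<close> and \<open>c\<close> through
  \<open>(1, 2)\<close>, and the path from \<open>c\<close> to the outer vertex
  \<open>(0, 3)\<close> runs through \<open>(0, 1)\<close> and \<open>(0, 2)\<close>.\<close>

definition block_h :: "(nat \<times> nat) list" where
  "block_h = [(1,0),(2,0),(1,1),(0,1),(1,2), (4,0),(3,0),(4,1),(5,1),(4,2),
    (1,6),(2,6),(1,5),(0,5),(1,4), (4,6),(3,6),(4,5),(5,5),(4,4), (2,3),(3,3)]"

text \<open>The edge from \<open>(6, 2)\<close> to \<open>(6, 3)\<close> is left out here, since it
  depends on whether the literal belongs to the clause.\<close>

definition block_v :: "(nat \<times> nat) list" where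
  "block_v = [(1,0),(2,0),(1,1),(2,1),(0,1),(0,2),(2,2), (5,0),(4,0),(5,1),(4,1),(6,1),(4,2),
    (1,5),(2,5),(1,4),(2,4),(0,4),(0,3),(2,3), (5,5),(4,5),(5,4),(4,4),(6,4),(6,3),(4,3)]"

definition block_3 :: "(nat \<times> nat) list" where
  "block_3 = [(2,0),(1,1),(4,0),(5,1),(2,6),(1,5),(4,6),(5,5),(2,3),(4,3)]"

lemma all_less_7: "(\<forall>x<7::nat. P x) \<longleftrightarrow> P 0 \<and> P 1 \<and> P 2 \<and> P 3 \<and> P 4 \<and> P 5 \<and> P 6"
  by (simp add: numeral_eq_Suc All_less_Suc; blast)

text \<open>The row enters at \<open>(0, 3)\<close> and leaves at \<open>(6, 3)\<close>, the column enters at \<open>(3, 0)\<close> and leaves at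
  \<open>(3, 6)\<close>; \<open>r\<close> and \<open>c\<close> say whether they are active, that is, restricted at the entrance.\<close>

lemma block_colorable:
  fixes L :: "nat \<Rightarrow> nat \<Rightarrow> nat set"
  assumes L: "\<And>x y. x < 7 \<Longrightarrow> y < 7 \<Longrightarrow> card (L x y) = (if (x, y) \<in> set block_3 then 3 else 2)"
    and Rh: "\<And>x y. single (Rh x y)" and Rv: "\<And>x y. single (Rv x y)"
  shows "\<exists>col. (\<forall>x<7. \<forall>y<7. col x y \<in> L x y) \<and>
    (\<forall>(x, y) \<in> set block_h. Rh x y (col x y) (col (Suc x) y)) \<and>
    (\<forall>(x, y) \<in> set block_v. Rv x y (col x y) (col x (Suc y))) \<and>
    (\<not> tap \<longrightarrow> Rv 6 2 (col 6 2) (col 6 3)) \<and>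
    (r \<longrightarrow> col 0 3 \<noteq> kw) \<and> (c \<longrightarrow> col 3 0 \<noteq> kn) \<and>
    (\<not> (r \<and> (c \<or> \<not> tap)) \<longrightarrow> col 6 3 \<noteq> ke) \<and> (\<not> c \<longrightarrow> col 3 6 \<noteq> ks)"
proof -
  have L2: "card (L x y) = 2" if "x < 7" "y < 7" "(x, y) \<notin> set block_3" for x y using L that by simp
  have L3: "card (L x y) = 3" if "(x, y) \<in> set block_3" for x y
    using L[of x y] that by (auto simp: block_3_def)
  note fl = Rh Rv single_flip[OF Rh] single_flip[OF Rv]
  have c2: "(x, y) \<notin> set block_3 \<Longrightarrow> x < 7 \<Longrightarrow> y < 7 \<Longrightarrow> card (L x y) = 2" for x y using L2 by blast
  have "\<exists>nwn nww nwz. \<forall>ch. \<exists>a\<in>L 2 2. \<exists>b\<in>L 2 0. \<exists>c\<in>L 1 1. \<exists>d\<in>L 2 1. \<exists>s\<in>L 1 0. \<exists>t\<in>L 1 2.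
    Rh 1 0 s b \<and> Rv 1 0 s c \<and> Rh 1 1 c d \<and> Rv 2 0 b d \<and> Rv 2 1 d a \<and> Rh 1 2 t a \<and> Rv 1 1 c t \<and>
    (\<forall>n. (ch \<longrightarrow> n \<noteq> nwn) \<longrightarrow> Rh 2 0 b n) \<and>
    (\<forall>w. (ch \<longrightarrow> w \<noteq> nww) \<longrightarrow> (\<exists>p\<in>L 0 1. \<exists>q\<in>L 0 2. Rh 0 1 p c \<and> Rv 0 1 p q \<and> Rv 0 2 q w)) \<and>
    (\<forall>z. (\<not> ch \<longrightarrow> z \<noteq> nwz) \<longrightarrow> Rv 2 2 a z)"
    by (rule corner; (rule Rh Rv single_flip[OF Rh] single_flip[OF Rv] | simp add: L2 L3 block_3_def))
  then obtain nwn nww nwz where NW: "\<forall>ch. \<exists>a\<in>L 2 2. \<exists>b\<in>L 2 0. \<exists>c\<in>L 1 1. \<exists>d\<in>L 2 1. \<exists>s\<in>L 1 0. \<exists>t\<in>L 1 2.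
    Rh 1 0 s b \<and> Rv 1 0 s c \<and> Rh 1 1 c d \<and> Rv 2 0 b d \<and> Rv 2 1 d a \<and> Rh 1 2 t a \<and> Rv 1 1 c t \<and>
    (\<forall>n. (ch \<longrightarrow> n \<noteq> nwn) \<longrightarrow> Rh 2 0 b n) \<and>
    (\<forall>w. (ch \<longrightarrow> w \<noteq> nww) \<longrightarrow> (\<exists>p\<in>L 0 1. \<exists>q\<in>L 0 2. Rh 0 1 p c \<and> Rv 0 1 p q \<and> Rv 0 2 q w)) \<and>
    (\<forall>z. (\<not> ch \<longrightarrow> z \<noteq> nwz) \<longrightarrow> Rv 2 2 a z)"
    by (elim exE) (rule that)
  have "\<exists>nen new nez. \<forall>ch. \<exists>a\<in>L 4 2. \<exists>b\<in>L 4 0. \<exists>c\<in>L 5 1. \<exists>d\<in>L 4 1. \<exists>s\<in>L 5 0. \<exists>t\<in>L 5 2.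
    Rh 4 0 b s \<and> Rv 5 0 s c \<and> Rh 4 1 d c \<and> Rv 4 0 b d \<and> Rv 4 1 d a \<and> Rh 4 2 a t \<and> Rv 5 1 c t \<and>
    (\<forall>n. (ch \<longrightarrow> n \<noteq> nen) \<longrightarrow> Rh 3 0 n b) \<and>
    (\<forall>w. (ch \<longrightarrow> w \<noteq> new) \<longrightarrow> (\<exists>p\<in>L 6 1. \<exists>q\<in>L 6 2. Rh 5 1 c p \<and> Rv 6 1 p q \<and> Rv 6 2 q w)) \<and>
    (\<forall>z. (\<not> ch \<longrightarrow> z \<noteq> nez) \<longrightarrow> Rv 4 2 a z)"
    by (rule corner; (rule Rh Rv single_flip[OF Rh] single_flip[OF Rv] | simp add: L2 L3 block_3_def))
  then obtain nen new nez where NE: "\<forall>ch. \<exists>a\<in>L 4 2. \<exists>b\<in>L 4 0. \<exists>c\<in>L 5 1. \<exists>d\<in>L 4 1. \<exists>s\<in>L 5 0. \<exists>t\<in>L 5 2.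
    Rh 4 0 b s \<and> Rv 5 0 s c \<and> Rh 4 1 d c \<and> Rv 4 0 b d \<and> Rv 4 1 d a \<and> Rh 4 2 a t \<and> Rv 5 1 c t \<and>
    (\<forall>n. (ch \<longrightarrow> n \<noteq> nen) \<longrightarrow> Rh 3 0 n b) \<and>
    (\<forall>w. (ch \<longrightarrow> w \<noteq> new) \<longrightarrow> (\<exists>p\<in>L 6 1. \<exists>q\<in>L 6 2. Rh 5 1 c p \<and> Rv 6 1 p q \<and> Rv 6 2 q w)) \<and>
    (\<forall>z. (\<not> ch \<longrightarrow> z \<noteq> nez) \<longrightarrow> Rv 4 2 a z)"
    by (elim exE) (rule that)
  have "\<exists>swn sww swz. \<forall>ch. \<exists>a\<in>L 2 4. \<exists>b\<in>L 2 6. \<exists>c\<in>L 1 5. \<exists>d\<in>L 2 5. \<exists>s\<in>L 1 6. \<exists>t\<in>L 1 4.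
    Rh 1 6 s b \<and> Rv 1 5 c s \<and> Rh 1 5 c d \<and> Rv 2 5 d b \<and> Rv 2 4 a d \<and> Rh 1 4 t a \<and> Rv 1 4 t c \<and>
    (\<forall>n. (ch \<longrightarrow> n \<noteq> swn) \<longrightarrow> Rh 2 6 b n) \<and>
    (\<forall>w. (ch \<longrightarrow> w \<noteq> sww) \<longrightarrow> (\<exists>p\<in>L 0 5. \<exists>q\<in>L 0 4. Rh 0 5 p c \<and> Rv 0 4 q p \<and> Rv 0 3 w q)) \<and>
    (\<forall>z. (\<not> ch \<longrightarrow> z \<noteq> swz) \<longrightarrow> Rv 2 3 z a)"
    by (rule corner; (rule Rh Rv single_flip[OF Rh] single_flip[OF Rv] | simp add: L2 L3 block_3_def))
  then obtain swn sww swz where SW: "\<forall>ch. \<exists>a\<in>L 2 4. \<exists>b\<in>L 2 6. \<exists>c\<in>L 1 5. \<exists>d\<in>L 2 5. \<exists>s\<in>L 1 6. \<exists>t\<in>L 1 4.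
    Rh 1 6 s b \<and> Rv 1 5 c s \<and> Rh 1 5 c d \<and> Rv 2 5 d b \<and> Rv 2 4 a d \<and> Rh 1 4 t a \<and> Rv 1 4 t c \<and>
    (\<forall>n. (ch \<longrightarrow> n \<noteq> swn) \<longrightarrow> Rh 2 6 b n) \<and>
    (\<forall>w. (ch \<longrightarrow> w \<noteq> sww) \<longrightarrow> (\<exists>p\<in>L 0 5. \<exists>q\<in>L 0 4. Rh 0 5 p c \<and> Rv 0 4 q p \<and> Rv 0 3 w q)) \<and>
    (\<forall>z. (\<not> ch \<longrightarrow> z \<noteq> swz) \<longrightarrow> Rv 2 3 z a)"
    by (elim exE) (rule that)
  have "\<exists>sen sew sez. \<forall>ch. \<exists>a\<in>L 4 4. \<exists>b\<in>L 4 6. \<exists>c\<in>L 5 5. \<exists>d\<in>L 4 5. \<exists>s\<in>L 5 6. \<exists>t\<in>L 5 4.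
    Rh 4 6 b s \<and> Rv 5 5 c s \<and> Rh 4 5 d c \<and> Rv 4 5 d b \<and> Rv 4 4 a d \<and> Rh 4 4 a t \<and> Rv 5 4 t c \<and>
    (\<forall>n. (ch \<longrightarrow> n \<noteq> sen) \<longrightarrow> Rh 3 6 n b) \<and>
    (\<forall>w. (ch \<longrightarrow> w \<noteq> sew) \<longrightarrow> (\<exists>p\<in>L 6 5. \<exists>q\<in>L 6 4. Rh 5 5 c p \<and> Rv 6 4 q p \<and> Rv 6 3 w q)) \<and>
    (\<forall>z. (\<not> ch \<longrightarrow> z \<noteq> sez) \<longrightarrow> Rv 4 3 z a)"
    by (rule corner; (rule Rh Rv single_flip[OF Rh] single_flip[OF Rv] | simp add: L2 L3 block_3_def))
  then obtain sen sew sez where SE: "\<forall>ch. \<exists>a\<in>L 4 4. \<exists>b\<in>L 4 6. \<exists>c\<in>L 5 5. \<exists>d\<in>L 4 5. \<exists>s\<in>L 5 6. \<exists>t\<in>L 5 4.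
    Rh 4 6 b s \<and> Rv 5 5 c s \<and> Rh 4 5 d c \<and> Rv 4 5 d b \<and> Rv 4 4 a d \<and> Rh 4 4 a t \<and> Rv 5 4 t c \<and>
    (\<forall>n. (ch \<longrightarrow> n \<noteq> sen) \<longrightarrow> Rh 3 6 n b) \<and>
    (\<forall>w. (ch \<longrightarrow> w \<noteq> sew) \<longrightarrow> (\<exists>p\<in>L 6 5. \<exists>q\<in>L 6 4. Rh 5 5 c p \<and> Rv 6 4 q p \<and> Rv 6 3 w q)) \<and>
    (\<forall>z. (\<not> ch \<longrightarrow> z \<noteq> sez) \<longrightarrow> Rv 4 3 z a)"
    by (elim exE) (rule that)
  \<comment> \<open>Through the middle vertex the two inner vertices see each other as if joined by
    one edge.\<close>
  define zz where "zz x y \<longleftrightarrow> (\<exists>m\<in>L 3 3. Rh 2 3 x m \<and> Rh 3 3 m y)" for x y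
  have "single zz" unfolding zz_def by (intro single_comp Rh L2) (simp_all add: block_3_def)
  then obtain zl zr where zz: "\<And>x y. x \<noteq> zl \<Longrightarrow> zz x y" "\<And>x y. y \<noteq> zr \<Longrightarrow> zz x y" using singleE by blast
  have two: "\<exists>w\<in>L x y. w \<noteq> k" if "x < 7" "y < 7" "(x, y) \<notin> set block_3" for x y k
    using pick2[OF L2[OF that]] by blast
  \<comment> \<open>The chosen corner is left or right according to \<open>r\<close> and top or
    bottom according to \<open>c\<close>. Then each of the four outer vertices has just one colour
    to avoid, either from its own obligation or from the chosen corner next to it. With
    \<open>tap\<close> the upper right corner does not reach \<open>(6, 3)\<close>, which is how an
    active row can become inactive at an inactive column.\<close>
  obtain w where w: "w \<in> L 0 3" "r \<longrightarrow> w \<noteq> kw" "\<not> r \<and> \<not> c \<longrightarrow> w \<noteq> nww" "\<not> r \<and> c \<longrightarrow> w \<noteq> sww"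
    using two[of 0 3 "if r then kw else if c then sww else nww"] by (auto simp: block_3_def split: if_splits)
  obtain n where n: "n \<in> L 3 0" "c \<longrightarrow> n \<noteq> kn" "\<not> r \<and> \<not> c \<longrightarrow> n \<noteq> nwn" "r \<and> \<not> c \<longrightarrow> n \<noteq> nen"
    using two[of 3 0 "if c then kn else if r then nen else nwn"] by (auto simp: block_3_def split: if_splits)
  obtain s where s: "s \<in> L 3 6" "\<not> c \<longrightarrow> s \<noteq> ks" "\<not> r \<and> c \<longrightarrow> s \<noteq> swn" "r \<and> c \<longrightarrow> s \<noteq> sen"
    using two[of 3 6 "if \<not> c then ks else if r then sen else swn"] by (auto simp: block_3_def split: if_splits)
  obtain e where e: "e \<in> L 6 3" "\<not> (r \<and> (c \<or> \<not> tap)) \<longrightarrow> e \<noteq> ke" "r \<and> \<not> c \<and> \<not> tap \<longrightarrow> e \<noteq> new" "r \<and> c \<longrightarrow> e \<noteq> sew"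
    using two[of 6 3 "if \<not> (r \<and> (c \<or> \<not> tap)) then ke else if c then sew else new"] by (auto simp: block_3_def split: if_splits)
  obtain z1 z2 where z: "z1 \<in> L 2 3" "z2 \<in> L 4 3" "zz z1 z2" "\<not> (\<not> r \<and> \<not> c) \<longrightarrow> z1 \<noteq> nwz" "\<not> (\<not> r \<and> c) \<longrightarrow> z1 \<noteq> swz"
    "\<not> (r \<and> \<not> c) \<longrightarrow> z2 \<noteq> nez" "\<not> (r \<and> c) \<longrightarrow> z2 \<noteq> sez"
  proof -
    \<comment> \<open>An inner vertex next to the chosen corner is spared one of its two
      restrictions and avoids the conflict of the middle path instead.\<close>
    obtain z1 where z1: "z1 \<in> L 2 3" "z1 \<noteq> (if \<not> r \<and> \<not> c then zl else nwz)" "z1 \<noteq> (if \<not> r \<and> c then zl else swz)"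
      using pick3[OF L3[of 2 3]] by (auto simp: block_3_def)
    obtain z2 where z2: "z2 \<in> L 4 3" "z2 \<noteq> (if r \<and> \<not> c then zr else nez)" "z2 \<noteq> (if r \<and> c then zr else sez)"
      using pick3[OF L3[of 4 3]] by (auto simp: block_3_def)
    have "zz z1 z2" using z1 z2 zz by (cases r; cases c) auto
    then show ?thesis using that[of z1 z2] z1 z2 by (auto split: if_splits)
  qed
  then obtain m where m: "m \<in> L 3 3" "Rh 2 3 z1 m" "Rh 3 3 m z2" unfolding zz_def by blast
  obtain a1 b1 c1 d1 s1 t1 where 1: "a1 \<in> L 2 2" "b1 \<in> L 2 0" "c1 \<in> L 1 1" "d1 \<in> L 2 1" "s1 \<in> L 1 0" "t1 \<in> L 1 2"
    "Rh 1 0 s1 b1" "Rv 1 0 s1 c1" "Rh 1 1 c1 d1" "Rv 2 0 b1 d1" "Rv 2 1 d1 a1" "Rh 1 2 t1 a1" "Rv 1 1 c1 t1"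
    "Rh 2 0 b1 n" "\<exists>p\<in>L 0 1. \<exists>q\<in>L 0 2. Rh 0 1 p c1 \<and> Rv 0 1 p q \<and> Rv 0 2 q w" "Rv 2 2 a1 z1"
    using NW[THEN spec, of "\<not> r \<and> \<not> c"] w(3) n(3) z(4) by (elim bexE conjE) (rule that; blast)
  obtain a2 b2 c2 d2 s2 t2 where 2: "a2 \<in> L 4 2" "b2 \<in> L 4 0" "c2 \<in> L 5 1" "d2 \<in> L 4 1" "s2 \<in> L 5 0" "t2 \<in> L 5 2"
    "Rh 4 0 b2 s2" "Rv 5 0 s2 c2" "Rh 4 1 d2 c2" "Rv 4 0 b2 d2" "Rv 4 1 d2 a2" "Rh 4 2 a2 t2" "Rv 5 1 c2 t2"
    "Rh 3 0 n b2" "\<forall>w. (r \<and> \<not> c \<longrightarrow> w \<noteq> new) \<longrightarrow> (\<exists>p\<in>L 6 1. \<exists>q\<in>L 6 2. Rh 5 1 c2 p \<and> Rv 6 1 p q \<and> Rv 6 2 q w)" "Rv 4 2 a2 z2"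
    using NE[THEN spec, of "r \<and> \<not> c"] n(4) z(6) by (elim bexE conjE) (rule that; blast)
  obtain a3 b3 c3 d3 s3 t3 where 3: "a3 \<in> L 2 4" "b3 \<in> L 2 6" "c3 \<in> L 1 5" "d3 \<in> L 2 5" "s3 \<in> L 1 6" "t3 \<in> L 1 4"
    "Rh 1 6 s3 b3" "Rv 1 5 c3 s3" "Rh 1 5 c3 d3" "Rv 2 5 d3 b3" "Rv 2 4 a3 d3" "Rh 1 4 t3 a3" "Rv 1 4 t3 c3"
    "Rh 2 6 b3 s" "\<exists>p\<in>L 0 5. \<exists>q\<in>L 0 4. Rh 0 5 p c3 \<and> Rv 0 4 q p \<and> Rv 0 3 w q" "Rv 2 3 z1 a3"
    using SW[THEN spec, of "\<not> r \<and> c"] w(4) s(3) z(5) by (elim bexE conjE) (rule that; blast)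
  obtain a4 b4 c4 d4 s4 t4 where 4: "a4 \<in> L 4 4" "b4 \<in> L 4 6" "c4 \<in> L 5 5" "d4 \<in> L 4 5" "s4 \<in> L 5 6" "t4 \<in> L 5 4"
    "Rh 4 6 b4 s4" "Rv 5 5 c4 s4" "Rh 4 5 d4 c4" "Rv 4 5 d4 b4" "Rv 4 4 a4 d4" "Rh 4 4 a4 t4" "Rv 5 4 t4 c4"
    "Rh 3 6 s b4" "\<exists>p\<in>L 6 5. \<exists>q\<in>L 6 4. Rh 5 5 c4 p \<and> Rv 6 4 q p \<and> Rv 6 3 e q" "Rv 4 3 z2 a4"
    using SE[THEN spec, of "r \<and> c"] e(4) s(4) z(7) by (elim bexE conjE) (rule that; blast)
  obtain p1 q1 where pq1: "p1 \<in> L 0 1" "q1 \<in> L 0 2" "Rh 0 1 p1 c1" "Rv 0 1 p1 q1" "Rv 0 2 q1 w" using 1(15) by blast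
  obtain p3 q3 where pq3: "p3 \<in> L 0 5" "q3 \<in> L 0 4" "Rh 0 5 p3 c3" "Rv 0 4 q3 p3" "Rv 0 3 w q3" using 3(15) by blast
  obtain p4 q4 where pq4: "p4 \<in> L 6 5" "q4 \<in> L 6 4" "Rh 5 5 c4 p4" "Rv 6 4 q4 p4" "Rv 6 3 e q4" using 4(15) by blast
  have "\<exists>p\<in>L 6 1. \<exists>q\<in>L 6 2. Rh 5 1 c2 p \<and> Rv 6 1 p q \<and> (\<not> tap \<longrightarrow> Rv 6 2 q e)"
  proof (cases tap)
    case True
    \<comment> \<open>Without the edge to \<open>(6, 3)\<close> the path may end as if next to any
      harmless colour.\<close>
    have "Suc new \<noteq> new" by simp
    then show ?thesis using 2(15) True by blast
  next
    case False
    then show ?thesis using 2(15) e(3) by blast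
  qed
  then obtain p2 q2 where pq2: "p2 \<in> L 6 1" "q2 \<in> L 6 2" "Rh 5 1 c2 p2" "Rv 6 1 p2 q2" "\<not> tap \<longrightarrow> Rv 6 2 q2 e" by blast
  define f where "f x y = (SOME v. v \<in> L x y)" for x y
  have f: "f x y \<in> L x y" if "x < 7" "y < 7" for x y
  proof -
    have "card (L x y) \<noteq> 0" using L[OF that] by simp
    then have "L x y \<noteq> {}" by auto
    then show ?thesis unfolding f_def by (rule some_in_eq[THEN iffD2])
  qed
  let ?M = "[[f 0 0, s1, b1, n, b2, s2, f 6 0],
    [p1, c1, d1, f 3 1, d2, c2, p2],
    [q1, t1, a1, f 3 2, a2, t2, q2],
    [w, f 1 3, z1, m, z2, f 5 3, e],
    [q3, t3, a3, f 3 4, a4, t4, q4],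
    [p3, c3, d3, f 3 5, d4, c4, p4],
    [f 0 6, s3, b3, s, b4, s4, f 6 6]]"
  show ?thesis
  proof (intro exI[of _ "\<lambda>x y. ?M ! y ! x"] conjI)
    show "\<forall>x<7. \<forall>y<7. ?M ! y ! x \<in> L x y"
      unfolding all_less_7 using 1(1-6) 2(1-6) 3(1-6) 4(1-6) pq1(1,2) pq2(1,2) pq3(1,2) pq4(1,2) f w(1) n(1) s(1) e(1) z(1,2) m(1)
      by simp
    show "\<forall>(x, y)\<in>set block_h. Rh x y (?M ! y ! x) (?M ! y ! Suc x)"
      using 1(7-16) 2(7-16) 3(7-16) 4(7-16) pq1 pq2 pq3 pq4 m by (simp add: block_h_def)
    show "\<forall>(x, y)\<in>set block_v. Rv x y (?M ! y ! x) (?M ! Suc y ! x)"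
      using 1(7-16) 2(7-16) 3(7-16) 4(7-16) pq1 pq2 pq3 pq4 m by (simp add: block_v_def)
  qed (use w n s e pq2 in simp_all)
qed

text \<open>Within a corner these conflicts pass colour \<open>1\<close> on from \<open>a\<close> to
  \<open>b\<close> and to the last vertex before \<open>w\<close>, which then deny \<open>1\<close>
  to \<open>n\<close> and \<open>w\<close>. Around the middle path they ensure that one of the four
  vertices \<open>a\<close> does have colour \<open>1\<close>.\<close>

definition block_hc :: "((nat \<times> nat) \<times> nat \<times> nat) list" where
  "block_hc = [((1,0),(1,2)),((2,0),(1,1)),((1,1),(3,1)),((0,1),(2,1)),((1,2),(2,1)),
    ((4,0),(2,1)),((3,0),(1,1)),((4,1),(1,3)),((5,1),(1,2)),((4,2),(1,2)),
    ((1,6),(1,2)),((2,6),(1,1)),((1,5),(3,1)),((0,5),(2,1)),((1,4),(2,1)),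
    ((4,6),(2,1)),((3,6),(1,1)),((4,5),(1,3)),((5,5),(1,2)),((4,4),(1,2)),
    ((2,3),(3,2)),((3,3),(1,3))]"

definition block_vc :: "((nat \<times> nat) \<times> nat \<times> nat) list" where
  "block_vc = [((1,0),(2,1)),((2,0),(3,1)),((1,1),(2,1)),((2,1),(2,1)),((0,1),(1,2)),((0,2),(1,1)),((2,2),(2,1)),
    ((5,0),(2,1)),((4,0),(3,1)),((5,1),(2,1)),((4,1),(2,1)),((6,1),(1,2)),((4,2),(2,1)),
    ((1,5),(1,2)),((2,5),(1,3)),((1,4),(1,2)),((2,4),(1,2)),((0,4),(2,1)),((0,3),(1,1)),((2,3),(2,2)),
    ((5,5),(1,2)),((4,5),(1,3)),((5,4),(1,2)),((4,4),(1,2)),((6,4),(2,1)),((6,3),(1,1)),((4,3),(2,2))]"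

text \<open>The choice of conflicts under which a chosen corner (\<open>a = 1\<close>) forces all other vertices.\<close>

lemma corner_forced:
  fixes a b c d s t p q :: nat
  assumes "a = 1" "d \<in> {1..2}" "t \<in> {1..2}" "s \<in> {1..2}" "p \<in> {1..2}" "q \<in> {1..2}" "b \<in> {1..3}" "c \<in> {1..3}"
    and "a = 1 \<longrightarrow> d \<noteq> 2" "a = 1 \<longrightarrow> t \<noteq> 2" "t = 1 \<longrightarrow> c \<noteq> 2" "d = 1 \<longrightarrow> c \<noteq> 3" "c = 1 \<longrightarrow> s \<noteq> 2"
      "s = 1 \<longrightarrow> b \<noteq> 2" "d = 1 \<longrightarrow> b \<noteq> 3" "c = 1 \<longrightarrow> p \<noteq> 2" "p = 1 \<longrightarrow> q \<noteq> 2"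
  shows "b = 1 \<and> q = 1"
proof -
  have "d = 1" "t = 1" using assms(1-3,9,10) by auto
  then have "c = 1" using assms(8,11,12) by auto
  then have "s = 1" "p = 1" using assms(4,5,13,16) by auto
  then show ?thesis using assms(6,7,14,15,17) \<open>d = 1\<close> by auto
qed

text \<open>Some corner has \<open>a = 1\<close>, and such a corner denies \<open>1\<close> to its
  outer vertices. Colour \<open>1\<close> at an entrance rules out the two corners there, so a
  corner at the opposite exit is chosen and the exit gets \<open>2\<close>. If the edge at
  \<open>(6, 2)\<close> is missing, the upper right corner must be ruled out by the column.\<close>

lemma block_forced:
  fixes g :: "nat \<Rightarrow> nat \<Rightarrow> nat"
  assumes range: "\<And>x y. x < 7 \<Longrightarrow> y < 7 \<Longrightarrow> g x y \<in> {1..if (x, y) \<in> set block_3 then 3 else 2}"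
    and h: "\<forall>((x, y), c) \<in> set block_hc. (g x y, g (Suc x) y) \<noteq> c"
    and v: "\<forall>((x, y), c) \<in> set block_vc. (g x y, g x (Suc y)) \<noteq> c"
    and tap: "\<not> tap \<Longrightarrow> (g 6 2, g 6 3) \<noteq> (1, 1)"
  shows "g 3 0 = 1 \<Longrightarrow> g 3 6 = 2"
    and "g 0 3 = 1 \<Longrightarrow> \<not> tap \<or> g 3 0 = 1 \<Longrightarrow> g 6 3 = 2"
proof -
  have r2: "g x y \<in> {1..2}" if "x < 7" "y < 7" "(x, y) \<notin> set block_3" for x y using range[OF that(1,2)] that(3) by simp
  have r3: "g x y \<in> {1..3}" if "(x, y) \<in> set block_3" for x y
    using range[of x y] that by (auto simp: block_3_def)
  note H = h[unfolded block_hc_def, simplified, folded numeral_2_eq_2]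
  note V = v[unfolded block_vc_def, simplified, folded numeral_2_eq_2]
  have NW: "g 2 0 = 1 \<and> g 0 2 = 1" if "g 2 2 = 1"
    by (rule corner_forced[OF that r2[of 2 1] r2[of 1 2] r2[of 1 0] r2[of 0 1] r2[of 0 2] r3[of 2 0] r3[of 1 1]])
       (use H V in \<open>auto simp: block_3_def\<close>)
  have NE: "g 4 0 = 1 \<and> g 6 2 = 1" if "g 4 2 = 1"
    by (rule corner_forced[OF that r2[of 4 1] r2[of 5 2] r2[of 5 0] r2[of 6 1] r2[of 6 2] r3[of 4 0] r3[of 5 1]])
       (use H V in \<open>auto simp: block_3_def\<close>)
  have SW: "g 2 6 = 1 \<and> g 0 4 = 1" if "g 2 4 = 1"
    by (rule corner_forced[OF that r2[of 2 5] r2[of 1 4] r2[of 1 6] r2[of 0 5] r2[of 0 4] r3[of 2 6] r3[of 1 5]])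
       (use H V in \<open>auto simp: block_3_def\<close>)
  have SE: "g 4 6 = 1 \<and> g 6 4 = 1" if "g 4 4 = 1"
    by (rule corner_forced[OF that r2[of 4 5] r2[of 5 4] r2[of 5 6] r2[of 6 5] r2[of 6 4] r3[of 4 6] r3[of 5 5]])
       (use H V in \<open>auto simp: block_3_def\<close>)
  have bin: "g 2 2 \<noteq> 1 \<Longrightarrow> g 2 2 = 2" "g 4 2 \<noteq> 1 \<Longrightarrow> g 4 2 = 2" "g 2 4 \<noteq> 1 \<Longrightarrow> g 2 4 = 2" "g 4 4 \<noteq> 1 \<Longrightarrow> g 4 4 = 2"
    "g 3 6 \<noteq> 1 \<Longrightarrow> g 3 6 = 2" "g 6 3 \<noteq> 1 \<Longrightarrow> g 6 3 = 2" "g 3 3 \<noteq> 2 \<Longrightarrow> g 3 3 = 1"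
    using r2[of 2 2] r2[of 4 2] r2[of 2 4] r2[of 4 4] r2[of 3 6] r2[of 6 3] r2[of 3 3] by (auto simp: block_3_def)
  have z: "g 2 3 = 1 \<or> g 2 3 = 2 \<or> g 2 3 = 3" "g 4 3 = 1 \<or> g 4 3 = 2 \<or> g 4 3 = 3"
    using r3[of 2 3] r3[of 4 3] by (auto simp: block_3_def)
  \<comment> \<open>If all four had colour \<open>2\<close>, both inner vertices would be forced to
    \<open>3\<close> and the middle vertex would have no colour left.\<close>
  have centre: "g 2 2 = 1 \<or> g 4 2 = 1 \<or> g 2 4 = 1 \<or> g 4 4 = 1"
  proof (rule ccontr)
    assume "\<not> ?thesis"
    then have a: "g 2 2 = 2" "g 4 2 = 2" "g 2 4 = 2" "g 4 4 = 2" using bin by blast+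
    then have "g 2 3 = 3" "g 4 3 = 3" using z V by auto
    then show False using H bin(7) by auto
  qed
  have out: "g 2 0 = 1 \<longrightarrow> g 3 0 \<noteq> 1" "g 3 0 = 1 \<longrightarrow> g 4 0 \<noteq> 1" "g 0 2 = 1 \<longrightarrow> g 0 3 \<noteq> 1"
    "g 0 3 = 1 \<longrightarrow> g 0 4 \<noteq> 1" "g 2 6 = 1 \<longrightarrow> g 3 6 \<noteq> 1" "g 3 6 = 1 \<longrightarrow> g 4 6 \<noteq> 1" "g 6 3 = 1 \<longrightarrow> g 6 4 \<noteq> 1"
    "\<not> tap \<longrightarrow> g 6 2 = 1 \<longrightarrow> g 6 3 \<noteq> 1"
    using H V tap by simp_all
  have n: "g 3 0 = 1 \<Longrightarrow> g 2 2 \<noteq> 1 \<and> g 4 2 \<noteq> 1" using NW NE out by blast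
  have w: "g 0 3 = 1 \<Longrightarrow> g 2 2 \<noteq> 1 \<and> g 2 4 \<noteq> 1" using NW SW out by blast
  show "g 3 0 = 1 \<Longrightarrow> g 3 6 = 2" using n centre SW SE out bin(5) by blast
  show "g 0 3 = 1 \<Longrightarrow> \<not> tap \<or> g 3 0 = 1 \<Longrightarrow> g 6 3 = 2" using w n centre NE SE out bin(6) by blast
qed

section \<open>Layout of quantified formulas\<close>

text \<open>Clause \<open>i\<close> consists of the literals \<open>j\<close> with \<open>lit i j\<close>; literal \<open>2 * v\<close> is the variable \<open>v\<close> and
  literal \<open>2 * v + 1\<close> its negation.\<close>

definition lit_true :: "(nat \<Rightarrow> bool) \<Rightarrow> nat \<Rightarrow> bool" where
  "lit_true \<alpha> j \<longleftrightarrow> \<alpha> (j div 2) = even j"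

definition qbf :: "nat \<Rightarrow> nat \<Rightarrow> (nat \<Rightarrow> bool) \<Rightarrow> (nat \<Rightarrow> nat \<Rightarrow> bool) \<Rightarrow> bool" where
  "qbf nv mc isU lit \<longleftrightarrow> (\<forall>U. \<exists>\<alpha>. (\<forall>v<nv. isU v \<longrightarrow> \<alpha> v = U v) \<and>
     (\<forall>i<mc. \<exists>j<2 * nv. lit i j \<and> lit_true \<alpha> j))"

text \<open>Blocks are numbered by rows \<open>I\<close> and columns \<open>J\<close>. Row \<open>0\<close> has the sources of the literals, column
  \<open>0\<close> the sources of the rows, column \<open>2 * nv + 1\<close> their ends; block \<open>(I, J)\<close> with \<open>0 < I\<close> and
  \<open>0 < J \<le> 2 * nv\<close> belongs to clause \<open>I - 1\<close> and literal \<open>J - 1\<close>. An active column means a false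
  literal, an active row that all literals of the clause so far are false.\<close>

definition lay_h :: "nat \<Rightarrow> nat \<Rightarrow> nat \<Rightarrow> nat \<Rightarrow> bool" where
  "lay_h nv mc X Y = (let I = Y div 7; J = X div 7; x = X mod 7; y = Y mod 7 in I \<le> mc \<and>
     (if I = 0 then 0 < J \<and> J \<le> 2 * nv \<and> (if odd J then 3 \<le> x else x < 3) \<and> (y = 5 \<or> y = 6)
      else if J = 0 then (x, y) = (5, 3) \<or> (x, y) = (5, 4) \<or> (x, y) = (6, 3)
      else if J = 2 * nv + 1 then (x, y) = (0, 3) \<or> (x, y) = (0, 4)
      else J \<le> 2 * nv \<and> ((x, y) \<in> set block_h \<or> (x, y) = (6, 3))))"

text \<open>The left rung between the two source rows exists only for universal variables. Without
  it the rows contain no cycle, and the colouring can decide which of the two sources is kept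
  clear.\<close>

definition lay_v :: "nat \<Rightarrow> nat \<Rightarrow> (nat \<Rightarrow> bool) \<Rightarrow> (nat \<Rightarrow> nat \<Rightarrow> bool) \<Rightarrow> nat \<Rightarrow> nat \<Rightarrow> bool" where
  "lay_v nv mc isU lit X Y = (let I = Y div 7; J = X div 7; x = X mod 7; y = Y mod 7 in I \<le> mc \<and>
     (if I = 0 then 0 < J \<and> J \<le> 2 * nv \<and> x = 3 \<and> (y = 5 \<and> (odd J \<longrightarrow> isU (J div 2)) \<or> y = 6 \<and> 0 < mc)
      else if J = 0 then (x, y) = (5, 3) \<or> (x, y) = (6, 3)
      else if J = 2 * nv + 1 then (x, y) = (0, 3) \<or> (x, y) = (1, 3)
      else J \<le> 2 * nv \<and> ((x, y) \<in> set block_v \<or> (x, y) = (6, 2) \<and> \<not> lit (I - 1) (J - 1) \<or>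
        (x, y) = (3, 6) \<and> I < mc)))"

definition lay_3 :: "nat \<Rightarrow> nat \<Rightarrow> nat \<Rightarrow> nat \<Rightarrow> bool" where
  "lay_3 nv mc X Y = (let I = Y div 7; J = X div 7; x = X mod 7; y = Y mod 7 in
     0 < I \<and> I \<le> mc \<and> 0 < J \<and> J \<le> 2 * nv \<and> (x, y) \<in> set block_3)"

lemma block_h_bound: "(x, y) \<in> set block_h \<Longrightarrow> x < 6 \<and> y < 7"
  by (auto simp: block_h_def)

lemma block_v_bound: "(x, y) \<in> set block_v \<Longrightarrow> x < 7 \<and> y < 6"
  by (auto simp: block_v_def)

lemma seven_div_mod [simp]: "x < 7 \<Longrightarrow> (7 * J + x) div 7 = J" "x < 7 \<Longrightarrow> (7 * J + x) mod 7 = (x :: nat)"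
  by auto

lemma seven_split:
  fixes X :: nat
  obtains J x where "X = 7 * J + x" "x < 7"
  by (metis mod_less_divisor mult_div_mod_eq zero_less_numeral)

lemma lay_h_bound: "lay_h nv mc X Y \<Longrightarrow> Suc X < 7 * (2 * nv + 2) \<and> Y < 7 * (mc + 1)"
proof -
  assume l: "lay_h nv mc X Y"
  obtain J x where X: "X = 7 * J + x" "x < 7" using seven_split[of X] by blast
  obtain I y where Y: "Y = 7 * I + y" "y < 7" using seven_split[of Y] by blast
  have "J \<le> 2 * nv \<or> J = 2 * nv + 1 \<and> x = 0"
    using l by (auto simp: lay_h_def X Y Let_def split: if_splits)
  moreover have "I \<le> mc" using l by (auto simp: lay_h_def X Y Let_def)
  ultimately show ?thesis using X Y by auto
qed

lemma lay_v_bound: "lay_v nv mc isU lit X Y \<Longrightarrow> X < 7 * (2 * nv + 2) \<and> Suc Y < 7 * (mc + 1)"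
proof -
  assume l: "lay_v nv mc isU lit X Y"
  obtain J x where X: "X = 7 * J + x" "x < 7" using seven_split[of X] by blast
  obtain I y where Y: "Y = 7 * I + y" "y < 7" using seven_split[of Y] by blast
  have "J \<le> 2 * nv + 1"
    using l by (auto simp: lay_v_def X Y Let_def split: if_splits)
  moreover have "I < mc \<or> I = mc \<and> y < 6"
    using l block_v_bound[of x y] by (auto simp: lay_v_def X Y Let_def split: if_splits)
  ultimately show ?thesis using X Y by auto
qed

section \<open>Paths, cycles and sources under arbitrary conflicts\<close>

lemma path_from_start:
  assumes "\<And>t. t \<le> m \<Longrightarrow> card (L t) = 2" "\<And>t. t < m \<Longrightarrow> single (R t)" "x \<in> L 0"
  shows "\<exists>g. g 0 = x \<and> (\<forall>t\<le>m. g t \<in> L t) \<and> (\<forall>t<m. R t (g t) (g (Suc t)))"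
  using assms
proof (induction m)
  case (Suc m)
  have "\<exists>g. g 0 = x \<and> (\<forall>t\<le>m. g t \<in> L t) \<and> (\<forall>t<m. R t (g t) (g (Suc t)))"
    by (rule Suc.IH) (simp_all add: Suc.prems)
  then obtain g where g: "g 0 = x" "\<forall>t\<le>m. g t \<in> L t" "\<forall>t<m. R t (g t) (g (Suc t))" by blast
  obtain \<beta> where \<beta>: "\<And>x y. y \<noteq> \<beta> \<Longrightarrow> R m x y" using singleE[OF Suc.prems(2)[OF lessI]] by metis
  obtain y where y: "y \<in> L (Suc m)" "y \<noteq> \<beta>" using pick2[OF Suc.prems(1)[of "Suc m"]] by blast
  show ?case
    by (rule exI[of _ "g(Suc m := y)"]) (use g y \<beta> in \<open>auto simp: le_Suc_eq less_Suc_eq\<close>)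
qed (auto intro: exI[of _ "\<lambda>_. x"])

lemma path_from_end:
  assumes "\<And>t. t \<le> m \<Longrightarrow> card (L t) = 2" "\<And>t. t < m \<Longrightarrow> single (R t)" "y \<in> L m"
  shows "\<exists>g. g m = y \<and> (\<forall>t\<le>m. g t \<in> L t) \<and> (\<forall>t<m. R t (g t) (g (Suc t)))"
proof -
  have "\<exists>g. g 0 = y \<and> (\<forall>t\<le>m. g t \<in> L (m - t)) \<and> (\<forall>t<m. R (m - Suc t) (g (Suc t)) (g t))"
    by (rule path_from_start[where R = "\<lambda>t x y. R (m - Suc t) y x"]) (use assms in \<open>auto intro: single_flip\<close>)
  then obtain g where g: "g 0 = y" "\<forall>t\<le>m. g t \<in> L (m - t)" "\<forall>t<m. R (m - Suc t) (g (Suc t)) (g t)" by blast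
  have "R t (g (m - t)) (g (m - Suc t))" if "t < m" for t
    using g(3)[rule_format, of "m - Suc t"] that by (simp add: Suc_diff_Suc)
  moreover have "g (m - t) \<in> L t" if "t \<le> m" for t
    using g(2)[rule_format, of "m - t"] that by simp
  ultimately show ?thesis
    using g(1) by (intro exI[of _ "\<lambda>t. g (m - t)"]) auto
qed

text \<open>Iterated composition as in \<open>single_comp\<close>, with the inner colours returned
  as a function.\<close>

lemma path_single:
  assumes "\<And>t. t \<le> Suc m \<Longrightarrow> card (L t) = 2" "\<And>t. t \<le> m \<Longrightarrow> single (R t)"
  shows "\<exists>\<alpha> \<beta>. \<forall>x y. x \<in> L 0 \<and> y \<in> L (Suc m) \<and> (x \<noteq> \<alpha> \<or> y \<noteq> \<beta>) \<longrightarrow>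
    (\<exists>g. g 0 = x \<and> g (Suc m) = y \<and> (\<forall>t\<le>Suc m. g t \<in> L t) \<and> (\<forall>t\<le>m. R t (g t) (g (Suc t))))"
  using assms
proof (induction m)
  case 0
  obtain \<alpha> \<beta> where "\<And>x y. x \<noteq> \<alpha> \<or> y \<noteq> \<beta> \<Longrightarrow> R 0 x y" using 0(2)[of 0] unfolding single_def by auto
  then have "x \<in> L 0 \<and> y \<in> L 1 \<and> (x \<noteq> \<alpha> \<or> y \<noteq> \<beta>) \<longrightarrow>
    (\<exists>g. g 0 = x \<and> g 1 = y \<and> (\<forall>t\<le>1. g t \<in> L t) \<and> (\<forall>t\<le>0. R t (g t) (g (Suc t))))" for x y
    by (intro impI exI[of _ "\<lambda>t. if t = 0 then x else y"]) (auto simp: le_Suc_eq)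
  then show ?case by auto
next
  case (Suc m)
  have "\<exists>\<alpha> \<beta>. \<forall>x y. x \<in> L 0 \<and> y \<in> L (Suc m) \<and> (x \<noteq> \<alpha> \<or> y \<noteq> \<beta>) \<longrightarrow>
    (\<exists>g. g 0 = x \<and> g (Suc m) = y \<and> (\<forall>t\<le>Suc m. g t \<in> L t) \<and> (\<forall>t\<le>m. R t (g t) (g (Suc t))))"
    by (rule Suc.IH) (simp_all add: Suc.prems)
  then obtain \<alpha> \<beta> where 1: "\<And>x y. x \<in> L 0 \<Longrightarrow> y \<in> L (Suc m) \<Longrightarrow> x \<noteq> \<alpha> \<or> y \<noteq> \<beta> \<Longrightarrow>
    \<exists>g. g 0 = x \<and> g (Suc m) = y \<and> (\<forall>t\<le>Suc m. g t \<in> L t) \<and> (\<forall>t\<le>m. R t (g t) (g (Suc t)))" by blast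
  obtain \<gamma> \<delta> where 2: "\<And>x y. x \<noteq> \<gamma> \<Longrightarrow> R (Suc m) x y" "\<And>x y. y \<noteq> \<delta> \<Longrightarrow> R (Suc m) x y"
    using singleE[OF Suc.prems(2)[OF order_refl]] by metis
  have c: "card (L (Suc m)) = 2" using Suc.prems(1) by simp
  have "\<exists>g. g 0 = x \<and> g (Suc (Suc m)) = y \<and> (\<forall>t\<le>Suc (Suc m). g t \<in> L t) \<and> (\<forall>t\<le>Suc m. R t (g t) (g (Suc t)))"
    if xy: "x \<in> L 0" "y \<in> L (Suc (Suc m))" "x \<noteq> \<alpha> \<or> y \<noteq> \<delta>" for x y
  proof -
    have "\<exists>w\<in>L (Suc m). (x \<noteq> \<alpha> \<or> w \<noteq> \<beta>) \<and> R (Suc m) w y"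
      using xy(3) pick2[OF c, of \<gamma>] pick2[OF c, of \<beta>] 2 by metis
    then obtain w where w: "w \<in> L (Suc m)" "x \<noteq> \<alpha> \<or> w \<noteq> \<beta>" "R (Suc m) w y" by blast
    then obtain g where g: "g 0 = x" "g (Suc m) = w" "\<forall>t\<le>Suc m. g t \<in> L t" "\<forall>t\<le>m. R t (g t) (g (Suc t))"
      using 1[OF xy(1) w(1,2)] by blast
    then show ?thesis
      using w xy by (intro exI[of _ "g(Suc (Suc m) := y)"]) (auto simp: le_Suc_eq)
  qed
  then show ?case by blast
qed

lemma path_singleE:
  assumes "\<And>t. t \<le> Suc m \<Longrightarrow> card (L t) = 2" "\<And>t. t \<le> m \<Longrightarrow> single (R t)"
  obtains \<alpha> \<beta> where "\<And>x y. x \<in> L 0 \<Longrightarrow> y \<in> L (Suc m) \<Longrightarrow> x \<noteq> \<alpha> \<or> y \<noteq> \<beta> \<Longrightarrow>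
    \<exists>g. g 0 = x \<and> g (Suc m) = y \<and> (\<forall>t\<le>Suc m. g t \<in> L t) \<and> (\<forall>t\<le>m. R t (g t) (g (Suc t)))"
proof -
  have "\<exists>\<alpha> \<beta>. \<forall>x y. x \<in> L 0 \<and> y \<in> L (Suc m) \<and> (x \<noteq> \<alpha> \<or> y \<noteq> \<beta>) \<longrightarrow>
    (\<exists>g. g 0 = x \<and> g (Suc m) = y \<and> (\<forall>t\<le>Suc m. g t \<in> L t) \<and> (\<forall>t\<le>m. R t (g t) (g (Suc t))))"
    by (rule path_single[OF assms])
  then show thesis
  proof (elim exE)
    fix \<alpha> \<beta>
    assume *: "\<forall>x y. x \<in> L 0 \<and> y \<in> L (Suc m) \<and> (x \<noteq> \<alpha> \<or> y \<noteq> \<beta>) \<longrightarrow>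
      (\<exists>g. g 0 = x \<and> g (Suc m) = y \<and> (\<forall>t\<le>Suc m. g t \<in> L t) \<and> (\<forall>t\<le>m. R t (g t) (g (Suc t))))"
    show thesis by (rule that[of \<alpha> \<beta>]) (rule *[rule_format], blast)
  qed
qed

text \<open>Going around the cycle, each vertex takes care of one edge: \<open>R01\<close> is
  settled at \<open>x1\<close>, \<open>R13\<close> at \<open>x3\<close>, \<open>R23\<close> at
  \<open>x2\<close> and \<open>R02\<close> at \<open>x0\<close>.\<close>

lemma cycle4:
  assumes "card L0 = 2" "card L1 = 2" "card L2 = 2" "card L3 = 2" "single R01" "single R02" "single R13" "single R23"
  shows "\<exists>x0\<in>L0. \<exists>x1\<in>L1. \<exists>x2\<in>L2. \<exists>x3\<in>L3. R01 x0 x1 \<and> R02 x0 x2 \<and> R13 x1 x3 \<and> R23 x2 x3"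
proof -
  obtain a where a: "\<And>x y. y \<noteq> a \<Longrightarrow> R01 x y" using singleE[OF assms(5)] by metis
  obtain b where b: "\<And>x y. x \<noteq> b \<Longrightarrow> R02 x y" using singleE[OF assms(6)] by metis
  obtain c where c: "\<And>x y. y \<noteq> c \<Longrightarrow> R13 x y" using singleE[OF assms(7)] by metis
  obtain d where d: "\<And>x y. x \<noteq> d \<Longrightarrow> R23 x y" using singleE[OF assms(8)] by metis
  show ?thesis
  proof -
    obtain x0 where "x0 \<in> L0" "x0 \<noteq> b" using pick2[OF assms(1)] by blast
    moreover obtain x1 where "x1 \<in> L1" "x1 \<noteq> a" using pick2[OF assms(2)] by blast
    moreover obtain x2 where "x2 \<in> L2" "x2 \<noteq> d" using pick2[OF assms(3)] by blast
    moreover obtain x3 where "x3 \<in> L3" "x3 \<noteq> c" using pick2[OF assms(4)] by blast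
    ultimately show ?thesis using a b c d by metis
  qed
qed

text \<open>The two rows of vertices that join the sources of a variable and of its negation.\<close>

definition source_ok ::
  "bool \<Rightarrow> (nat \<Rightarrow> nat set) \<Rightarrow> (nat \<Rightarrow> nat set) \<Rightarrow> (nat \<Rightarrow> nat \<Rightarrow> nat \<Rightarrow> bool) \<Rightarrow> (nat \<Rightarrow> nat \<Rightarrow> nat \<Rightarrow> bool) \<Rightarrow>
    (nat \<Rightarrow> nat \<Rightarrow> bool) \<Rightarrow> (nat \<Rightarrow> nat \<Rightarrow> bool) \<Rightarrow> nat \<Rightarrow> nat \<Rightarrow> bool \<Rightarrow> (nat \<Rightarrow> nat) \<Rightarrow> (nat \<Rightarrow> nat) \<Rightarrow> bool" where
  "source_ok u L5 L6 R5 R6 V0 V7 \<sigma> \<tau> s g5 g6 \<longleftrightarrow> (\<forall>t\<le>7. g5 t \<in> L5 t \<and> g6 t \<in> L6 t) \<and>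
     (\<forall>t<7. R5 t (g5 t) (g5 (Suc t)) \<and> R6 t (g6 t) (g6 (Suc t))) \<and>
     (u \<longrightarrow> V0 (g5 0) (g6 0)) \<and> V7 (g5 7) (g6 7) \<and> (s \<longrightarrow> g6 0 \<noteq> \<sigma>) \<and> (\<not> s \<longrightarrow> g6 7 \<noteq> \<tau>)"

text \<open>Row \<open>6\<close> is coloured starting from the end that has a colour to avoid, so
  either end can be preferred. Row \<open>5\<close> hangs on it by one rung and is coloured starting
  from there.\<close>

lemma source_exists:
  assumes L: "\<And>t. t \<le> 7 \<Longrightarrow> card (L5 t) = 2 \<and> card (L6 t) = 2"
    and R: "\<And>t. t < 7 \<Longrightarrow> single (R5 t) \<and> single (R6 t)" "single V7"
  shows "\<exists>g5 g6. source_ok False L5 L6 R5 R6 V0 V7 \<sigma> \<tau> s g5 g6"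
proof -
  obtain x where x: "x \<in> L6 0" "x \<noteq> \<sigma>" using pick2[of "L6 0" \<sigma>] L[of 0] by auto
  obtain y where y: "y \<in> L6 7" "y \<noteq> \<tau>" using pick2[of "L6 7" \<tau>] L[of 7] by auto
  have "\<exists>g6. (s \<longrightarrow> g6 0 \<noteq> \<sigma>) \<and> (\<not> s \<longrightarrow> g6 7 \<noteq> \<tau>) \<and> (\<forall>t\<le>7. g6 t \<in> L6 t) \<and> (\<forall>t<7. R6 t (g6 t) (g6 (Suc t)))"
    using path_from_start[of 7 L6 R6 x] path_from_end[of 7 L6 R6 y] x y L R(1) by (cases s) metis+
  then obtain g6 where g6: "s \<longrightarrow> g6 0 \<noteq> \<sigma>" "\<not> s \<longrightarrow> g6 7 \<noteq> \<tau>" "\<forall>t\<le>7. g6 t \<in> L6 t" "\<forall>t<7. R6 t (g6 t) (g6 (Suc t))" by blast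
  obtain k where k: "\<And>x y. x \<noteq> k \<Longrightarrow> V7 x y" using singleE[OF R(2)] by metis
  obtain z where z: "z \<in> L5 7" "z \<noteq> k" using pick2[of "L5 7" k] L[of 7] by auto
  obtain g5 where "g5 7 = z" "\<forall>t\<le>7. g5 t \<in> L5 t" "\<forall>t<7. R5 t (g5 t) (g5 (Suc t))"
    using path_from_end[of 7 L5 R5 z] z L R(1) by metis
  then have "source_ok False L5 L6 R5 R6 V0 V7 \<sigma> \<tau> s g5 g6"
    using g6 k z unfolding source_ok_def by auto
  then show ?thesis by blast
qed

text \<open>The ends of row \<open>6\<close> are joined by two routes, row \<open>6\<close> itself
  and the way around over row \<open>5\<close>, and each excludes at most one pair of end colours. A
  third pair to avoid is \<open>(\<sigma>, \<tau>)\<close>. Of the four pairs one remains and leaves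
  at least one end clear; which one depends on the conflicts.\<close>

lemma source_forall:
  assumes cards: "\<And>t. t \<le> 7 \<Longrightarrow> card (L5 t) = 2 \<and> card (L6 t) = 2"
    and singles: "\<And>t. t < 7 \<Longrightarrow> single (R5 t) \<and> single (R6 t)" "single V0" "single V7"
  shows "\<exists>s g5 g6. source_ok True L5 L6 R5 R6 V0 V7 \<sigma> \<tau> s g5 g6"
proof -
  \<comment> \<open>The way around as one path: the left end of row \<open>6\<close>, the eight
    vertices of row \<open>5\<close>, the right end of row \<open>6\<close>.\<close>
  define L where "L k = (if k = 0 then L6 0 else if k \<le> 8 then L5 (k - 1) else L6 7)" for k :: nat
  define R where "R k x y = (if k = 0 then V0 y x else if k \<le> 7 then R5 (k - 1) x y else V7 x y)" for k :: nat and x y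
  have cL: "card (L t) = 2" if "t \<le> Suc 8" for t
    using that cards[of 0] cards[of 7] cards[of "t - 1"] by (auto simp: L_def)
  have sR: "single (R t)" if "t \<le> 8" for t
  proof -
    have "R t = (if t = 0 then (\<lambda>x y. V0 y x) else if t \<le> 7 then R5 (t - 1) else V7)"
      by (auto simp: R_def fun_eq_iff)
    then show ?thesis using that singles(1)[of "t - 1"] singles(3) single_flip[OF singles(2)] by auto
  qed
  obtain \<alpha> \<beta> where 5: "\<And>x y. x \<in> L 0 \<Longrightarrow> y \<in> L (Suc 8) \<Longrightarrow> x \<noteq> \<alpha> \<or> y \<noteq> \<beta> \<Longrightarrow>
    \<exists>g. g 0 = x \<and> g (Suc 8) = y \<and> (\<forall>t\<le>Suc 8. g t \<in> L t) \<and> (\<forall>t\<le>8. R t (g t) (g (Suc t)))"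
    by (rule path_singleE[of 8 L R, OF cL sR]) (assumption | rule that)+
  have L09: "L 0 = L6 0" "L (Suc 8) = L6 7" by (simp_all add: L_def)
  have c6: "card (L6 t) = 2" if "t \<le> Suc 6" for t using cards[of t] that by simp
  have s6: "single (R6 t)" if "t \<le> 6" for t using singles(1)[of t] that by simp
  obtain \<gamma> \<delta> where 6: "\<And>x y. x \<in> L6 0 \<Longrightarrow> y \<in> L6 (Suc 6) \<Longrightarrow> x \<noteq> \<gamma> \<or> y \<noteq> \<delta> \<Longrightarrow>
    \<exists>g. g 0 = x \<and> g (Suc 6) = y \<and> (\<forall>t\<le>Suc 6. g t \<in> L6 t) \<and> (\<forall>t\<le>6. R6 t (g t) (g (Suc t)))"
    by (rule path_singleE[of 6 L6 R6, OF c6 s6]) (assumption | rule that)+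
  have S6: "Suc 6 = 7" by simp
  obtain x1 x2 where x: "L6 0 = {x1, x2}" "x1 \<noteq> x2" using cards[of 0] by (auto simp: card_2_iff)
  obtain y1 y2 where y: "L6 7 = {y1, y2}" "y1 \<noteq> y2" using cards[of 7] by (auto simp: card_2_iff)
  define S where "S = {(x1, y1), (x1, y2), (x2, y1), (x2, y2)}"
  define T where "T = {(\<alpha>, \<beta>), (\<gamma>, \<delta>), (\<sigma>, \<tau>)}"
  have "card T \<le> 3" by (auto simp: T_def card_insert_if)
  moreover have "card S = 4" using x y by (simp add: S_def)
  ultimately have "\<not> S \<subseteq> T" using card_mono[of T S] by (auto simp: T_def)
  then obtain a b where "(a, b) \<in> S" "(a, b) \<notin> T" by auto
  then have ab: "a \<in> L6 0" "b \<in> L6 7" "a \<noteq> \<alpha> \<or> b \<noteq> \<beta>" "a \<noteq> \<gamma> \<or> b \<noteq> \<delta>" "a \<noteq> \<sigma> \<or> b \<noteq> \<tau>"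
    unfolding x y by (auto simp: S_def T_def)
  obtain g where g: "g 0 = a" "g (Suc 8) = b" "\<forall>t\<le>Suc 8. g t \<in> L t" "\<forall>t\<le>8. R t (g t) (g (Suc t))"
    using 5[of a b] ab(1-3) unfolding L09 by blast
  obtain g6 where g6: "g6 0 = a" "g6 7 = b" "\<forall>t\<le>7. g6 t \<in> L6 t" "\<forall>t\<le>6. R6 t (g6 t) (g6 (Suc t))"
    using 6[of a b] ab(1,2,4) unfolding S6 by blast
  have "g (Suc t) \<in> L5 t" if "t \<le> 7" for t using g(3)[rule_format, of "Suc t"] that by (simp add: L_def)
  moreover have "R5 t (g (Suc t)) (g (Suc (Suc t)))" if "t < 7" for t using g(4)[rule_format, of "Suc t"] that by (simp add: R_def)
  moreover have "V0 (g (Suc 0)) (g6 0)" using g(4)[rule_format, of 0] g(1) g6(1) by (simp add: R_def)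
  moreover have "V7 (g (Suc 7)) (g6 7)" using g(4)[rule_format, of 8] g(2) g6(2) by (simp add: R_def)
  ultimately have "source_ok True L5 L6 R5 R6 V0 V7 \<sigma> \<tau> (a \<noteq> \<sigma>) (\<lambda>t. g (Suc t)) g6"
    using g6 ab(5) unfolding source_ok_def by (auto simp: less_Suc_eq_le[symmetric])
  then show ?thesis by blast
qed

section \<open>Colouring the layout of a true formula\<close>

lemma seven_Suc [simp]:
  "x < 6 \<Longrightarrow> Suc (7 * J + x) div 7 = J" "x < 6 \<Longrightarrow> Suc (7 * J + x) mod 7 = Suc x"
  "(7 * J + 6) div 7 = J" "(7 * J + 6) mod 7 = 6" "Suc (7 * J + 6) = 7 * Suc J" for J x :: nat
  by presburger+

lemma lay_h_block:
  assumes "x < 7" "y < 7"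
  shows "lay_h nv mc (7 * J + x) (7 * I + y) \<longleftrightarrow> I \<le> mc \<and>
     (if I = 0 then 0 < J \<and> J \<le> 2 * nv \<and> (if odd J then 3 \<le> x else x < 3) \<and> (y = 5 \<or> y = 6)
      else if J = 0 then (x, y) = (5, 3) \<or> (x, y) = (5, 4) \<or> (x, y) = (6, 3)
      else if J = 2 * nv + 1 then (x, y) = (0, 3) \<or> (x, y) = (0, 4)
      else J \<le> 2 * nv \<and> ((x, y) \<in> set block_h \<or> (x, y) = (6, 3)))"
  by (simp only: lay_h_def Let_def seven_div_mod[OF assms(1)] seven_div_mod[OF assms(2)])

lemma lay_v_block:
  assumes "x < 7" "y < 7"
  shows "lay_v nv mc isU lit (7 * J + x) (7 * I + y) \<longleftrightarrow> I \<le> mc \<and>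
     (if I = 0 then 0 < J \<and> J \<le> 2 * nv \<and> x = 3 \<and> (y = 5 \<and> (odd J \<longrightarrow> isU (J div 2)) \<or> y = 6 \<and> 0 < mc)
      else if J = 0 then (x, y) = (5, 3) \<or> (x, y) = (6, 3)
      else if J = 2 * nv + 1 then (x, y) = (0, 3) \<or> (x, y) = (1, 3)
      else J \<le> 2 * nv \<and> ((x, y) \<in> set block_v \<or> (x, y) = (6, 2) \<and> \<not> lit (I - 1) (J - 1) \<or>
        (x, y) = (3, 6) \<and> I < mc))"
  by (simp only: lay_v_def Let_def seven_div_mod[OF assms(1)] seven_div_mod[OF assms(2)])

lemma lay_3_block:
  assumes "x < 7" "y < 7"
  shows "lay_3 nv mc (7 * J + x) (7 * I + y) \<longleftrightarrow> 0 < I \<and> I \<le> mc \<and> 0 < J \<and> J \<le> 2 * nv \<and> (x, y) \<in> set block_3"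
  by (simp only: lay_3_def Let_def seven_div_mod[OF assms(1)] seven_div_mod[OF assms(2)])

lemma less_num7: "(0::nat) < 7" "(1::nat) < 7" "(3::nat) < 7" "(4::nat) < 7" "(5::nat) < 7" "(6::nat) < 7"
  by simp_all

lemma odd_block: "odd J \<Longrightarrow> 0 < J \<Longrightarrow> J \<le> 2 * nv \<Longrightarrow> \<exists>v<nv. J = 2 * v + 1" for J nv :: nat
  by presburger

lemma even_block: "even J \<Longrightarrow> 0 < J \<Longrightarrow> J \<le> 2 * nv \<Longrightarrow> \<exists>v<nv. J = 2 * v + 2" for J nv :: nat
  by presburger

text \<open>The sources of variable \<open>v\<close> are the cells \<open>14 * v + 10 + t\<close> with \<open>t \<le> 7\<close> of two rows.\<close>

lemma source_h:
  assumes "lay_h nv mc X Y" "Y < 7"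
  shows "\<exists>v t. v < nv \<and> t < 7 \<and> X = 14 * v + 10 + t \<and> (Y = 5 \<or> Y = 6)"
proof -
  obtain J x where X: "X = 7 * J + x" "x < 7" using seven_split[of X] by blast
  have l: "0 < J" "J \<le> 2 * nv" "if odd J then 3 \<le> x else x < 3" "Y = 5 \<or> Y = 6"
    using assms lay_h_block[OF X(2) assms(2), of nv mc J 0] X(1) by auto
  show ?thesis
  proof (cases "odd J")
    case True
    then obtain v where "v < nv" "J = 2 * v + 1" using odd_block l by blast
    then show ?thesis using l X True by (intro exI[of _ v] exI[of _ "x - 3"]) auto
  next
    case False
    then obtain v where "v < nv" "J = 2 * v + 2" using even_block l by blast
    then show ?thesis using l X False by (intro exI[of _ v] exI[of _ "x + 4"]) auto
  qed
qed

lemma source_v: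
  assumes "lay_v nv mc isU lit X Y" "Y < 7"
  shows "\<exists>v t. v < nv \<and> X = 14 * v + 10 + t \<and> (Y = 5 \<and> (t = 0 \<and> isU v \<or> t = 7) \<or> Y = 6 \<and> 0 < mc \<and> (t = 0 \<or> t = 7))"
proof -
  obtain J x where X: "X = 7 * J + x" "x < 7" using seven_split[of X] by blast
  have l: "0 < J" "J \<le> 2 * nv" "x = 3" "Y = 5 \<and> (odd J \<longrightarrow> isU (J div 2)) \<or> Y = 6 \<and> 0 < mc"
    using assms lay_v_block[OF X(2) assms(2), of nv mc isU lit J 0] X(1) by auto
  show ?thesis
  proof (cases "odd J")
    case True
    then obtain v where "v < nv" "J = 2 * v + 1" using odd_block l by blast
    then show ?thesis using l X True by (intro exI[of _ v] exI[of _ 0]) auto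
  next
    case False
    then obtain v where "v < nv" "J = 2 * v + 2" using even_block l by blast
    then show ?thesis using l X False by (intro exI[of _ v] exI[of _ 7]) auto
  qed
qed

text \<open>A link between blocks excludes one pair, and one of its ends is obliged to avoid its
  component of that pair: the entrance behind the link if the row or column is active, the exit
  before it otherwise. So \<open>rin\<close> and \<open>cin\<close> stand for active entrances,
  \<open>rout\<close> and \<open>cout\<close> for inactive exits.\<close>

definition block_good where
  "block_good L Rh Rv hE vE h1 h2 v1 v2 rin rout cin cout J I g \<longleftrightarrow>
    (\<forall>x<7. \<forall>y<7. g x y \<in> L (7 * J + x) (7 * I + y)) \<and>
    (\<forall>x<6. \<forall>y<7. hE (7 * J + x) (7 * I + y) \<longrightarrow> Rh (7 * J + x) (7 * I + y) (g x y) (g (Suc x) y)) \<and>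
    (\<forall>x<7. \<forall>y<6. vE (7 * J + x) (7 * I + y) \<longrightarrow> Rv (7 * J + x) (7 * I + y) (g x y) (g x (Suc y))) \<and>
    (rin \<longrightarrow> g 0 3 \<noteq> h2 (7 * J - 1) (7 * I + 3)) \<and> (rout \<longrightarrow> g 6 3 \<noteq> h1 (7 * J + 6) (7 * I + 3)) \<and>
    (cin \<longrightarrow> g 3 0 \<noteq> v2 (7 * J + 3) (7 * I - 1)) \<and> (cout \<longrightarrow> g 3 6 \<noteq> (v1 (7 * J + 3) (7 * I + 6) :: nat))"

theorem qbf_conflict_colorable:
  assumes q: "qbf nv mc isU lit"
  shows "conflict_colorable (7 * (2 * nv + 2)) (7 * (mc + 1)) (lay_h nv mc) (lay_v nv mc isU lit) (lay_3 nv mc)"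
  unfolding conflict_colorable_def
proof (intro allI impI)
  fix L :: "nat \<Rightarrow> nat \<Rightarrow> nat set" and Rh Rv :: "nat \<Rightarrow> nat \<Rightarrow> nat \<Rightarrow> nat \<Rightarrow> bool"
  let ?W = "7 * (2 * nv + 2)" and ?H = "7 * (mc + 1)" and ?h = "lay_h nv mc" and ?v = "lay_v nv mc isU lit"
  assume "\<forall>X<?W. \<forall>Y<?H. card (L X Y) = (if lay_3 nv mc X Y then 3 else 2)"
  then have L: "card (L X Y) = (if lay_3 nv mc X Y then 3 else 2)" if "X < ?W" "Y < ?H" for X Y
    using that by blast
  assume "\<forall>X Y. single (Rh X Y) \<and> single (Rv X Y)"
  then have Rh: "single (Rh X Y)" and Rv: "single (Rv X Y)" for X Y by blast+
  have "\<forall>X Y. \<exists>\<alpha> \<beta>. \<forall>x y. x \<noteq> \<alpha> \<or> y \<noteq> \<beta> \<longrightarrow> Rh X Y x y" using Rh unfolding single_def by blast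
  then obtain h1 h2 where h: "\<And>X Y x y. x \<noteq> h1 X Y \<or> y \<noteq> h2 X Y \<Longrightarrow> Rh X Y x y" by metis
  have "\<forall>X Y. \<exists>\<alpha> \<beta>. \<forall>x y. x \<noteq> \<alpha> \<or> y \<noteq> \<beta> \<longrightarrow> Rv X Y x y" using Rv unfolding single_def by blast
  then obtain v1 v2 where v: "\<And>X Y x y. x \<noteq> v1 X Y \<or> y \<noteq> v2 X Y \<Longrightarrow> Rv X Y x y" by metis
  define f where "f X Y = (SOME c. c \<in> L X Y)" for X Y
  have f: "f X Y \<in> L X Y" if "X < ?W" "Y < ?H" for X Y
  proof -
    have "card (L X Y) \<noteq> 0" using L[OF that] by simp
    then have "L X Y \<noteq> {}" by auto
    then show ?thesis unfolding f_def by (rule some_in_eq[THEN iffD2])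
  qed
  have in_range: "7 * J + x < ?W" "7 * I + y < ?H" if "J \<le> 2 * nv + 1" "I \<le> mc" "x < 7" "y < 7" for J I x y
    using that by auto
  have Lb: "card (L (7 * J + x) (7 * I + y)) = (if 0 < I \<and> 0 < J \<and> J \<le> 2 * nv \<and> (x, y) \<in> set block_3 then 3 else 2)"
    if "J \<le> 2 * nv + 1" "I \<le> mc" "x < 7" "y < 7" for J I x y
    using L[OF in_range[OF that]] that lay_3_block[OF that(3,4), of nv mc J I] by simp
  define src where "src b v = source_ok b (\<lambda>t. L (14 * v + 10 + t) 5) (\<lambda>t. L (14 * v + 10 + t) 6)
    (\<lambda>t. Rh (14 * v + 10 + t) 5) (\<lambda>t. Rh (14 * v + 10 + t) 6) (Rv (14 * v + 10) 5) (Rv (14 * v + 17) 5)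
    (v1 (14 * v + 10) 6) (v1 (14 * v + 17) 6)" for b v
  have top: "card (L (14 * v + 10 + t) 5) = 2 \<and> card (L (14 * v + 10 + t) 6) = 2" if "v < nv" "t \<le> 7" for v t
  proof -
    have "14 * v + 10 + t < ?W" using that by presburger
    then show ?thesis using L[of "14 * v + 10 + t" 5] L[of "14 * v + 10 + t" 6] by (simp add: lay_3_def)
  qed
  have src_all: "\<exists>s g5 g6. src True v s g5 g6" if "v < nv" for v
    unfolding src_def by (rule source_forall) (use top[OF that] Rh Rv in auto)
  have src_ex: "\<exists>g5 g6. src False v s g5 g6" if "v < nv" for v s
    unfolding src_def by (rule source_exists) (use top[OF that] Rh Rv in auto)
  \<comment> \<open>The conflicts at a universal variable determine a source that can be kept clear;
    this is the value that the adversary has chosen.\<close>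
  define U where "U v = (SOME s. \<exists>g5 g6. src True v s g5 g6)" for v
  have U: "\<exists>g5 g6. src True v (U v) g5 g6" if "v < nv" for v
    unfolding U_def using someI_ex[OF src_all[OF that]] .
  have "\<exists>\<alpha>. (\<forall>v<nv. isU v \<longrightarrow> \<alpha> v = U v) \<and> (\<forall>i<mc. \<exists>j<2 * nv. lit i j \<and> lit_true \<alpha> j)"
    using q unfolding qbf_def by (rule spec)
  then obtain \<alpha> where "\<forall>v<nv. isU v \<longrightarrow> \<alpha> v = U v" "\<forall>i<mc. \<exists>j<2 * nv. lit i j \<and> lit_true \<alpha> j"
    by (elim exE conjE) (rule that)
  note \<alpha> = this[rule_format]
  have "\<exists>g5 g6. src (isU v) v (\<alpha> v) g5 g6" if "v < nv" for v
    using U[OF that] src_ex[OF that] \<alpha>(1)[OF that] by (cases "isU v") simp_all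
  then obtain g5 g6 where g56: "\<And>v. v < nv \<Longrightarrow> src (isU v) v (\<alpha> v) (g5 v) (g6 v)" by metis
  \<comment> \<open>Columns are active iff their literal is false; row \<open>i\<close> is active
    before column \<open>j\<close> iff none of the first \<open>j\<close> literals is a true literal
    of the clause.\<close>
  define c where "c j \<longleftrightarrow> \<not> lit_true \<alpha> j" for j
  define r where "r i j \<longleftrightarrow> (\<forall>j'<j. lit i j' \<longrightarrow> c j')" for i j
  have r_Suc: "r i (Suc j) \<longleftrightarrow> r i j \<and> (c j \<or> \<not> lit i j)" for i j
    by (auto simp: r_def less_Suc_eq)
  have r_end: "\<not> r i (2 * nv)" if "i < mc" for i
    using \<alpha>(2)[OF that] by (auto simp: r_def c_def)
  have cyc: "\<exists>p0 p1 p2 p3. p0 \<in> L X Y \<and> p1 \<in> L X' Y \<and> p2 \<in> L X Y' \<and> p3 \<in> L X' Y' \<and>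
      Rh X Y p0 p1 \<and> Rv X Y p0 p2 \<and> Rv X' Y p1 p3 \<and> Rh X Y' p2 p3"
    if "card (L X Y) = 2" "card (L X' Y) = 2" "card (L X Y') = 2" "card (L X' Y') = 2" for X X' Y Y'
    using cycle4[OF that Rh[of X Y] Rv[of X Y] Rv[of X' Y] Rh[of X Y']] by blast
  let ?good = "\<lambda>J I. block_good L Rh Rv ?h ?v h1 h2 v1 v2 (0 < J \<and> r (I - 1) (J - 1)) (J \<le> 2 * nv \<and> \<not> r (I - 1) J)
    (0 < J \<and> J \<le> 2 * nv \<and> c (J - 1)) (0 < J \<and> J \<le> 2 * nv \<and> \<not> c (J - 1)) J I"
  have good: "\<exists>g. ?good J I g" if J: "J \<le> 2 * nv + 1" and I: "0 < I" "I \<le> mc" for J I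
  proof -
    consider "J = 0" | "J = 2 * nv + 1" | "0 < J" "J \<le> 2 * nv" using J by linarith
    then show ?thesis
    proof cases
      case 1
      have two: "card (L (7 * J + x) (7 * I + y)) = 2" if "x < 7" "y < 7" for x y
        using Lb[OF J I(2) that] 1 by simp
      obtain p0 p1 p2 p3 where p: "p0 \<in> L (7 * J + 5) (7 * I + 3)" "p1 \<in> L (7 * J + 6) (7 * I + 3)"
        "p2 \<in> L (7 * J + 5) (7 * I + 4)" "p3 \<in> L (7 * J + 6) (7 * I + 4)"
        "Rh (7 * J + 5) (7 * I + 3) p0 p1" "Rv (7 * J + 5) (7 * I + 3) p0 p2" "Rv (7 * J + 6) (7 * I + 3) p1 p3"
        "Rh (7 * J + 5) (7 * I + 4) p2 p3"
        using cyc[OF two[OF less_num7(5) less_num7(3)] two[OF less_num7(6) less_num7(3)] two[OF less_num7(5) less_num7(4)] two[OF less_num7(6) less_num7(4)]] by (elim exE conjE) (rule that)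
      define g where "g x y = (if y = 3 \<and> x = 5 then p0 else if y = 3 \<and> x = 6 then p1 else if y = 4 \<and> x = 5 then p2
        else if y = 4 \<and> x = 6 then p3 else f (7 * J + x) (7 * I + y))" for x y
      have gv: "g 5 3 = p0" "g 6 3 = p1" "g 5 4 = p2" "g 6 4 = p3" by (simp_all add: g_def)
      have s5: "Suc 5 = 6" by simp
      have hh: "Rh (7 * J + x) (7 * I + y) (g x y) (g (Suc x) y)" if e: "x < 6" "y < 7" "?h (7 * J + x) (7 * I + y)" for x y
      proof -
        have "x < 7" using e(1) by simp
        then have "x = 5 \<and> (y = 3 \<or> y = 4)"
          using e lay_h_block[of x y nv mc J I] 1 I by (simp, auto)
        then show ?thesis using p(5,8) gv s5 by (elim conjE disjE) (simp_all only:)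
      qed
      have vv: "Rv (7 * J + x) (7 * I + y) (g x y) (g x (Suc y))" if e: "x < 7" "y < 6" "?v (7 * J + x) (7 * I + y)" for x y
      proof -
        have "y < 7" using e(2) by simp
        then have "y = 3 \<and> (x = 5 \<or> x = 6)"
          using e lay_v_block[of x y nv mc isU lit J I] 1 I by (simp, auto)
        moreover have "Suc 3 = (4::nat)" by simp
        ultimately show ?thesis using p(6,7) gv by (elim conjE disjE) (simp_all only:)
      qed
      \<comment> \<open>Rows start active, so the exit of a start block has no obligation.\<close>
      have "r (I - 1) J" using 1 by (simp add: r_def)
      moreover have "g x y \<in> L (7 * J + x) (7 * I + y)" if "x < 7" "y < 7" for x y
        using p(1-4) f[OF in_range[OF J I(2) that]] unfolding g_def by (simp split: if_split)
      ultimately have "?good J I g"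
        unfolding block_good_def using 1 hh vv by simp
      then show ?thesis by blast
    next
      case 2
      have two: "card (L (7 * J + x) (7 * I + y)) = 2" if "x < 7" "y < 7" for x y
        using Lb[OF J I(2) that] 2 by simp
      obtain p0 p1 p2 p3 where p: "p0 \<in> L (7 * J + 0) (7 * I + 3)" "p1 \<in> L (7 * J + 1) (7 * I + 3)"
        "p2 \<in> L (7 * J + 0) (7 * I + 4)" "p3 \<in> L (7 * J + 1) (7 * I + 4)"
        "Rh (7 * J + 0) (7 * I + 3) p0 p1" "Rv (7 * J + 0) (7 * I + 3) p0 p2" "Rv (7 * J + 1) (7 * I + 3) p1 p3"
        "Rh (7 * J + 0) (7 * I + 4) p2 p3"
        using cyc[OF two[OF less_num7(1) less_num7(3)] two[OF less_num7(2) less_num7(3)] two[OF less_num7(1) less_num7(4)] two[OF less_num7(2) less_num7(4)]] by (elim exE conjE) (rule that)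
      define g where "g x y = (if y = 3 \<and> x = 0 then p0 else if y = 3 \<and> x = 1 then p1 else if y = 4 \<and> x = 0 then p2
        else if y = 4 \<and> x = 1 then p3 else f (7 * J + x) (7 * I + y))" for x y
      have gv: "g 0 3 = p0" "g 1 3 = p1" "g 0 4 = p2" "g 1 4 = p3" by (simp_all add: g_def)
      have s0: "Suc 0 = 1" by simp
      have hh: "Rh (7 * J + x) (7 * I + y) (g x y) (g (Suc x) y)" if e: "x < 6" "y < 7" "?h (7 * J + x) (7 * I + y)" for x y
      proof -
        have "x < 7" using e(1) by simp
        then have "x = 0 \<and> (y = 3 \<or> y = 4)"
          using e lay_h_block[of x y nv mc J I] 2 I by (simp, auto)
        then show ?thesis using p(5,8) gv s0 by (elim conjE disjE) (simp_all only:)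
      qed
      have vv: "Rv (7 * J + x) (7 * I + y) (g x y) (g x (Suc y))" if e: "x < 7" "y < 6" "?v (7 * J + x) (7 * I + y)" for x y
      proof -
        have "y < 7" using e(2) by simp
        then have "y = 3 \<and> (x = 0 \<or> x = 1)"
          using e lay_v_block[of x y nv mc isU lit J I] 2 I by (simp, auto)
        moreover have "Suc 3 = (4::nat)" by simp
        ultimately show ?thesis using p(6,7) gv by (elim conjE disjE) (simp_all only:)
      qed
      \<comment> \<open>Every clause is satisfied, so its row arrives inactive, and the end cycle
        only has to be coloured by itself.\<close>
      have "\<not> r (I - 1) (J - 1)" using 2 I r_end by simp
      moreover have "g x y \<in> L (7 * J + x) (7 * I + y)" if "x < 7" "y < 7" for x y
        using p(1-4) f[OF in_range[OF J I(2) that]] unfolding g_def by (simp split: if_split)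
      ultimately have "?good J I g"
        unfolding block_good_def using 2 hh vv by simp
      then show ?thesis by blast
    next
      case 3
      have "\<exists>col. (\<forall>x<7. \<forall>y<7. col x y \<in> L (7 * J + x) (7 * I + y)) \<and>
        (\<forall>(x, y) \<in> set block_h. Rh (7 * J + x) (7 * I + y) (col x y) (col (Suc x) y)) \<and>
        (\<forall>(x, y) \<in> set block_v. Rv (7 * J + x) (7 * I + y) (col x y) (col x (Suc y))) \<and>
        (\<not> lit (I - 1) (J - 1) \<longrightarrow> Rv (7 * J + 6) (7 * I + 2) (col 6 2) (col 6 3)) \<and>
        (r (I - 1) (J - 1) \<longrightarrow> col 0 3 \<noteq> h2 (7 * J - 1) (7 * I + 3)) \<and>
        (c (J - 1) \<longrightarrow> col 3 0 \<noteq> v2 (7 * J + 3) (7 * I - 1)) \<and>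
        (\<not> (r (I - 1) (J - 1) \<and> (c (J - 1) \<or> \<not> lit (I - 1) (J - 1))) \<longrightarrow> col 6 3 \<noteq> h1 (7 * J + 6) (7 * I + 3)) \<and>
        (\<not> c (J - 1) \<longrightarrow> col 3 6 \<noteq> v1 (7 * J + 3) (7 * I + 6))"
        by (rule block_colorable) (use Lb[OF J I(2)] 3 I Rh Rv in auto)
      then obtain col where col: "\<forall>x<7. \<forall>y<7. col x y \<in> L (7 * J + x) (7 * I + y)"
        "\<forall>(x, y) \<in> set block_h. Rh (7 * J + x) (7 * I + y) (col x y) (col (Suc x) y)"
        "\<forall>(x, y) \<in> set block_v. Rv (7 * J + x) (7 * I + y) (col x y) (col x (Suc y))"
        "\<not> lit (I - 1) (J - 1) \<longrightarrow> Rv (7 * J + 6) (7 * I + 2) (col 6 2) (col 6 3)"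
        "r (I - 1) (J - 1) \<longrightarrow> col 0 3 \<noteq> h2 (7 * J - 1) (7 * I + 3)"
        "c (J - 1) \<longrightarrow> col 3 0 \<noteq> v2 (7 * J + 3) (7 * I - 1)"
        "\<not> (r (I - 1) (J - 1) \<and> (c (J - 1) \<or> \<not> lit (I - 1) (J - 1))) \<longrightarrow> col 6 3 \<noteq> h1 (7 * J + 6) (7 * I + 3)"
        "\<not> c (J - 1) \<longrightarrow> col 3 6 \<noteq> v1 (7 * J + 3) (7 * I + 6)"
        by (elim exE conjE) (rule that)
      have "r (I - 1) J \<longleftrightarrow> r (I - 1) (J - 1) \<and> (c (J - 1) \<or> \<not> lit (I - 1) (J - 1))"
        using r_Suc[of "I - 1" "J - 1"] 3 by simp
      moreover have "Rh (7 * J + x) (7 * I + y) (col x y) (col (Suc x) y)"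
        if "x < 6" "y < 7" "?h (7 * J + x) (7 * I + y)" for x y
        using that col(2) 3 I by (auto simp: lay_h_block)
      moreover have "Rv (7 * J + x) (7 * I + y) (col x y) (col x (Suc y))"
        if "x < 7" "y < 6" "?v (7 * J + x) (7 * I + y)" for x y
        using that col(3,4) 3 I by (auto simp: lay_v_block numeral_3_eq_3 numeral_2_eq_2)
      ultimately have "?good J I col"
        unfolding block_good_def using col(1,5-8) by blast
      then show ?thesis by blast
    qed
  qed
  have "\<forall>J I. \<exists>g. J \<le> 2 * nv + 1 \<and> 0 < I \<and> I \<le> mc \<longrightarrow> ?good J I g" using good by blast
  then obtain G where G: "\<And>J I. J \<le> 2 * nv + 1 \<Longrightarrow> 0 < I \<Longrightarrow> I \<le> mc \<Longrightarrow> ?good J I (G J I)" by metis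
  \<comment> \<open>In the top strip the sources occupy eight columns per variable, starting at
    column \<open>10\<close> with period \<open>14\<close>, that is, two blocks.\<close>
  define col where "col X Y = (if Y < 7 then
      if 10 \<le> X \<and> (X - 10) mod 14 \<le> 7 \<and> (X - 10) div 14 < nv \<and> Y = 5 then g5 ((X - 10) div 14) ((X - 10) mod 14)
      else if 10 \<le> X \<and> (X - 10) mod 14 \<le> 7 \<and> (X - 10) div 14 < nv \<and> Y = 6 then g6 ((X - 10) div 14) ((X - 10) mod 14)
      else f X Y
    else G (X div 7) (Y div 7) (X mod 7) (Y mod 7))" for X Y
  have col_src: "col (14 * v + 10 + t) 5 = g5 v t" "col (14 * v + 10 + t) 6 = g6 v t" if "v < nv" "t \<le> 7" for v t
    using that by (simp_all add: col_def)
  have col_block: "col (7 * J + x) (7 * I + y) = G J I x y" if "0 < I" "x < 7" "y < 7" for J I x y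
    using that by (simp add: col_def)
  note src' = g56[unfolded src_def source_ok_def]
  note G' = G[unfolded block_good_def]
  show "\<exists>col. (\<forall>X<?W. \<forall>Y<?H. col X Y \<in> L X Y) \<and>
      (\<forall>X Y. ?h X Y \<longrightarrow> Rh X Y (col X Y) (col (Suc X) Y)) \<and> (\<forall>X Y. ?v X Y \<longrightarrow> Rv X Y (col X Y) (col X (Suc Y)))"
  proof (intro exI[of _ col] conjI allI impI)
    fix X Y assume XY: "X < ?W" "Y < ?H"
    show "col X Y \<in> L X Y"
    proof (cases "Y < 7")
      case True
      show ?thesis
      proof (cases "10 \<le> X \<and> (X - 10) mod 14 \<le> 7 \<and> (X - 10) div 14 < nv \<and> (Y = 5 \<or> Y = 6)")
        case True
        define v t where "v = (X - 10) div 14" and "t = (X - 10) mod 14"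
        have X: "X = 14 * v + 10 + t" "v < nv" "t \<le> 7" using True by (auto simp: v_def t_def)
        then show ?thesis using col_src[OF X(2,3)] src'[OF X(2)] True by auto
      next
        case False
        then show ?thesis using True f[OF XY] by (auto simp: col_def)
      qed
    next
      case False
      obtain J x where X: "X = 7 * J + x" "x < 7" using seven_split[of X] by blast
      obtain I y where Y: "Y = 7 * I + y" "y < 7" using seven_split[of Y] by blast
      have "J \<le> 2 * nv + 1" "0 < I" "I \<le> mc" using XY X Y False by auto
      then show ?thesis using G'[of J I] X Y by (simp add: col_block)
    qed
  next
    fix X Y assume e: "?h X Y"
    obtain J x where X: "X = 7 * J + x" "x < 7" using seven_split[of X] by blast
    obtain I y where Y: "Y = 7 * I + y" "y < 7" using seven_split[of Y] by blast
    show "Rh X Y (col X Y) (col (Suc X) Y)"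
    proof (cases "I = 0")
      case True
      then obtain w t where w: "w < nv" "t < 7" "X = 14 * w + 10 + t" "Y = 5 \<or> Y = 6"
        using source_h[OF e] Y by auto
      then have "Suc X = 14 * w + 10 + Suc t" by simp
      then show ?thesis
        using col_src[OF w(1), of t] col_src[OF w(1), of "Suc t"] src'[OF w(1)] w by auto
    next
      case False
      have I: "I \<le> mc" using e lay_h_block[OF X(2) Y(2)] X Y by auto
      show ?thesis
      proof (cases "x < 6")
        case True
        have J: "J \<le> 2 * nv + 1" using e lay_h_block[OF X(2) Y(2), of nv mc J I] X Y False by (auto split: if_splits)
        have "Suc X = 7 * J + Suc x" using X by simp
        then have "col X Y = G J I x y" "col (Suc X) Y = G J I (Suc x) y"
          using col_block[of I x y J] col_block[of I "Suc x" y J] True False X Y by simp_all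
        moreover have "Rh X Y (G J I x y) (G J I (Suc x) y)"
          using G'[THEN conjunct2, THEN conjunct1, rule_format, OF J _ I True Y(2)] e X(1) Y(1) False by simp
        ultimately show ?thesis by simp
      next
        case x: False
        then have J: "x = 6" "y = 3" "J \<le> 2 * nv"
          using e X Y block_h_bound[of x y] False lay_h_block[OF X(2) Y(2), of nv mc J I] by (auto split: if_splits)
        have "Suc X = 7 * Suc J + 0" using X J by simp
        then have c1: "col X Y = G J I 6 3" "col (Suc X) Y = G (Suc J) I 0 3"
          using col_block[of I 6 3 J] col_block[of I 0 3 "Suc J"] False X Y J by simp_all
        have pos: "J \<le> 2 * nv + 1" "Suc J \<le> 2 * nv + 1" "0 < I" "Suc J - 1 = J" using J(3) False by auto
        have eqs: "7 * Suc J - 1 = X" "7 * I + 3 = Y" "7 * J + 6 = X" using X Y J by auto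
        have "r (I - 1) J \<Longrightarrow> G (Suc J) I 0 3 \<noteq> h2 X Y" "\<not> r (I - 1) J \<Longrightarrow> G J I 6 3 \<noteq> h1 X Y"
          using G'[OF pos(2,3) I] G'[OF pos(1,3) I] J(3) unfolding eqs pos(4) by simp_all
        then show ?thesis
          unfolding c1 using h[of "G J I 6 3" X Y "G (Suc J) I 0 3"] by (cases "r (I - 1) J") simp_all
      qed
    qed
  next
    fix X Y assume e: "?v X Y"
    obtain J x where X: "X = 7 * J + x" "x < 7" using seven_split[of X] by blast
    obtain I y where Y: "Y = 7 * I + y" "y < 7" using seven_split[of Y] by blast
    show "Rv X Y (col X Y) (col X (Suc Y))"
    proof (cases "I = 0")
      case True
      then obtain w t where w: "w < nv" "X = 14 * w + 10 + t"
        "Y = 5 \<and> (t = 0 \<and> isU w \<or> t = 7) \<or> Y = 6 \<and> 0 < mc \<and> (t = 0 \<or> t = 7)"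
        using source_v[OF e] Y by auto
      show ?thesis
      proof (cases "Y = 5")
        case True
        then show ?thesis using w col_src[OF w(1), of t] src'[OF w(1)] by (auto simp: add.commute)
      next
        case Y5: False
        then have t: "Y = 6" "0 < mc" "t = 0 \<or> t = 7" using w(3) by auto
        define J' where "J' = (if t = 0 then 2 * w + 1 else 2 * w + 2)"
        have J': "X = 7 * J' + 3" "0 < J'" "J' \<le> 2 * nv" using w(1,2) t(3) by (auto simp: J'_def)
        have "c (J' - 1) \<longleftrightarrow> (if t = 0 then \<not> \<alpha> w else \<alpha> w)" using t(3) by (auto simp: c_def lit_true_def J'_def)
        moreover have "(t = 0 \<longrightarrow> \<alpha> w \<longrightarrow> g6 w t \<noteq> v1 X 6) \<and> (t = 7 \<longrightarrow> \<not> \<alpha> w \<longrightarrow> g6 w t \<noteq> v1 X 6)"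
          using src'[OF w(1)] w(2) by (auto simp: add.commute)
        moreover have "J' \<le> 2 * nv + 1" "1 \<le> mc" using J' t by auto
        then have "c (J' - 1) \<longrightarrow> G J' 1 3 0 \<noteq> v2 X 6"
          using G'[OF _ zero_less_one, THEN conjunct2, THEN conjunct2, THEN conjunct2, THEN conjunct2, THEN conjunct2, THEN conjunct1, of J'] J'
          by simp
        moreover have "col X (Suc Y) = G J' 1 3 0" using col_block[of 1 3 0 J'] J' t by simp
        moreover have "col X Y = g6 w t" using col_src(2)[OF w(1), of t] t w(2) by auto
        ultimately show ?thesis using v[of "g6 w t" X 6 "G J' 1 3 0"] t by auto
      qed
    next
      case False
      have I: "I \<le> mc" using e lay_v_block[OF X(2) Y(2)] X Y by auto
      have J: "J \<le> 2 * nv + 1" using e lay_v_block[OF X(2) Y(2), of nv mc isU lit J I] X Y False by (auto split: if_splits)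
      show ?thesis
      proof (cases "y < 6")
        case True
        have "Suc Y = 7 * I + Suc y" using Y by simp
        then have "col X Y = G J I x y" "col X (Suc Y) = G J I x (Suc y)"
          using col_block[of I x y J] col_block[of I x "Suc y" J] True False X Y by simp_all
        moreover have "Rv X Y (G J I x y) (G J I x (Suc y))"
          using G'[THEN conjunct2, THEN conjunct2, THEN conjunct1, rule_format, OF J _ I X(2) True] e X(1) Y(1) False by simp
        ultimately show ?thesis by simp
      next
        case y: False
        then have K: "x = 3" "y = 6" "0 < J" "J \<le> 2 * nv" "I < mc"
          using e X Y block_v_bound[of x y] False lay_v_block[OF X(2) Y(2), of nv mc isU lit J I] by (auto split: if_splits)
        have "Suc Y = 7 * Suc I + 0" using Y K by simp
        then have c1: "col X Y = G J I 3 6" "col X (Suc Y) = G J (Suc I) 3 0"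
          using col_block[of I 3 6 J] col_block[of "Suc I" 3 0 J] False X Y K by simp_all
        have pos: "0 < I" "0 < Suc I" "Suc I \<le> mc" using K(5) False by auto
        have eqs: "7 * Suc I - 1 = Y" "7 * J + 3 = X" "7 * I + 6 = Y" using X Y K by auto
        have "c (J - 1) \<Longrightarrow> G J (Suc I) 3 0 \<noteq> v2 X Y" "\<not> c (J - 1) \<Longrightarrow> G J I 3 6 \<noteq> v1 X Y"
          using G'[OF J pos(1) I] G'[OF J pos(2,3)] K(3,4) unfolding eqs by simp_all
        then show ?thesis
          unfolding c1 using v[of "G J I 3 6" X Y "G J (Suc I) 3 0"] by (cases "c (J - 1)") simp_all
      qed
    qed
  qed
qed

section \<open>The conflicts against a false formula\<close>

definition conflict_of :: "((nat \<times> nat) \<times> nat \<times> nat) list \<Rightarrow> nat \<times> nat \<Rightarrow> nat \<times> nat" where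
  "conflict_of cs p = (case map_of cs p of None \<Rightarrow> (1, 1) | Some c \<Rightarrow> c)"

text \<open>Colour \<open>2\<close> marks an active exit and \<open>1\<close> an active entrance;
  the conflict \<open>(2, 2)\<close> on links passes activity on. A start cycle is made to force
  \<open>2\<close> at its exit, an end cycle to forbid \<open>1\<close> at its entrance. Along row
  \<open>6\<close> of a source, \<open>1\<close> is copied to the right up to the last edge, which
  turns it into \<open>2\<close>, so at least one source is active. Row \<open>5\<close> copies
  \<open>1\<close> or \<open>2\<close>, depending on the value of the universal variable.\<close>

definition conf_h :: "nat \<Rightarrow> (nat \<Rightarrow> bool) \<Rightarrow> (nat \<Rightarrow> bool) \<Rightarrow> nat \<Rightarrow> nat \<Rightarrow> nat \<times> nat" where
  "conf_h nv isU U X Y = (let I = Y div 7; J = X div 7; x = X mod 7; y = Y mod 7 in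
     if I = 0 then if y = 6 then if even J \<and> x = 2 then (1, 1) else (1, 2)
       else if U ((J - 1) div 2) then (2, 1) else (1, 2)
     else if x = 6 then (2, 2)
     else if J = 0 then if y = 3 then (2, 1) else (1, 1)
     else if J = 2 * nv + 1 then if y = 3 then (1, 2) else (1, 1)
     else conflict_of block_hc (x, y))"

definition conf_v :: "nat \<Rightarrow> (nat \<Rightarrow> bool) \<Rightarrow> (nat \<Rightarrow> bool) \<Rightarrow> nat \<Rightarrow> nat \<Rightarrow> nat \<times> nat" where
  "conf_v nv isU U X Y = (let I = Y div 7; J = X div 7; x = X mod 7; y = Y mod 7 in
     if y = 6 then (2, 2)
     else if I = 0 then if isU ((J - 1) div 2) \<and> U ((J - 1) div 2) = even J then (2, 1) else (1, 2)
     else if J = 0 \<or> J = 2 * nv + 1 then (1, 2)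
     else conflict_of block_vc (x, y))"

lemma conf_h_block:
  assumes "x < 7" "y < 7"
  shows "conf_h nv isU U (7 * J + x) (7 * I + y) =
    (if I = 0 then if y = 6 then if even J \<and> x = 2 then (1, 1) else (1, 2)
       else if U ((J - 1) div 2) then (2, 1) else (1, 2)
     else if x = 6 then (2, 2)
     else if J = 0 then if y = 3 then (2, 1) else (1, 1)
     else if J = 2 * nv + 1 then if y = 3 then (1, 2) else (1, 1)
     else conflict_of block_hc (x, y))"
  by (simp only: conf_h_def Let_def seven_div_mod[OF assms(1)] seven_div_mod[OF assms(2)])

lemma conf_v_block:
  assumes "x < 7" "y < 7"
  shows "conf_v nv isU U (7 * J + x) (7 * I + y) =
    (if y = 6 then (2, 2)
     else if I = 0 then if isU ((J - 1) div 2) \<and> U ((J - 1) div 2) = even J then (2, 1) else (1, 2)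
     else if J = 0 \<or> J = 2 * nv + 1 then (1, 2)
     else conflict_of block_vc (x, y))"
  by (simp only: conf_v_def Let_def seven_div_mod[OF assms(1)] seven_div_mod[OF assms(2)])

lemma conflict_of_range:
  assumes "\<forall>(p, c) \<in> set cs. c \<in> {1, 2, 3} \<times> {1, 2, 3}"
  shows "conflict_of cs p \<in> {1, 2, 3} \<times> {1, 2, 3}"
  using assms by (auto simp: conflict_of_def split: option.split dest!: map_of_SomeD)

lemma conflict_of_block: "conflict_of block_hc p \<in> {1, 2, 3} \<times> {1, 2, 3}" "conflict_of block_vc p \<in> {1, 2, 3} \<times> {1, 2, 3}"
  by (rule conflict_of_range, simp add: block_hc_def block_vc_def)+

lemma conf_range: "conf_h nv isU U X Y \<in> {1, 2, 3} \<times> {1, 2, 3}" "conf_v nv isU U X Y \<in> {1, 2, 3} \<times> {1, 2, 3}"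
  unfolding conf_h_def conf_v_def Let_def using conflict_of_block by (simp_all split: if_split)

lemma block_conflicts:
  "\<forall>((x, y), c) \<in> set block_hc. (x, y) \<in> set block_h \<and> x < 6 \<and> y < 7 \<and> conflict_of block_hc (x, y) = c"
  "\<forall>((x, y), c) \<in> set block_vc. (x, y) \<in> set block_v \<and> x < 7 \<and> y < 6 \<and> conflict_of block_vc (x, y) = c"
  "conflict_of block_vc (6, 2) = (1, 1)"
  by (simp_all add: block_hc_def block_vc_def block_h_def block_v_def conflict_of_def)

text \<open>The second and third claim belong to the two values of a universal variable. If the left
  end of row \<open>6\<close> had colour \<open>1\<close>, its right end would have colour
  \<open>2\<close>; for the value false the left rung would then start row \<open>5\<close> with
  \<open>1\<close>, which is copied to the right and clashes there. So the source of the positive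
  literal is active. The value true is handled symmetrically.\<close>

lemma source_forced:
  fixes g5 g6 :: "nat \<Rightarrow> nat"
  assumes two: "\<And>t. t \<le> 7 \<Longrightarrow> g5 t \<in> {1, 2} \<and> g6 t \<in> {1, 2}"
    and g6: "\<And>t. t < 6 \<Longrightarrow> (g6 t, g6 (Suc t)) \<noteq> (1, 2)" "(g6 6, g6 7) \<noteq> (1, 1)"
  shows "g6 0 = 2 \<or> g6 7 = 2"
    and "(\<And>t. t < 7 \<Longrightarrow> (g5 t, g5 (Suc t)) \<noteq> (1, 2)) \<Longrightarrow> (g5 0, g6 0) \<noteq> (2, 1) \<Longrightarrow> (g5 7, g6 7) \<noteq> (1, 2) \<Longrightarrow> g6 0 = 2"
    and "(\<And>t. t < 7 \<Longrightarrow> (g5 t, g5 (Suc t)) \<noteq> (2, 1)) \<Longrightarrow> (g5 0, g6 0) \<noteq> (1, 2) \<Longrightarrow> (g5 7, g6 7) \<noteq> (2, 1) \<Longrightarrow> g6 7 = 2"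
proof -
  have 6: "t \<le> 6 \<Longrightarrow> g6 0 = 1 \<Longrightarrow> g6 t = 1" for t
  proof (induction t)
    case (Suc t)
    then show ?case using g6(1)[of t] two[of "Suc t"] by auto
  qed
  show one: "g6 0 = 2 \<or> g6 7 = 2" using 6[of 6] two[of 0] two[of 7] g6(2) by auto
  show "g6 0 = 2" if "\<And>t. t < 7 \<Longrightarrow> (g5 t, g5 (Suc t)) \<noteq> (1, 2)" "(g5 0, g6 0) \<noteq> (2, 1)" "(g5 7, g6 7) \<noteq> (1, 2)"
  proof -
    have "t \<le> 7 \<Longrightarrow> g5 0 = 1 \<Longrightarrow> g5 t = 1" for t
    proof (induction t)
      case (Suc t)
      then show ?case using that(1)[of t] two[of "Suc t"] by auto
    qed
    from this[of 7] show ?thesis using one that(2,3) two[of 0] two[of 7] by auto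
  qed
  show "g6 7 = 2" if "\<And>t. t < 7 \<Longrightarrow> (g5 t, g5 (Suc t)) \<noteq> (2, 1)" "(g5 0, g6 0) \<noteq> (1, 2)" "(g5 7, g6 7) \<noteq> (2, 1)"
  proof -
    have "t \<le> 7 \<Longrightarrow> g5 0 = 2 \<Longrightarrow> g5 t = 2" for t
    proof (induction t)
      case (Suc t)
      then show ?case using that(1)[of t] two[of "Suc t"] by auto
    qed
    from this[of 7] show ?thesis using one that(2,3) two[of 0] two[of 7] by auto
  qed
qed

text \<open>A colouring would define an assignment under which every false literal has an active
  column. Some clause then fails entirely, so its row stays active through all blocks and enters the
  end cycle with the colour \<open>1\<close> that this cycle forbids.\<close>

lemma no_conflict_coloring:
  assumes none: "\<And>\<alpha>. (\<And>v. v < nv \<Longrightarrow> isU v \<Longrightarrow> \<alpha> v = U v) \<Longrightarrow> \<exists>i<mc. \<forall>j<2 * nv. lit i j \<longrightarrow> \<not> lit_true \<alpha> j"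
    and range: "\<And>X Y. X < 7 * (2 * nv + 2) \<Longrightarrow> Y < 7 * (mc + 1) \<Longrightarrow> col X Y \<in> {1..if lay_3 nv mc X Y then 3 else (2 :: nat)}"
    and h: "\<And>X Y. lay_h nv mc X Y \<Longrightarrow> (col X Y, col (Suc X) Y) \<noteq> conf_h nv isU U X Y"
    and v: "\<And>X Y. lay_v nv mc isU lit X Y \<Longrightarrow> (col X Y, col X (Suc Y)) \<noteq> conf_v nv isU U X Y"
  shows False
proof -
  have top: "col (14 * w + 10 + t) Y \<in> {1, 2}" if "w < nv" "t \<le> 7" "Y < 7" for w t Y
  proof -
    have "14 * w + 10 + t < 7 * (2 * nv + 2)" "Y < 7 * (mc + 1)" using that by presburger+
    from range[OF this] show ?thesis using that(3) by (auto simp: lay_3_def)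
  qed
  have toph: "(col (14 * w + 10 + t) Y, col (14 * w + 10 + Suc t) Y) \<noteq>
      (if Y = 6 then if t = 6 then (1, 1) else (1, 2) else if U w then (2, 1) else (1, 2))"
    if "w < nv" "t < 7" "Y = 5 \<or> Y = 6" for w t Y
  proof -
    define J x where "J = (if t < 4 then 2 * w + 1 else 2 * w + 2)" and "x = (if t < 4 then t + 3 else t - 4)"
    have e: "14 * w + 10 + t = 7 * J + x" "14 * w + 10 + Suc t = Suc (7 * J + x)" "x < 7" using that by (auto simp: J_def x_def)
    have Y: "Y < 7" "Y = 7 * 0 + Y" using that(3) by auto
    have "lay_h nv mc (7 * J + x) (7 * 0 + Y)"
      unfolding lay_h_block[OF e(3) Y(1)] using that by (auto simp: J_def x_def)
    then have "(col (7 * J + x) Y, col (Suc (7 * J + x)) Y) \<noteq> conf_h nv isU U (7 * J + x) (7 * 0 + Y)"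
      using h by fastforce
    moreover have "conf_h nv isU U (7 * J + x) (7 * 0 + Y) =
        (if Y = 6 then if t = 6 then (1, 1) else (1, 2) else if U w then (2, 1) else (1, 2))"
      unfolding conf_h_block[OF e(3) Y(1)] using that by (auto simp: J_def x_def)
    ultimately show ?thesis unfolding e by simp
  qed
  have topv: "(col (14 * w + 10 + t) 5, col (14 * w + 10 + t) 6) \<noteq> (if U w = (t = 7) then (2, 1) else (1, 2))"
    if "w < nv" "t = 0 \<or> t = 7" "isU w" for w t
  proof -
    define J where "J = (if t = 0 then 2 * w + 1 else 2 * w + 2)"
    have e: "14 * w + 10 + t = 7 * J + 3" using that by (auto simp: J_def)
    have "lay_v nv mc isU lit (7 * J + 3) (7 * 0 + 5)"
      unfolding lay_v_block[of 3 5, simplified] using that by (auto simp: J_def)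
    then have "(col (7 * J + 3) 5, col (7 * J + 3) 6) \<noteq> conf_v nv isU U (7 * J + 3) (7 * 0 + 5)"
      using v by fastforce
    moreover have "conf_v nv isU U (7 * J + 3) (7 * 0 + 5) = (if U w = (t = 7) then (2, 1) else (1, 2))"
      unfolding conf_v_block[of 3 5, simplified] using that by (auto simp: J_def)
    ultimately show ?thesis unfolding e by simp
  qed
  \<comment> \<open>An existential variable is false if its positive source is active; otherwise its
    negative source is active by \<open>source_forced\<close>.\<close>
  define \<alpha> where "\<alpha> w = (if isU w then U w else col (14 * w + 10) 6 \<noteq> 2)" for w
  have \<alpha>: "(\<alpha> w \<or> col (14 * w + 10) 6 = 2) \<and> (\<alpha> w \<longrightarrow> col (14 * w + 17) 6 = 2)" if w: "w < nv" for w
  proof -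
    let ?g5 = "\<lambda>t. col (14 * w + 10 + t) 5" and ?g6 = "\<lambda>t. col (14 * w + 10 + t) 6"
    have a1: "?g5 t \<in> {1, 2} \<and> ?g6 t \<in> {1, 2}" if "t \<le> 7" for t using top[OF w that] by simp
    have a2: "(?g6 t, ?g6 (Suc t)) \<noteq> (1, 2)" if "t < 6" for t using toph[OF w, of t 6] that by simp
    have a3: "(?g6 6, ?g6 7) \<noteq> (1, 1)" using toph[OF w, of 6 6] by simp
    note f = source_forced[of ?g5 ?g6, OF a1 a2 a3]
    show ?thesis
    proof (cases "isU w")
      case True
      have e7: "14 * w + 10 + 7 = 14 * w + 17" by simp
      have r5: "(?g5 t, ?g5 (Suc t)) \<noteq> (if U w then (2, 1) else (1, 2))" if "t < 7" for t
        using toph[OF w that, of 5] by simp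
      show ?thesis
      proof (cases "U w")
        case U: True
        have "?g6 7 = 2" by (rule f(3)) (use r5 U topv[OF w _ True, of 0] topv[OF w _ True, of 7] in simp_all)
        then show ?thesis using True U unfolding e7 by (simp add: \<alpha>_def)
      next
        case U: False
        have "?g6 0 = 2" by (rule f(2)) (use r5 U topv[OF w _ True, of 0] topv[OF w _ True, of 7] in simp_all)
        then show ?thesis using True U by (simp add: \<alpha>_def)
      qed
    next
      case False
      then show ?thesis using f(1) by (auto simp: \<alpha>_def add.commute)
    qed
  qed
  obtain i where i: "i < mc" "\<And>j. j < 2 * nv \<Longrightarrow> lit i j \<Longrightarrow> \<not> lit_true \<alpha> j"
    using none[of \<alpha>] by (auto simp: \<alpha>_def)
  define g where "g J I x y = col (7 * J + x) (7 * I + y)" for J I x y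
  have gr: "g J I x y \<in> {1..if 0 < I \<and> 0 < J \<and> J \<le> 2 * nv \<and> (x, y) \<in> set block_3 then 3 else 2}"
    if "J \<le> 2 * nv + 1" "I \<le> mc" "x < 7" "y < 7" for J I x y
  proof -
    have "7 * J + x < 7 * (2 * nv + 2)" "7 * I + y < 7 * (mc + 1)" using that by auto
    from range[OF this] show ?thesis using lay_3_block[OF that(3,4), of nv mc J I] that(2) by (simp add: g_def)
  qed
  have gh: "(g J I x y, g J I (Suc x) y) \<noteq> conf_h nv isU U (7 * J + x) (7 * I + y)" if "lay_h nv mc (7 * J + x) (7 * I + y)" for J I x y
    using h[OF that] by (simp add: g_def)
  have gv: "(g J I x y, g J I x (Suc y)) \<noteq> conf_v nv isU U (7 * J + x) (7 * I + y)" if "lay_v nv mc isU lit (7 * J + x) (7 * I + y)" for J I x y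
    using v[OF that] by (simp add: g_def)
  have g67: "g J I 7 y = g (Suc J) I 0 y" "g J I x 7 = g J (Suc I) x 0" for J I x y
    by (simp_all add: g_def add.commute)
  have rowlink: "g (Suc J) I 0 3 = 1" if "g J I 6 3 = 2" "0 < I" "I \<le> mc" "J \<le> 2 * nv" for J I
  proof -
    have "lay_h nv mc (7 * J + 6) (7 * I + 3)" using lay_h_block[of 6 3 nv mc J I] that by simp
    then have "(g J I 6 3, g J I 7 3) \<noteq> (2, 2)" using gh[of J 6 I 3] conf_h_block[of 6 3 nv isU U J I] that(2) by simp
    moreover have "g (Suc J) I 0 3 \<in> {1..2}" using gr[of "Suc J" I 0 3] that by (simp add: block_3_def)
    ultimately show ?thesis using that(1) unfolding g67 by auto
  qed
  have collink: "g J (Suc I) 3 0 = 1" if "g J I 3 6 = 2" "I < mc" "0 < J" "J \<le> 2 * nv" for J I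
  proof -
    have "lay_v nv mc isU lit (7 * J + 3) (7 * I + 6)" using lay_v_block[of 3 6 nv mc isU lit J I] that by simp
    then have "(g J I 3 6, g J I 3 7) \<noteq> (2, 2)" using gv[of J 3 I 6] conf_v_block[of 3 6 nv isU U J I] by simp
    moreover have "g J (Suc I) 3 0 \<in> {1..2}" using gr[of J "Suc I" 3 0] that by (simp add: block_3_def)
    ultimately show ?thesis using that(1) unfolding g67 by auto
  qed
  have block: "(g J I 3 0 = 1 \<longrightarrow> g J I 3 6 = 2) \<and>
      (g J I 0 3 = 1 \<longrightarrow> \<not> lit (I - 1) (J - 1) \<or> g J I 3 0 = 1 \<longrightarrow> g J I 6 3 = 2)"
    if b: "0 < I" "I \<le> mc" "0 < J" "J \<le> 2 * nv" for J I
  proof -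
    have r: "\<And>x y. x < 7 \<Longrightarrow> y < 7 \<Longrightarrow> g J I x y \<in> {1..if (x, y) \<in> set block_3 then 3 else 2}"
      using gr[of J I] b by simp
    have "(g J I x y, g J I (Suc x) y) \<noteq> c" if "((x, y), c) \<in> set block_hc" for x y c
    proof -
      have xy: "(x, y) \<in> set block_h" "x < 6" "y < 7" "conflict_of block_hc (x, y) = c" using bspec[OF block_conflicts(1) that] by simp_all
      then have "lay_h nv mc (7 * J + x) (7 * I + y)" using lay_h_block[of x y nv mc J I] b by simp
      then show ?thesis using gh[of J x I y] conf_h_block[of x y nv isU U J I] xy b by simp
    qed
    then have hh: "\<forall>((x, y), c) \<in> set block_hc. (g J I x y, g J I (Suc x) y) \<noteq> c" by blast
    have "(g J I x y, g J I x (Suc y)) \<noteq> c" if "((x, y), c) \<in> set block_vc" for x y c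
    proof -
      have xy: "(x, y) \<in> set block_v" "x < 7" "y < 6" "conflict_of block_vc (x, y) = c" using bspec[OF block_conflicts(2) that] by simp_all
      then have "lay_v nv mc isU lit (7 * J + x) (7 * I + y)" using lay_v_block[of x y nv mc isU lit J I] b by simp
      then show ?thesis using gv[of J x I y] conf_v_block[of x y nv isU U J I] xy b by simp
    qed
    then have vv: "\<forall>((x, y), c) \<in> set block_vc. (g J I x y, g J I x (Suc y)) \<noteq> c" by blast
    have tap: "(g J I 6 2, g J I 6 3) \<noteq> (1, 1)" if "\<not> lit (I - 1) (J - 1)"
    proof -
      have "lay_v nv mc isU lit (7 * J + 6) (7 * I + 2)" using lay_v_block[of 6 2 nv mc isU lit J I] b that by simp
      then show ?thesis using gv[of J 6 I 2] conf_v_block[of 6 2 nv isU U J I] b block_conflicts(3) by simp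
    qed
    show ?thesis using block_forced[OF r hh vv tap] by blast
  qed
  \<comment> \<open>Activity travels down a column independently of the rows.\<close>
  have column: "g J (Suc I) 3 0 = 1" if J: "0 < J" "J \<le> 2 * nv" "\<not> lit_true \<alpha> (J - 1)" and "I < mc" for I J
    using \<open>I < mc\<close>
  proof (induction I)
    case 0
    have "g J 0 3 6 = 2"
    proof (cases "odd J")
      case True
      then obtain w where w: "w < nv" "J = 2 * w + 1" using odd_block J by blast
      have "7 * J + 3 = 14 * w + 10" using w by simp
      then show ?thesis using \<alpha>[OF w(1)] J(3) w(2) by (simp add: g_def lit_true_def add.commute)
    next
      case False
      then obtain w where w: "w < nv" "J = 2 * w + 2" using even_block J by blast
      have "7 * J + 3 = 14 * w + 17" "(J - 1) div 2 = w" "odd (J - 1)" using w(2) by simp_all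
      then show ?thesis using \<alpha>[OF w(1)] J(3) by (simp add: g_def lit_true_def add.commute)
    qed
    then show ?case using collink 0 J by blast
  next
    case (Suc I)
    then have "g J (Suc I) 3 0 = 1" by simp
    then have "g J (Suc I) 3 6 = 2" using block[of "Suc I" J] Suc.prems J by simp
    then show ?case using collink Suc.prems J by blast
  qed
  define I where "I = Suc i"
  have I: "0 < I" "I \<le> mc" "I - 1 = i" using i(1) by (auto simp: I_def)
  \<comment> \<open>A block of this row either lacks the literal and passes activity on regardless,
    or its column is active because the literal is false.\<close>
  have row: "J \<le> 2 * nv \<Longrightarrow> g (Suc J) I 0 3 = 1" for J
  proof (induction J)
    case 0
    have r: "g 0 I x y \<in> {1..2}" if "x < 7" "y < 7" for x y using gr[of 0 I x y] I that by simp
    have "(g 0 I 5 3, g 0 I 6 3) \<noteq> (2, 1)" "(g 0 I 5 4, g 0 I 6 4) \<noteq> (1, 1)"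
      "(g 0 I 5 3, g 0 I 5 4) \<noteq> (1, 2)" "(g 0 I 6 3, g 0 I 6 4) \<noteq> (1, 2)"
      using gh[of 0 5 I 3] gh[of 0 5 I 4] gv[of 0 5 I 3] gv[of 0 6 I 3] I(1,2)
        lay_h_block[of 5 3 nv mc 0 I] lay_h_block[of 5 4 nv mc 0 I] lay_v_block[of 5 3 nv mc isU lit 0 I] lay_v_block[of 6 3 nv mc isU lit 0 I]
        conf_h_block[of 5 3 nv isU U 0 I] conf_h_block[of 5 4 nv isU U 0 I] conf_v_block[of 5 3 nv isU U 0 I] conf_v_block[of 6 3 nv isU U 0 I]
      by simp_all
    then have "g 0 I 6 3 = 2" using r[of 5 3] r[of 6 3] r[of 5 4] r[of 6 4] by auto
    then show ?case using rowlink[of 0 I] I by simp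
  next
    case (Suc J)
    then have w: "g (Suc J) I 0 3 = 1" by simp
    have "\<not> lit (I - 1) J \<or> g (Suc J) I 3 0 = 1"
      using i(2)[of J] column[of "Suc J" i] Suc.prems i(1) I(3) by (auto simp: I_def)
    then have "g (Suc J) I 6 3 = 2" using block[OF I(1,2), of "Suc J"] w Suc.prems by simp
    then show ?case using rowlink[of "Suc J" I] I Suc.prems by simp
  qed
  define J where "J = Suc (2 * nv)"
  have J: "J = 2 * nv + 1" "J \<noteq> 0" by (simp_all add: J_def)
  have r: "g J I x y \<in> {1..2}" if "x < 7" "y < 7" for x y using gr[of J I x y] I that J by simp
  have "(g J I 0 3, g J I 1 3) \<noteq> (1, 2)" "(g J I 0 4, g J I 1 4) \<noteq> (1, 1)"
    "(g J I 0 3, g J I 0 4) \<noteq> (1, 2)" "(g J I 1 3, g J I 1 4) \<noteq> (1, 2)"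
    using gh[of J 0 I 3] gh[of J 0 I 4] gv[of J 0 I 3] gv[of J 1 I 3] I(1,2) J
      lay_h_block[of 0 3 nv mc J I] lay_h_block[of 0 4 nv mc J I] lay_v_block[of 0 3 nv mc isU lit J I] lay_v_block[of 1 3 nv mc isU lit J I]
      conf_h_block[of 0 3 nv isU U J I] conf_h_block[of 0 4 nv isU U J I] conf_v_block[of 0 3 nv isU U J I] conf_v_block[of 1 3 nv isU U J I]
    by simp_all
  then have "g J I 0 3 \<noteq> 1" using r[of 0 3] r[of 1 3] r[of 0 4] r[of 1 4] by auto
  then show False using row[of "2 * nv"] by (simp add: J_def)
qed

section \<open>Degrees in the layout\<close>

lemma lay_h_left:
  assumes "x < 7" "y < 7"
  shows "0 < 7 * J + x \<and> lay_h nv mc (7 * J + x - 1) (7 * I + y) \<longleftrightarrow>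
    (if x = 0 then 0 < J \<and> lay_h nv mc (7 * (J - 1) + 6) (7 * I + y) else lay_h nv mc (7 * J + (x - 1)) (7 * I + y))"
proof -
  have "x = 0 \<Longrightarrow> 0 < J \<Longrightarrow> 7 * J + x - 1 = 7 * (J - 1) + 6" by presburger
  moreover have "0 < x \<Longrightarrow> 7 * J + x - 1 = 7 * J + (x - 1)" by presburger
  ultimately show ?thesis by (cases "x = 0"; cases "J = 0") simp_all
qed

lemma lay_v_up:
  assumes "x < 7" "y < 7"
  shows "0 < 7 * I + y \<and> lay_v nv mc isU lit (7 * J + x) (7 * I + y - 1) \<longleftrightarrow>
    (if y = 0 then 0 < I \<and> lay_v nv mc isU lit (7 * J + x) (7 * (I - 1) + 6) else lay_v nv mc isU lit (7 * J + x) (7 * I + (y - 1)))"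
proof -
  have "y = 0 \<Longrightarrow> 0 < I \<Longrightarrow> 7 * I + y - 1 = 7 * (I - 1) + 6" by presburger
  moreover have "0 < y \<Longrightarrow> 7 * I + y - 1 = 7 * I + (y - 1)" by presburger
  ultimately show ?thesis by (cases "y = 0"; cases "I = 0") simp_all
qed

lemma degree_bounds:
  "coarse_degree hE vE X Y = 4 \<Longrightarrow> hE X Y \<and> (0 < X \<and> hE (X - 1) Y) \<and> vE X Y \<and> (0 < Y \<and> vE X (Y - 1))"
  "coarse_degree hE vE X Y = 2 \<Longrightarrow> \<not> (hE X Y \<and> (0 < X \<and> hE (X - 1) Y) \<and> (vE X Y \<or> 0 < Y \<and> vE X (Y - 1))) \<and>
    \<not> (vE X Y \<and> (0 < Y \<and> vE X (Y - 1)) \<and> (hE X Y \<or> 0 < X \<and> hE (X - 1) Y))"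
  unfolding coarse_degree_def
  by (cases "hE X Y"; cases "0 < X \<and> hE (X - 1) Y"; cases "vE X Y"; cases "0 < Y \<and> vE X (Y - 1)"; simp_all only: of_bool_eq simp_thms; simp)+

text \<open>A finite check over the cells of a block. The first part credits a cell with every edge
  it could have, including links to other blocks and the optional edge at \<open>(6, 2)\<close>; the
  second relies only on edges that are always present inside the block. So both apply to every
  formula.\<close>

lemma block_degree:
  assumes "x < 7" "y < 7"
  shows "((x, y) \<in> set block_h \<or> (x, y) = (6, 3)) \<and> ((x = 0 \<and> y = 3) \<or> 0 < x \<and> (x - 1, y) \<in> set block_h) \<and>
     ((x, y) \<in> set block_v \<or> (x, y) = (6, 2) \<or> (x, y) = (3, 6)) \<and>
     ((x = 3 \<and> y = 0) \<or> 0 < y \<and> ((x, y - 1) \<in> set block_v \<or> (x, y - 1) = (6, 2))) \<longrightarrow> (x, y) \<in> set block_3"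
    and "(x, y) \<in> set block_3 \<Longrightarrow>
      ((x, y) \<in> set block_h \<and> 0 < x \<and> (x - 1, y) \<in> set block_h \<and> ((x, y) \<in> set block_v \<or> 0 < y \<and> (x, y - 1) \<in> set block_v)) \<or>
      ((x, y) \<in> set block_v \<and> 0 < y \<and> (x, y - 1) \<in> set block_v \<and> ((x, y) \<in> set block_h \<or> 0 < x \<and> (x - 1, y) \<in> set block_h))"
proof -
  have xy: "x \<in> set [0..<7]" "y \<in> set [0..<7]" using assms by simp_all
  have a: "\<forall>x\<in>set [0..<7]. \<forall>y\<in>set [0..<7]. ((x, y) \<in> set block_h \<or> (x, y) = (6, 3)) \<and> ((x = 0 \<and> y = 3) \<or> 0 < x \<and> (x - 1, y) \<in> set block_h) \<and>
     ((x, y) \<in> set block_v \<or> (x, y) = (6, 2) \<or> (x, y) = (3, 6)) \<and>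
     ((x = 3 \<and> y = 0) \<or> 0 < y \<and> ((x, y - 1) \<in> set block_v \<or> (x, y - 1) = (6, 2))) \<longrightarrow> (x, y) \<in> set block_3"
    by code_simp
  show "((x, y) \<in> set block_h \<or> (x, y) = (6, 3)) \<and> ((x = 0 \<and> y = 3) \<or> 0 < x \<and> (x - 1, y) \<in> set block_h) \<and>
     ((x, y) \<in> set block_v \<or> (x, y) = (6, 2) \<or> (x, y) = (3, 6)) \<and>
     ((x = 3 \<and> y = 0) \<or> 0 < y \<and> ((x, y - 1) \<in> set block_v \<or> (x, y - 1) = (6, 2))) \<longrightarrow> (x, y) \<in> set block_3"
    by (rule a[THEN bspec, THEN bspec, OF xy])
  have b: "\<forall>(x, y) \<in> set block_3. 
      ((x, y) \<in> set block_h \<and> 0 < x \<and> (x - 1, y) \<in> set block_h \<and> ((x, y) \<in> set block_v \<or> 0 < y \<and> (x, y - 1) \<in> set block_v)) \<or>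
      ((x, y) \<in> set block_v \<and> 0 < y \<and> (x, y - 1) \<in> set block_v \<and> ((x, y) \<in> set block_h \<or> 0 < x \<and> (x - 1, y) \<in> set block_h))"
    by code_simp
  show "(x, y) \<in> set block_3 \<Longrightarrow>
      ((x, y) \<in> set block_h \<and> 0 < x \<and> (x - 1, y) \<in> set block_h \<and> ((x, y) \<in> set block_v \<or> 0 < y \<and> (x, y - 1) \<in> set block_v)) \<or>
      ((x, y) \<in> set block_v \<and> 0 < y \<and> (x, y - 1) \<in> set block_v \<and> ((x, y) \<in> set block_h \<or> 0 < x \<and> (x - 1, y) \<in> set block_h))"
    by (drule bspec[OF b]) (unfold prod.case)
qed

lemma lay_degree:
  "(coarse_degree (lay_h nv mc) (lay_v nv mc isU lit) X Y = 4 \<longrightarrow> lay_3 nv mc X Y) \<and>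
   (coarse_degree (lay_h nv mc) (lay_v nv mc isU lit) X Y = 2 \<longrightarrow> \<not> lay_3 nv mc X Y)"
proof -
  obtain J x where X: "X = 7 * J + x" "x < 7" using seven_split[of X] by blast
  obtain I y where Y: "Y = 7 * I + y" "y < 7" using seven_split[of Y] by blast
  have four: "lay_3 nv mc X Y" if "coarse_degree (lay_h nv mc) (lay_v nv mc isU lit) X Y = 4"
  proof -
    have e: "lay_h nv mc X Y" "0 < X \<and> lay_h nv mc (X - 1) Y" "lay_v nv mc isU lit X Y" "0 < Y \<and> lay_v nv mc isU lit X (Y - 1)"
      using degree_bounds(1)[OF that] by blast+
    note l = e[unfolded X(1) Y(1) lay_h_left[OF X(2) Y(2)] lay_v_up[OF X(2) Y(2)]]
    have l1: "lay_h nv mc (7 * J + x) (7 * I + y)" and l3: "lay_v nv mc isU lit (7 * J + x) (7 * I + y)" using l(1,3) .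
    have l2: "x = 0 \<and> 0 < J \<and> lay_h nv mc (7 * (J - 1) + 6) (7 * I + y) \<or> 0 < x \<and> lay_h nv mc (7 * J + (x - 1)) (7 * I + y)"
      using l(2) by (cases "x = 0") simp_all
    have l4: "y = 0 \<and> 0 < I \<and> lay_v nv mc isU lit (7 * J + x) (7 * (I - 1) + 6) \<or> 0 < y \<and> lay_v nv mc isU lit (7 * J + x) (7 * I + (y - 1))"
      using l(4) by (cases "y = 0") simp_all
    have x1: "x - 1 < 7" "y - 1 < 7" "(6::nat) < 7" using X Y by auto
    note L = l1[unfolded lay_h_block[OF X(2) Y(2)]] l2[unfolded lay_h_block[OF x1(1) Y(2)] lay_h_block[OF x1(3) Y(2)]]
      l3[unfolded lay_v_block[OF X(2) Y(2)]] l4[unfolded lay_v_block[OF X(2) x1(2)] lay_v_block[OF X(2) x1(3)]]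
    \<comment> \<open>Outside the crossing blocks no vertex has degree four.\<close>
    have I: "I \<noteq> 0"
    proof
      assume "I = 0"
      then have "x = 3" "odd J \<longrightarrow> 3 \<le> x - 1" "even J \<longrightarrow> x < 3" using L(1-3) by (auto split: if_splits)
      then show False by (cases "odd J") auto
    qed
    have J: "J \<noteq> 0"
    proof
      assume J0: "J = 0"
      have "(x, y) = (5, 3) \<or> (x, y) = (5, 4) \<or> (x, y) = (6, 3)" using L(1) I J0 by simp
      then have "x = 6" "y = 3" using L(2) I J0 by auto
      then show False using L(4) I J0 by simp
    qed
    have J': "J \<noteq> 2 * nv + 1"
    proof
      assume J1: "J = 2 * nv + 1"
      have "(x, y) = (0, 3) \<or> (x, y) = (0, 4)" using L(1) I J1 by simp
      then have "x = 0" "y = 3" using L(3) I J1 by auto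
      then show False using L(4) I J1 by simp
    qed
    have b6: "(6, y) \<notin> set block_h" "(x, 6) \<notin> set block_v" using block_h_bound[of 6 y] block_v_bound[of x 6] by auto
    have "(x, y) \<in> set block_h \<or> (x, y) = (6, 3)" using L(1) I J J' by simp
    moreover have "(x = 0 \<and> y = 3) \<or> 0 < x \<and> (x - 1, y) \<in> set block_h"
      using L(2) I J J' b6 X(2) by (auto split: if_splits)
    moreover have "(x, y) \<in> set block_v \<or> (x, y) = (6, 2) \<or> (x, y) = (3, 6)" using L(3) I J J' by auto
    moreover have "(x = 3 \<and> y = 0) \<or> 0 < y \<and> ((x, y - 1) \<in> set block_v \<or> (x, y - 1) = (6, 2))"
      using L(4) I J J' b6 Y(2) by (auto split: if_splits)
    ultimately have "(x, y) \<in> set block_3" using block_degree(1)[OF X(2) Y(2)] by blast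
    moreover have "I \<le> mc" "J \<le> 2 * nv" using L(1) I J J' by simp_all
    ultimately show ?thesis unfolding X(1) Y(1) lay_3_block[OF X(2) Y(2)] using I J by simp
  qed
  have two: False if d: "coarse_degree (lay_h nv mc) (lay_v nv mc isU lit) X Y = 2" and "lay_3 nv mc X Y"
  proof -
    have b: "0 < I" "I \<le> mc" "0 < J" "J \<le> 2 * nv" "(x, y) \<in> set block_3"
      using that(2) unfolding X(1) Y(1) lay_3_block[OF X(2) Y(2)] by simp_all
    have x1: "x - 1 < 7" "y - 1 < 7" using X Y by auto
    have "(x, y) \<in> set block_h \<Longrightarrow> lay_h nv mc X Y" "(x, y) \<in> set block_v \<Longrightarrow> lay_v nv mc isU lit X Y"
      unfolding X(1) Y(1) lay_h_block[OF X(2) Y(2)] lay_v_block[OF X(2) Y(2)] using b by simp_all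
    moreover have "0 < x \<and> (x - 1, y) \<in> set block_h \<Longrightarrow> 0 < X \<and> lay_h nv mc (X - 1) Y"
      unfolding X(1) Y(1) lay_h_left[OF X(2) Y(2)] lay_h_block[OF x1(1) Y(2)] using b by simp
    moreover have "0 < y \<and> (x, y - 1) \<in> set block_v \<Longrightarrow> 0 < Y \<and> lay_v nv mc isU lit X (Y - 1)"
      unfolding X(1) Y(1) lay_v_up[OF X(2) Y(2)] lay_v_block[OF X(2) x1(2)] using b by simp
    ultimately show False using block_degree(2)[OF X(2) Y(2) b(5)] degree_bounds(2)[OF d] by blast
  qed
  show ?thesis using four two by blast
qed

section \<open>The graph of a quantified formula\<close>

definition qbf_graph :: "nat \<Rightarrow> nat \<Rightarrow> (nat \<Rightarrow> bool) \<Rightarrow> (nat \<Rightarrow> nat \<Rightarrow> bool) \<Rightarrow> nat pair_pre_digraph" where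
  "qbf_graph nv mc isU lit = wire_graph (7 * (2 * nv + 2)) (7 * (mc + 1)) (lay_h nv mc) (lay_v nv mc isU lit)"

definition qbf_size :: "nat \<Rightarrow> nat \<Rightarrow> nat \<Rightarrow> nat" where
  "qbf_size nv mc = wire_size (7 * (mc + 1)) (lay_3 nv mc)"

lemma qbf_graph_choosable_within:
  assumes "3 \<le> k"
  shows "choosable_within (qbf_graph nv mc isU lit) (qbf_size nv mc) k \<longleftrightarrow> qbf nv mc isU lit"
proof
  assume "qbf nv mc isU lit"
  then show "choosable_within (qbf_graph nv mc isU lit) (qbf_size nv mc) k"
    unfolding qbf_graph_def qbf_size_def
    by (intro wire_graph_choosable lay_h_bound lay_v_bound qbf_conflict_colorable)
next
  assume c: "choosable_within (qbf_graph nv mc isU lit) (qbf_size nv mc) k"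
  show "qbf nv mc isU lit"
  proof (rule ccontr)
    assume "\<not> qbf nv mc isU lit"
    then obtain U where U: "\<And>\<alpha>. (\<And>v. v < nv \<Longrightarrow> isU v \<Longrightarrow> \<alpha> v = U v) \<Longrightarrow> \<exists>i<mc. \<forall>j<2 * nv. lit i j \<longrightarrow> \<not> lit_true \<alpha> j"
      unfolding qbf_def by metis
    have "\<not> choosable_within (qbf_graph nv mc isU lit) (qbf_size nv mc) k"
      unfolding qbf_graph_def qbf_size_def
    proof (rule wire_graph_not_choosable[where ch = "conf_h nv isU U" and cv = "conf_v nv isU U"])
      fix col
      assume "\<And>X Y. X < 7 * (2 * nv + 2) \<Longrightarrow> Y < 7 * (mc + 1) \<Longrightarrow> col X Y \<in> {1..if lay_3 nv mc X Y then 3 else (2 :: nat)}"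
        "\<And>X Y. lay_h nv mc X Y \<Longrightarrow> (col X Y, col (Suc X) Y) \<noteq> conf_h nv isU U X Y"
        "\<And>X Y. lay_v nv mc isU lit X Y \<Longrightarrow> (col X Y, col X (Suc Y)) \<noteq> conf_v nv isU U X Y"
      with U show False by (rule no_conflict_coloring)
    qed (assumption | rule lay_h_bound lay_v_bound conf_range assms)+
    with c show False by simp
  qed
qed

lemma qbf_size_in: "qbf_size nv mc v \<in> {2, 3}"
  by (simp add: qbf_size_def wire_size_def cell_size_def)

lemma qbf_graph_choosable: "choosable (qbf_graph nv mc isU lit) (qbf_size nv mc) \<longleftrightarrow> qbf nv mc isU lit"
proof
  assume "choosable (qbf_graph nv mc isU lit) (qbf_size nv mc)"
  moreover have "\<forall>v \<in> pverts (qbf_graph nv mc isU lit). qbf_size nv mc v \<le> 3"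
    by (simp add: qbf_size_def wire_size_def cell_size_def)
  ultimately have "choosable_within (qbf_graph nv mc isU lit) (qbf_size nv mc) 3" unfolding choosable_def by blast
  then show "qbf nv mc isU lit" using qbf_graph_choosable_within[of 3] by simp
next
  assume "qbf nv mc isU lit"
  then show "choosable (qbf_graph nv mc isU lit) (qbf_size nv mc)"
    unfolding choosable_def qbf_graph_def qbf_size_def
    by (intro allI impI wire_graph_choosable lay_h_bound lay_v_bound qbf_conflict_colorable)
qed

lemma qbf_graph_instance: "(qbf_graph nv mc isU lit, qbf_size nv mc) \<in> ch_instances {2, 3}"
proof -
  have "pair_graph (qbf_graph nv mc isU lit)" unfolding qbf_graph_def by (rule pair_graph_wire)
  then show ?thesis using qbf_size_in by (auto simp: ch_instances_def qbf_graph_def wire_graph_def)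
qed

lemma subgrid_qbf_graph: "subgrid (qbf_graph nv mc isU lit)"
  unfolding qbf_graph_def by (rule subgrid_wire)

lemma degree_condition_qbf_graph: "degree_condition (qbf_graph nv mc isU lit) (qbf_size nv mc)"
  unfolding qbf_graph_def qbf_size_def
  by (rule wire_graph_degree_condition) (erule lay_h_bound | erule lay_v_bound | rule lay_degree)+

section \<open>Composition of definable functions\<close>

lemma eval_append: "eval x (env @ env') (fold (\<lambda>_. lift (length env)) env' e) = eval x env e"
proof (induction env' arbitrary: e)
  case (Cons v env')
  have "eval x (env @ v # env') (fold (\<lambda>_. lift (length env)) env' (lift (length env) e)) = eval x env e"
    if "\<And>e. eval x (env @ env') (fold (\<lambda>_. lift (length env)) env' e) = eval x env e"
  proof -
    have "fold (\<lambda>_. lift (length env)) env' (lift (length env) e) = lift (length env) (fold (\<lambda>_. lift (length env)) env' e)"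
      by (induction env' arbitrary: e) auto
    then show ?thesis using eval_lift[of x env v env'] that by simp
  qed
  then show ?case using Cons.IH by simp
qed simp

lemma D_append: "definable inp us f \<Longrightarrow> definable inp (us @ vs) f"
proof -
  assume "definable inp us f"
  then obtain e where e: "\<And>s. f s = eval (inp s) (map (\<lambda>v. v s) us) e" unfolding definable_def by blast
  define e' where "e' = fold (\<lambda>_. lift (length us)) vs e"
  have "fold (\<lambda>_. lift (length us)) (map (\<lambda>v. v s) vs) e = e'" for s
    unfolding e'_def fold_map by (simp add: o_def)
  then have "f s = eval (inp s) (map (\<lambda>v. v s) (us @ vs)) e'" for s
    using e[of s] eval_append[of "inp s" "map (\<lambda>v. v s) us" "map (\<lambda>v. v s) vs" e] by simp
  then show ?thesis unfolding definable_def by blast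
qed

lemma D_comp: "definable inp us f \<Longrightarrow> definable (\<lambda>s. inp (h s)) (map (\<lambda>u s. u (h s)) us) (\<lambda>s. f (h s))"
  unfolding definable_def by (auto simp: o_def)

lemma D_snd [D_intros]: "definable inp (snd # vs) snd"
  by (rule D_var) simp

definition definable0 :: "(bool list \<Rightarrow> nat) \<Rightarrow> bool" where
  "definable0 N \<longleftrightarrow> definable (\<lambda>x. x) [] N"

definition definable1 :: "(bool list \<Rightarrow> nat \<Rightarrow> nat) \<Rightarrow> bool" where
  "definable1 F \<longleftrightarrow> definable fst [snd] (\<lambda>p. F (fst p) (snd p))"

definition definable2 :: "(bool list \<Rightarrow> nat \<Rightarrow> nat \<Rightarrow> nat) \<Rightarrow> bool" where
  "definable2 F \<longleftrightarrow> definable (\<lambda>p. fst (fst p)) [snd, \<lambda>p. snd (fst p)] (\<lambda>p. F (fst (fst p)) (snd (fst p)) (snd p))"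

lemma D_lift0: "definable0 N \<Longrightarrow> definable inp vs (\<lambda>s. N (inp s))"
  unfolding definable0_def using D_append[OF D_comp[of "\<lambda>x. x" "[]" N inp], of vs] by simp

text \<open>The language has no local definitions, so the value is bound by a sum over all numbers
  up to \<open>f s\<close> in which only the summand at \<open>f s\<close> survives.\<close>

lemma D_let:
  assumes "definable inp vs f" "definable (\<lambda>p. inp (fst p)) (snd # map (\<lambda>v p. v (fst p)) vs) (\<lambda>p. F (fst p) (snd p))"
  shows "definable inp vs (\<lambda>s. F s (f s))"
proof -
  have "definable inp vs (\<lambda>s. \<Sum>v<Suc (f s). of_bool (v = f s) * F s v)"
    by (rule D_sum[OF D_Suc[OF assms(1)] D_mult[OF D_eq[OF D_snd D_weaken[OF assms(1)]] assms(2)]])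
  then show ?thesis by (rule D_cong) (simp add: of_bool_def)
qed

lemma D_lift1:
  assumes "definable1 F" "definable inp vs f"
  shows "definable inp vs (\<lambda>s. F (inp s) (f s))"
proof (rule D_let[OF assms(2)])
  show "definable (\<lambda>p. inp (fst p)) (snd # map (\<lambda>v p. v (fst p)) vs) (\<lambda>p. F (inp (fst p)) (snd p))"
    using D_append[OF D_comp[OF assms(1)[unfolded definable1_def], of "\<lambda>p. (inp (fst p), snd p)"]] by simp
qed

lemma D_lift2:
  assumes "definable2 F" "definable inp vs f" "definable inp vs g"
  shows "definable inp vs (\<lambda>s. F (inp s) (f s) (g s))"
proof (rule D_let[OF assms(2)], rule D_let[OF D_weaken[OF assms(3)]])
  have "definable (\<lambda>p. inp (fst (fst p))) [snd, \<lambda>p. snd (fst p)] (\<lambda>p. F (inp (fst (fst p))) (snd (fst p)) (snd p))"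
    using D_comp[OF assms(1)[unfolded definable2_def], of "\<lambda>p. ((inp (fst (fst p)), snd (fst p)), snd p)"] by simp
  from D_append[OF this]
  show "definable (\<lambda>p. inp (fst (fst p))) (snd # map (\<lambda>v p. v (fst p)) (snd # map (\<lambda>v p. v (fst p)) vs))
     (\<lambda>p. F (inp (fst (fst p))) (snd (fst p)) (snd p))" by simp
qed

lemma D_mem:
  assumes "definable inp vs f" "definable inp vs g"
  shows "definable inp vs (\<lambda>s. of_bool ((f s, g s) \<in> set xs))"
proof (induction xs)
  case (Cons p xs)
  have "definable inp vs (\<lambda>s. of_bool ((f s = fst p \<and> g s = snd p) \<or> (f s, g s) \<in> set xs))"
    by (intro D_disj D_conj D_eq assms D_const Cons.IH)
  then show ?case by (rule D_cong) (auto simp: prod_eq_iff)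
qed (simp add: D_const)

lemma D_even [D_intros]: "definable inp vs f \<Longrightarrow> definable inp vs (\<lambda>s. of_bool (even (f s)))"
  unfolding even_iff_mod_2_eq_zero by (intro D_intros)

section \<open>Codes of instances\<close>

text \<open>The position at which the unary code of \<open>f v\<close> begins; \<open>Suc\<close>
  accounts for the terminating \<open>False\<close>.\<close>

definition unary_pos :: "(nat \<Rightarrow> nat) \<Rightarrow> nat \<Rightarrow> nat" where
  "unary_pos f v = (\<Sum>u<v. Suc (f u))"

lemma unary_pos_mono: "u < v \<Longrightarrow> unary_pos f u + f u < unary_pos f v"
proof (induction v)
  case (Suc v)
  then show ?case by (cases "u = v") (auto simp: unary_pos_def)
qed simp

lemma concat_unary: "concat (map (\<lambda>v. unary (f v)) [0..<n]) =
  map (\<lambda>r. \<exists>v<n. unary_pos f v \<le> r \<and> r < unary_pos f v + f v) [0..<unary_pos f n]"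
proof (induction n)
  case (Suc n)
  have p: "unary_pos f (Suc n) = unary_pos f n + Suc (f n)" by (simp add: unary_pos_def)
  have less: "v < n \<Longrightarrow> r < unary_pos f v + f v \<Longrightarrow> r < unary_pos f n" for v r
    using unary_pos_mono[of v n f] by simp
  have m1: "map (\<lambda>r. \<exists>v<Suc n. unary_pos f v \<le> r \<and> r < unary_pos f v + f v) [0..<unary_pos f n] =
    map (\<lambda>r. \<exists>v<n. unary_pos f v \<le> r \<and> r < unary_pos f v + f v) [0..<unary_pos f n]"
    by (auto simp: less_Suc_eq)
  have m2: "map (\<lambda>r. \<exists>v<Suc n. unary_pos f v \<le> r \<and> r < unary_pos f v + f v) [unary_pos f n..<unary_pos f n + Suc (f n)] =
    unary (f n)"
  proof (rule nth_equalityI)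
    fix i assume "i < length (map (\<lambda>r. \<exists>v<Suc n. unary_pos f v \<le> r \<and> r < unary_pos f v + f v) [unary_pos f n..<unary_pos f n + Suc (f n)])"
    then have i: "i < Suc (f n)" by simp
    have "\<not> (\<exists>v<n. unary_pos f v \<le> unary_pos f n + i \<and> unary_pos f n + i < unary_pos f v + f v)"
      using less by (meson not_add_less1)
    then have "(\<exists>v<Suc n. unary_pos f v \<le> unary_pos f n + i \<and> unary_pos f n + i < unary_pos f v + f v) \<longleftrightarrow> i < f n"
      by (auto simp: less_Suc_eq)
    then show "map (\<lambda>r. \<exists>v<Suc n. unary_pos f v \<le> r \<and> r < unary_pos f v + f v) [unary_pos f n..<unary_pos f n + Suc (f n)] ! i = unary (f n) ! i"
      using i by (auto simp: unary_def nth_append simp del: upt_Suc)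
  qed (simp add: unary_def)
  have "[0..<unary_pos f (Suc n)] = [0..<unary_pos f n] @ [unary_pos f n..<unary_pos f n + Suc (f n)]"
    unfolding p by (rule upt_add_eq_append) simp
  then have "map (\<lambda>r. \<exists>v<Suc n. unary_pos f v \<le> r \<and> r < unary_pos f v + f v) [0..<unary_pos f (Suc n)] =
    concat (map (\<lambda>v. unary (f v)) [0..<n]) @ unary (f n)"
    by (simp only: map_append m1 m2 Suc.IH)
  then show ?case by simp
qed (simp add: unary_pos_def)

lemma map_upt_shift: "map P [a..<a + b] = map (\<lambda>i. P (a + i)) [0..<b]"
  by (rule nth_equalityI) auto

lemma concat_rows: "concat (map (\<lambda>u. map (P u) [0..<n]) [0..<m]) = map (\<lambda>i. P (i div n) (i mod n)) [0..<m * n]"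
proof (induction m)
  case (Suc m)
  have "map (\<lambda>i. P (i div n) (i mod n)) [m * n..<m * n + n] = map (P m) [0..<n]"
    unfolding map_upt_shift by (rule nth_equalityI) auto
  then show ?case using Suc upt_add_eq_append[of 0 "m * n" n] by (simp add: add.commute)
qed simp

text \<open>The language describes a string only through a formula for the bit at a given position,
  so the concatenation in \<open>encode\<close> is unfolded into positions.\<close>

definition code_bit :: "nat \<Rightarrow> (nat \<Rightarrow> nat \<Rightarrow> bool) \<Rightarrow> (nat \<Rightarrow> nat) \<Rightarrow> nat \<Rightarrow> bool" where
  "code_bit n arc f i \<longleftrightarrow> (if i < n + 1 then i < n
     else if i < n + 1 + n * n then arc ((i - (n + 1)) div n) ((i - (n + 1)) mod n)
     else \<exists>v<n. unary_pos f v \<le> i - (n + 1 + n * n) \<and> i - (n + 1 + n * n) < unary_pos f v + f v)"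

lemma encode_eq_bits:
  assumes "card (pverts G) = n"
  shows "encode (G, f) = map (code_bit n (\<lambda>u v. (u, v) \<in> parcs G) f) [0..<n + 1 + n * n + unary_pos f n]"
proof -
  let ?b = "code_bit n (\<lambda>u v. (u, v) \<in> parcs G) f"
  have "map ?b [0..<n + 1] = unary n"
    by (rule nth_equalityI) (auto simp: unary_def code_bit_def nth_append simp del: upt_Suc)
  moreover have "map ?b [n + 1..<n + 1 + n * n] = concat (map (\<lambda>u. map (\<lambda>v. (u, v) \<in> parcs G) [0..<n]) [0..<n])"
    unfolding concat_rows map_upt_shift by (rule map_cong) (auto simp: code_bit_def)
  moreover have "map ?b [n + 1 + n * n..<n + 1 + n * n + unary_pos f n] = concat (map (\<lambda>v. unary (f v)) [0..<n])"
    unfolding concat_unary map_upt_shift by (rule map_cong) (auto simp: code_bit_def)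
  moreover have "[0..<n + 1 + n * n + unary_pos f n] = [0..<n + 1] @ [n + 1..<n + 1 + n * n] @ [n + 1 + n * n..<n + 1 + n * n + unary_pos f n]"
    using upt_add_eq_append[of 0 "n + 1" "n * n"] upt_add_eq_append[of 0 "n + 1 + n * n" "unary_pos f n"]
    by (simp only: le0 append_assoc simp_thms)
  ultimately show ?thesis using assms by (simp add: Let_def del: upt_Suc)
qed

lemma D_lay_h:
  assumes "definable inp vs N" "definable inp vs M" "definable inp vs f" "definable inp vs g"
  shows "definable inp vs (\<lambda>s. of_bool (lay_h (N s) (M s) (f s) (g s)))"
  unfolding lay_h_def Let_def prod.inject by (intro D_intros D_mem assms)

lemma D_lay_v:
  assumes "definable1 (\<lambda>x v. of_bool (isU x v))" "definable2 (\<lambda>x i j. of_bool (lit x i j))"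
    "definable inp vs N" "definable inp vs M" "definable inp vs f" "definable inp vs g"
  shows "definable inp vs (\<lambda>s. of_bool (lay_v (N s) (M s) (isU (inp s)) (lit (inp s)) (f s) (g s)))"
  unfolding lay_v_def Let_def prod.inject
  by (intro D_intros D_mem D_lift1[OF assms(1)] D_lift2[OF assms(2)] assms(3-6))

lemma D_lay_3:
  assumes "definable inp vs N" "definable inp vs M" "definable inp vs f" "definable inp vs g"
  shows "definable inp vs (\<lambda>s. of_bool (lay_3 (N s) (M s) (f s) (g s)))"
  unfolding lay_3_def Let_def prod.inject by (intro D_intros D_mem assms)

lemma D_wire_cell:
  assumes "definable inp vs f" "definable inp vs g"
  shows "definable inp vs (\<lambda>s. of_bool (wire_cell (f s) (g s)))"
  unfolding wire_cell_def insert_iff empty_iff simp_thms by (intro D_intros assms)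

theorem polytime_encode_qbf:
  assumes nv: "definable0 nv" and mc: "definable0 mc"
    and isU: "definable1 (\<lambda>x v. of_bool (isU x v))" and lit: "definable2 (\<lambda>x i j. of_bool (lit x i j))"
  shows "polytime (\<lambda>x. encode (qbf_graph (nv x) (mc x) (isU x) (lit x), qbf_size (nv x) (mc x)))"
proof -
  note nv' = D_lift0[OF nv] and mc' = D_lift0[OF mc]
  define H where "H x = 7 * (mc x + 1)" for x
  define W where "W x = 7 * (2 * nv x + 2)" for x
  define n where "n x = 5 * W x * (5 * H x)" for x
  have dH: "definable inp vs (\<lambda>s. H (inp s))" and dn: "definable inp vs (\<lambda>s. n (inp s))" for inp :: "'s \<Rightarrow> _" and vs
    unfolding n_def H_def W_def by (intro D_intros nv' mc')+
  define present where "present x = cell_present (lay_h (nv x) (mc x)) (lay_v (nv x) (mc x) (isU x) (lit x))" for x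
  have dp: "definable inp vs (\<lambda>s. of_bool (present (inp s) (f s) (g s)))" if "definable inp vs f" "definable inp vs g"
    for inp :: "'s \<Rightarrow> _" and vs f g
    unfolding present_def cell_present_def
    by (intro D_intros D_wire_cell D_lay_h D_lay_v isU lit nv' mc' that)
  define arc where "arc x u v \<longleftrightarrow> u < n x \<and> v < n x \<and>
    wire_arc (5 * H x) (lay_h (nv x) (mc x)) (lay_v (nv x) (mc x) (isU x) (lit x)) u v" for x u v
  have da: "definable inp vs (\<lambda>s. of_bool (arc (inp s) (f s) (g s)))" if "definable inp vs f" "definable inp vs g"
    for inp :: "'s \<Rightarrow> _" and vs f g
    unfolding arc_def wire_arc_def present_def[symmetric] cell_adj_def fst_conv snd_conv
    by (intro D_intros dp dn dH that)
  have ds: "definable inp vs (\<lambda>s. qbf_size (nv (inp s)) (mc (inp s)) (f s))" if "definable inp vs f"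
    for inp :: "'s \<Rightarrow> _" and vs f
    unfolding qbf_size_def wire_size_def cell_size_def by (intro D_intros D_lay_3 nv' mc' that)
  have dpos: "definable inp vs (\<lambda>s. unary_pos (qbf_size (nv (inp s)) (mc (inp s))) (f s))" if "definable inp vs f"
    for inp :: "'s \<Rightarrow> _" and vs f
    unfolding unary_pos_def by (intro D_intros ds that)
  have G: "card (pverts (qbf_graph (nv x) (mc x) (isU x) (lit x))) = n x"
    "(u, v) \<in> parcs (qbf_graph (nv x) (mc x) (isU x) (lit x)) \<longleftrightarrow> arc x u v" for x u v
    by (simp_all add: qbf_graph_def wire_graph_def n_def W_def H_def arc_def)
  define P where "P x = code_bit (n x) (arc x) (qbf_size (nv x) (mc x))" for x
  have "encode (qbf_graph (nv x) (mc x) (isU x) (lit x), qbf_size (nv x) (mc x)) =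
      map (P x) [0..<n x + 1 + n x * n x + unary_pos (qbf_size (nv x) (mc x)) (n x)]" for x
    unfolding P_def encode_eq_bits[OF G(1)] G(2) ..
  moreover have "definable (\<lambda>x. x) [] (\<lambda>x. n x + 1 + n x * n x + unary_pos (qbf_size (nv x) (mc x)) (n x))"
    by (intro D_intros dpos dn)
  moreover have "definable fst [snd] (\<lambda>p. of_bool (P (fst p) (snd p)))"
    unfolding P_def code_bit_def by (intro D_intros da dpos ds dn D_weaken D_snd)
  ultimately show ?thesis using polytime_definable[of _ P] by presburger
qed

section \<open>Uniform families of clauses\<close>

type_synonym uniform = "bool list \<Rightarrow> nat \<Rightarrow> nat \<Rightarrow> nat \<Rightarrow> nat"
text \<open>A guard and a list of signed variables, standing for one clause for every triple
  \<open>t, k, k'\<close> at which the guard is nonzero.\<close>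

type_synonym clause_rule = "uniform \<times> (bool \<times> uniform) list"

definition definable3 :: "uniform \<Rightarrow> bool" where
  "definable3 F \<longleftrightarrow> definable (\<lambda>p. fst (fst (fst p))) [snd, \<lambda>p. snd (fst p), \<lambda>p. snd (fst (fst p))]
     (\<lambda>p. F (fst (fst (fst p))) (snd (fst (fst p))) (snd (fst p)) (snd p))"

lemma D_lift3:
  assumes "definable3 F" "definable inp vs f" "definable inp vs g" "definable inp vs h"
  shows "definable inp vs (\<lambda>s. F (inp s) (f s) (g s) (h s))"
proof (rule D_let[OF assms(2)], rule D_let[OF D_weaken[OF assms(3)]], rule D_let[OF D_weaken[OF D_weaken[OF assms(4)]]])
  have "definable (\<lambda>p. inp (fst (fst (fst p)))) [snd, \<lambda>p. snd (fst p), \<lambda>p. snd (fst (fst p))]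
      (\<lambda>p. F (inp (fst (fst (fst p)))) (snd (fst (fst p))) (snd (fst p)) (snd p))"
    using D_comp[OF assms(1)[unfolded definable3_def],
        of "\<lambda>p. (((inp (fst (fst (fst p))), snd (fst (fst p))), snd (fst p)), snd p)"] by simp
  from D_append[OF this]
  show "definable (\<lambda>p. inp (fst (fst (fst p))))
     (snd # map (\<lambda>v p. v (fst p)) (snd # map (\<lambda>v p. v (fst p)) (snd # map (\<lambda>v p. v (fst p)) vs)))
     (\<lambda>p. F (inp (fst (fst (fst p)))) (snd (fst (fst p))) (snd (fst p)) (snd p))" by simp
qed

lemma D_list_ex:
  assumes "\<And>v. v \<in> set ls \<Longrightarrow> definable inp vs (\<lambda>s. of_bool (P v s))"
  shows "definable inp vs (\<lambda>s. of_bool (\<exists>v\<in>set ls. P v s))"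
  using assms
proof (induction ls)
  case (Cons v ls)
  have "definable inp vs (\<lambda>s. of_bool (P v s \<or> (\<exists>v\<in>set ls. P v s)))"
    using Cons by (intro D_disj) auto
  then show ?case by simp
qed (simp add: D_const)

lemma D_sum_list:
  assumes "\<And>v. v \<in> set ls \<Longrightarrow> definable inp vs (F v)"
  shows "definable inp vs (\<lambda>s. \<Sum>v\<leftarrow>ls. F v s)"
  using assms
proof (induction ls)
  case (Cons v ls)
  have "definable inp vs (\<lambda>s. F v s + (\<Sum>v\<leftarrow>ls. F v s))"
    using Cons by (intro D_add) auto
  then show ?case by simp
qed (simp add: D_const)

definition rules_sat :: "clause_rule list \<Rightarrow> nat \<Rightarrow> bool list \<Rightarrow> (nat \<Rightarrow> bool) \<Rightarrow> bool" where
  "rules_sat rs N x \<alpha> \<longleftrightarrow> (\<forall>(g, ls) \<in> set rs. \<forall>t<N. \<forall>k<N. \<forall>k'<N. g x t k k' \<noteq> 0 \<longrightarrow> (\<exists>(b, v) \<in> set ls. \<alpha> (v x t k k') = b))"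

definition rules_definable :: "clause_rule list \<Rightarrow> bool" where
  "rules_definable rs \<longleftrightarrow> (\<forall>(g, ls) \<in> set rs. definable3 g \<and> (\<forall>(b, v) \<in> set ls. definable3 v))"

text \<open>A crude bound: the sum of all variable numbers that the rules can produce.
  \<open>Suc\<close> guarantees a variable for the padding clauses.\<close>

definition rules_vars :: "clause_rule list \<Rightarrow> (bool list \<Rightarrow> nat) \<Rightarrow> bool list \<Rightarrow> nat" where
  "rules_vars rs N x = Suc (\<Sum>r\<leftarrow>rs. \<Sum>l\<leftarrow>snd r. \<Sum>t<N x. \<Sum>k<N x. \<Sum>k'<N x. snd l x t k k')"

text \<open>The number of a clause encodes the rule and its three parameters in mixed radix. Where
  the guard fails, the clause consists of the literals \<open>0\<close> and \<open>1\<close>, a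
  variable and its negation, so that the number of clauses is a plain product.\<close>

definition rules_lit :: "clause_rule list \<Rightarrow> (bool list \<Rightarrow> nat) \<Rightarrow> bool list \<Rightarrow> nat \<Rightarrow> nat \<Rightarrow> bool" where
  "rules_lit rs N x i j \<longleftrightarrow> (\<exists>d<length rs. i mod length rs = d \<and>
     (if fst (rs ! d) x (i div length rs mod N x) (i div length rs div N x mod N x) (i div length rs div N x div N x) \<noteq> 0
      then \<exists>l\<in>set (snd (rs ! d)). j = 2 * snd l x (i div length rs mod N x) (i div length rs div N x mod N x) (i div length rs div N x div N x) + of_bool (\<not> fst l)
      else j < 2))"

lemma D_rules_vars:
  assumes "rules_definable rs" "definable0 N"
  shows "definable0 (rules_vars rs N)"
proof -
  have "definable (\<lambda>x. x) [] (\<lambda>x. \<Sum>t<N x. \<Sum>k<N x. \<Sum>k'<N x. snd l x t k k')" if "r \<in> set rs" "l \<in> set (snd r)" for r l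
  proof -
    have "definable3 (snd l)" using assms(1) that unfolding rules_definable_def by fastforce
    then show ?thesis by (intro D_intros D_lift0[OF assms(2)] D_lift3[of "snd l"] D_weaken)
  qed
  then show ?thesis unfolding definable0_def rules_vars_def by (intro D_Suc D_sum_list)
qed

lemma D_rules_lit:
  assumes "rules_definable rs" "definable0 N"
  shows "definable2 (\<lambda>x i j. of_bool (rules_lit rs N x i j))"
proof -
  have i: "definable (\<lambda>p. fst (fst p)) [snd, \<lambda>p. snd (fst p)] (\<lambda>p. snd (fst p))"
    and j: "definable (\<lambda>p. fst (fst p)) [snd, \<lambda>p. snd (fst p)] snd" by (rule D_var, simp)+
  have g: "definable3 (fst (rs ! d))" if "d < length rs" for d
    using assms(1) nth_mem[OF that] unfolding rules_definable_def by fastforce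
  have v: "definable3 (snd l)" if "d < length rs" "l \<in> set (snd (rs ! d))" for d l
    using assms(1) nth_mem[OF that(1)] that(2) unfolding rules_definable_def by fastforce
  show ?thesis
    unfolding definable2_def rules_lit_def
    by (intro D_finite_ex D_conj D_if_bool D_eq D_not D_less D_list_ex D_add D_mult D_div D_mod D_const
        D_lift0[OF assms(2)] i j; (rule D_lift3[OF g] D_lift3[OF v]; assumption?)?; (intro D_div D_mod D_const i D_lift0[OF assms(2)])?)
qed

lemma mixed_radix_less:
  fixes a A b B :: nat
  assumes "a < A" "b < B"
  shows "a + A * b < A * B"
proof -
  have "A * Suc b \<le> A * B" using assms(2) by (intro mult_le_mono2) simp
  then show ?thesis using assms(1) by simp
qed

lemma mixed_radix_div_mod:
  fixes a A b :: nat
  assumes "a < A"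
  shows "(a + A * b) div A = b" "(a + A * b) mod A = a"
  using assms by simp_all

lemma rules_vars_bound:
  assumes that: "(g, ls) \<in> set rs" "(b, v) \<in> set ls" "t < N x" "k < N x" "k' < N x"
  shows "v x t k k' < rules_vars rs N x"
proof -
  have "v x t k k' \<le> (\<Sum>k'<N x. v x t k k')" using that(5) by (intro member_le_sum) auto
  also have "\<dots> \<le> (\<Sum>k<N x. \<Sum>k'<N x. v x t k k')" using that(4) by (intro member_le_sum[where f = "\<lambda>k. \<Sum>k'<N x. v x t k k'"]) auto
  also have "\<dots> \<le> (\<Sum>t<N x. \<Sum>k<N x. \<Sum>k'<N x. v x t k k')" using that(3) by (intro member_le_sum[where f = "\<lambda>t. \<Sum>k<N x. \<Sum>k'<N x. v x t k k'"]) auto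
  also have "\<dots> = (\<lambda>l. \<Sum>t<N x. \<Sum>k<N x. \<Sum>k'<N x. snd l x t k k') (b, v)" by simp
  also have "\<dots> \<le> (\<Sum>l\<leftarrow>ls. \<Sum>t<N x. \<Sum>k<N x. \<Sum>k'<N x. snd l x t k k')"
    using that(2) by (intro member_le_sum_list) force+
  also have "\<dots> = (\<lambda>r. \<Sum>l\<leftarrow>snd r. \<Sum>t<N x. \<Sum>k<N x. \<Sum>k'<N x. snd l x t k k') (g, ls)" by simp
  also have "\<dots> \<le> (\<Sum>r\<leftarrow>rs. \<Sum>l\<leftarrow>snd r. \<Sum>t<N x. \<Sum>k<N x. \<Sum>k'<N x. snd l x t k k')"
    using that(1) by (intro member_le_sum_list) force+
  finally show ?thesis by (simp add: rules_vars_def)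
qed

lemma rules_sat_iff:
  "(\<forall>i<length rs * (N x * (N x * N x)). \<exists>j<2 * rules_vars rs N x. rules_lit rs N x i j \<and> lit_true \<alpha> j) \<longleftrightarrow> rules_sat rs (N x) x \<alpha>"
    (is "?L \<longleftrightarrow> ?R")
proof -
  let ?D = "length rs" and ?N = "N x"
  have lt: "lit_true \<alpha> (2 * v + of_bool (\<not> b)) \<longleftrightarrow> \<alpha> v = b" for v b
    by (auto simp: lit_true_def)
  have code: "(d + ?D * (t + ?N * (k + ?N * k'))) mod ?D = d" "(d + ?D * (t + ?N * (k + ?N * k'))) div ?D mod ?N = t"
    "(d + ?D * (t + ?N * (k + ?N * k'))) div ?D div ?N mod ?N = k" "(d + ?D * (t + ?N * (k + ?N * k'))) div ?D div ?N div ?N = k'"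
    "d + ?D * (t + ?N * (k + ?N * k')) < ?D * (?N * (?N * ?N))"
    if "d < ?D" "t < ?N" "k < ?N" "k' < ?N" for d t k k'
  proof -
    have "k + ?N * k' < ?N * ?N" by (rule mixed_radix_less[OF that(3,4)])
    then have "t + ?N * (k + ?N * k') < ?N * (?N * ?N)" by (rule mixed_radix_less[OF that(2)])
    then show "d + ?D * (t + ?N * (k + ?N * k')) < ?D * (?N * (?N * ?N))" by (rule mixed_radix_less[OF that(1)])
  qed (simp_all only: mixed_radix_div_mod[OF that(1)] mixed_radix_div_mod[OF that(2)] mixed_radix_div_mod[OF that(3)])
  note bound = rules_vars_bound[where N = N]
  have clause: "(\<exists>j<2 * rules_vars rs N x. rules_lit rs N x i j \<and> lit_true \<alpha> j) \<longleftrightarrow>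
      (fst (rs ! d) x t k k' \<noteq> 0 \<longrightarrow> (\<exists>(b, v) \<in> set (snd (rs ! d)). \<alpha> (v x t k k') = b))"
    if i: "i mod ?D = d" "i div ?D mod ?N = t" "i div ?D div ?N mod ?N = k" "i div ?D div ?N div ?N = k'"
      and b: "d < ?D" "t < ?N" "k < ?N" "k' < ?N" for i d t k k'
  proof (cases "fst (rs ! d) x t k k' \<noteq> 0")
    case True
    have r: "rules_lit rs N x i j \<longleftrightarrow> (\<exists>l\<in>set (snd (rs ! d)). j = 2 * snd l x t k k' + of_bool (\<not> fst l))" for j
      unfolding rules_lit_def i using True b(1) by simp
    have "\<exists>j<2 * rules_vars rs N x. rules_lit rs N x i j \<and> lit_true \<alpha> j" if "(b', v) \<in> set (snd (rs ! d))" "\<alpha> (v x t k k') = b'" for b' v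
    proof (intro exI conjI)
      have "v x t k k' < rules_vars rs N x"
        by (rule bound[of "fst (rs ! d)" "snd (rs ! d)"]) (use that b in simp_all)
      then show "2 * v x t k k' + of_bool (\<not> b') < 2 * rules_vars rs N x" by simp
      show "rules_lit rs N x i (2 * v x t k k' + of_bool (\<not> b'))" unfolding r by (rule bexI[OF _ that(1)]) simp
      show "lit_true \<alpha> (2 * v x t k k' + of_bool (\<not> b'))" unfolding lt by (rule that(2))
    qed
    moreover have "\<exists>(b, v) \<in> set (snd (rs ! d)). \<alpha> (v x t k k') = b" if j: "rules_lit rs N x i j" "lit_true \<alpha> j" for j
    proof -
      obtain l where l: "l \<in> set (snd (rs ! d))" "j = 2 * snd l x t k k' + of_bool (\<not> fst l)" using j(1) unfolding r by blast
      then have "\<alpha> (snd l x t k k') = fst l" using j(2) lt by blast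
      then show ?thesis using l(1) by (intro bexI[of _ l]) (simp_all add: case_prod_beta)
    qed
    ultimately show ?thesis using True by blast
  next
    case False
    have r: "rules_lit rs N x i j \<longleftrightarrow> j < 2" for j
      unfolding rules_lit_def i using False b(1) by simp
    have "lit_true \<alpha> 0 \<or> lit_true \<alpha> 1" by (simp add: lit_true_def)
    moreover have "0 < 2 * rules_vars rs N x" "1 < 2 * rules_vars rs N x" by (simp_all add: rules_vars_def)
    ultimately have "\<exists>j<2 * rules_vars rs N x. rules_lit rs N x i j \<and> lit_true \<alpha> j" unfolding r by (metis one_less_numeral_iff semiring_norm(76) zero_less_numeral)
    then show ?thesis using False by blast
  qed
  show ?thesis
  proof
    assume L: ?L
    show ?R unfolding rules_sat_def
    proof (intro ballI, unfold split_paired_all case_prod_conv, intro allI impI)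
      fix g ls t k k' assume r: "(g, ls) \<in> set rs" and b: "t < ?N" "k < ?N" "k' < ?N" and gg: "g x t k k' \<noteq> 0"
      obtain d where d: "d < ?D" "rs ! d = (g, ls)" using r by (auto simp: in_set_conv_nth)
      show "\<exists>(b, v) \<in> set ls. \<alpha> (v x t k k') = b"
        using clause[OF code(1-4)[OF d(1) b] d(1) b] L[rule_format, OF code(5)[OF d(1) b]] gg unfolding d(2) by simp
    qed
  next
    assume R: ?R
    show ?L
    proof (intro allI impI)
      fix i assume i: "i < ?D * (?N * (?N * ?N))"
      define d t k k' where "d = i mod ?D" and "t = i div ?D mod ?N" and "k = i div ?D div ?N mod ?N" and "k' = i div ?D div ?N div ?N"
      have pos: "0 < ?D" "0 < ?N" using i by (auto intro!: gr0I)
      have b: "d < ?D" "t < ?N" "k < ?N" using pos by (simp_all add: d_def t_def k_def)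
      have "i div ?D < ?N * (?N * ?N)" using i by (simp add: less_mult_imp_div_less mult.commute)
      then have "i div ?D div ?N < ?N * ?N" by (simp add: less_mult_imp_div_less mult.commute)
      then have b4: "k' < ?N" unfolding k'_def by (simp add: less_mult_imp_div_less)
      have "rs ! d \<in> set rs" using b by simp
      then have "fst (rs ! d) x t k k' \<noteq> 0 \<longrightarrow> (\<exists>(b, v) \<in> set (snd (rs ! d)). \<alpha> (v x t k k') = b)"
        using R b b4 unfolding rules_sat_def by fastforce
      then show "\<exists>j<2 * rules_vars rs N x. rules_lit rs N x i j \<and> lit_true \<alpha> j"
        using clause[OF d_def[symmetric] t_def[symmetric] k_def[symmetric] k'_def[symmetric] b b4] by blast
    qed
  qed
qed

section \<open>Computations of Turing machines\<close>

text \<open>The halting state is made to idle: it rewrites the scanned symbols and moves no head.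
  The clauses can then treat all steps up to a fixed time alike.\<close>

definition next_action :: "tm \<Rightarrow> nat \<Rightarrow> nat list \<Rightarrow> nat \<times> (nat \<times> move) list" where
  "next_action M q as = (if q < num_states M then trans M q as else (q, map (\<lambda>a. (a, Stay)) as))"

lemma map2_act_Stay: "map2 act (map ((\<lambda>a. (a, Stay)) \<circ> scanned) ts) ts = ts"
proof (induction ts)
  case (Cons t ts)
  then show ?case by (cases t) simp
qed simp

lemma tm_step_next_action:
  "tm_step M (s, ts) = (fst (next_action M s (map scanned ts)), map2 act (snd (next_action M s (map scanned ts))) ts)"
proof (cases "s < num_states M")
  case True
  then show ?thesis by (simp only: tm_step.simps next_action_def if_True split_beta)
next
  case False
  then show ?thesis by (simp only: tm_step.simps next_action_def if_False fst_conv snd_conv map_map map2_act_Stay)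
qed

lemma next_action_wf:
  assumes "wf_tm M" "q \<le> num_states M" "length as = num_tapes M" "set as \<subseteq> {..<num_symbols M}"
  shows "fst (next_action M q as) \<le> num_states M" "length (snd (next_action M q as)) = num_tapes M"
    "\<tau> < num_tapes M \<Longrightarrow> fst (snd (next_action M q as) ! \<tau>) < num_symbols M"
proof -
  have "fst (next_action M q as) \<le> num_states M \<and> length (snd (next_action M q as)) = num_tapes M \<and>
    fst ` set (snd (next_action M q as)) \<subseteq> {..<num_symbols M}"
  proof (cases "q < num_states M")
    case True
    have "\<forall>s<num_states M. \<forall>as. length as = num_tapes M \<and> set as \<subseteq> {..<num_symbols M} \<longrightarrow>
        (case trans M s as of (s', acts) \<Rightarrow>
          s' \<le> num_states M \<and> length acts = num_tapes M \<and> fst ` set acts \<subseteq> {..<num_symbols M})"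
      using assms(1) unfolding wf_tm_def by (elim conjE)
    from this[rule_format, OF True conjI[OF assms(3,4)]] show ?thesis
      using True by (simp add: next_action_def case_prod_beta)
  next
    case False
    then show ?thesis using assms by (auto simp: next_action_def image_image)
  qed
  then show "fst (next_action M q as) \<le> num_states M" "length (snd (next_action M q as)) = num_tapes M"
    "\<tau> < num_tapes M \<Longrightarrow> fst (snd (next_action M q as) ! \<tau>) < num_symbols M"
    by (auto simp: subset_iff)
qed

definition run :: "tm \<Rightarrow> bool list \<Rightarrow> nat \<Rightarrow> config" where
  "run M w t = (tm_step M ^^ t) (initial_config M w)"

abbreviation "run_state M w t \<equiv> fst (run M w t)"
abbreviation "run_cell M w t \<tau> \<equiv> fst (snd (run M w t) ! \<tau>)"
abbreviation "run_head M w t \<tau> \<equiv> snd (snd (run M w t) ! \<tau>)"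

definition run_scan :: "tm \<Rightarrow> bool list \<Rightarrow> nat \<Rightarrow> nat list" where
  "run_scan M w t = map scanned (snd (run M w t))"

lemma scanned_def': "scanned t = fst t (snd t)"
  by (cases t) simp

lemma act_def': "act am t = ((fst t)(snd t := fst am), move_head (snd am) (snd t))"
  by (cases t; cases am) simp

lemma run_Suc: "run M w (Suc t) = (fst (next_action M (run_state M w t) (run_scan M w t)),
    map2 act (snd (next_action M (run_state M w t) (run_scan M w t))) (snd (run M w t)))"
  using tm_step_next_action[of M "run_state M w t" "snd (run M w t)"] by (simp add: run_def run_scan_def)

lemma move_head_bound: "\<bar>move_head m h\<bar> \<le> \<bar>h\<bar> + 1"
  by (cases m) auto

lemma set_scanned:
  assumes "\<And>i p. i < length ts \<Longrightarrow> fst (ts ! i) p < n"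
  shows "set (map scanned ts) \<subseteq> {..<n}"
proof
  fix a assume "a \<in> set (map scanned ts)"
  then obtain i where "i < length ts" "a = scanned (ts ! i)" by (metis in_set_conv_nth length_map nth_map)
  then show "a \<in> {..<n}" using assms by (simp add: scanned_def')
qed

lemma run_invariant:
  assumes "wf_tm M"
  shows "run_state M w t \<le> num_states M \<and> length (snd (run M w t)) = num_tapes M \<and>
    (\<forall>\<tau><num_tapes M. (\<forall>p. run_cell M w t \<tau> p < num_symbols M) \<and> \<bar>run_head M w t \<tau>\<bar> \<le> int t)"
proof (induction t)
  case 0
  have "3 \<le> num_symbols M" "1 \<le> num_tapes M" using assms by (auto simp: wf_tm_def)
  then show ?case
    by (auto simp: run_def initial_config_def input_tape_def bit_symbol_def nth_Cons split: nat.split)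
next
  case (Suc t)
  have l: "length (run_scan M w t) = num_tapes M" using Suc by (simp add: run_scan_def)
  have s: "set (run_scan M w t) \<subseteq> {..<num_symbols M}"
    unfolding run_scan_def by (rule set_scanned) (use Suc in simp)
  note n = next_action_wf[OF assms _ l s, of "run_state M w t"]
  have len: "length (snd (next_action M (run_state M w t) (run_scan M w t))) = num_tapes M" using n(2) Suc by blast
  have "(\<forall>p. run_cell M w (Suc t) \<tau> p < num_symbols M) \<and> \<bar>run_head M w (Suc t) \<tau>\<bar> \<le> int (Suc t)" if "\<tau> < num_tapes M" for \<tau>
  proof -
    have "fst (snd (next_action M (run_state M w t) (run_scan M w t)) ! \<tau>) < num_symbols M" using n(3) Suc that by blast
    moreover have "snd (run M w (Suc t)) ! \<tau> = act (snd (next_action M (run_state M w t) (run_scan M w t)) ! \<tau>) (snd (run M w t) ! \<tau>)"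
      using that Suc len by (simp add: run_Suc)
    moreover have "\<forall>p. run_cell M w t \<tau> p < num_symbols M" "\<bar>run_head M w t \<tau>\<bar> \<le> int t" using Suc that by blast+
    moreover note move_head_bound[of "snd (snd (next_action M (run_state M w t) (run_scan M w t)) ! \<tau>)" "run_head M w t \<tau>"]
    ultimately show ?thesis by (simp add: act_def')
  qed
  moreover have "run_state M w (Suc t) \<le> num_states M" using n(1) Suc by (simp add: run_Suc)
  moreover have "length (snd (run M w (Suc t))) = num_tapes M" using len Suc by (simp add: run_Suc)
  ultimately show ?case by blast
qed

lemma run_scan_wf:
  assumes "wf_tm M"
  shows "length (run_scan M w t) = num_tapes M" "set (run_scan M w t) \<subseteq> {..<num_symbols M}"
    "\<tau> < num_tapes M \<Longrightarrow> run_scan M w t ! \<tau> = run_cell M w t \<tau> (run_head M w t \<tau>)"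
proof -
  note i = run_invariant[OF assms, of w t]
  show "length (run_scan M w t) = num_tapes M" using i by (simp add: run_scan_def)
  show "set (run_scan M w t) \<subseteq> {..<num_symbols M}"
    unfolding run_scan_def by (rule set_scanned) (use i in simp)
  show "\<tau> < num_tapes M \<Longrightarrow> run_scan M w t ! \<tau> = run_cell M w t \<tau> (run_head M w t \<tau>)"
    using i by (simp add: run_scan_def scanned_def')
qed

lemma run_step:
  fixes w t
  assumes "wf_tm M" "\<tau> < num_tapes M"
  defines "a \<equiv> snd (next_action M (run_state M w t) (run_scan M w t)) ! \<tau>"
  shows "run_cell M w (Suc t) \<tau> = (run_cell M w t \<tau>)(run_head M w t \<tau> := fst a)"
    "run_head M w (Suc t) \<tau> = move_head (snd a) (run_head M w t \<tau>)"
proof -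
  have "length (snd (run M w t)) = num_tapes M" using run_invariant[OF assms(1)] by blast
  moreover have "length (snd (next_action M (run_state M w t) (run_scan M w t))) = num_tapes M"
    using next_action_wf(2)[OF assms(1) _ run_scan_wf(1,2)[OF assms(1)]] run_invariant[OF assms(1)] by blast
  ultimately have "snd (run M w (Suc t)) ! \<tau> = act a (snd (run M w t) ! \<tau>)"
    using assms(2) by (simp add: run_Suc a_def)
  then show "run_cell M w (Suc t) \<tau> = (run_cell M w t \<tau>)(run_head M w t \<tau> := fst a)"
    "run_head M w (Suc t) \<tau> = move_head (snd a) (run_head M w t \<tau>)" by (simp_all add: act_def')
qed

lemma run_init:
  assumes "wf_tm M" "\<tau> < num_tapes M"
  shows "run_state M w 0 = 0" "run_head M w 0 \<tau> = 0"
    "run_cell M w 0 \<tau> p = (if \<tau> = 0 \<and> 0 \<le> p \<and> p < int (length w) then bit_symbol (w ! nat p) else 0)"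
  using assms by (auto simp: run_def initial_config_def input_tape_def nth_Cons split: nat.split)

lemma run_halted:
  assumes "run_state M w t = num_states M"
  shows "run M w (t + d) = run M w t"
proof (induction d)
  case (Suc d)
  have "tm_step M (run M w t) = run M w t" using assms by (cases "run M w t") simp
  moreover have "run M w (Suc (t + d)) = tm_step M (run M w (t + d))" by (simp add: run_def)
  ultimately show ?case using Suc by simp
qed simp

lemma poly_mono_nat:
  fixes p :: "nat poly"
  assumes "m \<le> n"
  shows "poly p m \<le> poly p n"
  using assms by (induction p) (auto intro!: add_mono mult_mono)

lemma run_output:
  assumes wf: "wf_tm M" and out: "halted_with_output M ((tm_step M ^^ t) (initial_config M w)) [b]" and "t \<le> T"
  shows "run_cell M w T (num_tapes M - 1) 0 = bit_symbol b"
proof -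
  have "num_tapes M \<ge> 1" using wf by (auto simp: wf_tm_def)
  then have l: "snd (run M w t) \<noteq> []" "length (snd (run M w t)) = num_tapes M" using run_invariant[OF wf, of w t] by auto
  have "run_state M w t = num_states M" "fst (last (snd (run M w t))) 0 = bit_symbol b"
    using out by (auto simp: halted_with_output_def run_def Let_def)
  moreover from this(1) have "run M w T = run M w t" using run_halted[of M w t "T - t"] assms(3) by simp
  ultimately show ?thesis using l by (simp add: last_conv_nth)
qed

section \<open>The clauses of a computation\<close>

definition rule_sat :: "nat \<Rightarrow> bool list \<Rightarrow> (nat \<Rightarrow> bool) \<Rightarrow> clause_rule \<Rightarrow> bool" where
  "rule_sat N x \<alpha> r \<longleftrightarrow> (\<forall>t<N. \<forall>k<N. \<forall>k'<N. fst r x t k k' \<noteq> 0 \<longrightarrow> (\<exists>l \<in> set (snd r). \<alpha> (snd l x t k k') = fst l))"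

lemma rules_sat_all: "rules_sat rs N x \<alpha> \<longleftrightarrow> (\<forall>r \<in> set rs. rule_sat N x \<alpha> r)"
  by (simp add: rules_sat_def rule_sat_def case_prod_beta)

definition rule_definable :: "clause_rule \<Rightarrow> bool" where
  "rule_definable r \<longleftrightarrow> definable3 (fst r) \<and> (\<forall>l \<in> set (snd r). definable3 (snd l))"

lemma rules_definable_all: "rules_definable rs \<longleftrightarrow> (\<forall>r \<in> set rs. rule_definable r)"
  by (simp add: rules_definable_def rule_definable_def case_prod_beta)

fun move_index :: "move \<Rightarrow> nat \<Rightarrow> nat" where
  "move_index Go_Left k = k - 1"
| "move_index Stay k = k"
| "move_index Go_Right k = k + 1"

locale tableau =
  fixes M :: tm and p1 p2 p3 :: "nat poly"
  assumes wf: "wf_tm M"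
begin

definition tapes :: nat where "tapes = num_tapes M"

text \<open>A variable for the whole combination of state and scanned symbols lets the clauses of
  each tape refer to a complete transition by one literal.\<close>

definition situations :: "(nat \<times> nat list) list" where
  "situations = List.product [0..<Suc (num_states M)] (List.n_lists tapes [0..<num_symbols M])"

text \<open>Larger than every possible last argument of a variable, be it a state, the number of a
  situation, a symbol or a small constant.\<close>

definition base_a :: nat where "base_a = num_states M + length situations + num_symbols M + 3"
definition base_c :: nat where "base_c = 4 + 3 * tapes"
definition y_max :: "bool list \<Rightarrow> nat" where "y_max x = poly p1 (length x)"
text \<open>Pairing doubles its first component and adds two bits, so
  \<open>str_pair (str_pair x y) z\<close> has
  \<open>4 * length x + 4 + 2 * length y + 2 + length z\<close> bits.\<close>

definition w_max :: "bool list \<Rightarrow> nat" where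
  "w_max x = 4 * length x + 2 * y_max x + 6 + poly p2 (2 * length x + 2 + y_max x)"
text \<open>Enough for the machine to halt and for the input to fit into the tableau. A head moves
  at most one cell per step, so the cells from \<open>- time x\<close> to \<open>time x + 1\<close>
  suffice, which gives \<open>width\<close>.\<close>

definition time :: "bool list \<Rightarrow> nat" where "time x = poly p3 (w_max x) + w_max x + 1"
definition width :: "bool list \<Rightarrow> nat" where "width x = 2 * time x + 2"

text \<open>Kinds of variables: \<open>0\<close> state, \<open>1\<close> situation, \<open>2\<close> presence and value of the bits of \<open>y\<close>, \<open>3\<close> lower
  bounds for the length of \<open>y\<close>; then for every tape the head position, the contents of a cell, and
  the scanned symbol. Cell \<open>k\<close> of the tableau is cell \<open>k - time x\<close> of the tape.\<close>

definition var :: "bool list \<Rightarrow> nat \<Rightarrow> nat \<Rightarrow> nat \<Rightarrow> nat \<Rightarrow> nat" where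
  "var x t c k a = ((t * base_c + c) * width x + k) * base_a + a"

abbreviation "hd_kind \<tau> \<equiv> 4 + \<tau>"
abbreviation "cell_kind \<tau> \<equiv> 4 + tapes + \<tau>"
abbreviation "scan_kind \<tau> \<equiv> 4 + 2 * tapes + \<tau>"

text \<open>In the nested pair every bit of \<open>x\<close> appears four times, and the separator
  behind \<open>x\<close> appears with doubled bits as
  \<open>False, False, True, True\<close>.\<close>

definition fixed_bit :: "bool list \<Rightarrow> nat \<Rightarrow> bool" where
  "fixed_bit x k \<longleftrightarrow> (if k < 4 * length x then bit_at x (k div 4) else 4 * length x + 2 \<le> k)"

definition y_cell :: "bool list \<Rightarrow> nat \<Rightarrow> nat" where
  "y_cell x k = time x + (4 * length x + 4 + 2 * k)"

text \<open>Offsets \<open>0\<close> and \<open>1\<close> behind the bits of \<open>y\<close> are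
  the outer separator; offset \<open>2\<close> stands for the first cell behind the longest
  admissible \<open>z\<close>.\<close>

definition end_offset :: "nat \<Rightarrow> bool list \<Rightarrow> nat \<Rightarrow> nat" where
  "end_offset i x k = (if i < 2 then i else 2 + poly p2 (2 * length x + 2 + k))"

definition r_state :: clause_rule where
  "r_state = (\<lambda>x t k k'. 1, [(True, \<lambda>x t k k'. var x 0 0 0 0)])"
definition r_head :: "nat \<Rightarrow> clause_rule" where
  "r_head \<tau> = (\<lambda>x t k k'. 1, [(True, \<lambda>x t k k'. var x 0 (hd_kind \<tau>) (time x) 0)])"
definition r_blank :: "nat \<Rightarrow> clause_rule" where
  "r_blank \<tau> = (\<lambda>x t k k'. 1, [(True, \<lambda>x t k k'. var x 0 (cell_kind \<tau>) k 0)])"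
definition r_left :: clause_rule where
  "r_left = (\<lambda>x t k k'. of_bool (k < time x), [(True, \<lambda>x t k k'. var x 0 (cell_kind 0) k 0)])"
definition r_symbol :: clause_rule where
  "r_symbol = (\<lambda>x t k k'. of_bool (time x \<le> k),
     [(True, \<lambda>x t k k'. var x 0 (cell_kind 0) k 0), (True, \<lambda>x t k k'. var x 0 (cell_kind 0) k 1), (True, \<lambda>x t k k'. var x 0 (cell_kind 0) k 2)])"
text \<open>Blanks continue to the right, so the nonblank cells form a string. Its part behind the
  outer separator is left open: this is how \<open>z\<close> is guessed together with its
  length.\<close>

definition r_right :: clause_rule where
  "r_right = (\<lambda>x t k k'. of_bool (time x \<le> k \<and> Suc k < width x),
     [(False, \<lambda>x t k k'. var x 0 (cell_kind 0) k 0), (True, \<lambda>x t k k'. var x 0 (cell_kind 0) (Suc k) 0)])"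
text \<open>Wrong symbols are excluded instead of right ones being asserted: the input string is
  later read off from the cells where symbol \<open>2\<close> holds, so a spurious \<open>2\<close>
  must be impossible here. The right symbol then follows from \<open>r_symbol\<close>.\<close>

definition r_fixed0 :: clause_rule where
  "r_fixed0 = (\<lambda>x t k k'. of_bool (k < 4 * length x + 4), [(False, \<lambda>x t k k'. var x 0 (cell_kind 0) (time x + k) 0)])"
definition r_fixed1 :: clause_rule where
  "r_fixed1 = (\<lambda>x t k k'. of_bool (k < 4 * length x + 4 \<and> fixed_bit x k), [(False, \<lambda>x t k k'. var x 0 (cell_kind 0) (time x + k) 1)])"
definition r_fixed2 :: clause_rule where
  "r_fixed2 = (\<lambda>x t k k'. of_bool (k < 4 * length x + 4 \<and> \<not> fixed_bit x k), [(False, \<lambda>x t k k'. var x 0 (cell_kind 0) (time x + k) 2)])"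
definition r_length0 :: clause_rule where
  "r_length0 = (\<lambda>x t k k'. 1, [(True, \<lambda>x t k k'. var x 0 3 0 0)])"
text \<open>Kind \<open>3\<close> at \<open>k\<close> says that the first \<open>k\<close> bits of
  \<open>y\<close> are present. The string ends at the first absent bit, whatever the later
  variables say, so every assignment to the universal variables codes some \<open>y\<close>.\<close>

definition r_length :: clause_rule where
  "r_length = (\<lambda>x t k k'. of_bool (k < y_max x),
     [(False, \<lambda>x t k k'. var x 0 3 k 0), (False, \<lambda>x t k k'. var x 0 2 k 0), (True, \<lambda>x t k k'. var x 0 3 (Suc k) 0)])"
definition r_y0 :: "nat \<Rightarrow> clause_rule" where
  "r_y0 i = (\<lambda>x t k k'. of_bool (k < y_max x), [(False, \<lambda>x t k k'. var x 0 3 k 0), (False, \<lambda>x t k k'. var x 0 2 k 0),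
     (False, \<lambda>x t k k'. var x 0 (cell_kind 0) (y_cell x k + i) 0)])"
definition r_y1 :: "nat \<Rightarrow> clause_rule" where
  "r_y1 i = (\<lambda>x t k k'. of_bool (k < y_max x), [(False, \<lambda>x t k k'. var x 0 3 k 0), (False, \<lambda>x t k k'. var x 0 2 k 0),
     (False, \<lambda>x t k k'. var x 0 2 k 1), (False, \<lambda>x t k k'. var x 0 (cell_kind 0) (y_cell x k + i) 1)])"
definition r_y2 :: "nat \<Rightarrow> clause_rule" where
  "r_y2 i = (\<lambda>x t k k'. of_bool (k < y_max x), [(False, \<lambda>x t k k'. var x 0 3 k 0), (False, \<lambda>x t k k'. var x 0 2 k 0),
     (True, \<lambda>x t k k'. var x 0 2 k 1), (False, \<lambda>x t k k'. var x 0 (cell_kind 0) (y_cell x k + i) 2)])"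
text \<open>The string \<open>y\<close> ends at \<open>k\<close> if bit \<open>k\<close> is absent;
  \<open>r_end_max\<close> covers the end at maximal length, where no further bit is
  consulted.\<close>

definition r_end :: "nat \<times> nat \<Rightarrow> clause_rule" where
  "r_end p = (\<lambda>x t k k'. of_bool (k < y_max x), [(False, \<lambda>x t k k'. var x 0 3 k 0), (True, \<lambda>x t k k'. var x 0 2 k 0),
     (False, \<lambda>x t k k'. var x 0 (cell_kind 0) (y_cell x k + end_offset (fst p) x k) (snd p))])"
definition r_end_max :: "nat \<times> nat \<Rightarrow> clause_rule" where
  "r_end_max p = (\<lambda>x t k k'. of_bool (k = y_max x), [(False, \<lambda>x t k k'. var x 0 3 k 0),
     (False, \<lambda>x t k k'. var x 0 (cell_kind 0) (y_cell x k + end_offset (fst p) x k) (snd p))])"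
text \<open>Cell \<open>time x\<close> of the tableau is cell \<open>0\<close> of the tape, and
  symbol \<open>1\<close> there is the output \<open>False\<close>.\<close>

definition r_accept :: clause_rule where
  "r_accept = (\<lambda>x t k k'. 1, [(False, \<lambda>x t k k'. var x (time x) (cell_kind (tapes - 1)) (time x) 1)])"
definition r_situation :: "nat \<Rightarrow> clause_rule" where
  "r_situation g = (\<lambda>x t k k'. of_bool (t < time x), (False, \<lambda>x t k k'. var x t 0 0 (fst (situations ! g))) #
     (True, \<lambda>x t k k'. var x t 1 0 g) # map (\<lambda>\<tau>. (False, \<lambda>x t k k'. var x t (scan_kind \<tau>) 0 (snd (situations ! g) ! \<tau>))) [0..<tapes])"
definition r_scan :: "nat \<Rightarrow> nat \<Rightarrow> clause_rule" where
  "r_scan \<tau> a = (\<lambda>x t k k'. of_bool (t < time x), [(False, \<lambda>x t k k'. var x t (hd_kind \<tau>) k 0), (False, \<lambda>x t k k'. var x t (cell_kind \<tau>) k a),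
     (True, \<lambda>x t k k'. var x t (scan_kind \<tau>) 0 a)])"
definition act_of :: "nat \<Rightarrow> nat \<times> (nat \<times> move) list" where
  "act_of g = next_action M (fst (situations ! g)) (snd (situations ! g))"
definition r_next_state :: "nat \<Rightarrow> clause_rule" where
  "r_next_state g = (\<lambda>x t k k'. of_bool (t < time x), [(False, \<lambda>x t k k'. var x t 1 0 g), (True, \<lambda>x t k k'. var x (Suc t) 0 0 (fst (act_of g)))])"
definition r_next_head :: "nat \<Rightarrow> nat \<Rightarrow> clause_rule" where
  "r_next_head g \<tau> = (\<lambda>x t k k'. of_bool (t < time x \<and> Suc k < width x), [(False, \<lambda>x t k k'. var x t 1 0 g), (False, \<lambda>x t k k'. var x t (hd_kind \<tau>) k 0),
     (True, \<lambda>x t k k'. var x (Suc t) (hd_kind \<tau>) (move_index (snd (snd (act_of g) ! \<tau>)) k) 0)])"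
definition r_next_cell :: "nat \<Rightarrow> nat \<Rightarrow> clause_rule" where
  "r_next_cell g \<tau> = (\<lambda>x t k k'. of_bool (t < time x), [(False, \<lambda>x t k k'. var x t 1 0 g), (False, \<lambda>x t k k'. var x t (hd_kind \<tau>) k 0),
     (True, \<lambda>x t k k'. var x (Suc t) (cell_kind \<tau>) k (fst (snd (act_of g) ! \<tau>)))])"
definition r_frame :: "nat \<Rightarrow> nat \<Rightarrow> clause_rule" where
  "r_frame \<tau> a = (\<lambda>x t k k'. of_bool (t < time x \<and> k \<noteq> k'), [(False, \<lambda>x t k k'. var x t (cell_kind \<tau>) k a),
     (False, \<lambda>x t k k'. var x t (hd_kind \<tau>) k' 0), (True, \<lambda>x t k k'. var x (Suc t) (cell_kind \<tau>) k a)])"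

text \<open>Pairs of an offset and a forbidden symbol: the separator must read \<open>1, 2\<close>,
  that is \<open>False, True\<close>, and the cell behind the longest \<open>z\<close> must be
  blank.\<close>

definition end_symbols :: "(nat \<times> nat) list" where
  "end_symbols = [(0, 0), (0, 2), (1, 0), (1, 1), (2, 1), (2, 2)]"

definition rules :: "clause_rule list" where
  "rules = [r_state, r_left, r_symbol, r_right, r_fixed0, r_fixed1, r_fixed2, r_length0, r_length,
      r_y0 0, r_y1 0, r_y2 0, r_y0 1, r_y1 1, r_y2 1, r_accept] @
    map r_end end_symbols @ map r_end_max end_symbols @
    map r_head [0..<tapes] @ map r_blank [1..<tapes] @ map r_situation [0..<length situations] @ map r_next_state [0..<length situations] @
    concat (map (\<lambda>\<tau>. map (r_scan \<tau>) [0..<num_symbols M]) [0..<tapes]) @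
    concat (map (\<lambda>\<tau>. map (r_frame \<tau>) [0..<num_symbols M]) [0..<tapes]) @
    concat (map (\<lambda>\<tau>. map (\<lambda>g. r_next_head g \<tau>) [0..<length situations]) [0..<tapes]) @
    concat (map (\<lambda>\<tau>. map (\<lambda>g. r_next_cell g \<tau>) [0..<length situations]) [0..<tapes])"

lemmas rule_defs = r_state_def r_left_def r_symbol_def r_right_def r_fixed0_def r_fixed1_def r_fixed2_def r_length0_def r_length_def
  r_y0_def r_y1_def r_y2_def r_accept_def r_end_def r_end_max_def r_head_def r_blank_def r_situation_def r_next_state_def
  r_scan_def r_frame_def r_next_head_def r_next_cell_def

lemma rules_all: "(\<forall>r \<in> set rules. P r) \<longleftrightarrow>
    P r_state \<and> P r_left \<and> P r_symbol \<and> P r_right \<and> P r_fixed0 \<and> P r_fixed1 \<and> P r_fixed2 \<and> P r_length0 \<and> P r_length \<and>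
    (\<forall>i<2. P (r_y0 i) \<and> P (r_y1 i) \<and> P (r_y2 i)) \<and> P r_accept \<and> (\<forall>p \<in> set end_symbols. P (r_end p) \<and> P (r_end_max p)) \<and>
    (\<forall>\<tau><tapes. P (r_head \<tau>)) \<and> (\<forall>\<tau><tapes. 0 < \<tau> \<longrightarrow> P (r_blank \<tau>)) \<and>
    (\<forall>g<length situations. P (r_situation g) \<and> P (r_next_state g)) \<and>
    (\<forall>\<tau><tapes. \<forall>a<num_symbols M. P (r_scan \<tau> a) \<and> P (r_frame \<tau> a)) \<and>
    (\<forall>\<tau><tapes. \<forall>g<length situations. P (r_next_head g \<tau>) \<and> P (r_next_cell g \<tau>))"
proof -
  have "(\<forall>i<2. Q i) \<longleftrightarrow> Q 0 \<and> Q 1" for Q :: "nat \<Rightarrow> bool" by (auto simp: numeral_2_eq_2 less_Suc_eq)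
  moreover have "(\<forall>y \<in> \<Union> (set ` (\<lambda>\<tau>. map (f \<tau>) [0..<n]) ` {0..<m}). P y) \<longleftrightarrow> (\<forall>\<tau><m. \<forall>a<n. P (f \<tau> a))" for f and m n :: nat
    by auto
  moreover have "(\<forall>i\<in>{0..<n}. Q i) \<longleftrightarrow> (\<forall>i<n. Q i)" for Q and n :: nat by auto
  moreover have "(\<forall>\<tau>\<in>{1..<tapes}. P (r_blank \<tau>)) \<longleftrightarrow> (\<forall>\<tau><tapes. 0 < \<tau> \<longrightarrow> P (r_blank \<tau>))" by auto
  ultimately show ?thesis
    unfolding rules_def by (simp only: set_append set_map set_concat set_upt ball_Un ball_simps list.set) blast
qed

lemma definable0_bounds: "definable0 time" "definable0 width" "definable0 y_max"
  unfolding definable0_def width_def time_def w_max_def y_max_def by (intro D_intros)+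

lemma definable3_vars:
  "definable (\<lambda>p. fst (fst (fst p))) [snd, \<lambda>p. snd (fst p), \<lambda>p. snd (fst (fst p))] (\<lambda>p. snd p)"
  "definable (\<lambda>p. fst (fst (fst p))) [snd, \<lambda>p. snd (fst p), \<lambda>p. snd (fst (fst p))] (\<lambda>p. snd (fst p))"
  "definable (\<lambda>p. fst (fst (fst p))) [snd, \<lambda>p. snd (fst p), \<lambda>p. snd (fst (fst p))] (\<lambda>p. snd (fst (fst p)))"
  by (rule D_var, simp)+

lemma D_move_index: "definable inp vs f \<Longrightarrow> definable inp vs (\<lambda>s. move_index m (f s))"
  by (cases m) (simp_all, (intro D_intros; assumption)+)

lemma definable3_intros:
  "definable3 (\<lambda>x t k k'. c)"
  "definable3 (\<lambda>x t k k'. t)" "definable3 (\<lambda>x t k k'. k)" "definable3 (\<lambda>x t k k'. k')"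
  "definable3 (\<lambda>x t k k'. time x)" "definable3 (\<lambda>x t k k'. width x)" "definable3 (\<lambda>x t k k'. y_max x)" "definable3 (\<lambda>x t k k'. length x)"
  "definable3 F \<Longrightarrow> definable3 G \<Longrightarrow> definable3 (\<lambda>x t k k'. F x t k k' + G x t k k')"
  "definable3 F \<Longrightarrow> definable3 (\<lambda>x t k k'. Suc (F x t k k'))"
  "definable3 F \<Longrightarrow> definable3 (\<lambda>x t k k'. m * F x t k k')"
  "definable3 F \<Longrightarrow> definable3 (\<lambda>x t k k'. move_index mv (F x t k k'))"
  "definable3 F \<Longrightarrow> definable3 G \<Longrightarrow> definable3 (\<lambda>x t k k'. of_bool (F x t k k' < G x t k k'))"
  "definable3 F \<Longrightarrow> definable3 G \<Longrightarrow> definable3 (\<lambda>x t k k'. of_bool (F x t k k' \<le> G x t k k'))"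
  "definable3 F \<Longrightarrow> definable3 G \<Longrightarrow> definable3 (\<lambda>x t k k'. of_bool (F x t k k' = G x t k k'))"
  "definable3 (\<lambda>x t k k'. of_bool (P x t k k')) \<Longrightarrow> definable3 (\<lambda>x t k k'. of_bool (\<not> P x t k k'))"
  "definable3 (\<lambda>x t k k'. of_bool (P x t k k')) \<Longrightarrow> definable3 (\<lambda>x t k k'. of_bool (Q x t k k')) \<Longrightarrow>
    definable3 (\<lambda>x t k k'. of_bool (P x t k k' \<and> Q x t k k'))"
  "definable3 F \<Longrightarrow> definable3 (\<lambda>x t k k'. of_bool (fixed_bit x (F x t k k')))"
  "definable3 F \<Longrightarrow> definable3 (\<lambda>x t k k'. y_cell x (F x t k k'))"
  "definable3 F \<Longrightarrow> definable3 (\<lambda>x t k k'. end_offset i x (F x t k k'))"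
  "definable3 F \<Longrightarrow> definable3 G \<Longrightarrow> definable3 (\<lambda>x t k k'. var x (F x t k k') c (G x t k k') a)"
  unfolding definable3_def fixed_bit_def y_cell_def end_offset_def var_def
  by (intro D_intros definable3_vars D_lift0[OF definable0_bounds(1)] D_lift0[OF definable0_bounds(2)] D_lift0[OF definable0_bounds(3)] D_move_index; assumption)+

lemma rules_definable: "rules_definable rules"
  unfolding rules_definable_all rules_all rule_definable_def rule_defs
  by (simp only: fst_conv snd_conv list.set set_map ball_simps) (intro conjI allI impI ballI definable3_intros TrueI; simp?)

end

section \<open>Satisfying assignments contain the computation\<close>

lemma rule_satD:
  assumes "rule_sat N x \<alpha> r" "t < N" "k < N" "k' < N" "fst r x t k k' \<noteq> 0"
  shows "\<exists>l \<in> set (snd r). \<alpha> (snd l x t k k') = fst l"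
  using assms unfolding rule_sat_def by blast

context tableau
begin

definition holds :: "bool list \<Rightarrow> (nat \<Rightarrow> bool) \<Rightarrow> nat \<Rightarrow> nat \<Rightarrow> nat \<Rightarrow> nat \<Rightarrow> bool" where
  "holds x \<alpha> t c k a = \<alpha> (var x t c k a)"

lemma width_bounds: "time x < width x" "t < time x \<Longrightarrow> t < width x" "0 < width x" "k \<le> y_max x \<Longrightarrow> k < width x"
  "k < 4 * length x + 4 \<Longrightarrow> k < width x"
  by (auto simp: width_def time_def w_max_def)

lemma situation_index:
  assumes "q \<le> num_states M" "length as = tapes" "set as \<subseteq> {..<num_symbols M}"
  obtains g where "g < length situations" "situations ! g = (q, as)"
proof -
  have "(q, as) \<in> set situations" using assms by (auto simp: situations_def set_n_lists)
  then show thesis using that by (auto simp: in_set_conv_nth)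
qed

lemma move_index_head:
  assumes "\<bar>h\<bar> < int T"
  shows "move_index m (nat (int T + h)) = nat (int T + move_head m h)"
  using assms by (cases m) auto

lemma
  assumes "\<forall>r \<in> set rules. rule_sat (width x) x \<alpha> r"
  shows sat_state: "holds x \<alpha> 0 0 0 0"
    and sat_head: "\<tau> < tapes \<Longrightarrow> holds x \<alpha> 0 (hd_kind \<tau>) (time x) 0"
    and sat_blank: "0 < \<tau> \<Longrightarrow> \<tau> < tapes \<Longrightarrow> k < width x \<Longrightarrow> holds x \<alpha> 0 (cell_kind \<tau>) k 0"
    and sat_left: "k < time x \<Longrightarrow> holds x \<alpha> 0 (cell_kind 0) k 0"
    and sat_symbol: "time x \<le> k \<Longrightarrow> k < width x \<Longrightarrow>
      holds x \<alpha> 0 (cell_kind 0) k 0 \<or> holds x \<alpha> 0 (cell_kind 0) k 1 \<or> holds x \<alpha> 0 (cell_kind 0) k 2"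
    and sat_right: "time x \<le> k \<Longrightarrow> Suc k < width x \<Longrightarrow> holds x \<alpha> 0 (cell_kind 0) k 0 \<Longrightarrow> holds x \<alpha> 0 (cell_kind 0) (Suc k) 0"
    and sat_fixed0: "k < 4 * length x + 4 \<Longrightarrow> \<not> holds x \<alpha> 0 (cell_kind 0) (time x + k) 0"
    and sat_fixed1: "k < 4 * length x + 4 \<Longrightarrow> fixed_bit x k \<Longrightarrow> \<not> holds x \<alpha> 0 (cell_kind 0) (time x + k) 1"
    and sat_fixed2: "k < 4 * length x + 4 \<Longrightarrow> \<not> fixed_bit x k \<Longrightarrow> \<not> holds x \<alpha> 0 (cell_kind 0) (time x + k) 2"
    and sat_length0: "holds x \<alpha> 0 3 0 0"
    and sat_length: "k < y_max x \<Longrightarrow> holds x \<alpha> 0 3 k 0 \<Longrightarrow> holds x \<alpha> 0 2 k 0 \<Longrightarrow> holds x \<alpha> 0 3 (Suc k) 0"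
    and sat_y0: "i < 2 \<Longrightarrow> k < y_max x \<Longrightarrow> holds x \<alpha> 0 3 k 0 \<Longrightarrow> holds x \<alpha> 0 2 k 0 \<Longrightarrow> \<not> holds x \<alpha> 0 (cell_kind 0) (y_cell x k + i) 0"
    and sat_y1: "i < 2 \<Longrightarrow> k < y_max x \<Longrightarrow> holds x \<alpha> 0 3 k 0 \<Longrightarrow> holds x \<alpha> 0 2 k 0 \<Longrightarrow> holds x \<alpha> 0 2 k 1 \<Longrightarrow>
      \<not> holds x \<alpha> 0 (cell_kind 0) (y_cell x k + i) 1"
    and sat_y2: "i < 2 \<Longrightarrow> k < y_max x \<Longrightarrow> holds x \<alpha> 0 3 k 0 \<Longrightarrow> holds x \<alpha> 0 2 k 0 \<Longrightarrow> \<not> holds x \<alpha> 0 2 k 1 \<Longrightarrow>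
      \<not> holds x \<alpha> 0 (cell_kind 0) (y_cell x k + i) 2"
    and sat_end: "p \<in> set end_symbols \<Longrightarrow> k \<le> y_max x \<Longrightarrow> holds x \<alpha> 0 3 k 0 \<Longrightarrow> k = y_max x \<or> \<not> holds x \<alpha> 0 2 k 0 \<Longrightarrow>
      \<not> holds x \<alpha> 0 (cell_kind 0) (y_cell x k + end_offset (fst p) x k) (snd p)"
    and sat_accept: "\<not> holds x \<alpha> (time x) (cell_kind (tapes - 1)) (time x) 1"
    and sat_situation: "t < time x \<Longrightarrow> g < length situations \<Longrightarrow> holds x \<alpha> t 0 0 (fst (situations ! g)) \<Longrightarrow>
      (\<And>\<tau>. \<tau> < tapes \<Longrightarrow> holds x \<alpha> t (scan_kind \<tau>) 0 (snd (situations ! g) ! \<tau>)) \<Longrightarrow> holds x \<alpha> t 1 0 g"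
    and sat_scan: "t < time x \<Longrightarrow> k < width x \<Longrightarrow> \<tau> < tapes \<Longrightarrow> a < num_symbols M \<Longrightarrow> holds x \<alpha> t (hd_kind \<tau>) k 0 \<Longrightarrow>
      holds x \<alpha> t (cell_kind \<tau>) k a \<Longrightarrow> holds x \<alpha> t (scan_kind \<tau>) 0 a"
    and sat_next_state: "t < time x \<Longrightarrow> g < length situations \<Longrightarrow> holds x \<alpha> t 1 0 g \<Longrightarrow> holds x \<alpha> (Suc t) 0 0 (fst (act_of g))"
    and sat_next_head: "t < time x \<Longrightarrow> g < length situations \<Longrightarrow> \<tau> < tapes \<Longrightarrow> Suc k < width x \<Longrightarrow> holds x \<alpha> t 1 0 g \<Longrightarrow>
      holds x \<alpha> t (hd_kind \<tau>) k 0 \<Longrightarrow> holds x \<alpha> (Suc t) (hd_kind \<tau>) (move_index (snd (snd (act_of g) ! \<tau>)) k) 0"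
    and sat_next_cell: "t < time x \<Longrightarrow> g < length situations \<Longrightarrow> \<tau> < tapes \<Longrightarrow> k < width x \<Longrightarrow> holds x \<alpha> t 1 0 g \<Longrightarrow>
      holds x \<alpha> t (hd_kind \<tau>) k 0 \<Longrightarrow> holds x \<alpha> (Suc t) (cell_kind \<tau>) k (fst (snd (act_of g) ! \<tau>))"
    and sat_frame: "t < time x \<Longrightarrow> \<tau> < tapes \<Longrightarrow> a < num_symbols M \<Longrightarrow> k < width x \<Longrightarrow> k' < width x \<Longrightarrow> k \<noteq> k' \<Longrightarrow>
      holds x \<alpha> t (cell_kind \<tau>) k a \<Longrightarrow> holds x \<alpha> t (hd_kind \<tau>) k' 0 \<Longrightarrow> holds x \<alpha> (Suc t) (cell_kind \<tau>) k a"
proof -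
  note S = assms[unfolded rules_all]
  have ax: "rule_sat (width x) x \<alpha> r_state" "rule_sat (width x) x \<alpha> r_left" "rule_sat (width x) x \<alpha> r_symbol"
    "rule_sat (width x) x \<alpha> r_right" "rule_sat (width x) x \<alpha> r_fixed0" "rule_sat (width x) x \<alpha> r_fixed1"
    "rule_sat (width x) x \<alpha> r_fixed2" "rule_sat (width x) x \<alpha> r_length0" "rule_sat (width x) x \<alpha> r_length"
    "rule_sat (width x) x \<alpha> r_accept"
    using S by simp_all
  have ay: "rule_sat (width x) x \<alpha> (r_y0 i)" "rule_sat (width x) x \<alpha> (r_y1 i)" "rule_sat (width x) x \<alpha> (r_y2 i)" if "i < 2" for i
    using S that by simp_all
  have ae: "rule_sat (width x) x \<alpha> (r_end p)" "rule_sat (width x) x \<alpha> (r_end_max p)" if "p \<in> set end_symbols" for p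
    using S that by simp_all
  have at: "rule_sat (width x) x \<alpha> (r_head \<tau>)" "0 < \<tau> \<Longrightarrow> rule_sat (width x) x \<alpha> (r_blank \<tau>)"
    "a < num_symbols M \<Longrightarrow> rule_sat (width x) x \<alpha> (r_scan \<tau> a)" "a < num_symbols M \<Longrightarrow> rule_sat (width x) x \<alpha> (r_frame \<tau> a)"
    "g < length situations \<Longrightarrow> rule_sat (width x) x \<alpha> (r_next_head g \<tau>)"
    "g < length situations \<Longrightarrow> rule_sat (width x) x \<alpha> (r_next_cell g \<tau>)" if "\<tau> < tapes" for \<tau> a g
    using S that by simp_all
  have ag: "rule_sat (width x) x \<alpha> (r_situation g)" "rule_sat (width x) x \<alpha> (r_next_state g)" if "g < length situations" for g
    using S that by simp_all
  note w = width_bounds[where x = x]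
  note D = rule_satD[of "width x" x \<alpha>]
  show "holds x \<alpha> 0 0 0 0" using D[OF ax(1), of 0 0 0] w(3) by (simp add: r_state_def holds_def)
  show "\<tau> < tapes \<Longrightarrow> holds x \<alpha> 0 (hd_kind \<tau>) (time x) 0" using D[OF at(1)[of \<tau>], of 0 0 0] w(3) by (simp add: r_head_def holds_def)
  show "0 < \<tau> \<Longrightarrow> \<tau> < tapes \<Longrightarrow> k < width x \<Longrightarrow> holds x \<alpha> 0 (cell_kind \<tau>) k 0"
    using D[OF at(2)[of \<tau>], of 0 k 0] w(3) by (simp add: r_blank_def holds_def)
  show "k < time x \<Longrightarrow> holds x \<alpha> 0 (cell_kind 0) k 0" using D[OF ax(2), of 0 k 0] w(2,3) by (simp add: r_left_def holds_def)
  show "time x \<le> k \<Longrightarrow> k < width x \<Longrightarrow>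
      holds x \<alpha> 0 (cell_kind 0) k 0 \<or> holds x \<alpha> 0 (cell_kind 0) k 1 \<or> holds x \<alpha> 0 (cell_kind 0) k 2"
    using D[OF ax(3), of 0 k 0] w(3) by (simp add: r_symbol_def holds_def)
  show "time x \<le> k \<Longrightarrow> Suc k < width x \<Longrightarrow> holds x \<alpha> 0 (cell_kind 0) k 0 \<Longrightarrow> holds x \<alpha> 0 (cell_kind 0) (Suc k) 0"
    using D[OF ax(4), of 0 k 0] w(3) by (simp add: r_right_def holds_def)
  show "k < 4 * length x + 4 \<Longrightarrow> \<not> holds x \<alpha> 0 (cell_kind 0) (time x + k) 0"
    using D[OF ax(5), of 0 k 0] w(3,5) by (simp add: r_fixed0_def holds_def)
  show "k < 4 * length x + 4 \<Longrightarrow> fixed_bit x k \<Longrightarrow> \<not> holds x \<alpha> 0 (cell_kind 0) (time x + k) 1"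
    using D[OF ax(6), of 0 k 0] w(3,5) by (simp add: r_fixed1_def holds_def)
  show "k < 4 * length x + 4 \<Longrightarrow> \<not> fixed_bit x k \<Longrightarrow> \<not> holds x \<alpha> 0 (cell_kind 0) (time x + k) 2"
    using D[OF ax(7), of 0 k 0] w(3,5) by (simp add: r_fixed2_def holds_def)
  show "holds x \<alpha> 0 3 0 0" using D[OF ax(8), of 0 0 0] w(3) by (simp add: r_length0_def holds_def)
  show "k < y_max x \<Longrightarrow> holds x \<alpha> 0 3 k 0 \<Longrightarrow> holds x \<alpha> 0 2 k 0 \<Longrightarrow> holds x \<alpha> 0 3 (Suc k) 0"
    using D[OF ax(9), of 0 k 0] w(3,4) by (simp add: r_length_def holds_def)
  show "i < 2 \<Longrightarrow> k < y_max x \<Longrightarrow> holds x \<alpha> 0 3 k 0 \<Longrightarrow> holds x \<alpha> 0 2 k 0 \<Longrightarrow> \<not> holds x \<alpha> 0 (cell_kind 0) (y_cell x k + i) 0"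
    using D[OF ay(1)[of i], of 0 k 0] w(3,4) by (simp add: r_y0_def holds_def)
  show "i < 2 \<Longrightarrow> k < y_max x \<Longrightarrow> holds x \<alpha> 0 3 k 0 \<Longrightarrow> holds x \<alpha> 0 2 k 0 \<Longrightarrow> holds x \<alpha> 0 2 k 1 \<Longrightarrow>
      \<not> holds x \<alpha> 0 (cell_kind 0) (y_cell x k + i) 1"
    using D[OF ay(2)[of i], of 0 k 0] w(3,4) by (simp add: r_y1_def holds_def)
  show "i < 2 \<Longrightarrow> k < y_max x \<Longrightarrow> holds x \<alpha> 0 3 k 0 \<Longrightarrow> holds x \<alpha> 0 2 k 0 \<Longrightarrow> \<not> holds x \<alpha> 0 2 k 1 \<Longrightarrow>
      \<not> holds x \<alpha> 0 (cell_kind 0) (y_cell x k + i) 2"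
    using D[OF ay(3)[of i], of 0 k 0] w(3,4) by (simp add: r_y2_def holds_def)
  show "p \<in> set end_symbols \<Longrightarrow> k \<le> y_max x \<Longrightarrow> holds x \<alpha> 0 3 k 0 \<Longrightarrow> k = y_max x \<or> \<not> holds x \<alpha> 0 2 k 0 \<Longrightarrow>
      \<not> holds x \<alpha> 0 (cell_kind 0) (y_cell x k + end_offset (fst p) x k) (snd p)"
    using D[OF ae(1)[of p], of 0 k 0] D[OF ae(2)[of p], of 0 k 0] w(3,4)
    by (cases "k = y_max x") (simp_all add: r_end_def r_end_max_def holds_def)
  show "\<not> holds x \<alpha> (time x) (cell_kind (tapes - 1)) (time x) 1" using D[OF ax(10), of 0 0 0] w(3) by (simp add: r_accept_def holds_def)
  show "t < time x \<Longrightarrow> g < length situations \<Longrightarrow> holds x \<alpha> t 0 0 (fst (situations ! g)) \<Longrightarrow>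
      (\<And>\<tau>. \<tau> < tapes \<Longrightarrow> holds x \<alpha> t (scan_kind \<tau>) 0 (snd (situations ! g) ! \<tau>)) \<Longrightarrow> holds x \<alpha> t 1 0 g"
    using D[OF ag(1)[of g], of t 0 0] w(2,3) by (auto simp add: r_situation_def holds_def)
  show "t < time x \<Longrightarrow> k < width x \<Longrightarrow> \<tau> < tapes \<Longrightarrow> a < num_symbols M \<Longrightarrow> holds x \<alpha> t (hd_kind \<tau>) k 0 \<Longrightarrow>
      holds x \<alpha> t (cell_kind \<tau>) k a \<Longrightarrow> holds x \<alpha> t (scan_kind \<tau>) 0 a"
    using D[OF at(3)[of \<tau> a], of t k 0] w(2,3) by (simp add: r_scan_def holds_def)
  show "t < time x \<Longrightarrow> g < length situations \<Longrightarrow> holds x \<alpha> t 1 0 g \<Longrightarrow> holds x \<alpha> (Suc t) 0 0 (fst (act_of g))"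
    using D[OF ag(2)[of g], of t 0 0] w(2,3) by (simp add: r_next_state_def holds_def)
  show "t < time x \<Longrightarrow> g < length situations \<Longrightarrow> \<tau> < tapes \<Longrightarrow> Suc k < width x \<Longrightarrow> holds x \<alpha> t 1 0 g \<Longrightarrow>
      holds x \<alpha> t (hd_kind \<tau>) k 0 \<Longrightarrow> holds x \<alpha> (Suc t) (hd_kind \<tau>) (move_index (snd (snd (act_of g) ! \<tau>)) k) 0"
    using D[OF at(5)[of \<tau> g], of t k 0] w(2,3) by (simp add: r_next_head_def holds_def)
  show "t < time x \<Longrightarrow> g < length situations \<Longrightarrow> \<tau> < tapes \<Longrightarrow> k < width x \<Longrightarrow> holds x \<alpha> t 1 0 g \<Longrightarrow>
      holds x \<alpha> t (hd_kind \<tau>) k 0 \<Longrightarrow> holds x \<alpha> (Suc t) (cell_kind \<tau>) k (fst (snd (act_of g) ! \<tau>))"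
    using D[OF at(6)[of \<tau> g], of t k 0] w(2,3) by (simp add: r_next_cell_def holds_def)
  show "t < time x \<Longrightarrow> \<tau> < tapes \<Longrightarrow> a < num_symbols M \<Longrightarrow> k < width x \<Longrightarrow> k' < width x \<Longrightarrow> k \<noteq> k' \<Longrightarrow>
      holds x \<alpha> t (cell_kind \<tau>) k a \<Longrightarrow> holds x \<alpha> t (hd_kind \<tau>) k' 0 \<Longrightarrow> holds x \<alpha> (Suc t) (cell_kind \<tau>) k a"
    using D[OF at(4)[of \<tau> a], of t k k'] w(2,3) by (simp add: r_frame_def holds_def)
qed

text \<open>Only inclusion is claimed: the assignment may contain further, contradictory facts, but
  the facts of the real run follow from those of the input by induction on time.\<close>

lemma run_holds:
  assumes sat: "\<forall>r \<in> set rules. rule_sat (width x) x \<alpha> r"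
    and input: "\<And>k. k < width x \<Longrightarrow> holds x \<alpha> 0 (cell_kind 0) k (run_cell M w 0 0 (int k - int (time x)))"
    and "t \<le> time x"
  shows "holds x \<alpha> t 0 0 (run_state M w t) \<and>
    (\<forall>\<tau><tapes. holds x \<alpha> t (hd_kind \<tau>) (nat (int (time x) + run_head M w t \<tau>)) 0 \<and>
      (\<forall>k<width x. holds x \<alpha> t (cell_kind \<tau>) k (run_cell M w t \<tau> (int k - int (time x)))))"
  using assms(3)
proof (induction t)
  case 0
  have "holds x \<alpha> 0 (cell_kind \<tau>) k (run_cell M w 0 \<tau> (int k - int (time x)))" if "\<tau> < tapes" "k < width x" for \<tau> k
    using input[OF that(2)] sat_blank[OF sat _ that] run_init(3)[OF wf, of \<tau> w] that(1) by (cases "\<tau> = 0") (simp_all add: tapes_def)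
  moreover have "0 < num_tapes M" using wf by (simp add: wf_tm_def)
  ultimately show ?case
    using sat_state[OF sat] sat_head[OF sat] run_init(1)[OF wf, of 0 w] run_init(2)[OF wf, of _ w] by (simp add: tapes_def)
next
  case (Suc t)
  have t: "t < time x" using Suc.prems by simp
  define h where "h \<tau> = nat (int (time x) + run_head M w t \<tau>)" for \<tau>
  have IH: "holds x \<alpha> t 0 0 (run_state M w t)" "\<And>\<tau>. \<tau> < tapes \<Longrightarrow> holds x \<alpha> t (hd_kind \<tau>) (h \<tau>) 0"
    "\<And>\<tau> k. \<tau> < tapes \<Longrightarrow> k < width x \<Longrightarrow> holds x \<alpha> t (cell_kind \<tau>) k (run_cell M w t \<tau> (int k - int (time x)))"
    using Suc unfolding h_def by simp_all
  note inv = run_invariant[OF wf, of w t, folded tapes_def]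
  have sym: "run_cell M w t \<tau> p < num_symbols M" and hb: "\<bar>run_head M w t \<tau>\<bar> < int (time x)" if "\<tau> < tapes" for \<tau> p
  proof -
    have "(\<forall>p. run_cell M w t \<tau> p < num_symbols M) \<and> \<bar>run_head M w t \<tau>\<bar> \<le> int t" using inv that by blast
    then show "run_cell M w t \<tau> p < num_symbols M" "\<bar>run_head M w t \<tau>\<bar> < int (time x)" using t by simp_all
  qed
  have h: "int (h \<tau>) - int (time x) = run_head M w t \<tau>" "Suc (h \<tau>) < width x" if "\<tau> < tapes" for \<tau>
    using hb[OF that] by (auto simp: h_def width_def)
  note scan = run_scan_wf[OF wf, where w = w and t = t, folded tapes_def]
  have G: "holds x \<alpha> t (scan_kind \<tau>) 0 (run_scan M w t ! \<tau>)" if "\<tau> < tapes" for \<tau>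
    using sat_scan[OF sat t _ that sym[OF that] IH(2)[OF that], of "run_head M w t \<tau>"] IH(3)[OF that, of "h \<tau>"] h[OF that] scan(3)[OF that] by simp
  obtain g where g: "g < length situations" "situations ! g = (run_state M w t, run_scan M w t)"
    using situation_index[OF _ scan(1,2), of "run_state M w t"] inv by blast
  have X: "holds x \<alpha> t 1 0 g" by (rule sat_situation[OF sat t g(1)]) (use g(2) IH(1) G in simp_all)
  have act: "act_of g = next_action M (run_state M w t) (run_scan M w t)" by (simp add: act_of_def g(2))
  have S: "holds x \<alpha> (Suc t) 0 0 (run_state M w (Suc t))"
    using sat_next_state[OF sat t g(1) X] by (simp add: act run_Suc)
  have "holds x \<alpha> (Suc t) (hd_kind \<tau>) (nat (int (time x) + run_head M w (Suc t) \<tau>)) 0" if \<tau>: "\<tau> < tapes" for \<tau>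
  proof -
    have "run_head M w (Suc t) \<tau> = move_head (snd (snd (act_of g) ! \<tau>)) (run_head M w t \<tau>)"
      using run_step(2)[OF wf, of \<tau> w t] \<tau> by (simp add: act tapes_def)
    then show ?thesis
      using sat_next_head[OF sat t g(1) \<tau> h(2)[OF \<tau>] X IH(2)[OF \<tau>]] move_index_head[OF hb[OF \<tau>]] by (simp add: h_def)
  qed
  moreover have "holds x \<alpha> (Suc t) (cell_kind \<tau>) k (run_cell M w (Suc t) \<tau> (int k - int (time x)))" if \<tau>: "\<tau> < tapes" and k: "k < width x" for \<tau> k
  proof -
    have c: "run_cell M w (Suc t) \<tau> = (run_cell M w t \<tau>)(run_head M w t \<tau> := fst (snd (act_of g) ! \<tau>))"
      using run_step(1)[OF wf, of \<tau> w t] \<tau> by (simp add: act tapes_def)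
    show ?thesis
    proof (cases "k = h \<tau>")
      case True
      then show ?thesis using sat_next_cell[OF sat t g(1) \<tau> k X] IH(2)[OF \<tau>] h(1)[OF \<tau>] by (simp add: c)
    next
      case False
      then have "int k - int (time x) \<noteq> run_head M w t \<tau>" using h(1)[OF \<tau>] by auto
      then show ?thesis
        using sat_frame[OF sat t \<tau> sym[OF \<tau>] k _ False IH(3)[OF \<tau> k] IH(2)[OF \<tau>]] h(2)[OF \<tau>] by (simp add: c)
    qed
  qed
  ultimately show ?case using S by blast
qed

end

section \<open>The guessed input string\<close>

lemma length_double: "length (concat (map (\<lambda>b. [b, b]) x)) = 2 * length x"
  by (induction x) auto

lemma nth_double: "i < 2 * length x \<Longrightarrow> concat (map (\<lambda>b. [b, b]) x) ! i = x ! (i div 2)"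
proof (induction x arbitrary: i)
  case (Cons b x)
  show ?case
  proof (cases "i < 2")
    case True
    then show ?thesis by (cases i) (auto simp: less_Suc_eq)
  next
    case False
    then obtain i' where "i = Suc (Suc i')" by (metis add_2_eq_Suc le_Suc_ex not_less)
    then show ?thesis using Cons by simp
  qed
qed simp

lemma length_str_pair: "length (str_pair x y) = 2 * length x + 2 + length y"
  by (simp add: str_pair_def length_double)

lemma nth_str_pair: "str_pair x y ! i = (if i < 2 * length x then x ! (i div 2) else if i = 2 * length x then False
    else if i = Suc (2 * length x) then True else y ! (i - (2 * length x + 2)))"
proof -
  have "i - 2 * length x = Suc (Suc (i - (2 * length x + 2)))" if "\<not> i < 2 * length x" "i \<noteq> 2 * length x" "i \<noteq> Suc (2 * length x)"
    using that by linarith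
  then show ?thesis by (auto simp: str_pair_def nth_append length_double nth_double)
qed

lemma str_pair_append: "str_pair x y = str_pair x [] @ y"
  by (simp add: str_pair_def)

context tableau
begin

definition y_start :: "bool list \<Rightarrow> nat" where "y_start x = 4 * length x + 4"

lemma
  fixes x y z
  defines "w \<equiv> str_pair (str_pair x y) z"
  shows nth_fixed: "i < y_start x \<Longrightarrow> w ! i \<longleftrightarrow> fixed_bit x i"
    and nth_y: "k < length y \<Longrightarrow> j < 2 \<Longrightarrow> w ! (y_start x + 2 * k + j) = y ! k"
    and nth_end: "\<not> w ! (y_start x + 2 * length y)" "w ! Suc (y_start x + 2 * length y)"
    and length_w: "length w = y_start x + 2 * length y + 2 + length z"
proof -
  show "length w = y_start x + 2 * length y + 2 + length z" by (simp add: w_def length_str_pair y_start_def)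
  show "\<not> w ! (y_start x + 2 * length y)" "w ! Suc (y_start x + 2 * length y)"
    by (simp_all add: w_def nth_str_pair length_str_pair y_start_def)
  show "w ! (y_start x + 2 * k + j) = y ! k" if "k < length y" "j < 2"
  proof -
    have "(y_start x + 2 * k + j) div 2 = 2 * length x + 2 + k" using that(2) by (auto simp: y_start_def)
    then show ?thesis using that by (simp add: w_def nth_str_pair length_str_pair y_start_def)
  qed
  show "w ! i \<longleftrightarrow> fixed_bit x i" if i: "i < y_start x"
  proof -
    have w: "w ! i = str_pair x y ! (i div 2)" using i by (simp add: w_def nth_str_pair[of "str_pair x y"] length_str_pair y_start_def)
    have d: "i div 2 div 2 = i div 4" by (simp add: div_mult2_eq[symmetric])
    show ?thesis
    proof (cases "i < 4 * length x")
      case True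
      then have "i div 2 < 2 * length x" "i div 4 < length x" by auto
      then show ?thesis using True by (simp add: w nth_str_pair d fixed_bit_def bit_at_def)
    next
      case False
      then have "i div 2 = 2 * length x \<or> i div 2 = Suc (2 * length x)" "i div 2 = 2 * length x \<longleftrightarrow> i < 4 * length x + 2"
        using i by (auto simp: y_start_def)
      then show ?thesis using False by (auto simp: w nth_str_pair fixed_bit_def)
    qed
  qed
qed

lemma y_cell_eq: "y_cell x k = time x + (y_start x + 2 * k)"
  by (simp add: y_cell_def y_start_def)

lemma w_max_bound:
  assumes "k \<le> y_max x"
  shows "y_start x + 2 * k + 2 + poly p2 (2 * length x + 2 + k) \<le> w_max x"
  using poly_mono_nat[of "2 * length x + 2 + k" "2 * length x + 2 + y_max x" p2] assms
  by (simp add: w_max_def y_start_def)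

lemma w_max_less: "i \<le> w_max x \<Longrightarrow> time x + i < width x"
  by (simp add: width_def time_def)

text \<open>The string \<open>z\<close> is read off from the input cells. The facts of the real run
  on the resulting input are contained in the assignment, so if the machine rejected, the forbidden
  output symbol would be among them.\<close>

lemma satisfied_imp_accepted:
  assumes sat: "\<forall>r \<in> set rules. rule_sat (width x) x \<alpha> r"
    and out: "\<And>w. halted_with_output M ((tm_step M ^^ poly p3 (length w)) (initial_config M w)) [w \<in> Acc]"
    and y: "length y \<le> y_max x"
    and present: "\<And>k. k < y_max x \<Longrightarrow> holds x \<alpha> 0 2 k 0 \<longleftrightarrow> k < length y"
    and bit: "\<And>k. k < length y \<Longrightarrow> holds x \<alpha> 0 2 k 1 \<longleftrightarrow> y ! k"
  shows "\<exists>z. length z \<le> poly p2 (length (str_pair x y)) \<and> str_pair (str_pair x y) z \<in> Acc"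
proof -
  define cell where "cell i = holds x \<alpha> 0 (cell_kind 0) (time x + i)" for i
  define l where "l = length y"
  have R: "k \<le> l \<Longrightarrow> holds x \<alpha> 0 3 k 0" for k
  proof (induction k)
    case 0
    show ?case by (rule sat_length0[OF sat])
  next
    case (Suc k)
    then show ?case using sat_length[OF sat, of k] present[of k] y by (simp add: l_def)
  qed
  define e where "e = y_start x + 2 * l + 2"
  define B where "B = e + poly p2 (2 * length x + 2 + l)"
  have B: "B \<le> w_max x" using w_max_bound[of l x] y by (simp add: B_def e_def l_def)
  have sym: "cell i 0 \<or> cell i 1 \<or> cell i 2" if "i \<le> w_max x" for i
    using sat_symbol[OF sat, of "time x + i"] w_max_less[OF that] by (simp add: cell_def)
  have ends: "\<not> cell (y_start x + 2 * l + end_offset i x l) a" if "(i, a) \<in> set end_symbols" for i a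
  proof -
    have "l = y_max x \<or> \<not> holds x \<alpha> 0 2 l 0" using y present[of l] by (cases "l = y_max x") (simp_all add: l_def)
    then show ?thesis using sat_end[OF sat that _ R[OF order_refl]] y by (simp add: cell_def y_cell_eq l_def add.assoc)
  qed
  \<comment> \<open>Before \<open>z\<close> begins, the wrong symbols are excluded in every cell.
    The cases are the copy of \<open>x\<close> with its separator, the bits of \<open>y\<close>, and
    the two bits of the outer separator.\<close>
  have pre: "\<not> cell i 0 \<and> (if str_pair (str_pair x y) [] ! i then \<not> cell i 1 else \<not> cell i 2)" if i: "i < e" for i
  proof -
    consider "i < y_start x" | k j where "k < l" "j < 2" "i = y_start x + 2 * k + j" | "i = y_start x + 2 * l" | "i = Suc (y_start x + 2 * l)"
    proof (cases "i < y_start x \<or> y_start x + 2 * l \<le> i")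
      case True
      then show thesis using that i by (fastforce simp: e_def)
    next
      case False
      define d where "d = i - y_start x"
      have "i = y_start x + d" "d < 2 * l" using False by (auto simp: d_def)
      then have "d div 2 < l" "i = y_start x + 2 * (d div 2) + d mod 2" by simp_all
      then show thesis using that(2)[of "d div 2" "d mod 2"] by simp
    qed
    then show ?thesis
    proof cases
      case 1
      then show ?thesis using sat_fixed0[OF sat, of i] sat_fixed1[OF sat, of i] sat_fixed2[OF sat, of i] nth_fixed[of i x y "[]"]
        by (simp add: cell_def y_start_def)
    next
      case (2 k j)
      have "k < y_max x" "holds x \<alpha> 0 3 k 0" "holds x \<alpha> 0 2 k 0" using 2 y R[of k] present[of k] by (simp_all add: l_def)
      then show ?thesis
        using sat_y0[OF sat 2(2), of k] sat_y1[OF sat 2(2), of k] sat_y2[OF sat 2(2), of k] nth_y[of k y j x "[]"] bit[of k] 2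
        by (simp add: cell_def y_cell_eq l_def add.assoc)
    next
      case 3
      then show ?thesis using ends[of 0 0] ends[of 0 2] nth_end(1)[of x y "[]"]
        by (simp add: end_symbols_def end_offset_def l_def)
    next
      case 4
      then show ?thesis using ends[of 1 0] ends[of 1 1] nth_end(2)[of x y "[]"]
        by (simp add: end_symbols_def end_offset_def l_def)
    qed
  qed
  \<comment> \<open>Behind the longest admissible \<open>z\<close> both bit symbols are excluded, so
    a blank holds there, and the first blank cell gives an admissible length.\<close>
  have "cell B 0"
    using ends[of 2 1] ends[of 2 2] sym[OF B] by (simp add: end_symbols_def end_offset_def B_def e_def add.assoc)
  define len where "len = (LEAST i. cell i 0)"
  have len: "cell len 0" "len \<le> B" and below: "i < len \<Longrightarrow> \<not> cell i 0" for i
    using \<open>cell B 0\<close> unfolding len_def by (auto intro: LeastI Least_le dest: not_less_Least)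
  have "e \<le> len" using pre[of len] len(1) by (meson not_le)
  \<comment> \<open>A cell of the open part may carry both bit symbols; the bit is then taken as
    \<open>True\<close>. What matters is that the symbol read off does hold in the
    assignment.\<close>
  define w where "w = map (\<lambda>i. cell i 2) [0..<len]"
  define z where "z = drop e w"
  have wz: "w = str_pair (str_pair x y) z"
  proof -
    have e: "length (str_pair (str_pair x y) []) = e" by (simp add: length_w e_def l_def)
    have "take e w = str_pair (str_pair x y) []"
    proof (rule nth_equalityI)
      show "length (take e w) = length (str_pair (str_pair x y) [])" using \<open>e \<le> len\<close> by (simp add: e w_def)
      fix i assume "i < length (take e w)"
      then have i: "i < e" "i < len" by (simp_all add: w_def)
      have "take e w ! i = cell i 2" using i by (simp add: w_def)
      also have "\<dots> = str_pair (str_pair x y) [] ! i"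
        using pre[OF i(1)] sym[of i] i(2) len(2) B by (auto split: if_splits)
      finally show "take e w ! i = str_pair (str_pair x y) [] ! i" .
    qed
    then show ?thesis using str_pair_append[of "str_pair x y" z] append_take_drop_id[of e w] by (simp add: z_def)
  qed
  have lw: "length w \<le> w_max x" using len(2) B by (simp add: w_def)
  have blank: "cell i 0" if "len \<le> i" "time x + i < width x" for i
    using that
  proof (induction i rule: dec_induct)
    case base
    then show ?case using len(1) by simp
  next
    case (step i)
    then show ?case using sat_right[OF sat, of "time x + i"] by (simp add: cell_def)
  qed
  have init: "holds x \<alpha> 0 (cell_kind 0) k (run_cell M w 0 0 (int k - int (time x)))" if k: "k < width x" for k
  proof -
    have nt: "0 < num_tapes M" using wf by (simp add: wf_tm_def)
    note ri = run_init(3)[OF wf nt, of w "int k - int (time x)"]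
    show ?thesis
    proof (cases "k < time x")
      case True
      then show ?thesis using sat_left[OF sat True] ri by simp
    next
      case False
      define i where "i = k - time x"
      have ki: "k = time x + i" using False by (simp add: i_def)
      show ?thesis
      proof (cases "i < len")
        case True
        have "cell i (bit_symbol (cell i 2))" using sym[of i] below[OF True] True len(2) B by (auto simp: bit_symbol_def)
        then show ?thesis using True ri by (simp add: ki w_def cell_def)
      next
        case i: False
        then show ?thesis using blank[of i] k ri by (simp add: ki w_def cell_def)
      qed
    qed
  qed
  have nt: "tapes - 1 < tapes" using wf by (simp add: wf_tm_def tapes_def)
  have "holds x \<alpha> (time x) (cell_kind (tapes - 1)) (time x) (run_cell M w (time x) (tapes - 1) 0)"
    using run_holds[OF sat init order_refl] nt width_bounds(1)[of x] by fastforce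
  then have "run_cell M w (time x) (tapes - 1) 0 \<noteq> 1" using sat_accept[OF sat] by metis
  moreover have "run_cell M w (time x) (tapes - 1) 0 = bit_symbol (w \<in> Acc)"
    unfolding tapes_def
    by (rule run_output[OF wf out]) (use poly_mono_nat[OF lw, of p3] in \<open>simp add: time_def\<close>)
  ultimately have "w \<in> Acc" by (auto simp: bit_symbol_def split: if_splits)
  moreover have "length z \<le> poly p2 (length (str_pair x y))"
    using len(2) \<open>e \<le> len\<close> by (simp add: z_def w_def B_def length_str_pair l_def)
  ultimately show ?thesis using wz by blast
qed

end

section \<open>The computation as a satisfying assignment\<close>

lemma rule_satI:
  assumes "\<And>t k k'. t < N \<Longrightarrow> k < N \<Longrightarrow> k' < N \<Longrightarrow> fst r x t k k' \<noteq> 0 \<Longrightarrow> \<exists>l \<in> set (snd r). \<alpha> (snd l x t k k') = fst l"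
  shows "rule_sat N x \<alpha> r"
  using assms unfolding rule_sat_def by blast

context tableau
begin

definition var_kind :: "bool list \<Rightarrow> nat \<Rightarrow> nat" where
  "var_kind x v = v div base_a div width x mod base_c"

lemma var_decode:
  assumes "c < base_c" "k < width x" "a < base_a"
  shows "var x t c k a mod base_a = a" "var x t c k a div base_a mod width x = k"
    "var_kind x (var x t c k a) = c" "var x t c k a div base_a div width x div base_c = t"
proof -
  have 1: "var x t c k a div base_a = (t * base_c + c) * width x + k" using assms(3) by (simp add: var_def)
  then have 2: "var x t c k a div base_a div width x = t * base_c + c" using assms(2) by simp
  show "var x t c k a mod base_a = a" using assms(3) by (simp add: var_def)
  show "var x t c k a div base_a mod width x = k" unfolding 1 using assms(2) by simp
  show "var_kind x (var x t c k a) = c" "var x t c k a div base_a div width x div base_c = t"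
    unfolding var_kind_def 2 using assms(1) by simp_all
qed

text \<open>The intended meaning of all kinds of variables except kind \<open>2\<close>, which is
  left to the universal assignment.\<close>

definition real_fact :: "bool list \<Rightarrow> bool list \<Rightarrow> nat \<Rightarrow> nat \<Rightarrow> nat \<Rightarrow> nat \<Rightarrow> nat \<Rightarrow> bool" where
  "real_fact x w l t c k a \<longleftrightarrow>
     (if c = 0 then a = run_state M w t
      else if c = 1 then situations ! a = (run_state M w t, run_scan M w t)
      else if c = 3 then k \<le> l
      else if c < 4 + tapes then run_head M w t (c - 4) = int k - int (time x)
      else if c < 4 + 2 * tapes then run_cell M w t (c - 4 - tapes) (int k - int (time x)) = a
      else run_scan M w t ! (c - 4 - 2 * tapes) = a)"

definition run_assignment :: "bool list \<Rightarrow> bool list \<Rightarrow> nat \<Rightarrow> (nat \<Rightarrow> bool) \<Rightarrow> nat \<Rightarrow> bool" where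
  "run_assignment x w l U v \<longleftrightarrow> (if var_kind x v = 2 then U v
     else real_fact x w l (v div base_a div width x div base_c) (var_kind x v) (v div base_a mod width x) (v mod base_a))"

lemma bases: "q \<le> num_states M \<Longrightarrow> q < base_a" "g < length situations \<Longrightarrow> g < base_a" "a < num_symbols M \<Longrightarrow> a < base_a"
  "0 < base_a" "Suc 0 < base_a" "2 < base_a" "c < 4 \<Longrightarrow> c < base_c" "\<tau> < tapes \<Longrightarrow> hd_kind \<tau> < base_c" "\<tau> < tapes \<Longrightarrow> cell_kind \<tau> < base_c"
  "\<tau> < tapes \<Longrightarrow> scan_kind \<tau> < base_c" "0 < tapes"
  using wf by (auto simp: base_a_def base_c_def tapes_def wf_tm_def)

lemma holds_run:
  fixes x w l U
  defines "h \<equiv> holds x (run_assignment x w l U)"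
  shows "q \<le> num_states M \<Longrightarrow> h t 0 0 q \<longleftrightarrow> q = run_state M w t"
    and "g < length situations \<Longrightarrow> h t 1 0 g \<longleftrightarrow> situations ! g = (run_state M w t, run_scan M w t)"
    and "k < width x \<Longrightarrow> a < 2 \<Longrightarrow> h 0 2 k a \<longleftrightarrow> U (var x 0 2 k a)"
    and "k < width x \<Longrightarrow> h 0 3 k 0 \<longleftrightarrow> k \<le> l"
    and "\<tau> < tapes \<Longrightarrow> k < width x \<Longrightarrow> h t (hd_kind \<tau>) k 0 \<longleftrightarrow> run_head M w t \<tau> = int k - int (time x)"
    and "\<tau> < tapes \<Longrightarrow> k < width x \<Longrightarrow> a < base_a \<Longrightarrow> h t (cell_kind \<tau>) k a \<longleftrightarrow> run_cell M w t \<tau> (int k - int (time x)) = a"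
    and "\<tau> < tapes \<Longrightarrow> a < base_a \<Longrightarrow> h t (scan_kind \<tau>) 0 a \<longleftrightarrow> run_scan M w t ! \<tau> = a"
proof -
  have e: "h t c k a \<longleftrightarrow> (if c = 2 then U (var x t c k a) else real_fact x w l t c k a)" if "c < base_c" "k < width x" "a < base_a" for t c k a
    unfolding h_def holds_def run_assignment_def var_decode[OF that] ..
  note b = bases width_bounds(3)[of x]
  show "q \<le> num_states M \<Longrightarrow> h t 0 0 q \<longleftrightarrow> q = run_state M w t" using e[of 0 0 q t] b by (simp add: real_fact_def)
  show "g < length situations \<Longrightarrow> h t 1 0 g \<longleftrightarrow> situations ! g = (run_state M w t, run_scan M w t)"
    using e[of 1 0 g t] b by (simp add: real_fact_def)
  show "k < width x \<Longrightarrow> a < 2 \<Longrightarrow> h 0 2 k a \<longleftrightarrow> U (var x 0 2 k a)" using e[of 2 k a 0] b by (simp add: real_fact_def)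
  show "k < width x \<Longrightarrow> h 0 3 k 0 \<longleftrightarrow> k \<le> l" using e[of 3 k 0 0] b by (simp add: real_fact_def)
  show "\<tau> < tapes \<Longrightarrow> k < width x \<Longrightarrow> h t (hd_kind \<tau>) k 0 \<longleftrightarrow> run_head M w t \<tau> = int k - int (time x)"
    using e[of "hd_kind \<tau>" k 0 t] b by (simp add: real_fact_def)
  show "\<tau> < tapes \<Longrightarrow> k < width x \<Longrightarrow> a < base_a \<Longrightarrow> h t (cell_kind \<tau>) k a \<longleftrightarrow> run_cell M w t \<tau> (int k - int (time x)) = a"
    using e[of "cell_kind \<tau>" k a t] b by (simp add: real_fact_def)
  show "\<tau> < tapes \<Longrightarrow> a < base_a \<Longrightarrow> h t (scan_kind \<tau>) 0 a \<longleftrightarrow> run_scan M w t ! \<tau> = a"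
    using e[of "scan_kind \<tau>" 0 a t] b by (simp add: real_fact_def)
qed

lemma accepted_imp_satisfied:
  assumes out: "\<And>w. halted_with_output M ((tm_step M ^^ poly p3 (length w)) (initial_config M w)) [w \<in> Acc]"
    and y: "length y \<le> y_max x"
    and present: "\<And>k. k < length y \<Longrightarrow> U (var x 0 2 k 0)" "length y < y_max x \<Longrightarrow> \<not> U (var x 0 2 (length y) 0)"
    and bit: "\<And>k. k < length y \<Longrightarrow> U (var x 0 2 k 1) \<longleftrightarrow> y ! k"
    and z: "length z \<le> poly p2 (length (str_pair x y))" "str_pair (str_pair x y) z \<in> Acc"
  defines "\<alpha> \<equiv> run_assignment x (str_pair (str_pair x y) z) (length y) U"
  shows "\<forall>r \<in> set rules. rule_sat (width x) x \<alpha> r"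
proof -
  define w where "w = str_pair (str_pair x y) z"
  define l where "l = length y"
  define h where "h = holds x \<alpha>"
  have fa: "\<alpha> (var x t c k a) = h t c k a" for t c k a by (simp add: h_def holds_def)
  have hS: "h t 0 0 q \<longleftrightarrow> q = run_state M w t" if "q \<le> num_states M" for t q
    using holds_run(1)[OF that, of x w l U t] by (simp add: h_def \<alpha>_def w_def l_def)
  have hX: "h t 1 0 g \<longleftrightarrow> situations ! g = (run_state M w t, run_scan M w t)" if "g < length situations" for t g
    using holds_run(2)[OF that, of x w l U t] by (simp add: h_def \<alpha>_def w_def l_def)
  have hU: "h 0 2 k a \<longleftrightarrow> U (var x 0 2 k a)" if "k < width x" "a < 2" for k a
    using holds_run(3)[OF that, of w l U] by (simp add: h_def \<alpha>_def w_def l_def)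
  have hR: "h 0 3 k 0 \<longleftrightarrow> k \<le> l" if "k < width x" for k
    using holds_run(4)[OF that, of w l U] by (simp add: h_def \<alpha>_def w_def l_def)
  have hH: "h t (hd_kind \<tau>) k 0 \<longleftrightarrow> run_head M w t \<tau> = int k - int (time x)" if "\<tau> < tapes" "k < width x" for t \<tau> k
    using holds_run(5)[OF that, of w l U t] by (simp add: h_def \<alpha>_def w_def l_def)
  have hC: "h t (cell_kind \<tau>) k a \<longleftrightarrow> run_cell M w t \<tau> (int k - int (time x)) = a" if "\<tau> < tapes" "k < width x" "a < base_a" for t \<tau> k a
    using holds_run(6)[OF that, of w l U t] by (simp add: h_def \<alpha>_def w_def l_def)
  have hG: "h t (scan_kind \<tau>) 0 a \<longleftrightarrow> run_scan M w t ! \<tau> = a" if "\<tau> < tapes" "a < base_a" for t \<tau> a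
    using holds_run(7)[OF that, of x w l U t] by (simp add: h_def \<alpha>_def w_def l_def)
  note b = bases and wb = width_bounds[where x = x]
  have nt: "0 < num_tapes M" using b(11) by (simp add: tapes_def)
  have len: "length w = y_start x + 2 * l + 2 + length z" by (simp add: w_def length_w l_def)
  have lenB: "length w \<le> y_start x + 2 * l + 2 + poly p2 (2 * length x + 2 + l)" using z(1) by (simp add: len length_str_pair l_def)
  also have B: "\<dots> \<le> w_max x" using w_max_bound[OF y] by (simp add: l_def)
  finally have lw: "length w \<le> w_max x" .
  have c0: "h 0 (cell_kind 0) (time x + i) a \<longleftrightarrow> (if i < length w then bit_symbol (w ! i) else 0) = a" if "time x + i < width x" "a < base_a" for i a
    using hC[OF b(11) that, of 0] run_init(3)[OF wf nt, of w "int i"] by simp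
  have cneg: "h 0 (cell_kind 0) k 0" if "k < time x" for k
    using hC[OF b(11) wb(2)[OF that] b(4), of 0] run_init(3)[OF wf nt, of w "int k - int (time x)"] that by simp
  have inv: "run_state M w t \<le> num_states M" for t using run_invariant[OF wf, of w t] by simp
  have head: "\<bar>run_head M w t \<tau>\<bar> \<le> int t" if "\<tau> < tapes" for t \<tau>
    using run_invariant[OF wf, of w t] that by (simp add: tapes_def)
  have scan: "length (run_scan M w t) = tapes" for t using run_scan_wf(1)[OF wf] by (simp add: tapes_def)
  have act: "act_of g = next_action M (run_state M w t) (run_scan M w t)" if "situations ! g = (run_state M w t, run_scan M w t)" for g t
    by (simp add: act_of_def that)
  have sit: "fst (situations ! g) \<le> num_states M \<and> length (snd (situations ! g)) = tapes \<and> set (snd (situations ! g)) \<subseteq> {..<num_symbols M}"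
    if "g < length situations" for g
  proof -
    have "situations ! g \<in> set situations" using that by simp
    then show ?thesis by (auto simp: situations_def set_n_lists)
  qed
  have acts: "fst (act_of g) \<le> num_states M" "\<tau> < tapes \<Longrightarrow> fst (snd (act_of g) ! \<tau>) < num_symbols M" if "g < length situations" for g \<tau>
    using next_action_wf(1,3)[OF wf, of "fst (situations ! g)" "snd (situations ! g)"] sit[OF that] by (simp_all add: act_of_def tapes_def)
  \<comment> \<open>The bit at position \<open>length y\<close> is absent unless the maximal length
    is reached, so a reached position with a present bit lies inside \<open>y\<close>.\<close>
  have ylen: "k < l" if "k \<le> l" "k < y_max x" "h 0 2 k 0" for k
    using that hU[of k 0] wb(4)[of k] present(2) by (cases "k = l") (auto simp: l_def)
  show ?thesis unfolding rules_all
  proof (intro conjI allI impI ballI)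
    show "rule_sat (width x) x \<alpha> r_state"
      by (rule rule_satI) (simp add: r_state_def fa hS run_init(1)[OF wf nt])
    show "rule_sat (width x) x \<alpha> r_left"
      by (rule rule_satI) (simp add: r_left_def fa cneg[simplified])
    show "rule_sat (width x) x \<alpha> r_symbol"
    proof (rule rule_satI)
      fix t k k' assume k: "k < width x" and g: "fst r_symbol x t k k' \<noteq> 0"
      then obtain i where "k = time x + i" by (auto simp: r_symbol_def le_iff_add)
      then show "\<exists>l\<in>set (snd r_symbol). \<alpha> (snd l x t k k') = fst l"
        using c0[of i 0] c0[of i 1] c0[of i 2] k b by (auto simp: r_symbol_def fa bit_symbol_def)
    qed
    show "rule_sat (width x) x \<alpha> r_right"
    proof (rule rule_satI)
      fix t k k' assume k: "k < width x" and g: "fst r_right x t k k' \<noteq> 0"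
      then obtain i where "k = time x + i" "Suc k < width x" by (auto simp: r_right_def le_iff_add split: if_splits)
      then show "\<exists>l\<in>set (snd r_right). \<alpha> (snd l x t k k') = fst l"
        using c0[of i 0] c0[of "Suc i" 0] b by (auto simp: r_right_def fa bit_symbol_def)
    qed
    have fx: "time x + k < width x \<and> k < length w \<and> w ! k = fixed_bit x k" if "k < 4 * length x + 4" for k
      using that w_max_less[of k x] lw len nth_fixed[of k x y z] by (simp add: y_start_def w_def)
    show "rule_sat (width x) x \<alpha> r_fixed0"
    proof (rule rule_satI)
      fix t k k' assume "fst r_fixed0 x t k k' \<noteq> 0"
      then show "\<exists>l\<in>set (snd r_fixed0). \<alpha> (snd l x t k k') = fst l"
        using fx[of k] c0[of k 0] b by (simp add: r_fixed0_def fa bit_symbol_def)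
    qed
    show "rule_sat (width x) x \<alpha> r_fixed1"
    proof (rule rule_satI)
      fix t k k' assume "fst r_fixed1 x t k k' \<noteq> 0"
      then show "\<exists>l\<in>set (snd r_fixed1). \<alpha> (snd l x t k k') = fst l"
        using fx[of k] c0[of k 1] b by (simp add: r_fixed1_def fa bit_symbol_def)
    qed
    show "rule_sat (width x) x \<alpha> r_fixed2"
    proof (rule rule_satI)
      fix t k k' assume "fst r_fixed2 x t k k' \<noteq> 0"
      then show "\<exists>l\<in>set (snd r_fixed2). \<alpha> (snd l x t k k') = fst l"
        using fx[of k] c0[of k 2] b by (simp add: r_fixed2_def fa bit_symbol_def)
    qed
    show "rule_sat (width x) x \<alpha> r_length0"
      by (rule rule_satI) (simp add: r_length0_def fa hR)
    show "rule_sat (width x) x \<alpha> r_length"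
    proof (rule rule_satI)
      fix t k k' assume "fst r_length x t k k' \<noteq> 0"
      then have k: "k < y_max x" by (simp add: r_length_def)
      then show "\<exists>l\<in>set (snd r_length). \<alpha> (snd l x t k k') = fst l"
        using ylen[of k] hR[of k] hR[of "Suc k"] wb(4)[of k] wb(4)[of "Suc k"] by (auto simp: r_length_def fa)
    qed
    have yc: "y_cell x k + i < width x \<and> y_cell x k + i = time x + (y_start x + 2 * k + i) \<and> y_start x + 2 * k + i < length w \<and>
        w ! (y_start x + 2 * k + i) = y ! k \<and> h 0 2 k 1 = y ! k" if "k < y_max x" "h 0 3 k 0" "h 0 2 k 0" "i < 2" for k i
    proof -
      have k: "k < l" using ylen[of k] hR[of k] wb(4)[of k] that by simp
      then show ?thesis using w_max_less[of "y_start x + 2 * k + i" x] that(1,4) lw len nth_y[of k y i x z] bit[of k] hU[of k 1] wb(4)[of k]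
        by (simp add: y_cell_eq w_def l_def)
    qed
    show "rule_sat (width x) x \<alpha> (r_y0 i)" if "i < 2" for i
    proof (rule rule_satI)
      fix t k k' assume "fst (r_y0 i) x t k k' \<noteq> 0"
      then have k: "k < y_max x" by (simp add: r_y0_def)
      show "\<exists>l\<in>set (snd (r_y0 i)). \<alpha> (snd l x t k k') = fst l"
        using yc[OF k _ _ that] c0[of "y_start x + 2 * k + i" 0] b by (auto simp: r_y0_def fa bit_symbol_def add.assoc)
    qed
    show "rule_sat (width x) x \<alpha> (r_y1 i)" if "i < 2" for i
    proof (rule rule_satI)
      fix t k k' assume "fst (r_y1 i) x t k k' \<noteq> 0"
      then have k: "k < y_max x" by (simp add: r_y1_def)
      show "\<exists>l\<in>set (snd (r_y1 i)). \<alpha> (snd l x t k k') = fst l"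
        using yc[OF k _ _ that] c0[of "y_start x + 2 * k + i" 1] b by (auto simp: r_y1_def fa bit_symbol_def add.assoc)
    qed
    show "rule_sat (width x) x \<alpha> (r_y2 i)" if "i < 2" for i
    proof (rule rule_satI)
      fix t k k' assume "fst (r_y2 i) x t k k' \<noteq> 0"
      then have k: "k < y_max x" by (simp add: r_y2_def)
      show "\<exists>l\<in>set (snd (r_y2 i)). \<alpha> (snd l x t k k') = fst l"
        using yc[OF k _ _ that] c0[of "y_start x + 2 * k + i" 2] b by (auto simp: r_y2_def fa bit_symbol_def add.assoc)
    qed
    have ends: "\<not> h 0 (cell_kind 0) (y_cell x l + end_offset (fst p) x l) (snd p)" if "p \<in> set end_symbols" for p
    proof -
      have "end_offset (fst p) x l \<le> 2 + poly p2 (2 * length x + 2 + l)" by (simp add: end_offset_def)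
      then have "time x + (y_start x + 2 * l + end_offset (fst p) x l) < width x" using w_max_less[OF order_trans[OF _ B]] by simp
      then show ?thesis
        using that c0[of "y_start x + 2 * l + end_offset (fst p) x l" "snd p"] len lenB nth_end[of x y z] b
        by (auto simp: end_symbols_def end_offset_def y_cell_eq add.assoc bit_symbol_def w_def l_def)
    qed
    show "rule_sat (width x) x \<alpha> (r_end p)" if "p \<in> set end_symbols" for p
    proof (rule rule_satI)
      fix t k k' assume "fst (r_end p) x t k k' \<noteq> 0"
      then have k: "k < y_max x" by (simp add: r_end_def)
      have "h 0 2 k 0" if "k < l" using present(1)[of k] hU[of k 0] wb(4)[of k] k that by (simp add: l_def)
      then show "\<exists>l\<in>set (snd (r_end p)). \<alpha> (snd l x t k k') = fst l"
        using ends[OF that] hR[of k] wb(4)[of k] k by (cases "k = l") (auto simp: r_end_def fa)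
    qed
    show "rule_sat (width x) x \<alpha> (r_end_max p)" if "p \<in> set end_symbols" for p
    proof (rule rule_satI)
      fix t k k' assume "fst (r_end_max p) x t k k' \<noteq> 0"
      then have k: "k = y_max x" by (simp add: r_end_max_def)
      show "\<exists>l\<in>set (snd (r_end_max p)). \<alpha> (snd l x t k k') = fst l"
        using ends[OF that] hR[of k] wb(4)[of k] k y by (cases "k = l") (auto simp: r_end_max_def fa l_def)
    qed
    show "rule_sat (width x) x \<alpha> r_accept"
    proof -
      have "run_cell M w (time x) (tapes - 1) 0 = bit_symbol (w \<in> Acc)"
        unfolding tapes_def
        by (rule run_output[OF wf out]) (use poly_mono_nat[OF lw, of p3] in \<open>simp add: time_def\<close>)
      then have "\<not> h (time x) (cell_kind (tapes - 1)) (time x) 1"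
        using hC[of "tapes - 1" "time x" 1 "time x"] b wb(1) z(2) by (simp add: bit_symbol_def w_def)
      then show ?thesis by (intro rule_satI) (simp add: r_accept_def fa)
    qed
    show "rule_sat (width x) x \<alpha> (r_head \<tau>)" if "\<tau> < tapes" for \<tau>
      by (rule rule_satI) (use hH[OF that wb(1), of 0] run_init(2)[OF wf, of \<tau> w] that in \<open>simp add: r_head_def fa tapes_def\<close>)
    show "rule_sat (width x) x \<alpha> (r_blank \<tau>)" if "\<tau> < tapes" "0 < \<tau>" for \<tau>
      by (rule rule_satI) (use hC[OF that(1) _ b(4), of _ 0] run_init(3)[OF wf, of \<tau> w] that in \<open>simp add: r_blank_def fa tapes_def\<close>)
    show "rule_sat (width x) x \<alpha> (r_situation g)" if g: "g < length situations" for g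
    proof (rule rule_satI)
      fix t k k'
      obtain q as where qa: "situations ! g = (q, as)" by (cases "situations ! g")
      have s: "q \<le> num_states M" "length as = tapes" "set as \<subseteq> {..<num_symbols M}" using sit[OF g] by (simp_all add: qa)
      have as: "as ! \<tau> < base_a" if "\<tau> < tapes" for \<tau>
      proof -
        have "as ! \<tau> \<in> set as" using s(2) that by simp
        then show ?thesis using s(3) b(3) by blast
      qed
      show "\<exists>l\<in>set (snd (r_situation g)). \<alpha> (snd l x t k k') = fst l"
      proof (cases "h t 1 0 g")
        case True
        then show ?thesis by (simp add: r_situation_def fa)
      next
        case False
        then have "q \<noteq> run_state M w t \<or> as \<noteq> run_scan M w t" using hX[OF g, of t] by (simp add: qa)
        then have "\<not> h t 0 0 q \<or> (\<exists>\<tau><tapes. \<not> h t (scan_kind \<tau>) 0 (as ! \<tau>))"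
          using hS[OF s(1), of t] hG[OF _ as, of _ _ t] s(2) scan[of t] by (metis nth_equalityI)
        then show ?thesis by (auto simp: r_situation_def fa qa)
      qed
    qed
    show "rule_sat (width x) x \<alpha> (r_next_state g)" if g: "g < length situations" for g
      by (rule rule_satI) (use hX[OF g] hS[OF acts(1)[OF g]] act[of g] in \<open>auto simp: r_next_state_def fa run_Suc\<close>)
    show "rule_sat (width x) x \<alpha> (r_scan \<tau> a)" if \<tau>: "\<tau> < tapes" and a: "a < num_symbols M" for \<tau> a
      by (rule rule_satI) (use hH[OF \<tau>] hC[OF \<tau> _ b(3)[OF a]] hG[OF \<tau> b(3)[OF a]] run_scan_wf(3)[OF wf, of \<tau> w] \<tau> in \<open>auto simp: r_scan_def fa tapes_def\<close>)
    show "rule_sat (width x) x \<alpha> (r_frame \<tau> a)" if \<tau>: "\<tau> < tapes" and a: "a < num_symbols M" for \<tau> a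
      by (rule rule_satI) (use hH[OF \<tau>] hC[OF \<tau> _ b(3)[OF a]] run_step(1)[OF wf, of \<tau> w] \<tau> in \<open>auto simp: r_frame_def fa tapes_def\<close>)
    show "rule_sat (width x) x \<alpha> (r_next_head g \<tau>)" if \<tau>: "\<tau> < tapes" and g: "g < length situations" for g \<tau>
    proof (rule rule_satI)
      fix t k k' assume k: "k < width x" and "fst (r_next_head g \<tau>) x t k k' \<noteq> 0"
      then have t: "t < time x" "Suc k < width x" by (simp_all add: r_next_head_def split: if_splits)
      show "\<exists>l\<in>set (snd (r_next_head g \<tau>)). \<alpha> (snd l x t k k') = fst l"
      proof (cases "h t 1 0 g \<and> h t (hd_kind \<tau>) k 0")
        case True
        then have s: "situations ! g = (run_state M w t, run_scan M w t)" "run_head M w t \<tau> = int k - int (time x)"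
          using hX[OF g] hH[OF \<tau> k] by simp_all
        let ?m = "snd (snd (act_of g) ! \<tau>)"
        have "run_head M w (Suc t) \<tau> = move_head ?m (run_head M w t \<tau>)"
          using run_step(2)[OF wf, of \<tau> w t] \<tau> act[OF s(1)] by (simp add: tapes_def)
        \<comment> \<open>\<open>move_index\<close> truncates at zero, which would be wrong for a
          head in cell zero of the tableau. But after fewer than \<open>time x\<close> steps the
          head is less than \<open>time x\<close> cells away from its start.\<close>
        moreover have "0 < k" using head[OF \<tau>, of t] s(2) t(1) by simp
        ultimately have "run_head M w (Suc t) \<tau> = int (move_index ?m k) - int (time x)" "move_index ?m k < width x"
          using s(2) t(2) by (cases ?m; simp)+
        then have "h (Suc t) (hd_kind \<tau>) (move_index ?m k) 0" using hH[OF \<tau>] by blast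
        then show ?thesis by (simp add: r_next_head_def fa)
      qed (auto simp: r_next_head_def fa)
    qed
    show "rule_sat (width x) x \<alpha> (r_next_cell g \<tau>)" if \<tau>: "\<tau> < tapes" and g: "g < length situations" for g \<tau>
      by (rule rule_satI) (use hX[OF g] hH[OF \<tau>] hC[OF \<tau> _ b(3)[OF acts(2)[OF g \<tau>]]] act[of g] run_step(1)[OF wf, of \<tau> w] \<tau>
        in \<open>auto simp: r_next_cell_def fa tapes_def\<close>)
  qed
qed

end

section \<open>Reduction to quantified formulas\<close>

context tableau
begin

definition universal_var :: "bool list \<Rightarrow> nat \<Rightarrow> bool" where
  "universal_var x v \<longleftrightarrow> var_kind x v = 2"

lemma definable1_universal_var: "definable1 (\<lambda>x v. of_bool (universal_var x v))"
  unfolding definable1_def universal_var_def var_kind_def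
  by (intro D_intros D_lift0[OF definable0_bounds(2)])

lemma universal_var_less:
  assumes "k < y_max x" "a < 2"
  shows "var x 0 2 k a < rules_vars rules width x"
proof -
  have w: "0 < width x" "k < width x" using assms(1) width_bounds(3)[of x] width_bounds(4)[of k x] by auto
  have 1: "(fst (r_y1 0), snd (r_y1 0)) \<in> set rules" by (simp add: rules_def)
  have 2: "(False, \<lambda>x t k k'. var x 0 2 k a) \<in> set (snd (r_y1 0))"
    using assms(2) by (auto simp: r_y1_def less_2_cases_iff)
  show ?thesis by (rule rules_vars_bound[where N = width and x = x and k = k, OF 1 2 w(1,2,1)])
qed

lemma tableau_qbf:
  assumes out: "\<And>w. halted_with_output M ((tm_step M ^^ poly p3 (length w)) (initial_config M w)) [w \<in> Acc]"
  shows "qbf (rules_vars rules width x) (length rules * (width x * (width x * width x))) (universal_var x) (rules_lit rules width x) \<longleftrightarrow>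
    (\<forall>y. length y \<le> y_max x \<longrightarrow> (\<exists>z. length z \<le> poly p2 (length (str_pair x y)) \<and> str_pair (str_pair x y) z \<in> Acc))"
  unfolding qbf_def rules_sat_iff rules_sat_all
proof (intro iffI allI impI)
  fix y :: "bool list"
  assume A: "\<forall>U. \<exists>\<alpha>. (\<forall>v<rules_vars rules width x. universal_var x v \<longrightarrow> \<alpha> v = U v) \<and> (\<forall>r\<in>set rules. rule_sat (width x) x \<alpha> r)"
    and y: "length y \<le> y_max x"
  \<comment> \<open>The given \<open>y\<close> as a universal assignment: last argument
    \<open>0\<close> tells whether a bit is present, last argument \<open>1\<close> gives its
    value.\<close>
  define U where "U v \<longleftrightarrow> v div base_a mod width x < length y \<and> (v mod base_a = 0 \<or> y ! (v div base_a mod width x))" for v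
  obtain \<alpha> where \<alpha>: "\<forall>v<rules_vars rules width x. universal_var x v \<longrightarrow> \<alpha> v = U v" "\<forall>r\<in>set rules. rule_sat (width x) x \<alpha> r"
    using A[rule_format, of U] by (elim exE conjE) (rule that)
  have h: "holds x \<alpha> 0 2 k a \<longleftrightarrow> k < length y \<and> (a = 0 \<or> y ! k)" if "k < y_max x" "a < 2" for k a
  proof -
    have d: "2 < base_c" "k < width x" "a < base_a" using bases(5,6,7) that width_bounds(4)[of k x] by auto
    have "\<alpha> (var x 0 2 k a) = U (var x 0 2 k a)"
      using \<alpha>(1) universal_var_less[OF that] var_decode(3)[OF d, of 0] by (simp add: universal_var_def)
    also have "\<dots> \<longleftrightarrow> k < length y \<and> (a = 0 \<or> y ! k)" unfolding U_def var_decode[OF d] ..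
    finally show ?thesis by (simp add: holds_def)
  qed
  show "\<exists>z. length z \<le> poly p2 (length (str_pair x y)) \<and> str_pair (str_pair x y) z \<in> Acc"
    by (rule satisfied_imp_accepted[OF \<alpha>(2) out y]) (use h y in auto)
next
  fix U
  assume A: "\<forall>y. length y \<le> y_max x \<longrightarrow> (\<exists>z. length z \<le> poly p2 (length (str_pair x y)) \<and> str_pair (str_pair x y) z \<in> Acc)"
  \<comment> \<open>Conversely, an arbitrary universal assignment is read as a string up to the
    first absent bit.\<close>
  define l where "l = (LEAST l. l = y_max x \<or> \<not> U (var x 0 2 l 0))"
  have l: "l = y_max x \<or> \<not> U (var x 0 2 l 0)" unfolding l_def by (rule LeastI[of _ "y_max x"]) simp
  have l_le: "l \<le> y_max x" unfolding l_def by (rule Least_le) simp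
  have below: "k < l \<Longrightarrow> U (var x 0 2 k 0)" for k unfolding l_def by (drule not_less_Least) simp
  define y where "y = map (\<lambda>k. U (var x 0 2 k 1)) [0..<l]"
  have y: "length y = l" by (simp add: y_def)
  obtain z where z: "length z \<le> poly p2 (length (str_pair x y))" "str_pair (str_pair x y) z \<in> Acc"
    using A[rule_format, of y] y l_le by auto
  define \<alpha> where "\<alpha> = run_assignment x (str_pair (str_pair x y) z) (length y) U"
  have "\<forall>r\<in>set rules. rule_sat (width x) x \<alpha> r"
    unfolding \<alpha>_def by (rule accepted_imp_satisfied[OF out _ _ _ _ z]) (use l l_le below y in \<open>auto simp: y_def\<close>)
  moreover have "\<forall>v<rules_vars rules width x. universal_var x v \<longrightarrow> \<alpha> v = U v"
    by (simp add: \<alpha>_def run_assignment_def universal_var_def)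
  ultimately show "\<exists>\<alpha>. (\<forall>v<rules_vars rules width x. universal_var x v \<longrightarrow> \<alpha> v = U v) \<and> (\<forall>r\<in>set rules. rule_sat (width x) x \<alpha> r)"
    by blast
qed

end

theorem Pi2_reduces_to_qbf:
  assumes "A \<in> Pi_p 2"
  shows "\<exists>nv mc isU lit. definable0 nv \<and> definable0 mc \<and> definable1 (\<lambda>x v. of_bool (isU x v)) \<and>
    definable2 (\<lambda>x i j. of_bool (lit x i j)) \<and> (\<forall>x. x \<in> A \<longleftrightarrow> qbf (nv x) (mc x) (isU x) (lit x))"
proof -
  have "A \<in> Pi_p (Suc (Suc 0))" using assms by (simp only: numeral_2_eq_2)
  then obtain p1 :: "nat poly" and B where B: "B \<in> Sigma_p (Suc 0)" "\<And>x. x \<in> A \<longleftrightarrow> (\<forall>y. length y \<le> poly p1 (length x) \<longrightarrow> str_pair x y \<in> B)"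
    by auto
  then obtain p2 :: "nat poly" and Acc where Acc: "Acc \<in> class_P" "\<And>x. x \<in> B \<longleftrightarrow> (\<exists>y. length y \<le> poly p2 (length x) \<and> str_pair x y \<in> Acc)"
    by auto
  then obtain M p3 where M: "wf_tm M" "\<And>x. halted_with_output M ((tm_step M ^^ poly p3 (length x)) (initial_config M x)) [x \<in> Acc]"
    unfolding class_P_def polytime_def by auto
  interpret tableau M p1 p2 p3 by unfold_locales (rule M(1))
  define mc where "mc x = length rules * (width x * (width x * width x))" for x
  have "definable0 mc"
    unfolding definable0_def mc_def by (intro D_intros definable0_bounds(2)[unfolded definable0_def])
  moreover have "x \<in> A \<longleftrightarrow> qbf (rules_vars rules width x) (mc x) (universal_var x) (rules_lit rules width x)" for x
    unfolding mc_def tableau_qbf[OF M(2)] B(2) Acc(2) y_max_def ..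
  ultimately show ?thesis
    using D_rules_vars[OF rules_definable definable0_bounds(2)] D_rules_lit[OF rules_definable definable0_bounds(2)]
      definable1_universal_var by blast
qed

text \<open>A code determines the graph, but the size function only on its vertices. Hence
  \<open>inv\<close>: the property \<open>Q\<close> must depend on nothing else.\<close>

lemma Pi2_hard:
  assumes "A \<in> Pi_p 2" and R: "\<And>nv mc isU lit. R (qbf_graph nv mc isU lit) (qbf_size nv mc)"
    and Q: "\<And>nv mc isU lit. Q (qbf_graph nv mc isU lit) (qbf_size nv mc) \<longleftrightarrow> qbf nv mc isU lit"
    and inv: "\<And>G f g. (G, f) \<in> ch_instances {2, 3} \<Longrightarrow> (G, g) \<in> ch_instances {2, 3} \<Longrightarrow> \<forall>v \<in> pverts G. f v = g v \<Longrightarrow> Q G f \<longleftrightarrow> Q G g"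
  shows "\<exists>F. polytime F \<and> (\<forall>x. F x \<in> encode ` {(G, f) \<in> ch_instances {2, 3}. R G f} \<and>
    (x \<in> A \<longleftrightarrow> F x \<in> encode ` {(G, f) \<in> ch_instances {2, 3}. R G f \<and> Q G f}))"
proof -
  obtain nv mc isU lit where *: "definable0 nv" "definable0 mc" "definable1 (\<lambda>x v. of_bool (isU x v))"
    "definable2 (\<lambda>x i j. of_bool (lit x i j))" "\<And>x. x \<in> A \<longleftrightarrow> qbf (nv x) (mc x) (isU x) (lit x)"
    using Pi2_reduces_to_qbf[OF assms(1)] by blast
  define G where "G x = qbf_graph (nv x) (mc x) (isU x) (lit x)" for x
  define f where "f x = qbf_size (nv x) (mc x)" for x
  have inst: "(G x, f x) \<in> ch_instances {2, 3}" for x unfolding G_def f_def by (rule qbf_graph_instance)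
  have Rx: "R (G x) (f x)" for x unfolding G_def f_def by (rule R)
  have Qx: "Q (G x) (f x) \<longleftrightarrow> x \<in> A" for x unfolding G_def f_def *(5) by (rule Q)
  have "encode (G x, f x) \<in> encode ` {(G, f) \<in> ch_instances {2, 3}. R G f}" for x
    by (rule imageI) (simp add: inst Rx)
  moreover have "x \<in> A \<longleftrightarrow> encode (G x, f x) \<in> encode ` {(G, f) \<in> ch_instances {2, 3}. R G f \<and> Q G f}" for x
  proof
    assume "x \<in> A"
    then show "encode (G x, f x) \<in> encode ` {(G, f) \<in> ch_instances {2, 3}. R G f \<and> Q G f}"
      by (intro imageI) (simp add: inst Rx Qx)
  next
    assume "encode (G x, f x) \<in> encode ` {(G, f) \<in> ch_instances {2, 3}. R G f \<and> Q G f}"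
    then obtain H g where H: "encode (G x, f x) = encode (H, g)" "(H, g) \<in> ch_instances {2, 3}" "Q H g"
      by (auto simp del: encode.simps)
    note e = encode_inject[OF inst H(2,1)]
    have "Q (G x) (f x)" using inv[of "G x" "f x" g] inst[of x] e H by simp
    then show "x \<in> A" by (simp add: Qx)
  qed
  moreover have "polytime (\<lambda>x. encode (G x, f x))"
    unfolding G_def f_def by (rule polytime_encode_qbf[OF *(1-4)])
  ultimately show ?thesis by (intro exI[of _ "\<lambda>x. encode (G x, f x)"]) blast
qed

section \<open>Membership in the second universal level\<close>

lemma bit_at_str_pair: "bit_at (str_pair x y) i \<longleftrightarrow> (if i < 2 * length x then x ! (i div 2) else if i = 2 * length x then False
    else if i = Suc (2 * length x) then True else bit_at y (i - (2 * length x + 2)))"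
proof -
  have "i < 2 * length x + 2 + length y \<longleftrightarrow> i - (2 * length x + 2) < length y" if "2 * length x + 2 \<le> i"
    using that by linarith
  then show ?thesis by (auto simp: bit_at_def nth_str_pair length_str_pair)
qed

text \<open>Recovers the length of the first component of a pair from the bits: doubled bits agree
  until the separator \<open>False, True\<close> is met, and the sum counts the pairs before
  it.\<close>

definition half_length :: "nat \<Rightarrow> (nat \<Rightarrow> bool) \<Rightarrow> nat" where
  "half_length n b = (\<Sum>i<n. of_bool (\<forall>j<Suc i. b (2 * j) = b (2 * j + 1)))"

lemma half_length_str_pair:
  assumes "length w \<le> n"
  shows "half_length n (bit_at (str_pair w z)) = length w"
proof -
  have "(\<forall>j<Suc i. bit_at (str_pair w z) (2 * j) = bit_at (str_pair w z) (2 * j + 1)) \<longleftrightarrow> i < length w" for i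
  proof
    assume a: "\<forall>j<Suc i. bit_at (str_pair w z) (2 * j) = bit_at (str_pair w z) (2 * j + 1)"
    show "i < length w"
    proof (rule ccontr)
      assume "\<not> i < length w"
      then have "bit_at (str_pair w z) (2 * length w) = bit_at (str_pair w z) (2 * length w + 1)" using a by simp
      then show False by (simp add: bit_at_str_pair)
    qed
  next
    assume "i < length w"
    then show "\<forall>j<Suc i. bit_at (str_pair w z) (2 * j) = bit_at (str_pair w z) (2 * j + 1)"
      by (auto simp: bit_at_str_pair)
  qed
  then have "half_length n (bit_at (str_pair w z)) = card {i. i < n \<and> i < length w}"
    by (simp add: half_length_def Int_def)
  also have "{i. i < n \<and> i < length w} = {..<length w}" using assms by auto
  finally show ?thesis by simp
qed

text \<open>The parts of \<open>str_pair (str_pair x y) z\<close>.\<close>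

definition w_len :: "bool list \<Rightarrow> nat" where "w_len v = half_length (length v) (bit_at v)"
definition w_bit :: "bool list \<Rightarrow> nat \<Rightarrow> bool" where "w_bit v i \<longleftrightarrow> i < w_len v \<and> bit_at v (2 * i)"
definition x_len :: "bool list \<Rightarrow> nat" where "x_len v = half_length (length v) (w_bit v)"
definition x_bit :: "bool list \<Rightarrow> nat \<Rightarrow> bool" where "x_bit v i \<longleftrightarrow> i < x_len v \<and> w_bit v (2 * i)"
definition y_bit :: "bool list \<Rightarrow> nat \<Rightarrow> bool" where "y_bit v i \<longleftrightarrow> w_bit v (2 * x_len v + 2 + i)"
definition z_bit :: "bool list \<Rightarrow> nat \<Rightarrow> bool" where "z_bit v i \<longleftrightarrow> bit_at v (2 * w_len v + 2 + i)"

lemma parts_of_str_pair: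
  fixes x y z
  defines "v \<equiv> str_pair (str_pair x y) z"
  shows "x_len v = length x" "x_bit v = bit_at x" "y_bit v = bit_at y" "z_bit v = bit_at z"
proof -
  have w: "w_len v = length (str_pair x y)"
    unfolding w_len_def v_def by (rule half_length_str_pair) (simp add: length_str_pair)
  have wb: "w_bit v = bit_at (str_pair x y)"
    unfolding fun_eq_iff w_bit_def w by (auto simp: v_def bit_at_str_pair[of "str_pair x y"]) (auto simp: bit_at_def)
  show x: "x_len v = length x"
    unfolding x_len_def wb by (rule half_length_str_pair) (simp add: v_def length_str_pair)
  show "x_bit v = bit_at x"
    unfolding fun_eq_iff x_bit_def wb x by (auto simp: bit_at_str_pair) (auto simp: bit_at_def)
  show "y_bit v = bit_at y" unfolding fun_eq_iff y_bit_def wb x by (simp add: bit_at_str_pair)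
  show "z_bit v = bit_at z" unfolding fun_eq_iff z_bit_def w by (simp add: v_def bit_at_str_pair[of "str_pair x y"])
qed

lemma D_w_len: "definable inp vs (\<lambda>s. w_len (inp s))"
  unfolding w_len_def half_length_def by (intro D_intros)

lemma D_w_bit: "definable inp vs f \<Longrightarrow> definable inp vs (\<lambda>s. of_bool (w_bit (inp s) (f s)))"
  unfolding w_bit_def by (intro D_intros D_w_len)

lemma D_x_len [D_intros]: "definable inp vs (\<lambda>s. x_len (inp s))"
  unfolding x_len_def half_length_def by (intro D_intros D_w_bit)

lemma D_x_bit [D_intros]: "definable inp vs f \<Longrightarrow> definable inp vs (\<lambda>s. of_bool (x_bit (inp s) (f s)))"
  unfolding x_bit_def by (intro D_intros D_w_bit)

lemma D_y_bit: "definable inp vs f \<Longrightarrow> definable inp vs (\<lambda>s. of_bool (y_bit (inp s) (f s)))"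
  unfolding y_bit_def by (intro D_intros D_w_bit)

lemma D_z_bit: "definable inp vs f \<Longrightarrow> definable inp vs (\<lambda>s. of_bool (z_bit (inp s) (f s)))"
  unfolding z_bit_def by (intro D_intros D_w_len)

definition y_table :: "nat poly \<Rightarrow> bool list \<Rightarrow> nat \<Rightarrow> nat \<Rightarrow> bool" where
  "y_table q v i j \<longleftrightarrow> i < poly q (x_len v) \<and> j < poly q (x_len v) \<and> y_bit v (i + poly q (x_len v) * j)"

definition z_table :: "nat poly \<Rightarrow> bool list \<Rightarrow> nat \<Rightarrow> nat \<Rightarrow> nat \<Rightarrow> bool" where
  "z_table q v c i j \<longleftrightarrow> c < 4 \<and> i < poly q (x_len v) \<and> j < poly q (x_len v) \<and> z_bit v (c + 4 * (i + poly q (x_len v) * j))"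

lemma D_y_table [D_intros]:
  "definable inp vs f \<Longrightarrow> definable inp vs g \<Longrightarrow> definable inp vs (\<lambda>s. of_bool (y_table q (inp s) (f s) (g s)))"
  unfolding y_table_def by (intro D_intros D_y_bit)

lemma D_z_table [D_intros]:
  "definable inp vs f \<Longrightarrow> definable inp vs g \<Longrightarrow> definable inp vs h \<Longrightarrow>
    definable inp vs (\<lambda>s. of_bool (z_table q (inp s) (f s) (g s) (h s)))"
  unfolding z_table_def by (intro D_intros D_z_bit)

text \<open>A normal form in which both certificates are tables whose side is a polynomial in the
  input length. Strings are cut to size, or padded because \<open>bit_at\<close> is
  \<open>False\<close> behind the end, so verifiers need not care about lengths of
  certificates.\<close>

lemma Pi2_tables:
  fixes q :: "nat poly" and P :: "nat \<Rightarrow> (nat \<Rightarrow> bool) \<Rightarrow> (nat \<Rightarrow> nat \<Rightarrow> bool) \<Rightarrow> (nat \<Rightarrow> nat \<Rightarrow> nat \<Rightarrow> bool) \<Rightarrow> bool"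
  assumes P: "definable (\<lambda>v. v) [] (\<lambda>v. of_bool (P (x_len v) (x_bit v) (y_table q v) (z_table q v)))"
    and Y: "\<And>x. x \<in> Y \<longleftrightarrow> (\<forall>A. (\<forall>i j. A i j \<longrightarrow> i < poly q (length x) \<and> j < poly q (length x)) \<longrightarrow>
      (\<exists>Z. (\<forall>c i j. Z c i j \<longrightarrow> c < 4 \<and> i < poly q (length x) \<and> j < poly q (length x)) \<and> P (length x) (bit_at x) A Z))"
  shows "Y \<in> Pi_p 2"
proof -
  define Acc where "Acc = {v. P (x_len v) (x_bit v) (y_table q v) (z_table q v)}"
  have Acc: "Acc \<in> class_P" unfolding Acc_def by (rule class_P_definable[OF P])
  define p1 where "p1 = q * q"
  define p2 where "p2 = 4 * (q * q)"
  define B where "B = {w. \<exists>z. length z \<le> poly p2 (length w) \<and> str_pair w z \<in> Acc}"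
  have B: "B \<in> Sigma_p (Suc 0)"
    using Acc unfolding B_def by (auto intro!: exI[of _ p2] bexI[of _ Acc])
  define tabA where "tabA S b = (\<lambda>i j. i < S \<and> j < S \<and> b (i + S * j))" for S :: nat and b :: "nat \<Rightarrow> bool"
  define tabZ where "tabZ S b = (\<lambda>c i j. c < 4 \<and> i < S \<and> j < S \<and> b (c + 4 * (i + S * j)))" for S :: nat and b :: "nat \<Rightarrow> bool"
  have acc: "str_pair (str_pair x y) z \<in> Acc \<longleftrightarrow>
      P (length x) (bit_at x) (tabA (poly q (length x)) (bit_at y)) (tabZ (poly q (length x)) (bit_at z))" for x y z
    unfolding Acc_def mem_Collect_eq y_table_def z_table_def parts_of_str_pair tabA_def tabZ_def ..
  have "x \<in> Y \<longleftrightarrow> (\<forall>y. length y \<le> poly p1 (length x) \<longrightarrow> str_pair x y \<in> B)" for x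
  proof -
    define S where "S = poly q (length x)"
    have codeA: "(i + S * j) mod S = i" "(i + S * j) div S = j" "i + S * j < S * S" if "i < S" "j < S" for i j
      using mixed_radix_div_mod[OF that(1)] mixed_radix_less[OF that] by simp_all
    \<comment> \<open>The bound for \<open>z\<close> is evaluated at the length of the pair, which
      is at least that of \<open>x\<close>, so there is room for four tables.\<close>
    have len: "4 * (S * S) \<le> poly p2 (length (str_pair x y))" for y
    proof -
      have "length x \<le> length (str_pair x y)" by (simp add: length_str_pair)
      then have "S \<le> poly q (length (str_pair x y))" unfolding S_def by (rule poly_mono_nat)
      then have "S * S \<le> poly q (length (str_pair x y)) * poly q (length (str_pair x y))" by (intro mult_le_mono)
      then show ?thesis by (simp add: p2_def)
    qed
    show ?thesis
    proof
      assume x: "x \<in> Y"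
      show "\<forall>y. length y \<le> poly p1 (length x) \<longrightarrow> str_pair x y \<in> B"
      proof (intro allI impI)
        fix y
        have "\<exists>Z. (\<forall>c i j. Z c i j \<longrightarrow> c < 4 \<and> i < S \<and> j < S) \<and> P (length x) (bit_at x) (tabA S (bit_at y)) Z"
          unfolding S_def by (rule x[unfolded Y, THEN spec, THEN mp]) (simp add: tabA_def)
        then obtain Z where Z: "\<forall>c i j. Z c i j \<longrightarrow> c < 4 \<and> i < S \<and> j < S" "P (length x) (bit_at x) (tabA S (bit_at y)) Z"
          by (elim exE conjE) (rule that)
        define z where "z = map (\<lambda>e. Z (e mod 4) (e div 4 mod S) (e div 4 div S)) [0..<4 * (S * S)]"
        have "tabZ S (bit_at z) c i j = Z c i j" for c i j :: nat
        proof (cases "c < 4 \<and> i < S \<and> j < S")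
          case True
          define e where "e = c + 4 * (i + S * j)"
          have d: "e mod 4 = c" "e div 4 = i + S * j" "e < 4 * (S * S)"
            unfolding e_def using mixed_radix_div_mod[of c 4 "i + S * j"] mixed_radix_less[of c 4 "i + S * j" "S * S"] codeA(3) True by simp_all
          have "bit_at z e = Z c i j"
            using d(3) by (simp add: bit_at_def z_def d(1,2) codeA(1,2) True)
          then have "bit_at z (c + 4 * (i + S * j)) = Z c i j" unfolding e_def .
          then show ?thesis using True by (simp add: tabZ_def)
        next
          case False
          then show ?thesis using Z(1) by (auto simp: tabZ_def)
        qed
        then have "tabZ S (bit_at z) = Z" by (simp add: fun_eq_iff)
        then have "str_pair (str_pair x y) z \<in> Acc" unfolding acc using Z(2) by (simp add: S_def)
        moreover have "length z \<le> poly p2 (length (str_pair x y))" using len by (simp add: z_def)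
        ultimately show "str_pair x y \<in> B" unfolding B_def by (intro CollectI exI conjI)
      qed
    next
      assume a: "\<forall>y. length y \<le> poly p1 (length x) \<longrightarrow> str_pair x y \<in> B"
      show "x \<in> Y" unfolding Y
      proof (intro allI impI)
        fix A :: "nat \<Rightarrow> nat \<Rightarrow> bool" assume A: "\<forall>i j. A i j \<longrightarrow> i < poly q (length x) \<and> j < poly q (length x)"
        define y where "y = map (\<lambda>e. A (e mod S) (e div S)) [0..<S * S]"
        have "tabA S (bit_at y) i j = A i j" for i j
        proof (cases "i < S \<and> j < S")
          case True
          then show ?thesis using codeA[of i j] by (simp add: tabA_def bit_at_def y_def)
        next
          case False
          then show ?thesis using A by (auto simp: tabA_def S_def)
        qed
        then have tA: "tabA S (bit_at y) = A" by (simp add: fun_eq_iff)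
        have "length y \<le> poly p1 (length x)" by (simp add: y_def p1_def S_def)
        then have "str_pair x y \<in> B" using a by simp
        then obtain z where "str_pair (str_pair x y) z \<in> Acc" unfolding B_def by (elim CollectE exE conjE) (rule that)
        then have "P (length x) (bit_at x) A (tabZ S (bit_at z))" unfolding acc using tA by (simp add: S_def)
        moreover have "\<forall>c i j. tabZ S (bit_at z) c i j \<longrightarrow> c < 4 \<and> i < S \<and> j < S" by (simp add: tabZ_def)
        ultimately show "\<exists>Z. (\<forall>c i j. Z c i j \<longrightarrow> c < 4 \<and> i < poly q (length x) \<and> j < poly q (length x)) \<and> P (length x) (bit_at x) A Z"
          unfolding S_def by (intro exI conjI)
      qed
    qed
  qed
  then show ?thesis unfolding numeral_2_eq_2 Pi_p.simps mem_Collect_eq by (intro exI bexI[OF _ B] allI)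
qed

text \<open>Points are added in increasing order: a successor stays a successor, and every larger
  gap becomes exactly two. So each point adds at most two, and adjacency is neither lost nor
  created.\<close>

lemma compress_coordinates:
  assumes "finite X"
  shows "\<exists>\<psi>. \<forall>s\<in>X. \<psi> s \<le> 2 * card X \<and> (\<forall>t\<in>X. (s < t \<longrightarrow> \<psi> s < \<psi> t) \<and> (\<psi> t = Suc (\<psi> s) \<longleftrightarrow> t = Suc (s :: nat)))"
  using assms
proof (induction X rule: finite_linorder_max_induct)
  case (insert b X)
  then obtain \<psi> where \<psi>: "\<And>s. s \<in> X \<Longrightarrow> \<psi> s \<le> 2 * card X" "\<And>s t. s \<in> X \<Longrightarrow> t \<in> X \<Longrightarrow> s < t \<Longrightarrow> \<psi> s < \<psi> t"
    "\<And>s t. s \<in> X \<Longrightarrow> t \<in> X \<Longrightarrow> \<psi> t = Suc (\<psi> s) \<longleftrightarrow> t = Suc s" by blast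
  have lt: "s < b" if "s \<in> X" for s using insert(2) that by blast
  have "b \<notin> X" using lt by blast
  then have card: "card (insert b X) = Suc (card X)" using insert(1) by simp
  define c where "c = (if X = {} then 0 else if b = Suc (Max X) then Suc (\<psi> (Max X)) else \<psi> (Max X) + 2)"
  define \<psi>' where "\<psi>' = \<psi>(b := c)"
  have \<psi>': "\<psi>' b = c" "\<And>s. s \<in> X \<Longrightarrow> \<psi>' s = \<psi> s" using \<open>b \<notin> X\<close> by (auto simp: \<psi>'_def)
  have M: "Max X \<in> X" "s \<le> Max X" if "s \<in> X" for s using that insert(1) by (auto intro: Max_in)
  have le: "\<psi> s \<le> \<psi> (Max X)" "\<psi> s = \<psi> (Max X) \<longleftrightarrow> s = Max X" if "s \<in> X" for s
    using \<psi>(2)[OF that M(1)[OF that]] M[OF that] by (cases "s = Max X"; simp)+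
  have new: "\<psi> s < c \<and> (c = Suc (\<psi> s) \<longleftrightarrow> b = Suc s)" if "s \<in> X" for s
  proof -
    have "X \<noteq> {}" using that by blast
    then show ?thesis using le[OF that] M[OF that] lt[OF M(1)[OF that]] by (auto simp: c_def)
  qed
  have "X \<noteq> {} \<Longrightarrow> \<psi> (Max X) \<le> 2 * card X" using \<psi>(1)[OF Max_in[OF insert(1)]] by simp
  then have "c \<le> 2 * Suc (card X)" by (cases "X = {}"; cases "b = Suc (Max X)") (simp_all add: c_def)
  moreover have "\<psi> s \<le> 2 * Suc (card X)" if "s \<in> X" for s using \<psi>(1)[OF that] by simp
  ultimately have A: "\<forall>s\<in>insert b X. \<psi>' s \<le> 2 * card (insert b X)"
    unfolding card using \<psi>' by simp
  have B: "\<forall>s\<in>insert b X. \<forall>t\<in>insert b X. (s < t \<longrightarrow> \<psi>' s < \<psi>' t) \<and> (\<psi>' t = Suc (\<psi>' s) \<longleftrightarrow> t = Suc s)"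
  proof (intro ballI)
    fix s t assume st: "s \<in> insert b X" "t \<in> insert b X"
    consider "s = b" "t = b" | "s \<in> X" "t = b" | "s = b" "t \<in> X" | "s \<in> X" "t \<in> X" using st by blast
    then show "(s < t \<longrightarrow> \<psi>' s < \<psi>' t) \<and> (\<psi>' t = Suc (\<psi>' s) \<longleftrightarrow> t = Suc s)"
    proof cases
      case 2
      then show ?thesis using new[OF 2(1)] \<psi>' by simp
    next
      case 3
      then show ?thesis using new[OF 3(2)] \<psi>' lt[OF 3(2)] by simp
    next
      case 4
      then show ?thesis using \<psi>(2,3)[OF 4] \<psi>' by simp
    qed simp
  qed
  show ?case
  proof (rule exI[of _ \<psi>'], rule ballI, rule conjI)
    fix s assume s: "s \<in> insert b X"
    show "\<psi>' s \<le> 2 * card (insert b X)" by (rule bspec[OF A s])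
    show "\<forall>t\<in>insert b X. (s < t \<longrightarrow> \<psi>' s < \<psi>' t) \<and> (\<psi>' t = Suc (\<psi>' s) \<longleftrightarrow> t = Suc s)" by (rule bspec[OF B s])
  qed
qed simp

lemma compress_embedding:
  assumes "finite (pverts G)" "grid_embedding G \<phi>"
  shows "\<exists>\<psi>. grid_embedding G \<psi> \<and> (\<forall>v\<in>pverts G. fst (\<psi> v) \<le> 2 * card (pverts G) \<and> snd (\<psi> v) \<le> 2 * card (pverts G))"
proof -
  have *: "\<exists>\<psi>. (\<forall>v\<in>pverts G. \<psi> (h v) \<le> 2 * card (pverts G)) \<and>
      (\<forall>u\<in>pverts G. \<forall>v\<in>pverts G. (\<psi> (h u) = \<psi> (h v) \<longleftrightarrow> h u = h v) \<and> (\<psi> (h v) = Suc (\<psi> (h u)) \<longleftrightarrow> h v = Suc (h u)))"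
    for h :: "'a \<Rightarrow> nat"
  proof -
    obtain \<psi> where p: "\<forall>s\<in>h ` pverts G. \<psi> s \<le> 2 * card (h ` pverts G) \<and>
        (\<forall>t\<in>h ` pverts G. (s < t \<longrightarrow> \<psi> s < \<psi> t) \<and> (\<psi> t = Suc (\<psi> s) \<longleftrightarrow> t = Suc s))"
      using compress_coordinates[OF finite_imageI[OF assms(1), of h]] by (elim exE) (rule that)
    have \<psi>: "\<psi> s \<le> 2 * card (h ` pverts G)" "t \<in> h ` pverts G \<Longrightarrow> s < t \<Longrightarrow> \<psi> s < \<psi> t"
      "t \<in> h ` pverts G \<Longrightarrow> \<psi> t = Suc (\<psi> s) \<longleftrightarrow> t = Suc s" if "s \<in> h ` pverts G" for s t
      using conjunct1[OF bspec[OF p that]] bspec[OF conjunct2[OF bspec[OF p that]], of t] by simp_all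
    have "\<psi> (h v) \<le> 2 * card (pverts G)" if "v \<in> pverts G" for v
      using \<psi>(1)[of "h v"] card_image_le[OF assms(1), of h] that by (meson imageI le_trans mult_le_mono2)
    moreover have "\<psi> (h u) = \<psi> (h v) \<longleftrightarrow> h u = h v" if "u \<in> pverts G" "v \<in> pverts G" for u v
    proof (cases rule: linorder_cases[of "h u" "h v"])
      case less
      then show ?thesis using \<psi>(2)[of "h u" "h v"] that by simp
    next
      case greater
      then show ?thesis using \<psi>(2)[of "h v" "h u"] that by simp
    qed simp
    moreover have "\<psi> (h v) = Suc (\<psi> (h u)) \<longleftrightarrow> h v = Suc (h u)" if "u \<in> pverts G" "v \<in> pverts G" for u v
      using \<psi>(3)[of "h u" "h v"] that by simp
    ultimately show ?thesis by (intro exI[of _ \<psi>]) simp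
  qed
  obtain \<psi>1 where p1: "(\<forall>v\<in>pverts G. \<psi>1 (fst (\<phi> v)) \<le> 2 * card (pverts G)) \<and>
      (\<forall>u\<in>pverts G. \<forall>v\<in>pverts G. (\<psi>1 (fst (\<phi> u)) = \<psi>1 (fst (\<phi> v)) \<longleftrightarrow> fst (\<phi> u) = fst (\<phi> v)) \<and>
        (\<psi>1 (fst (\<phi> v)) = Suc (\<psi>1 (fst (\<phi> u))) \<longleftrightarrow> fst (\<phi> v) = Suc (fst (\<phi> u))))"
    using *[of "\<lambda>v. fst (\<phi> v)"] by (elim exE) (rule that)
  have 1: "\<psi>1 (fst (\<phi> u)) \<le> 2 * card (pverts G)"
    "v \<in> pverts G \<Longrightarrow> \<psi>1 (fst (\<phi> u)) = \<psi>1 (fst (\<phi> v)) \<longleftrightarrow> fst (\<phi> u) = fst (\<phi> v)"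
    "v \<in> pverts G \<Longrightarrow> \<psi>1 (fst (\<phi> v)) = Suc (\<psi>1 (fst (\<phi> u))) \<longleftrightarrow> fst (\<phi> v) = Suc (fst (\<phi> u))" if "u \<in> pverts G" for u v
    using bspec[OF conjunct1[OF p1] that] bspec[OF conjunct2[OF p1] that] by simp_all
  obtain \<psi>2 where p2: "(\<forall>v\<in>pverts G. \<psi>2 (snd (\<phi> v)) \<le> 2 * card (pverts G)) \<and>
      (\<forall>u\<in>pverts G. \<forall>v\<in>pverts G. (\<psi>2 (snd (\<phi> u)) = \<psi>2 (snd (\<phi> v)) \<longleftrightarrow> snd (\<phi> u) = snd (\<phi> v)) \<and>
        (\<psi>2 (snd (\<phi> v)) = Suc (\<psi>2 (snd (\<phi> u))) \<longleftrightarrow> snd (\<phi> v) = Suc (snd (\<phi> u))))"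
    using *[of "\<lambda>v. snd (\<phi> v)"] by (elim exE) (rule that)
  have 2: "\<psi>2 (snd (\<phi> u)) \<le> 2 * card (pverts G)"
    "v \<in> pverts G \<Longrightarrow> \<psi>2 (snd (\<phi> u)) = \<psi>2 (snd (\<phi> v)) \<longleftrightarrow> snd (\<phi> u) = snd (\<phi> v)"
    "v \<in> pverts G \<Longrightarrow> \<psi>2 (snd (\<phi> v)) = Suc (\<psi>2 (snd (\<phi> u))) \<longleftrightarrow> snd (\<phi> v) = Suc (snd (\<phi> u))" if "u \<in> pverts G" for u v
    using bspec[OF conjunct1[OF p2] that] bspec[OF conjunct2[OF p2] that] by simp_all
  define \<psi> where "\<psi> v = (\<psi>1 (fst (\<phi> v)), \<psi>2 (snd (\<phi> v)))" for v
  have "grid_embedding G \<psi>"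
    using assms(2) unfolding grid_embedding_def
  proof (elim conjE, intro conjI ballI)
    assume "inj_on \<phi> (pverts G)"
    then show "inj_on \<psi> (pverts G)"
      unfolding inj_on_def \<psi>_def using 1(2) 2(2) by (simp add: prod_eq_iff)
  next
    fix u v assume uv: "u \<in> pverts G" "v \<in> pverts G" and "\<forall>u\<in>pverts G. \<forall>v\<in>pverts G. (u, v) \<in> parcs G \<longleftrightarrow> cell_adj (\<phi> u) (\<phi> v)"
    then have "(u, v) \<in> parcs G \<longleftrightarrow> cell_adj (\<phi> u) (\<phi> v)" by blast
    also have "\<dots> \<longleftrightarrow> cell_adj (\<psi> u) (\<psi> v)"
      unfolding cell_adj_def \<psi>_def fst_conv snd_conv 1(2)[OF uv] 2(2)[OF uv] 1(3)[OF uv] 2(3)[OF uv] 1(3)[OF uv(2,1)] 2(3)[OF uv(2,1)] ..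
    finally show "(u, v) \<in> parcs G \<longleftrightarrow> cell_adj (\<psi> u) (\<psi> v)" .
  qed
  then show ?thesis using 1(1) 2(1) by (intro exI[of _ \<psi>]) (simp add: \<psi>_def)
qed

text \<open>All lists together contain at most three colours per vertex, so an injective renaming
  moves them into the bounded range, and a colouring is pulled back along it.\<close>

lemma choosable_iff_within:
  assumes G: "pair_graph G" and f: "\<forall>v\<in>pverts G. f v \<le> 3"
  shows "choosable G f \<longleftrightarrow> choosable_within G f (3 * card (pverts G) + 3)"
proof
  assume "choosable G f"
  moreover have "\<forall>v\<in>pverts G. f v \<le> 3 * card (pverts G) + 3" using f by (auto intro: trans_le_add2)
  ultimately show "choosable_within G f (3 * card (pverts G) + 3)" unfolding choosable_def by blast
next
  interpret pair_graph G by fact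
  assume c: "choosable_within G f (3 * card (pverts G) + 3)"
  show "choosable G f"
    unfolding choosable_def choosable_within_def
  proof (intro allI impI)
    fix k :: nat and L :: "'a \<Rightarrow> nat set" assume L: "\<forall>v\<in>pverts G. L v \<subseteq> {1..k} \<and> card (L v) = f v"
    define U where "U = (\<Union>v\<in>pverts G. L v)"
    have fin: "finite (L v)" if "v \<in> pverts G" for v
      using finite_subset[OF conjunct1[OF bspec[OF L that]]] by simp
    have finU: "finite U" unfolding U_def by (intro finite_UN_I pair_finite_verts fin)
    have "card U \<le> (\<Sum>v\<in>pverts G. card (L v))" unfolding U_def by (rule card_UN_le[OF pair_finite_verts])
    also have "\<dots> \<le> (\<Sum>v\<in>pverts G. 3)" using L f by (intro sum_mono) simp
    finally have "card U \<le> card {1..3 * card (pverts G) + 3}" by simp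
    then obtain h where h: "h ` U \<subseteq> {1..3 * card (pverts G) + 3}" "inj_on h U"
      using card_le_inj[OF finU, of "{1..3 * card (pverts G) + 3}"] by auto
    have LU: "L v \<subseteq> U" if "v \<in> pverts G" for v using that by (auto simp: U_def)
    have L': "\<forall>v\<in>pverts G. h ` L v \<subseteq> {1..3 * card (pverts G) + 3} \<and> card (h ` L v) = f v"
    proof
      fix v assume v: "v \<in> pverts G"
      have "card (h ` L v) = card (L v)" by (rule card_image[OF inj_on_subset[OF h(2) LU[OF v]]])
      moreover have "h ` L v \<subseteq> {1..3 * card (pverts G) + 3}"
        by (rule subset_trans[OF image_mono[OF LU[OF v]] h(1)])
      ultimately show "h ` L v \<subseteq> {1..3 * card (pverts G) + 3} \<and> card (h ` L v) = f v" using bspec[OF L v] by simp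
    qed
    obtain c' where c': "proper_coloring G c'" "\<forall>v\<in>pverts G. c' v \<in> h ` L v"
      using c[unfolded choosable_within_def, THEN spec, THEN mp, OF L'] by (elim exE conjE) (rule that)
    define c where "c v = (SOME a. a \<in> L v \<and> h a = c' v)" for v
    have c: "c v \<in> L v \<and> h (c v) = c' v" if "v \<in> pverts G" for v
      unfolding c_def by (rule someI_ex) (use bspec[OF c'(2) that] in auto)
    have "proper_coloring G c"
      unfolding proper_coloring_def
    proof (intro ballI, unfold split_paired_all case_prod_conv)
      fix u v assume e: "(u, v) \<in> parcs G"
      have "u \<in> pverts G" "v \<in> pverts G" using wellformed'[OF e] by simp_all
      moreover have "c' u \<noteq> c' v" using c'(1) e unfolding proper_coloring_def by blast
      ultimately show "c u \<noteq> c v" using c[of u] c[of v] by auto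
    qed
    moreover have "\<forall>v\<in>pverts G. c v \<in> L v" using c by simp
    ultimately show "\<exists>c. proper_coloring G c \<and> (\<forall>v\<in>pverts G. c v \<in> L v)" by (intro exI conjI)
  qed
qed

text \<open>Table \<open>0\<close> of the certificate says where the list size is \<open>3\<close>; tables \<open>1\<close>, \<open>2\<close> and \<open>3\<close> give the
  grid coordinates and the colours as cardinalities of their rows.\<close>

definition row_card :: "nat \<Rightarrow> (nat \<Rightarrow> nat \<Rightarrow> nat \<Rightarrow> bool) \<Rightarrow> nat \<Rightarrow> nat \<Rightarrow> nat" where
  "row_card m Z c v = (\<Sum>a<m. of_bool (Z c v a))"

definition cert_size :: "(nat \<Rightarrow> nat \<Rightarrow> nat \<Rightarrow> bool) \<Rightarrow> nat \<Rightarrow> nat" where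
  "cert_size Z v = 2 + of_bool (Z 0 v 0)"

definition code_arc :: "(nat \<Rightarrow> bool) \<Rightarrow> nat \<Rightarrow> nat \<Rightarrow> nat \<Rightarrow> bool" where
  "code_arc \<xi> n u v \<longleftrightarrow> \<xi> (n + 1 + (u * n + v))"

text \<open>The number \<open>n\<close> and the sizes are guessed and the code is recomputed from
  them, which avoids parsing. The conditions on tables \<open>1\<close> and \<open>2\<close> are
  those of \<open>grid_embedding\<close>, and degrees are counted along the rows of the adjacency
  matrix.\<close>

definition instance_ok :: "bool \<Rightarrow> nat \<Rightarrow> (nat \<Rightarrow> bool) \<Rightarrow> (nat \<Rightarrow> nat \<Rightarrow> nat \<Rightarrow> bool) \<Rightarrow> nat \<Rightarrow> bool" where
  "instance_ok dc N \<xi> Z n \<longleftrightarrow>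
     N = n + 1 + n * n + unary_pos (cert_size Z) n \<and> (\<forall>i<N. \<xi> i = code_bit n (code_arc \<xi> n) (cert_size Z) i) \<and>
     (\<forall>u<n. \<not> code_arc \<xi> n u u) \<and> (\<forall>u<n. \<forall>v<n. code_arc \<xi> n u v \<longrightarrow> code_arc \<xi> n v u) \<and>
     (\<forall>u<n. \<forall>v<n. row_card (2 * n) Z 1 u = row_card (2 * n) Z 1 v \<and> row_card (2 * n) Z 2 u = row_card (2 * n) Z 2 v \<longrightarrow> u = v) \<and>
     (\<forall>u<n. \<forall>v<n. code_arc \<xi> n u v \<longleftrightarrow>
       cell_adj (row_card (2 * n) Z 1 u, row_card (2 * n) Z 2 u) (row_card (2 * n) Z 1 v, row_card (2 * n) Z 2 v)) \<and>
     (dc \<longrightarrow> (\<forall>v<n. ((\<Sum>u<n. of_bool (code_arc \<xi> n v u)) = (4 :: nat) \<longrightarrow> cert_size Z v = 3) \<and>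
       ((\<Sum>u<n. of_bool (code_arc \<xi> n v u)) = (2 :: nat) \<longrightarrow> cert_size Z v = 2)))"

text \<open>A table whose rows have wrong cardinalities is no list assignment and is accepted at
  once. Colours start at \<open>1\<close>, hence the shift by \<open>Suc\<close> and the demand for
  a nonzero colour.\<close>

definition coloring_ok :: "nat \<Rightarrow> (nat \<Rightarrow> bool) \<Rightarrow> (nat \<Rightarrow> nat \<Rightarrow> bool) \<Rightarrow> (nat \<Rightarrow> nat \<Rightarrow> nat \<Rightarrow> bool) \<Rightarrow> nat \<Rightarrow> bool" where
  "coloring_ok K \<xi> A Z n \<longleftrightarrow> (\<exists>v<n. (\<Sum>a<K. of_bool (A v (Suc a))) \<noteq> cert_size Z v) \<or>
     (\<forall>v<n. 0 < row_card K Z 3 v \<and> A v (row_card K Z 3 v)) \<and>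
     (\<forall>u<n. \<forall>v<n. code_arc \<xi> n u v \<longrightarrow> row_card K Z 3 u \<noteq> row_card K Z 3 v)"

definition certificate_ok ::
  "bool \<Rightarrow> nat poly \<Rightarrow> nat \<Rightarrow> (nat \<Rightarrow> bool) \<Rightarrow> (nat \<Rightarrow> nat \<Rightarrow> bool) \<Rightarrow> (nat \<Rightarrow> nat \<Rightarrow> nat \<Rightarrow> bool) \<Rightarrow> bool" where
  "certificate_ok dc kp N \<xi> A Z \<longleftrightarrow> (\<exists>n<N. instance_ok dc N \<xi> Z n \<and> coloring_ok (poly kp n) \<xi> A Z n)"

lemma D_certificate_ok:
  "definable (\<lambda>v. v) [] (\<lambda>v. of_bool (certificate_ok dc kp (x_len v) (x_bit v) (y_table q v) (z_table q v)))"
proof -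
  have row: "definable inp vs (\<lambda>s. row_card (f s) (z_table q (inp s)) c (g s))"
    if "definable inp vs f" "definable inp vs g" for inp :: "'s \<Rightarrow> _" and vs f g c
    unfolding row_card_def by (intro D_intros that D_weaken)
  have size: "definable inp vs (\<lambda>s. cert_size (z_table q (inp s)) (f s))" if "definable inp vs f" for inp :: "'s \<Rightarrow> _" and vs f
    unfolding cert_size_def by (intro D_intros that D_weaken)
  have pos: "definable inp vs (\<lambda>s. unary_pos (cert_size (z_table q (inp s))) (f s))" if "definable inp vs f" for inp :: "'s \<Rightarrow> _" and vs f
    unfolding unary_pos_def by (intro D_intros size that D_weaken)
  have arc: "definable inp vs (\<lambda>s. of_bool (code_arc (x_bit (inp s)) (f s) (g s) (h s)))"
    if "definable inp vs f" "definable inp vs g" "definable inp vs h" for inp :: "'s \<Rightarrow> _" and vs f g h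
    unfolding code_arc_def by (intro D_intros that D_weaken)
  have bit: "definable inp vs (\<lambda>s. of_bool (code_bit (f s) (code_arc (x_bit (inp s)) (f s)) (cert_size (z_table q (inp s))) (g s)))"
    if "definable inp vs f" "definable inp vs g" for inp :: "'s \<Rightarrow> _" and vs f g
    unfolding code_bit_def by (intro D_intros arc pos size that D_weaken)
  have inst: "definable inp vs (\<lambda>s. of_bool (instance_ok dc (x_len (inp s)) (x_bit (inp s)) (z_table q (inp s)) (f s)))"
    if "definable inp vs f" for inp :: "'s \<Rightarrow> _" and vs f
    unfolding instance_ok_def cell_adj_def fst_conv snd_conv
    by (intro D_intros arc pos size bit row that D_weaken)
  have col: "definable inp vs (\<lambda>s. of_bool (coloring_ok (poly kp (f s)) (x_bit (inp s)) (y_table q (inp s)) (z_table q (inp s)) (f s)))"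
    if "definable inp vs f" for inp :: "'s \<Rightarrow> _" and vs f
    unfolding coloring_ok_def by (intro D_intros arc size row that D_weaken)
  show ?thesis unfolding certificate_ok_def by (intro D_intros inst col)
qed

section \<open>Correctness of the verifier\<close>

definition code_graph :: "nat \<Rightarrow> (nat \<Rightarrow> nat \<Rightarrow> bool) \<Rightarrow> nat pair_pre_digraph" where
  "code_graph n arc = \<lparr>pverts = {..<n}, parcs = {(u, v). u < n \<and> v < n \<and> arc u v}\<rparr>"

lemma pair_graph_code_graph:
  assumes "\<And>u. u < n \<Longrightarrow> \<not> arc u u" "\<And>u v. u < n \<Longrightarrow> v < n \<Longrightarrow> arc u v \<Longrightarrow> arc v u"
  shows "pair_graph (code_graph n arc)"
proof -
  have sub: "parcs (code_graph n arc) \<subseteq> pverts (code_graph n arc) \<times> pverts (code_graph n arc)"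
    by (auto simp: code_graph_def)
  have fin: "finite (pverts (code_graph n arc))" by (simp add: code_graph_def)
  then have "finite (parcs (code_graph n arc))" using sub finite_subset by blast
  moreover have "symmetric (with_proj (code_graph n arc))"
    using assms(2) by (auto simp: symmetric_def sym_def code_graph_def)
  ultimately show ?thesis
    using sub fin assms(1) by unfold_locales (auto, auto simp: code_graph_def)
qed

lemma sum_of_bool_less:
  fixes P :: "nat \<Rightarrow> bool"
  shows "(\<Sum>u<n. of_bool (P u)) = card {u. u < n \<and> P u}"
  by (simp add: Int_def)

lemma out_degree_eq_sum:
  fixes G :: "nat pair_pre_digraph"
  assumes "pair_graph G" "pverts G = {..<n}"
  shows "out_degree (with_proj G) v = (\<Sum>u<n. of_bool ((v, u) \<in> parcs G))"
proof -
  interpret pair_graph G by fact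
  have "out_arcs (with_proj G) v = Pair v ` {u. u < n \<and> (v, u) \<in> parcs G}"
    using wellformed' assms(2) by (auto simp: out_arcs_def)
  then have "out_degree (with_proj G) v = card {u. u < n \<and> (v, u) \<in> parcs G}"
    by (simp add: out_degree_def card_image inj_on_def)
  then show ?thesis by (simp only: sum_of_bool_less)
qed

lemma instance_okD:
  assumes ok: "instance_ok dc (length x) (bit_at x) Z n"
  defines "G \<equiv> code_graph n (code_arc (bit_at x) n)"
  shows "(G, cert_size Z) \<in> ch_instances {2, 3}" "x = encode (G, cert_size Z)" "subgrid G" "dc \<Longrightarrow> degree_condition G (cert_size Z)"
    "card (pverts G) = n"
proof -
  note o = ok[unfolded instance_ok_def]
  note o2 = conjunct1[OF conjunct2[OF o], rule_format]
  have G: "pair_graph G" unfolding G_def by (rule pair_graph_code_graph) (use o in blast)+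
  have V: "pverts G = {..<n}" and E: "\<And>u v. (u, v) \<in> parcs G \<longleftrightarrow> u < n \<and> v < n \<and> code_arc (bit_at x) n u v"
    by (simp_all add: G_def code_graph_def)
  show card: "card (pverts G) = n" by (simp add: V)
  show "(G, cert_size Z) \<in> ch_instances {2, 3}" using G V by (auto simp: ch_instances_def cert_size_def)
  show "x = encode (G, cert_size Z)"
  proof -
    have "code_bit n (\<lambda>u v. (u, v) \<in> parcs G) (cert_size Z) i = code_bit n (code_arc (bit_at x) n) (cert_size Z) i" for i
    proof (cases "n + 1 \<le> i \<and> i < n + 1 + n * n")
      case True
      then have "i - (n + 1) < n * n" by linarith
      moreover from this have "0 < n" by (cases n) auto
      ultimately have "(i - (n + 1)) div n < n" "(i - (n + 1)) mod n < n"
        by (simp_all add: less_mult_imp_div_less)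
      then show ?thesis by (simp add: code_bit_def E)
    qed (auto simp: code_bit_def)
    then have "encode (G, cert_size Z) = map (code_bit n (code_arc (bit_at x) n) (cert_size Z)) [0..<length x]"
      using encode_eq_bits[OF card] o by presburger
    also have "\<dots> = map (\<lambda>i. bit_at x i) [0..<length x]" by (rule map_cong) (simp_all add: o2)
    also have "\<dots> = x" by (rule nth_equalityI) (simp_all add: bit_at_def)
    finally show ?thesis ..
  qed
  show "subgrid G"
    unfolding subgrid_iff[OF G]
  proof (rule exI[of _ "\<lambda>v. (row_card (2 * n) Z 1 v, row_card (2 * n) Z 2 v)"], unfold grid_embedding_def, intro conjI ballI)
    show "inj_on (\<lambda>v. (row_card (2 * n) Z 1 v, row_card (2 * n) Z 2 v)) (pverts G)"
    proof (rule inj_onI)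
      fix u v assume "u \<in> pverts G" "v \<in> pverts G"
        "(row_card (2 * n) Z 1 u, row_card (2 * n) Z 2 u) = (row_card (2 * n) Z 1 v, row_card (2 * n) Z 2 v)"
      then show "u = v" using o V by simp
    qed
    fix u v assume "u \<in> pverts G" "v \<in> pverts G"
    then show "(u, v) \<in> parcs G \<longleftrightarrow> cell_adj (row_card (2 * n) Z 1 u, row_card (2 * n) Z 2 u) (row_card (2 * n) Z 1 v, row_card (2 * n) Z 2 v)"
      using o V E by simp
  qed
  show "degree_condition G (cert_size Z)" if dc
    unfolding degree_condition_def
  proof
    fix v assume "v \<in> pverts G"
    then have v: "v < n" by (simp add: V)
    have "out_degree (with_proj G) v = (\<Sum>u<n. of_bool (code_arc (bit_at x) n v u))"
      unfolding out_degree_eq_sum[OF G V] using v by (intro sum.cong) (simp_all add: E)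
    then show "(out_degree (with_proj G) v = 4 \<longrightarrow> cert_size Z v = 3) \<and> (out_degree (with_proj G) v = 2 \<longrightarrow> cert_size Z v = 2)"
      using o that v by presburger
  qed
qed

lemma instance_okI:
  assumes G: "(G, f) \<in> ch_instances {2, 3}" and x: "x = encode (G, f)" and n: "n = card (pverts G)"
    and \<phi>: "grid_embedding G \<phi>" "\<And>v. v \<in> pverts G \<Longrightarrow> fst (\<phi> v) \<le> 2 * n \<and> snd (\<phi> v) \<le> 2 * n"
    and dc: "dc \<Longrightarrow> degree_condition G f"
    and Z: "\<And>v. v < n \<Longrightarrow> Z 0 v 0 = (f v = 3)" "\<And>v a. v < n \<Longrightarrow> Z 1 v a = (a < fst (\<phi> v))" "\<And>v a. v < n \<Longrightarrow> Z 2 v a = (a < snd (\<phi> v))"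
  shows "instance_ok dc (length x) (bit_at x) Z n" "n < length x" "\<And>u v. u < n \<Longrightarrow> v < n \<Longrightarrow> code_arc (bit_at x) n u v \<longleftrightarrow> (u, v) \<in> parcs G"
    "\<And>v. v < n \<Longrightarrow> cert_size Z v = f v"
proof -
  have pg: "pair_graph G" and V: "pverts G = {..<n}" and f: "\<And>v. v < n \<Longrightarrow> f v = 2 \<or> f v = 3"
    using G unfolding ch_instances_def n by auto
  show size: "cert_size Z v = f v" if "v < n" for v using f[OF that] Z(1)[OF that] by (auto simp: cert_size_def)
  have pos: "unary_pos (cert_size Z) v = unary_pos f v" if "v \<le> n" for v
    unfolding unary_pos_def using size that by (intro sum.cong) auto
  note bits = encode_eq_bits[OF n[symmetric], of f]
  have len: "length x = n + 1 + n * n + unary_pos f n" unfolding x bits by simp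
  then show "n < length x" by simp
  have at: "bit_at x i = code_bit n (\<lambda>u v. (u, v) \<in> parcs G) f i" if "i < length x" for i
    using that len unfolding bit_at_def by (simp add: x bits del: encode.simps upt_Suc)
  show arc: "code_arc (bit_at x) n u v \<longleftrightarrow> (u, v) \<in> parcs G" if "u < n" "v < n" for u v
  proof -
    have i: "u * n + v < n * n" using mixed_radix_less[OF that(2,1)] by (simp add: mult.commute add.commute)
    have d: "(u * n + v) div n = u" "(u * n + v) mod n = v" using that(2) by simp_all
    have l: "n + 1 + (u * n + v) < length x" using i len by simp
    have "n + 1 + (u * n + v) - (n + 1) = u * n + v" by simp
    then show ?thesis unfolding code_arc_def at[OF l] code_bit_def using i d by simp
  qed
  have row: "row_card (2 * n) Z 1 v = fst (\<phi> v)" "row_card (2 * n) Z 2 v = snd (\<phi> v)" if "v < n" for v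
  proof -
    have c: "(\<Sum>a<m. of_bool (a < t)) = t" if "t \<le> m" for t m :: nat
    proof -
      have "{a. a < m \<and> a < t} = {..<t}" using that by auto
      then show ?thesis by (simp add: Int_def)
    qed
    show "row_card (2 * n) Z 1 v = fst (\<phi> v)" "row_card (2 * n) Z 2 v = snd (\<phi> v)"
      unfolding row_card_def Z(2)[OF that] Z(3)[OF that] by (rule c, use \<phi>(2)[of v] that V in simp)+
  qed
  have code: "code_bit n (code_arc (bit_at x) n) (cert_size Z) i = code_bit n (\<lambda>u v. (u, v) \<in> parcs G) f i" for i
  proof (cases "n + 1 \<le> i \<and> i < n + 1 + n * n")
    case True
    then have "i - (n + 1) < n * n" by linarith
    moreover from this have "0 < n" by (cases n) auto
    ultimately have "(i - (n + 1)) div n < n" "(i - (n + 1)) mod n < n"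
      by (simp_all add: less_mult_imp_div_less)
    then show ?thesis using True arc by (simp add: code_bit_def)
  next
    case False
    have "(unary_pos (cert_size Z) v \<le> r \<and> r < unary_pos (cert_size Z) v + cert_size Z v) \<longleftrightarrow>
        (unary_pos f v \<le> r \<and> r < unary_pos f v + f v)" if "v < n" for v r
      using pos[of v] size[of v] that by simp
    then show ?thesis using False unfolding code_bit_def by (simp cong: conj_cong)
  qed
  interpret pair_graph G by (rule pg)
  show "instance_ok dc (length x) (bit_at x) Z n"
    unfolding instance_ok_def
  proof (intro conjI allI impI)
    show "length x = n + 1 + n * n + unary_pos (cert_size Z) n" using len pos[of n] by simp
    show "bit_at x i = code_bit n (code_arc (bit_at x) n) (cert_size Z) i" if "i < length x" for i
      using at[OF that] code[of i] by simp
    show "\<not> code_arc (bit_at x) n u u" if "u < n" for u using arc[OF that that] pair_no_loops[of "(u, u)"] by auto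
    show "code_arc (bit_at x) n v u" if "u < n" "v < n" "code_arc (bit_at x) n u v" for u v
      using arc[OF that(1,2)] arc[OF that(2,1)] that(3) arcs_symmetric[of u v] by simp
    show "u = v" if uv: "u < n" "v < n"
      and e: "row_card (2 * n) Z 1 u = row_card (2 * n) Z 1 v \<and> row_card (2 * n) Z 2 u = row_card (2 * n) Z 2 v" for u v
    proof -
      have "inj_on \<phi> (pverts G)" using \<phi>(1) by (simp add: grid_embedding_def)
      moreover have "\<phi> u = \<phi> v" using e row[OF uv(1)] row[OF uv(2)] by (simp add: prod_eq_iff)
      ultimately show ?thesis using uv V by (auto dest: inj_onD)
    qed
    show "code_arc (bit_at x) n u v \<longleftrightarrow>
      cell_adj (row_card (2 * n) Z 1 u, row_card (2 * n) Z 2 u) (row_card (2 * n) Z 1 v, row_card (2 * n) Z 2 v)" if "u < n" "v < n" for u v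
      using \<phi>(1) V that arc[OF that] row[OF that(1)] row[OF that(2)] by (simp add: grid_embedding_def)
    have deg: "(\<Sum>u<n. of_bool (code_arc (bit_at x) n v u)) = out_degree (with_proj G) v" if "v < n" for v
      unfolding out_degree_eq_sum[OF pg V] using that by (intro sum.cong) (simp_all add: arc)
    show "cert_size Z v = 3" if dc "v < n" "(\<Sum>u<n. of_bool (code_arc (bit_at x) n v u)) = (4 :: nat)" for v
      using dc[OF that(1)] that(2,3) V size[OF that(2)] unfolding deg[OF that(2)] degree_condition_def by simp
    show "cert_size Z v = 2" if dc "v < n" "(\<Sum>u<n. of_bool (code_arc (bit_at x) n v u)) = (2 :: nat)" for v
      using dc[OF that(1)] that(2,3) V size[OF that(2)] unfolding deg[OF that(2)] degree_condition_def by simp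
  qed
qed

lemma sum_less_of_bool: "t \<le> m \<Longrightarrow> (\<Sum>a<m. of_bool (a < t)) = (t :: nat)"
proof -
  assume "t \<le> m"
  then have "{a. a < m \<and> a < t} = {..<t}" by auto
  then show ?thesis by (simp add: Int_def)
qed

lemma card_list_row: "card {a \<in> {1..K}. P a} = (\<Sum>a<K. of_bool (P (Suc a)))"
proof -
  have "{a \<in> {1..K}. P a} = Suc ` {a. a < K \<and> P (Suc a)}"
  proof (intro set_eqI iffI)
    fix a assume "a \<in> {a \<in> {1..K}. P a}"
    then show "a \<in> Suc ` {a. a < K \<and> P (Suc a)}" by (intro image_eqI[of _ _ "a - 1"]) auto
  qed auto
  then show ?thesis unfolding sum_of_bool_less by (simp add: card_image)
qed

text \<open>The existential certificate, which includes sizes and coordinates, may change with the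
  list table \<open>A\<close>. Still all certificates speak of the same instance, because
  \<open>encode\<close> determines the graph and the sizes of its vertices.\<close>

lemma Pi2_member:
  assumes Q: "\<And>G f. (G, f) \<in> ch_instances {2, 3} \<Longrightarrow> Q G f \<longleftrightarrow> choosable_within G f (poly kp (card (pverts G)))"
    and R: "\<And>G f. R G f \<longleftrightarrow> subgrid G \<and> (dc \<longrightarrow> degree_condition G f)"
  shows "encode ` {(G, f) \<in> ch_instances {2, 3}. R G f \<and> Q G f} \<in> Pi_p 2"
proof (rule Pi2_tables[OF D_certificate_ok[of dc kp "kp + [:2, 2:]"]])
  fix x
  \<comment> \<open>The side of the tables must exceed the row indices below \<open>n\<close>, the
    coordinates up to \<open>2 * n\<close> and the colours up to \<open>poly kp n\<close>, where
    \<open>n < length x\<close>.\<close>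
  let ?q = "kp + [:2, 2:]"
  have q: "poly ?q N = poly kp N + 2 + 2 * N" for N by simp
  show "x \<in> encode ` {(G, f) \<in> ch_instances {2, 3}. R G f \<and> Q G f} \<longleftrightarrow>
    (\<forall>A. (\<forall>i j. A i j \<longrightarrow> i < poly ?q (length x) \<and> j < poly ?q (length x)) \<longrightarrow>
      (\<exists>Z. (\<forall>c i j. Z c i j \<longrightarrow> c < 4 \<and> i < poly ?q (length x) \<and> j < poly ?q (length x)) \<and> certificate_ok dc kp (length x) (bit_at x) A Z))"
    (is "?L \<longleftrightarrow> ?R")
  proof
    assume ?L
    then obtain G f where G: "(G, f) \<in> ch_instances {2, 3}" "R G f" "Q G f" "x = encode (G, f)"
      by (auto simp del: encode.simps)
    define n where "n = card (pverts G)"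
    have pg: "pair_graph G" and V: "pverts G = {..<n}" using G(1) by (auto simp: ch_instances_def n_def)
    have "subgrid G" and dc: "dc \<Longrightarrow> degree_condition G f" using G(2) R by blast+
    then obtain \<phi>0 where "grid_embedding G \<phi>0" using subgrid_iff[OF pg] by blast
    then obtain \<phi> where \<phi>: "grid_embedding G \<phi>" "\<forall>v\<in>pverts G. fst (\<phi> v) \<le> 2 * n \<and> snd (\<phi> v) \<le> 2 * n"
      using compress_embedding[of G \<phi>0] V unfolding n_def[symmetric] by auto
    define K where "K = poly kp n"
    show ?R
    proof (intro allI impI)
      fix A :: "nat \<Rightarrow> nat \<Rightarrow> bool"
      define L where "L v = {a \<in> {1..K}. A v a}" for v
      have "\<exists>c. (\<forall>v<n. c v \<le> K) \<and> ((\<forall>v<n. card (L v) = f v) \<longrightarrow> proper_coloring G c \<and> (\<forall>v<n. c v \<in> L v))"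
      proof (cases "\<forall>v<n. card (L v) = f v")
        case True
        then have "\<forall>v\<in>pverts G. L v \<subseteq> {1..K} \<and> card (L v) = f v" by (auto simp: L_def V)
        moreover have "choosable_within G f K" using Q[OF G(1)] G(3) by (simp add: K_def n_def)
        ultimately obtain c where c: "proper_coloring G c" "\<forall>v\<in>pverts G. c v \<in> L v" unfolding choosable_within_def by blast
        then have "\<forall>v<n. c v \<le> K" by (auto simp: V L_def)
        then show ?thesis using c V by auto
      next
        case False
        \<comment> \<open>If \<open>A\<close> is no list assignment, no colouring is demanded; zero
          stays within the table.\<close>
        then show ?thesis by (intro exI[of _ "\<lambda>_. 0"]) blast
      qed
      then obtain c where c: "\<And>v. v < n \<Longrightarrow> c v \<le> K" "(\<forall>v<n. card (L v) = f v) \<Longrightarrow> proper_coloring G c \<and> (\<forall>v<n. c v \<in> L v)"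
        by (elim exE conjE) (rule that, simp_all)
      \<comment> \<open>Numbers are stored as initial segments of rows, so that the cardinality of a
        row gives the number back.\<close>
      define Z where "Z t v a \<longleftrightarrow> v < n \<and> (if t = 0 then a = 0 \<and> f v = 3 else if t = 1 then a < fst (\<phi> v)
        else if t = 2 then a < snd (\<phi> v) else t = 3 \<and> a < c v)" for t v a :: nat
      have Z0: "Z 0 v 0 = (f v = 3)" and Z1: "Z 1 v a = (a < fst (\<phi> v))" and Z2: "Z 2 v a = (a < snd (\<phi> v))" and Z3: "Z 3 v a = (a < c v)"
        if "v < n" for v a using that by (simp_all add: Z_def)
      have \<phi>': "\<And>v. v \<in> pverts G \<Longrightarrow> fst (\<phi> v) \<le> 2 * n \<and> snd (\<phi> v) \<le> 2 * n" using \<phi>(2) by blast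
      note I = instance_okI[OF G(1,4) n_def \<phi>(1) \<phi>' dc Z0 Z1 Z2, of dc]
      have ok: "instance_ok dc (length x) (bit_at x) Z n" "n < length x"
        and arc: "\<And>u v. u < n \<Longrightarrow> v < n \<Longrightarrow> code_arc (bit_at x) n u v \<longleftrightarrow> (u, v) \<in> parcs G"
        and size: "\<And>v. v < n \<Longrightarrow> cert_size Z v = f v"
        using I by simp_all
      have K: "K \<le> poly kp (length x)" unfolding K_def by (rule poly_mono_nat) (use ok(2) in simp)
      have supp: "t < 4 \<and> v < poly ?q (length x) \<and> a < poly ?q (length x)" if z: "Z t v a" for t v a
      proof -
        have v: "v < n" using z by (simp add: Z_def)
        have "fst (\<phi> v) \<le> 2 * n" "snd (\<phi> v) \<le> 2 * n" using \<phi>'[of v] v V by simp_all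
        then have "t < 4 \<and> (a = 0 \<or> a < 2 * n \<or> a < K)" using z c(1)[OF v] by (auto simp: Z_def split: if_splits)
        then show ?thesis unfolding q using v ok(2) K by linarith
      qed
      have row: "row_card K Z 3 v = c v" if "v < n" for v
        unfolding row_card_def Z3[OF that] by (rule sum_less_of_bool[OF c(1)[OF that]])
      have "coloring_ok K (bit_at x) A Z n"
      proof (cases "\<forall>v<n. card (L v) = f v")
        case True
        have p: "proper_coloring G c" "\<And>v. v < n \<Longrightarrow> c v \<in> L v" using c(2)[OF True] by blast+
        have "0 < row_card K Z 3 v \<and> A v (row_card K Z 3 v)" if "v < n" for v
          using p(2)[OF that] row[OF that] by (simp add: L_def)
        moreover have "row_card K Z 3 u \<noteq> row_card K Z 3 v" if uv: "u < n" "v < n" "code_arc (bit_at x) n u v" for u v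
        proof -
          have "(u, v) \<in> parcs G" using arc uv by simp
          then have "c u \<noteq> c v" using p(1) unfolding proper_coloring_def by blast
          then show ?thesis using row uv(1,2) by simp
        qed
        ultimately show ?thesis unfolding coloring_ok_def by (intro disjI2 conjI allI impI) simp_all
      next
        case False
        then obtain v where v: "v < n" "card (L v) \<noteq> f v" by blast
        then have "(\<Sum>a<K. of_bool (A v (Suc a))) \<noteq> cert_size Z v" unfolding size[OF v(1)] card_list_row[symmetric] by (simp add: L_def)
        then show ?thesis unfolding coloring_ok_def using v(1) by blast
      qed
      then have "certificate_ok dc kp (length x) (bit_at x) A Z"
        unfolding certificate_ok_def using ok unfolding K_def by blast
      then show "\<exists>Z. (\<forall>c i j. Z c i j \<longrightarrow> c < 4 \<and> i < poly ?q (length x) \<and> j < poly ?q (length x)) \<and> certificate_ok dc kp (length x) (bit_at x) A Z"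
        using supp by (intro exI[of _ Z]) simp
    qed
  next
    assume r: ?R
    have cert: "\<exists>Z n. instance_ok dc (length x) (bit_at x) Z n \<and> coloring_ok (poly kp n) (bit_at x) A Z n \<and> n < length x"
      if "\<forall>i j. A i j \<longrightarrow> i < poly ?q (length x) \<and> j < poly ?q (length x)" for A
      using r[THEN spec, THEN mp, OF that] unfolding certificate_ok_def by (elim exE conjE) (intro exI conjI)
    \<comment> \<open>Some list table has to be supplied before a certificate yields the instance;
      the empty one will do.\<close>
    obtain Z n where Zn: "instance_ok dc (length x) (bit_at x) Z n" "n < length x" using cert[of "\<lambda>_ _. False"] by blast
    define G where "G = code_graph n (code_arc (bit_at x) n)"
    define f where "f = cert_size Z"
    note D = instance_okD[OF Zn(1), folded G_def f_def]
    define K where "K = poly kp n"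
    have K: "K \<le> poly kp (length x)" unfolding K_def by (rule poly_mono_nat) (use Zn(2) in simp)
    have V: "pverts G = {..<n}" by (simp add: G_def code_graph_def)
    have "choosable_within G f K"
      unfolding choosable_within_def
    proof (intro allI impI)
      fix L :: "nat \<Rightarrow> nat set" assume L: "\<forall>v\<in>pverts G. L v \<subseteq> {1..K} \<and> card (L v) = f v"
      define A where "A v a \<longleftrightarrow> v < n \<and> a \<in> L v" for v a
      have A: "v < n" "a \<le> K" if "A v a" for v a
        using that bspec[OF L, of v] V by (auto simp: A_def)
      have "\<forall>i j. A i j \<longrightarrow> i < poly ?q (length x) \<and> j < poly ?q (length x)"
        unfolding q
      proof (intro allI impI)
        fix i j assume "A i j"
        from A[OF this] show "i < poly kp (length x) + 2 + 2 * length x \<and> j < poly kp (length x) + 2 + 2 * length x"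
          using Zn(2) K by linarith
      qed
      then obtain Z' n' where Z': "instance_ok dc (length x) (bit_at x) Z' n'" "coloring_ok (poly kp n') (bit_at x) A Z' n'"
        using cert[of A] by blast
      note D' = instance_okD[OF Z'(1)]
      have "encode (G, f) = encode (code_graph n' (code_arc (bit_at x) n'), cert_size Z')" using D(2) D'(2) by simp
      note e = encode_inject[OF D(1) D'(1) this]
      have n': "n' = n" using D(5) D'(5) e(1) by simp
      have size: "cert_size Z' v = f v" if "v < n" for v using e(2) that V by simp
      have sum: "(\<Sum>a<K. of_bool (A v (Suc a))) = cert_size Z' v" if v: "v < n" for v
      proof -
        have Lv: "L v \<subseteq> {1..K}" "card (L v) = f v" using bspec[OF L, of v] v V by simp_all
        then have "L v = {a \<in> {1..K}. A v a}" using v by (auto simp: A_def)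
        then show ?thesis using card_list_row[of K "A v"] Lv(2) size[OF v] by simp
      qed
      have co: "(\<forall>v<n. 0 < row_card K Z' 3 v \<and> A v (row_card K Z' 3 v)) \<and>
          (\<forall>u<n. \<forall>v<n. code_arc (bit_at x) n u v \<longrightarrow> row_card K Z' 3 u \<noteq> row_card K Z' 3 v)"
        using Z'(2) unfolding n' K_def[symmetric] coloring_ok_def
      proof (rule disjE)
        assume "\<exists>v<n. (\<Sum>a<K. of_bool (A v (Suc a))) \<noteq> cert_size Z' v"
        then show ?thesis using sum by blast
      qed
      have c: "A v (row_card K Z' 3 v)" "u < n \<Longrightarrow> code_arc (bit_at x) n u v \<Longrightarrow> row_card K Z' 3 u \<noteq> row_card K Z' 3 v"
        if "v < n" for u v using co that by simp_all
      have "proper_coloring G (row_card K Z' 3)"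
        unfolding proper_coloring_def using c(2) by (auto simp: G_def code_graph_def)
      moreover have "\<forall>v\<in>pverts G. row_card K Z' 3 v \<in> L v" using c(1) V by (simp add: A_def)
      ultimately show "\<exists>c. proper_coloring G c \<and> (\<forall>v\<in>pverts G. c v \<in> L v)" by blast
    qed
    then have "Q G f" using Q[OF D(1)] D(5) by (simp add: K_def)
    moreover have "R G f" using R D(3,4) by blast
    ultimately show ?L using D(1,2) by (intro image_eqI[of _ _ "(G, f)"]) simp_all
  qed
qed

section \<open>Completeness\<close>

lemma choosable_within_cong:
  assumes "\<forall>v \<in> pverts G. f v = g v"
  shows "choosable_within G f k \<longleftrightarrow> choosable_within G g k"
  using assms unfolding choosable_within_def by simp

lemma choosable_cong:
  assumes "\<forall>v \<in> pverts G. f v = g v"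
  shows "choosable G f \<longleftrightarrow> choosable G g"
  using assms choosable_within_cong[OF assms] unfolding choosable_def by simp

text \<open>The flag \<open>dc\<close> switches the degree condition on, so that the plain and the
  restricted problem share one verifier and one reduction.\<close>

lemma Pi2_completeI:
  assumes "\<And>G f. (G, f) \<in> ch_instances {2, 3} \<Longrightarrow> Q G f \<longleftrightarrow> choosable_within G f (poly kp (card (pverts G)))"
    and "\<And>nv mc isU lit. Q (qbf_graph nv mc isU lit) (qbf_size nv mc) \<longleftrightarrow> qbf nv mc isU lit"
    and "\<And>G f g. \<forall>v \<in> pverts G. f v = g v \<Longrightarrow> Q G f \<longleftrightarrow> Q G g"
    and R: "\<And>G f. R G f \<longleftrightarrow> subgrid G \<and> (dc \<longrightarrow> degree_condition G f)"
  shows "Pi2_complete {2, 3} R Q"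
  unfolding Pi2_complete_def complete_problem_def
proof (intro conjI ballI)
  show "encode ` {(G, f) \<in> ch_instances {2, 3}. R G f \<and> Q G f} \<subseteq> encode ` {(G, f) \<in> ch_instances {2, 3}. R G f}"
    by (rule image_mono) auto
  show "encode ` {(G, f) \<in> ch_instances {2, 3}. R G f \<and> Q G f} \<in> Pi_p 2"
    by (rule Pi2_member[OF assms(1) R])
  fix A assume "A \<in> Pi_p 2"
  then show "\<exists>F. polytime F \<and> (\<forall>x. F x \<in> encode ` {(G, f) \<in> ch_instances {2, 3}. R G f} \<and>
      (x \<in> A \<longleftrightarrow> F x \<in> encode ` {(G, f) \<in> ch_instances {2, 3}. R G f \<and> Q G f}))"
    by (rule Pi2_hard) (use assms(2,3) R subgrid_qbf_graph degree_condition_qbf_graph in blast)+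
qed

theorem theorem4p3:
  shows "CH_Pi2_complete {2, 3} (\<lambda>G f. subgrid G) \<and>
    CH_Pi2_complete {2, 3} (\<lambda>G f. subgrid G \<and> degree_condition G f) \<and>
    (\<forall>k \<ge> 3. bounded_CH_Pi2_complete {2, 3} k (\<lambda>G f. subgrid G) \<and>
      bounded_CH_Pi2_complete {2, 3} k (\<lambda>G f. subgrid G \<and> degree_condition G f))"
proof -
  have ch: "CH_Pi2_complete {2, 3} R" if "\<And>G f. R G f \<longleftrightarrow> subgrid G \<and> (dc \<longrightarrow> degree_condition G f)" for R dc
    unfolding CH_Pi2_complete_def
  \<comment> \<open>Without a bound on the colours the verifier works with \<open>3 * n + 3\<close>
    of them, as in \<open>choosable_iff_within\<close>.\<close>
  proof (rule Pi2_completeI[where kp = "[:3, 3:]" and dc = dc])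
    fix G f assume "(G, f) \<in> ch_instances {2, 3}"
    then have "pair_graph G" "\<forall>v\<in>pverts G. f v \<le> 3" by (auto simp: ch_instances_def)
    from choosable_iff_within[OF this]
    show "choosable G f \<longleftrightarrow> choosable_within G f (poly [:3, 3:] (card (pverts G)))" by (simp add: algebra_simps)
  qed (rule qbf_graph_choosable, erule choosable_cong, rule that)
  have bounded: "bounded_CH_Pi2_complete {2, 3} k R"
    if "3 \<le> k" "\<And>G f. R G f \<longleftrightarrow> subgrid G \<and> (dc \<longrightarrow> degree_condition G f)" for R dc k
    unfolding bounded_CH_Pi2_complete_def
  proof (rule Pi2_completeI[where kp = "[:k:]" and dc = dc])
  qed (simp, rule qbf_graph_choosable_within[OF that(1)], erule choosable_within_cong, rule that(2))
  show ?thesis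
    using ch[of "\<lambda>G f. subgrid G" False] ch[of "\<lambda>G f. subgrid G \<and> degree_condition G f" True]
      bounded[of _ "\<lambda>G f. subgrid G" False] bounded[of _ "\<lambda>G f. subgrid G \<and> degree_condition G f" True]
    by simp
qed

end
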